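(* Let $S$ be a Lie group with a left-invariant Kähler structure that extends to a (not necessarily left-invariant) projective special Kähler structure. Suppose the universal cover $\widetilde S$ is a product of three or more Kähler factors (Lie groups of positive dimension with left-invariant Kähler structures). Then there are exactly three factors and $$\widetilde S=\mathbb CH(1)\times\mathbb CH(1)\times\mathbb CH(1),$$ each with holomorphic sectional curvature $-1$ (in the normalisation specified in the context).
   Context: $S$ is a Lie group of real dimension $2n$ with left-invariant complex structure $J$, (positive definite) metric $g_S$ and Kähler form $\omega_S=g_S(J\cdot,\cdot)$. The universal cover $\widetilde S$ carries the induced left-invariant Kähler structure. The Kähler structure *extends to a projective special Kähler structure* if the following data exist. There is a principal circle bundle $\pi\colon C_0\to S$ with connection one-form $\varphi$ such that $d\varphi=2\pi^*\omega_S$; let $X$ be the generator of the circle action, $\varphi(X)=1$. On the cone $C=\mathbb R_{>0}\times C_0$, with coordinate $t$ on $\mathbb R_{>0}$, one has the pseudo-Kähler structure $$g_C=t^2\pi^*g_S-t^2\varphi^2-dt^2,\qquad \omega_C=t^2\pi^*\omega_S-t\,\varphi\wedge dt=g_C(J\cdot,\cdot),$$ whose complex structure $J$ satisfies $JX=t\partial_t$. It is required that $C$ admits a connection $\nabla$ on $TC$ that is torsion-free, flat, satisfies $\nabla\omega_C=0$, $(\nabla_AJ)B=(\nabla_BJ)A$ for all vector fields $A,B$, and $\nabla X=-J$. **Normalisation of curvature.** $\mathbb CH(1)$ denotes the complex hyperbolic line, regarded as the two-dimensional Kähler Lie group with left-invariant orthonormal coframe $a,b$, $Ja=b$, satisfying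 $da=0$, $db=c\,a\wedge b$ for a constant $c\neq0$, with metric $a^2+b^2$ and Kähler form $a\wedge b$. Its holomorphic sectional curvature is normalised to be $-c^2/4$; thus the value $-1$ corresponds to $c^2=4$, i.e. to Gaussian curvature $-4$ of the metric $a^2+b^2$. *)

theory Defs
  imports "HOL-Analysis.Analysis" "HOL-Algebra.Product_Groups"
begin

section \<open>Smooth manifolds\<close>

text \<open>Open subsets of Euclidean d-space are open sets of the library topology
  \<^const>\<open>Euclidean_space\<close>, whose points are sequences vanishing from index d on. This lets
  the dimension be an ordinary natural number, varying within a family of manifolds.\<close>

primrec Ck_on :: "nat \<Rightarrow> nat \<Rightarrow> (nat \<Rightarrow> real) set \<Rightarrow> ((nat \<Rightarrow> real) \<Rightarrow> real) \<Rightarrow> bool" where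
  "Ck_on 0 d V f \<longleftrightarrow> continuous_map (subtopology (Euclidean_space d) V) euclideanreal f"
| "Ck_on (Suc k) d V f \<longleftrightarrow>
     continuous_map (subtopology (Euclidean_space d) V) euclideanreal f \<and>
     (\<forall>i<d. \<exists>f'. (\<forall>x\<in>V. ((\<lambda>s. f (x(i := s))) has_real_derivative f' x) (at (x i)))
               \<and> Ck_on k d V f')"

definition Cinf_on :: "nat \<Rightarrow> (nat \<Rightarrow> real) set \<Rightarrow> ((nat \<Rightarrow> real) \<Rightarrow> real) \<Rightarrow> bool" where
  "Cinf_on d V f \<longleftrightarrow> (\<forall>k. Ck_on k d V f)"

record 'a mfd =
  mtop :: "'a topology"
  mdim :: nat
  atlas :: "('a set \<times> ('a \<Rightarrow> nat \<Rightarrow> real)) set"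

abbreviation pts :: "('a, 'z) mfd_scheme \<Rightarrow> 'a set" where
  "pts M \<equiv> topspace (mtop M)"

definition smooth_manifold :: "('a, 'z) mfd_scheme \<Rightarrow> bool" where
  "smooth_manifold M \<longleftrightarrow>
     Hausdorff_space (mtop M) \<and> second_countable (mtop M) \<and>
     (\<Union>(U, \<psi>)\<in>atlas M. U) = pts M \<and>
     (\<forall>(U, \<psi>)\<in>atlas M. openin (mtop M) U \<and>
        (\<exists>V. openin (Euclidean_space (mdim M)) V \<and>
             homeomorphic_map (subtopology (mtop M) U) (subtopology (Euclidean_space (mdim M)) V) \<psi>)) \<and>
     (\<forall>(U, \<psi>)\<in>atlas M. \<forall>(U', \<psi>')\<in>atlas M. \<forall>i<mdim M.
        Cinf_on (mdim M) (\<psi> ` (U \<inter> U')) (\<lambda>y. \<psi>' (inv_into U \<psi> y) i))"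

text \<open>Smooth real functions are normalised to be 0 off the manifold, so that functions on M
  correspond to unique HOL functions; the cut-off below restores this convention.\<close>

definition cut :: "('a, 'z) mfd_scheme \<Rightarrow> ('a \<Rightarrow> real) \<Rightarrow> 'a \<Rightarrow> real" where
  "cut M f = (\<lambda>x. if x \<in> pts M then f x else 0)"

definition smooth_fun :: "('a, 'z) mfd_scheme \<Rightarrow> ('a \<Rightarrow> real) set" where
  "smooth_fun M = {f. (\<forall>x. x \<notin> pts M \<longrightarrow> f x = 0) \<and>
     (\<forall>(U, \<psi>)\<in>atlas M. Cinf_on (mdim M) (\<psi> ` U) (\<lambda>y. f (inv_into U \<psi> y)))}"

definition smooth_map :: "('a, 'y) mfd_scheme \<Rightarrow> ('b, 'z) mfd_scheme \<Rightarrow> ('a \<Rightarrow> 'b) \<Rightarrow> bool" where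
  "smooth_map M N F \<longleftrightarrow> continuous_map (mtop M) (mtop N) F \<and>
     (\<forall>(U, \<psi>)\<in>atlas M. \<forall>(V, \<eta>)\<in>atlas N. \<forall>i<mdim N.
        Cinf_on (mdim M) (\<psi> ` (U \<inter> F -` V)) (\<lambda>y. \<eta> (F (inv_into U \<psi> y)) i))"

definition diffeo :: "('a, 'y) mfd_scheme \<Rightarrow> ('b, 'z) mfd_scheme \<Rightarrow> ('a \<Rightarrow> 'b) \<Rightarrow> bool" where
  "diffeo M N F \<longleftrightarrow> bij_betw F (pts M) (pts N) \<and> smooth_map M N F \<and>
     smooth_map N M (inv_into (pts M) F)"

definition open_submfd :: "('a, 'z) mfd_scheme \<Rightarrow> 'a set \<Rightarrow> 'a mfd" where
  "open_submfd M W = \<lparr>mtop = subtopology (mtop M) W, mdim = mdim M,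
     atlas = {(U \<inter> W, \<psi>) | U \<psi>. (U, \<psi>) \<in> atlas M}\<rparr>"

definition prod_mfd :: "('a, 'y) mfd_scheme \<Rightarrow> ('b, 'z) mfd_scheme \<Rightarrow> ('a \<times> 'b) mfd" where
  "prod_mfd M N = \<lparr>mtop = prod_topology (mtop M) (mtop N), mdim = mdim M + mdim N,
     atlas = {(U \<times> V, \<lambda>(x, y) k. if k < mdim M then \<psi> x k else \<eta> y (k - mdim M)) | U \<psi> V \<eta>.
                (U, \<psi>) \<in> atlas M \<and> (V, \<eta>) \<in> atlas N}\<rparr>"

text \<open>Product of a finite family. The coordinates (i, l) of a product chart are enumerated by an
  arbitrary bijection e; different enumerations give charts that differ by a permutation of
  coordinates, so all of them belong to the same smooth structure.\<close>

definition Pi_mfd :: "'i set \<Rightarrow> ('i \<Rightarrow> ('a, 'z) mfd_scheme) \<Rightarrow> ('i \<Rightarrow> 'a) mfd" where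
  "Pi_mfd I M = \<lparr>mtop = product_topology (\<lambda>i. mtop (M i)) I, mdim = (\<Sum>i\<in>I. mdim (M i)),
     atlas = {(\<Pi>\<^sub>E i\<in>I. U i,
               \<lambda>x k. if k < (\<Sum>i\<in>I. mdim (M i)) then \<psi> (fst (e k)) (x (fst (e k))) (snd (e k)) else 0)
              | U \<psi> e. (\<forall>i\<in>I. (U i, \<psi> i) \<in> atlas (M i)) \<and>
                  bij_betw e {..<\<Sum>i\<in>I. mdim (M i)} (SIGMA i:I. {..<mdim (M i)})}\<rparr>"

definition half_line :: "real mfd" where
  "half_line = \<lparr>mtop = top_of_set {0<..}, mdim = 1,
     atlas = {({0<..}, \<lambda>t k. if k = 0 then t else 0)}\<rparr>"

definition circle :: "complex mfd" where
  "circle = \<lparr>mtop = top_of_set (sphere 0 1), mdim = 1,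
     atlas = {(sphere 0 1 - {- w}, \<lambda>z k. if k = 0 then Arg (z / w) else 0) | w. norm w = 1}\<rparr>"


section \<open>Tangent vectors, vector fields and tensors\<close>

text \<open>Tangent vectors at p are the derivations at p of the algebra of smooth functions (set to 0
  on arguments that are not smooth functions). Vector fields and tensors are pointwise objects;
  vector fields vanish off the manifold.\<close>

type_synonym 'a tvec = "('a \<Rightarrow> real) \<Rightarrow> real"
type_synonym 'a vfield = "'a \<Rightarrow> 'a tvec"
type_synonym 'a form1 = "'a \<Rightarrow> 'a tvec \<Rightarrow> real"
type_synonym 'a bil = "'a \<Rightarrow> 'a tvec \<Rightarrow> 'a tvec \<Rightarrow> real"
type_synonym 'a endo = "'a \<Rightarrow> 'a tvec \<Rightarrow> 'a tvec"

definition tangent :: "('a, 'z) mfd_scheme \<Rightarrow> 'a \<Rightarrow> 'a tvec set" where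
  "tangent M p = {v. (\<forall>f. f \<notin> smooth_fun M \<longrightarrow> v f = 0) \<and>
     (\<forall>f\<in>smooth_fun M. \<forall>h\<in>smooth_fun M. \<forall>c.
        v (\<lambda>x. c * f x + h x) = c * v f + v h \<and>
        v (\<lambda>x. f x * h x) = f p * v h + h p * v f)}"

definition push :: "('a, 'y) mfd_scheme \<Rightarrow> ('b, 'z) mfd_scheme \<Rightarrow> ('a \<Rightarrow> 'b) \<Rightarrow> 'a tvec \<Rightarrow> 'b tvec" where
  "push M N F v = (\<lambda>f. if f \<in> smooth_fun N then v (cut M (\<lambda>x. f (F x))) else 0)"

definition vfields :: "('a, 'z) mfd_scheme \<Rightarrow> 'a vfield set" where
  "vfields M = {X. (\<forall>p\<in>pts M. X p \<in> tangent M p) \<and> (\<forall>p. p \<notin> pts M \<longrightarrow> X p = (\<lambda>_. 0)) \<and>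
     (\<forall>f\<in>smooth_fun M. (\<lambda>p. X p f) \<in> smooth_fun M)}"

definition bracket :: "'a vfield \<Rightarrow> 'a vfield \<Rightarrow> 'a vfield" where
  "bracket X Y = (\<lambda>p f. X p (\<lambda>q. Y q f) - Y p (\<lambda>q. X q f))"

definition ev1 :: "('a, 'z) mfd_scheme \<Rightarrow> 'a form1 \<Rightarrow> 'a vfield \<Rightarrow> 'a \<Rightarrow> real" where
  "ev1 M \<alpha> X = cut M (\<lambda>p. \<alpha> p (X p))"

definition ev2 :: "('a, 'z) mfd_scheme \<Rightarrow> 'a bil \<Rightarrow> 'a vfield \<Rightarrow> 'a vfield \<Rightarrow> 'a \<Rightarrow> real" where
  "ev2 M b X Y = cut M (\<lambda>p. b p (X p) (Y p))"

definition app :: "('a, 'z) mfd_scheme \<Rightarrow> 'a endo \<Rightarrow> 'a vfield \<Rightarrow> 'a vfield" where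
  "app M J X = (\<lambda>p. if p \<in> pts M then J p (X p) else (\<lambda>_. 0))"

definition linear_on_tangent :: "('a, 'z) mfd_scheme \<Rightarrow> 'a \<Rightarrow> ('a tvec \<Rightarrow> real) \<Rightarrow> bool" where
  "linear_on_tangent M p L \<longleftrightarrow>
     (\<forall>v\<in>tangent M p. \<forall>w\<in>tangent M p. \<forall>c. L (\<lambda>f. c * v f + w f) = c * L v + L w)"

definition one_form :: "('a, 'z) mfd_scheme \<Rightarrow> 'a form1 \<Rightarrow> bool" where
  "one_form M \<alpha> \<longleftrightarrow> (\<forall>p\<in>pts M. linear_on_tangent M p (\<alpha> p)) \<and>
     (\<forall>X\<in>vfields M. ev1 M \<alpha> X \<in> smooth_fun M)"

definition bilinear_field :: "('a, 'z) mfd_scheme \<Rightarrow> 'a bil \<Rightarrow> bool" where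
  "bilinear_field M b \<longleftrightarrow>
     (\<forall>p\<in>pts M. \<forall>v\<in>tangent M p. linear_on_tangent M p (b p v) \<and>
                                   linear_on_tangent M p (\<lambda>w. b p w v)) \<and>
     (\<forall>X\<in>vfields M. \<forall>Y\<in>vfields M. ev2 M b X Y \<in> smooth_fun M)"

definition endo_field :: "('a, 'z) mfd_scheme \<Rightarrow> 'a endo \<Rightarrow> bool" where
  "endo_field M J \<longleftrightarrow>
     (\<forall>p\<in>pts M. \<forall>v\<in>tangent M p. J p v \<in> tangent M p \<and>
        (\<forall>w\<in>tangent M p. \<forall>c. J p (\<lambda>f. c * v f + w f) = (\<lambda>f. c * J p v f + J p w f))) \<and>
     (\<forall>X\<in>vfields M. app M J X \<in> vfields M)"

text \<open>Exterior derivatives, in the convention without factors 1/2 (and accordingly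
  \<open>\<alpha> \<and> \<beta> = \<alpha> \<otimes> \<beta> - \<beta> \<otimes> \<alpha>\<close>).\<close>

definition wedge :: "'a form1 \<Rightarrow> 'a form1 \<Rightarrow> 'a bil" where
  "wedge \<alpha> \<beta> p v w = \<alpha> p v * \<beta> p w - \<alpha> p w * \<beta> p v"

definition d1 :: "('a, 'z) mfd_scheme \<Rightarrow> 'a form1 \<Rightarrow> 'a vfield \<Rightarrow> 'a vfield \<Rightarrow> 'a \<Rightarrow> real" where
  "d1 M \<alpha> X Y p = X p (ev1 M \<alpha> Y) - Y p (ev1 M \<alpha> X) - \<alpha> p (bracket X Y p)"

definition d2 :: "('a, 'z) mfd_scheme \<Rightarrow> 'a bil \<Rightarrow> 'a vfield \<Rightarrow> 'a vfield \<Rightarrow> 'a vfield \<Rightarrow> 'a \<Rightarrow> real" where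
  "d2 M \<omega> X Y Z p = X p (ev2 M \<omega> Y Z) - Y p (ev2 M \<omega> X Z) + Z p (ev2 M \<omega> X Y)
     - \<omega> p (bracket X Y p) (Z p) + \<omega> p (bracket X Z p) (Y p) - \<omega> p (bracket Y Z p) (X p)"

definition has_d1 :: "('a, 'z) mfd_scheme \<Rightarrow> 'a form1 \<Rightarrow> 'a bil \<Rightarrow> bool" where
  "has_d1 M \<alpha> b \<longleftrightarrow> (\<forall>X\<in>vfields M. \<forall>Y\<in>vfields M. \<forall>p\<in>pts M. d1 M \<alpha> X Y p = b p (X p) (Y p))"


section \<open>Kaehler structures\<close>

definition pseudo_riemannian :: "('a, 'z) mfd_scheme \<Rightarrow> 'a bil \<Rightarrow> bool" where
  "pseudo_riemannian M g \<longleftrightarrow> bilinear_field M g \<and>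
     (\<forall>p\<in>pts M. \<forall>v\<in>tangent M p.
        (\<forall>w\<in>tangent M p. g p v w = g p w v) \<and>
        ((\<forall>w\<in>tangent M p. g p v w = 0) \<longrightarrow> v = (\<lambda>_. 0)))"

text \<open>A complex structure is an almost complex structure with vanishing Nijenhuis tensor.\<close>

definition complex_structure :: "('a, 'z) mfd_scheme \<Rightarrow> 'a endo \<Rightarrow> bool" where
  "complex_structure M J \<longleftrightarrow> endo_field M J \<and>
     (\<forall>p\<in>pts M. \<forall>v\<in>tangent M p. J p (J p v) = (\<lambda>f. - v f)) \<and>
     (\<forall>X\<in>vfields M. \<forall>Y\<in>vfields M. \<forall>p\<in>pts M. \<forall>f.
        bracket (app M J X) (app M J Y) p f - bracket X Y p f
        - J p (bracket (app M J X) Y p) f - J p (bracket X (app M J Y) p) f = 0)"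

definition kform :: "'a bil \<Rightarrow> 'a endo \<Rightarrow> 'a bil" where
  "kform g J p v w = g p (J p v) w"

definition pseudo_kaehler :: "('a, 'z) mfd_scheme \<Rightarrow> 'a bil \<Rightarrow> 'a endo \<Rightarrow> bool" where
  "pseudo_kaehler M g J \<longleftrightarrow> pseudo_riemannian M g \<and> complex_structure M J \<and>
     (\<forall>p\<in>pts M. \<forall>v\<in>tangent M p. \<forall>w\<in>tangent M p. g p (J p v) (J p w) = g p v w) \<and>
     (\<forall>X\<in>vfields M. \<forall>Y\<in>vfields M. \<forall>Z\<in>vfields M. \<forall>p\<in>pts M. d2 M (kform g J) X Y Z p = 0)"

definition kaehler :: "('a, 'z) mfd_scheme \<Rightarrow> 'a bil \<Rightarrow> 'a endo \<Rightarrow> bool" where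
  "kaehler M g J \<longleftrightarrow> pseudo_kaehler M g J \<and>
     (\<forall>p\<in>pts M. \<forall>v\<in>tangent M p. v \<noteq> (\<lambda>_. 0) \<longrightarrow> 0 < g p v v)"


section \<open>Lie groups with left-invariant Kaehler structure\<close>

record 'a klg = "'a mfd" +
  grp :: "'a monoid"
  met :: "'a bil"
  cpx :: "'a endo"

definition lie_group :: "('a, 'z) mfd_scheme \<Rightarrow> 'a monoid \<Rightarrow> bool" where
  "lie_group M G \<longleftrightarrow> smooth_manifold M \<and> group G \<and> carrier G = pts M \<and>
     smooth_map (prod_mfd M M) M (\<lambda>(x, y). x \<otimes>\<^bsub>G\<^esub> y) \<and> smooth_map M M (m_inv G)"

abbreviation dL :: "'a klg \<Rightarrow> 'a \<Rightarrow> 'a tvec \<Rightarrow> 'a tvec" where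
  "dL G a \<equiv> push G G (\<lambda>x. a \<otimes>\<^bsub>grp G\<^esub> x)"

definition kaehler_lie_group :: "'a klg \<Rightarrow> bool" where
  "kaehler_lie_group G \<longleftrightarrow> lie_group G (grp G) \<and> kaehler G (met G) (cpx G) \<and>
     (\<forall>a\<in>pts G. \<forall>x\<in>pts G. \<forall>v\<in>tangent G x.
        cpx G (a \<otimes>\<^bsub>grp G\<^esub> x) (dL G a v) = dL G a (cpx G x v) \<and>
        (\<forall>w\<in>tangent G x. met G (a \<otimes>\<^bsub>grp G\<^esub> x) (dL G a v) (dL G a w) = met G x v w))"

definition preserves_kaehler :: "'a klg \<Rightarrow> 'b klg \<Rightarrow> ('a \<Rightarrow> 'b) \<Rightarrow> bool" where
  "preserves_kaehler G H F \<longleftrightarrow> (\<forall>x\<in>pts G. \<forall>v\<in>tangent G x.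
     cpx H (F x) (push G H F v) = push G H F (cpx G x v) \<and>
     (\<forall>w\<in>tangent G x. met H (F x) (push G H F v) (push G H F w) = met G x v w))"

definition kaehler_lie_isomorphic :: "'a klg \<Rightarrow> 'b klg \<Rightarrow> bool" where
  "kaehler_lie_isomorphic G H \<longleftrightarrow>
     (\<exists>F. F \<in> iso (grp G) (grp H) \<and> diffeo G H F \<and> preserves_kaehler G H F)"

text \<open>The product metric is the sum of the pullbacks along the projections. The product complex
  structure is the sum over i of \<open>d(\<iota>\<^sub>i) \<circ> J\<^sub>i \<circ> d(pr\<^sub>i)\<close>, where \<open>\<iota>\<^sub>i\<close> is the inclusion of the
  i-th slice through the given point.\<close>

definition prod_klg :: "'i set \<Rightarrow> ('i \<Rightarrow> 'a klg) \<Rightarrow> ('i \<Rightarrow> 'a) klg" where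
  "prod_klg I F = (let P = Pi_mfd I F in
     \<lparr>mtop = mtop P, mdim = mdim P, atlas = atlas P,
      grp = product_group I (\<lambda>i. grp (F i)),
      met = (\<lambda>p v w. \<Sum>i\<in>I. met (F i) (p i) (push P (F i) (\<lambda>x. x i) v) (push P (F i) (\<lambda>x. x i) w)),
      cpx = (\<lambda>p v f. \<Sum>i\<in>I. push (F i) P (\<lambda>y. p(i := y))
                              (cpx (F i) (p i) (push P (F i) (\<lambda>x. x i) v)) f)\<rparr>)"


section \<open>Universal covers\<close>

text \<open>The versions for abstract topologies of \<^const>\<open>covering_space\<close> and
  \<^const>\<open>simply_connected\<close>; note that the latter includes path-connectedness.\<close>

definition covering_map :: "'a topology \<Rightarrow> 'b topology \<Rightarrow> ('a \<Rightarrow> 'b) \<Rightarrow> bool" where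
  "covering_map X Y p \<longleftrightarrow> continuous_map X Y p \<and> p ` topspace X = topspace Y \<and>
     (\<forall>y\<in>topspace Y. \<exists>T. y \<in> T \<and> openin Y T \<and>
        (\<exists>\<V>. \<Union>\<V> = topspace X \<inter> p -` T \<and> (\<forall>U\<in>\<V>. openin X U) \<and> pairwise disjnt \<V> \<and>
             (\<forall>U\<in>\<V>. homeomorphic_map (subtopology X U) (subtopology Y T) p)))"

definition simply_connected_top :: "'a topology \<Rightarrow> bool" where
  "simply_connected_top X \<longleftrightarrow>
     (\<forall>\<gamma> \<delta>. pathin X \<gamma> \<and> \<gamma> 1 = \<gamma> 0 \<and> pathin X \<delta> \<and> \<delta> 1 = \<delta> 0 \<longrightarrow>
        homotopic_with (\<lambda>r. r 1 = r 0) (top_of_set {0..1::real}) X \<gamma> \<delta>)"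

definition universal_cover :: "'b klg \<Rightarrow> ('b \<Rightarrow> 'a) \<Rightarrow> 'a klg \<Rightarrow> bool" where
  "universal_cover St p S \<longleftrightarrow> kaehler_lie_group St \<and> simply_connected_top (mtop St) \<and>
     p \<in> hom (grp St) (grp S) \<and> covering_map (mtop St) (mtop S) p \<and> smooth_map St S p \<and>
     (\<forall>x\<in>pts St. bij_betw (push St S p) (tangent St x) (tangent S (p x))) \<and>
     preserves_kaehler St S p"


section \<open>Projective special Kaehler structures\<close>

definition principal_circle_bundle ::
  "('c, 'y) mfd_scheme \<Rightarrow> ('a, 'z) mfd_scheme \<Rightarrow> ('c \<Rightarrow> 'a) \<Rightarrow> (complex \<Rightarrow> 'c \<Rightarrow> 'c) \<Rightarrow> bool" where
  "principal_circle_bundle C0 S \<pi> act \<longleftrightarrow>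
     smooth_manifold C0 \<and> smooth_map C0 S \<pi> \<and>
     smooth_map (prod_mfd circle C0) C0 (\<lambda>(z, x). act z x) \<and>
     (\<forall>x\<in>pts C0. act 1 x = x \<and>
        (\<forall>z\<in>pts circle. \<pi> (act z x) = \<pi> x \<and>
           (\<forall>w\<in>pts circle. act (z * w) x = act z (act w x)))) \<and>
     (\<forall>s\<in>pts S. \<exists>U \<Phi>. openin (mtop S) U \<and> s \<in> U \<and>
        diffeo (open_submfd C0 (pts C0 \<inter> \<pi> -` U)) (prod_mfd (open_submfd S U) circle) \<Phi> \<and>
        (\<forall>x\<in>pts C0 \<inter> \<pi> -` U. fst (\<Phi> x) = \<pi> x \<and>
           (\<forall>z\<in>pts circle. \<Phi> (act z x) = (\<pi> x, z * snd (\<Phi> x)))))"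

text \<open>The generator of a circle action: the velocity at time 0 of the action of \<open>exp (\<i> \<theta>)\<close>.\<close>

definition circle_generator :: "('c, 'z) mfd_scheme \<Rightarrow> (complex \<Rightarrow> 'c \<Rightarrow> 'c) \<Rightarrow> 'c vfield" where
  "circle_generator M act = (\<lambda>x f. if x \<in> pts M \<and> f \<in> smooth_fun M
                                    then deriv (\<lambda>\<theta>. f (act (cis \<theta>) x)) 0 else 0)"

definition connection_form ::
  "('c, 'z) mfd_scheme \<Rightarrow> (complex \<Rightarrow> 'c \<Rightarrow> 'c) \<Rightarrow> 'c form1 \<Rightarrow> bool" where
  "connection_form C0 act \<phi> \<longleftrightarrow> one_form C0 \<phi> \<and>
     (\<forall>x\<in>pts C0. \<phi> x (circle_generator C0 act x) = 1 \<and>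
        (\<forall>z\<in>pts circle. \<forall>v\<in>tangent C0 x. \<phi> (act z x) (push C0 C0 (act z) v) = \<phi> x v))"

definition affine_connection ::
  "('a, 'z) mfd_scheme \<Rightarrow> ('a vfield \<Rightarrow> 'a vfield \<Rightarrow> 'a vfield) \<Rightarrow> bool" where
  "affine_connection M nabla \<longleftrightarrow>
     (\<forall>A\<in>vfields M. \<forall>B\<in>vfields M. nabla A B \<in> vfields M \<and>
        (\<forall>D\<in>vfields M. \<forall>h\<in>smooth_fun M.
           nabla (\<lambda>p f. h p * A p f + B p f) D = (\<lambda>p f. h p * nabla A D p f + nabla B D p f) \<and>
           nabla A (\<lambda>p f. h p * B p f + D p f)
             = (\<lambda>p f. A p h * B p f + h p * nabla A B p f + nabla A D p f)))"

definition torsion_free ::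
  "('a, 'z) mfd_scheme \<Rightarrow> ('a vfield \<Rightarrow> 'a vfield \<Rightarrow> 'a vfield) \<Rightarrow> bool" where
  "torsion_free M nabla \<longleftrightarrow> (\<forall>A\<in>vfields M. \<forall>B\<in>vfields M. \<forall>p f.
     nabla A B p f - nabla B A p f = bracket A B p f)"

definition flat ::
  "('a, 'z) mfd_scheme \<Rightarrow> ('a vfield \<Rightarrow> 'a vfield \<Rightarrow> 'a vfield) \<Rightarrow> bool" where
  "flat M nabla \<longleftrightarrow> (\<forall>A\<in>vfields M. \<forall>B\<in>vfields M. \<forall>D\<in>vfields M. \<forall>p f.
     nabla A (nabla B D) p f - nabla B (nabla A D) p f - nabla (bracket A B) D p f = 0)"

definition parallel2 ::
  "('a, 'z) mfd_scheme \<Rightarrow> ('a vfield \<Rightarrow> 'a vfield \<Rightarrow> 'a vfield) \<Rightarrow> 'a bil \<Rightarrow> bool" where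
  "parallel2 M nabla \<omega> \<longleftrightarrow> (\<forall>A\<in>vfields M. \<forall>B\<in>vfields M. \<forall>D\<in>vfields M. \<forall>p\<in>pts M.
     A p (ev2 M \<omega> B D) - \<omega> p (nabla A B p) (D p) - \<omega> p (B p) (nabla A D p) = 0)"

definition cov_endo ::
  "('a, 'z) mfd_scheme \<Rightarrow> ('a vfield \<Rightarrow> 'a vfield \<Rightarrow> 'a vfield) \<Rightarrow> 'a endo \<Rightarrow>
   'a vfield \<Rightarrow> 'a vfield \<Rightarrow> 'a vfield" where
  "cov_endo M nabla J A B = (\<lambda>p f. nabla A (app M J B) p f - app M J (nabla A B) p f)"

text \<open>Objects on the cone \<open>C = (0,\<infinity>) \<times> C0\<close>, whose points are pairs (t, x).\<close>

abbreviation cone_mfd :: "('c, 'z) mfd_scheme \<Rightarrow> (real \<times> 'c) mfd" where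
  "cone_mfd C0 \<equiv> prod_mfd half_line C0"

definition cone_dt :: "('c, 'z) mfd_scheme \<Rightarrow> (real \<times> 'c) form1" where
  "cone_dt C0 p v = v (cut (cone_mfd C0) fst)"

definition cone_t_ddt :: "('c, 'z) mfd_scheme \<Rightarrow> (real \<times> 'c) vfield" where
  "cone_t_ddt C0 = (\<lambda>(t, x) f. if (t, x) \<in> pts (cone_mfd C0) \<and> f \<in> smooth_fun (cone_mfd C0)
                                then t * deriv (\<lambda>s. f (s, x)) t else 0)"

definition cone_act :: "(complex \<Rightarrow> 'c \<Rightarrow> 'c) \<Rightarrow> complex \<Rightarrow> real \<times> 'c \<Rightarrow> real \<times> 'c" where
  "cone_act act z = (\<lambda>(t, x). (t, act z x))"

definition cone_form :: "('c, 'z) mfd_scheme \<Rightarrow> 'c form1 \<Rightarrow> (real \<times> 'c) form1" where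
  "cone_form C0 \<phi> p v = \<phi> (snd p) (push (cone_mfd C0) C0 snd v)"

definition cone_pull ::
  "('c, 'z) mfd_scheme \<Rightarrow> ('c \<Rightarrow> 'a) \<Rightarrow> ('a, 'y) mfd_scheme \<Rightarrow> 'a bil \<Rightarrow> (real \<times> 'c) bil" where
  "cone_pull C0 \<pi> S b p v w = b (\<pi> (snd p)) (push (cone_mfd C0) S (\<lambda>q. \<pi> (snd q)) v)
                                          (push (cone_mfd C0) S (\<lambda>q. \<pi> (snd q)) w)"

definition cone_metric :: "'a klg \<Rightarrow> ('c, 'z) mfd_scheme \<Rightarrow> ('c \<Rightarrow> 'a) \<Rightarrow> 'c form1 \<Rightarrow> (real \<times> 'c) bil" where
  "cone_metric S C0 \<pi> \<phi> p v w =
     (fst p)\<^sup>2 * cone_pull C0 \<pi> S (met S) p v w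
     - (fst p)\<^sup>2 * (cone_form C0 \<phi> p v * cone_form C0 \<phi> p w)
     - cone_dt C0 p v * cone_dt C0 p w"

definition cone_kform :: "'a klg \<Rightarrow> ('c, 'z) mfd_scheme \<Rightarrow> ('c \<Rightarrow> 'a) \<Rightarrow> 'c form1 \<Rightarrow> (real \<times> 'c) bil" where
  "cone_kform S C0 \<pi> \<phi> p v w =
     (fst p)\<^sup>2 * cone_pull C0 \<pi> S (kform (met S) (cpx S)) p v w
     - fst p * wedge (cone_form C0 \<phi>) (cone_dt C0) p v w"

text \<open>The extension consists of a principal circle bundle with connection form, the complex
  structure J of the cone (determined by the cone metric and the Kaehler form) and the special
  connection. The type argument is the type in which the total space of the bundle lives.\<close>

definition extends_to_psk :: "'c itself \<Rightarrow> 'a klg \<Rightarrow> bool" where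
  "extends_to_psk T S \<longleftrightarrow>
     (\<exists>(C0 :: 'c mfd) \<pi> act \<phi> J nabla.
        let C = cone_mfd C0; X = circle_generator C (cone_act act);
            gC = cone_metric S C0 \<pi> \<phi>; \<omega>C = cone_kform S C0 \<pi> \<phi> in
        principal_circle_bundle C0 S \<pi> act \<and> connection_form C0 act \<phi> \<and>
        has_d1 C0 \<phi> (\<lambda>x v w. 2 * kform (met S) (cpx S) (\<pi> x) (push C0 S \<pi> v) (push C0 S \<pi> w)) \<and>
        pseudo_kaehler C gC J \<and>
        (\<forall>p\<in>pts C. \<forall>v\<in>tangent C p. \<forall>w\<in>tangent C p. \<omega>C p v w = kform gC J p v w) \<and>
        app C J X = cone_t_ddt C0 \<and>
        affine_connection C nabla \<and> torsion_free C nabla \<and> flat C nabla \<and> parallel2 C nabla \<omega>C \<and>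
        (\<forall>A\<in>vfields C. \<forall>B\<in>vfields C. cov_endo C nabla J A B = cov_endo C nabla J B A) \<and>
        (\<forall>A\<in>vfields C. nabla A X = (\<lambda>p f. - app C J A p f)))"


section \<open>The complex hyperbolic line\<close>

definition left_invariant_form :: "'a klg \<Rightarrow> 'a form1 \<Rightarrow> bool" where
  "left_invariant_form G \<alpha> \<longleftrightarrow> one_form G \<alpha> \<and>
     (\<forall>a\<in>pts G. \<forall>x\<in>pts G. \<forall>v\<in>tangent G x. \<alpha> (a \<otimes>\<^bsub>grp G\<^esub> x) (dL G a v) = \<alpha> x v)"

text \<open>The complex hyperbolic line with structure constant c. The action of J on one-forms is
  \<open>J\<alpha> = - \<alpha> \<circ> J\<close>, the sign being forced by \<open>J a = b\<close>, the metric \<open>a\<^sup>2 + b\<^sup>2\<close> and the Kaehler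
  form \<open>a \<and> b = g(J\<cdot>,\<cdot>)\<close>. As a Kaehler Lie group it is determined up to isomorphism by c.\<close>

definition is_CH1 :: "real \<Rightarrow> 'a klg \<Rightarrow> bool" where
  "is_CH1 c G \<longleftrightarrow> kaehler_lie_group G \<and> simply_connected_top (mtop G) \<and> mdim G = 2 \<and> c \<noteq> 0 \<and>
     (\<exists>a b. left_invariant_form G a \<and> left_invariant_form G b \<and>
        (\<forall>x\<in>pts G. \<forall>v\<in>tangent G x. b x v = - a x (cpx G x v) \<and>
           (\<forall>w\<in>tangent G x. met G x v w = a x v * a x w + b x v * b x w \<and>
                             kform (met G) (cpx G) x v w = wedge a b x v w)) \<and>
        has_d1 G a (\<lambda>x v w. 0) \<and> has_d1 G b (\<lambda>x v w. c * wedge a b x v w))"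

definition CH1_hol_sect_curv :: "real \<Rightarrow> real" where
  "CH1_hol_sect_curv c = - (c\<^sup>2 / 4)"

end

theory Submission
  imports Defs "HOL-Library.Function_Algebras"
begin

text \<open>The special connection lives on the cone C over a circle bundle over S and nothing forces it to
  be invariant under S. The point of the proof is that flatness nevertheless has a purely algebraic
  consequence at every single point of C.

  Let T be the Lie algebra of S, with its metric g, complex structure J and
  \<open>\<omega>(a, b) = g(J a, b)\<close>. The horizontal lifts \<open>e\<^sub>a\<close> of the left-invariant fields
  (a in T), the generator X of the circle action and \<open>E = J X\<close> span all tangent spaces of C, and
  \<open>[e\<^sub>a, e\<^sub>b] = e\<^bsub>[a,b]\<^esub> - 2 \<omega>(a, b) X\<close>. The conditions imposed on \<open>\<nabla>\<close> give
  \<open>\<nabla>\<^bsub>X\<^esub> e\<^sub>a = - e\<^bsub>J a\<^esub>\<close>, \<open>\<nabla>\<^bsub>e\<^sub>a\<^esub> E = e\<^sub>a\<close> and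
  \<open>\<nabla>\<^bsub>e\<^sub>a\<^esub> e\<^sub>b = e\<^bsub>\<Gamma>\<^sub>a b\<^esub> - \<omega>(a, b) X + g(a, b) E\<close> with coefficients
  \<open>\<Gamma>\<^sub>a\<close> that vary from point to point (lemmas \<open>W_\<phi>\<close>, \<open>W_tC\<close>, \<open>special_point_\<Gamma>\<close>).
  Split \<open>\<Gamma>\<^sub>a = D\<^sub>a + S\<^sub>a\<close> into the parts that commute and anticommute with J. Then S is totally
  symmetric, while D is metric and torsion-free, hence is given by the Koszul formula: it is the
  Levi-Civita connection of the group and the same at all points of C. Therefore the derivatives of
  \<open>\<Gamma>\<close> drop out of the J-commuting part of the flatness equation, and with R the curvature of the group
  there remains (lemma \<open>curvature_identity\<close>)
  \<open>R(a, b) c + [S\<^sub>a, S\<^sub>b] c = g(a, c) b + \<omega>(a, c) J b - g(b, c) a - \<omega>(b, c) J a + 2 \<omega>(a, b) J c\<close>.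

  Now let the universal cover be a product. The factors give pairwise orthogonal, pairwise commuting,
  J-invariant ideals \<open>V\<^sub>i\<close> with sum T, and R vanishes when its arguments do not all come from one of
  them. The identity, together with its version for \<open>J a\<close> in place of a, yields
  \<open>S\<^sub>a S\<^sub>a c = |a|\<^sup>2 c\<close> for a and c in different ideals, \<open>S\<^sub>a S\<^sub>b c = 0\<close> for a, b, c in three different
  ideals, and \<open>S\<^sub>b S\<^sub>a c = 0\<close> for a, c in \<open>V\<^sub>i\<close> and b in another ideal. The first relation shows that
  the kernel of \<open>S\<^sub>b\<close> lies in the ideal of b, so the other two say that S maps \<open>V\<^sub>i \<times> V\<^sub>j\<close> into every
  third ideal and \<open>V\<^sub>i \<times> V\<^sub>i\<close> into every ideal other than \<open>V\<^sub>i\<close>. As there are at least three ideals,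
  \<open>S(V\<^sub>i, V\<^sub>i) = 0\<close>; if there were four, \<open>S(V\<^sub>i, V\<^sub>j)\<close> would vanish too and contradict the first
  relation. So there are exactly three, \<open>V\<^sub>i\<close> is spanned by a and \<open>J a\<close> for each non-zero a, and for a
  unit vector the identity reads \<open>R(a, J a) a = 4 J a\<close>: the factors have Gaussian curvature -4
  (theorems \<open>three_factors\<close> and \<open>factor_structure\<close>). A unit vector u with \<open>[u, J u] = 2 J u\<close> then
  provides the coframe of the complex hyperbolic line with structure constant -2.

  The remaining lemmas connect this computation with manifolds given by atlases and tangent vectors
  given by derivations. The analytic ingredients are the Hadamard expansion, by which a derivation is
  determined by its values on coordinates, and bump functions, by which it is local; on these rest
  the smoothness of left-invariant fields and of horizontal lifts.\<close>

section \<open>Differentiable functions on Euclidean space\<close>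

text \<open>The topology of Euclidean space is that of pointwise convergence of sequences, so cubes in the
  first d coordinates are the convenient neighbourhood basis.\<close>

definition cube :: "nat \<Rightarrow> (nat \<Rightarrow> real) \<Rightarrow> real \<Rightarrow> (nat \<Rightarrow> real) set" where
  "cube d z r = {y \<in> topspace (Euclidean_space d). \<forall>i<d. \<bar>y i - z i\<bar> < r}"

abbreviation eopen :: "nat \<Rightarrow> (nat \<Rightarrow> real) set \<Rightarrow> bool" where
  "eopen d V \<equiv> openin (Euclidean_space d) V"

lemma eopen_eq: "eopen d V \<longleftrightarrow> (\<exists>T. open T \<and> V = T \<inter> {x. \<forall>i\<ge>d. x i = 0})"
  by (simp add: Euclidean_space_def openin_subtopology euclidean_product_topology)

lemma eopen_subset: "eopen d V \<Longrightarrow> V \<subseteq> topspace (Euclidean_space d)"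
  by (rule openin_subset)

lemma open_cube: "open {y :: nat \<Rightarrow> real. \<forall>i<(d::nat). \<bar>y i - z i\<bar> < r}"
proof -
  have "{y :: nat \<Rightarrow> real. \<forall>i<d. \<bar>y i - z i\<bar> < r} = (\<Inter>i\<in>{..<d}. {y. \<bar>y i - z i\<bar> < r})" by auto
  moreover have "open {y :: nat \<Rightarrow> real. \<bar>y i - z i\<bar> < r}" for i
    by (intro open_Collect_less continuous_intros continuous_on_product_coordinates)
  ultimately show ?thesis by (simp add: open_INT)
qed

lemma eopen_cube: "eopen d (cube d z r)"
  unfolding eopen_eq cube_def
  by (rule exI[of _ "{y. \<forall>i<d. \<bar>y i - z i\<bar> < r}"]) (auto simp: open_cube topspace_Euclidean_space)

lemma eopen_imp_cube:
  assumes "eopen d V" "x \<in> V"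
  obtains r where "0 < r" "cube d x r \<subseteq> V"
proof -
  obtain T where T: "open T" "V = T \<inter> {x. \<forall>i\<ge>d. x i = 0}"
    using assms(1) unfolding eopen_eq by blast
  have "openin (product_topology (\<lambda>i. euclidean) UNIV) T"
    using T(1) by (simp add: euclidean_product_topology)
  moreover have "x \<in> T" using assms(2) T(2) by simp
  ultimately obtain X where X: "x \<in> (\<Pi>\<^sub>E i\<in>UNIV. X i)" "\<And>i. open (X i)"
      "finite {i. X i \<noteq> (UNIV :: real set)}" "(\<Pi>\<^sub>E i\<in>UNIV. X i) \<subseteq> T"
    using product_topology_open_contains_basis[of "\<lambda>i. euclideanreal" UNIV T x] by auto
  have "\<exists>r>0. ball (x i) r \<subseteq> X i" for i
    using X(1,2) open_contains_ball by (metis PiE_iff UNIV_I)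
  then obtain r where r: "\<And>i. r i > 0" "\<And>i. ball (x i) (r i) \<subseteq> X i" by metis
  define R where "R = Min (insert 1 (r ` {i. i < d}))"
  have R: "R > 0" unfolding R_def using r(1) by (subst Min_gr_iff) auto
  have Rle: "R \<le> r i" if "i < d" for i unfolding R_def using that by (intro Min_le) auto
  have "cube d x R \<subseteq> V"
  proof
    fix y assume y: "y \<in> cube d x R"
    have "y i \<in> X i" for i
    proof (cases "i < d")
      case True
      then have "\<bar>y i - x i\<bar> < r i" using y Rle[of i] by (force simp: cube_def)
      then have "y i \<in> ball (x i) (r i)" by (simp add: dist_real_def abs_minus_commute)
      then show ?thesis using r(2) by blast
    next
      case False
      then have "y i = x i" using y assms(2) T(2) by (simp add: cube_def topspace_Euclidean_space)
      then show ?thesis using X(1) by (simp add: PiE_iff)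
    qed
    then have "y \<in> T" using X(4) by (auto simp: PiE_iff)
    then show "y \<in> V" using T(2) y by (simp add: cube_def topspace_Euclidean_space)
  qed
  with R show thesis using that by blast
qed

lemma cube_self: "x \<in> topspace (Euclidean_space d) \<Longrightarrow> 0 < r \<Longrightarrow> x \<in> cube d x r"
  by (simp add: cube_def)

lemma eopenI:
  assumes "\<And>x. x \<in> V \<Longrightarrow> x \<in> topspace (Euclidean_space d) \<and> (\<exists>r>0. cube d x r \<subseteq> V)"
  shows "eopen d V"
proof (subst openin_subopen, intro ballI)
  fix x assume "x \<in> V"
  with assms obtain r where "0 < r" "cube d x r \<subseteq> V" "x \<in> topspace (Euclidean_space d)" by blast
  then show "\<exists>T. eopen d T \<and> x \<in> T \<and> T \<subseteq> V" using eopen_cube[of d x r] cube_self[of x d r] by (intro exI[of _ "cube d x r"]) simp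
qed

lemma continuous_map_Ed:
  assumes "V \<subseteq> topspace (Euclidean_space d)"
  shows "continuous_map (subtopology (Euclidean_space d) V) euclideanreal f \<longleftrightarrow> continuous_on V f"
proof -
  have "{x. \<forall>i\<ge>d. x i = 0} \<inter> V = V" using assms by (auto simp: topspace_Euclidean_space)
  then show ?thesis
    by (simp add: Euclidean_space_def subtopology_subtopology euclidean_product_topology)
qed

lemma continuous_on_Ed:
  fixes f :: "(nat \<Rightarrow> real) \<Rightarrow> real"
  assumes "V \<subseteq> topspace (Euclidean_space d)"
  shows "continuous_on V f \<longleftrightarrow>
    (\<forall>x\<in>V. \<forall>e>0. \<exists>r>0. \<forall>y\<in>V \<inter> cube d x r. \<bar>f y - f x\<bar> < e)" (is "?L \<longleftrightarrow> ?R")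
proof
  assume L: ?L
  show ?R
  proof (intro ballI allI impI)
    fix x e assume x: "x \<in> V" and e: "(e::real) > 0"
    have "open (ball (f x) e)" "f x \<in> ball (f x) e" using e by auto
    then obtain A where A: "open A" "x \<in> A" "\<forall>y\<in>V. y \<in> A \<longrightarrow> f y \<in> ball (f x) e"
      using L x unfolding continuous_on_topological by meson
    have "eopen d (A \<inter> {x. \<forall>i\<ge>d. x i = 0})" unfolding eopen_eq using A(1) by blast
    moreover have "x \<in> A \<inter> {x. \<forall>i\<ge>d. x i = 0}" using A(2) x assms by (auto simp: topspace_Euclidean_space)
    ultimately obtain r where "0 < r" "cube d x r \<subseteq> A \<inter> {x. \<forall>i\<ge>d. x i = 0}" using eopen_imp_cube by blast
    then show "\<exists>r>0. \<forall>y\<in>V \<inter> cube d x r. \<bar>f y - f x\<bar> < e"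
      using A(3) by (intro exI[of _ r]) (auto simp: dist_real_def abs_minus_commute)
  qed
next
  assume R: ?R
  show ?L
    unfolding continuous_on_topological
  proof (intro ballI allI impI)
    fix x B assume x: "x \<in> V" and B: "open B" "f x \<in> B"
    then obtain e where e: "e > 0" "ball (f x) e \<subseteq> B" using open_contains_ball by blast
    with R x obtain r where r: "r > 0" "\<forall>y\<in>V \<inter> cube d x r. \<bar>f y - f x\<bar> < e" by blast
    show "\<exists>A. open A \<and> x \<in> A \<and> (\<forall>y\<in>V. y \<in> A \<longrightarrow> f y \<in> B)"
    proof (intro exI conjI ballI impI)
      show "open {y :: nat \<Rightarrow> real. \<forall>i<d. \<bar>y i - x i\<bar> < r}" by (rule open_cube)
      show "x \<in> {y. \<forall>i<d. \<bar>y i - x i\<bar> < r}" using r by simp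
      fix y assume "y \<in> V" "y \<in> {y. \<forall>i<d. \<bar>y i - x i\<bar> < r}"
      then have "y \<in> V \<inter> cube d x r" using assms by (auto simp: cube_def)
      then have "\<bar>f y - f x\<bar> < e" using r by blast
      then have "f y \<in> ball (f x) e" by (simp add: dist_real_def abs_minus_commute)
      then show "f y \<in> B" using e by blast
    qed
  qed
qed

lemma eventually_upd:
  assumes "eopen d V" "x \<in> V" "i < d"
  shows "eventually (\<lambda>s. x(i := s) \<in> V) (nhds (x i))"
proof -
  obtain r where r: "0 < r" "cube d x r \<subseteq> V" using eopen_imp_cube assms by blast
  have "x(i := s) \<in> V" if "dist s (x i) < r" for s
  proof -
    have "x \<in> topspace (Euclidean_space d)" using eopen_subset assms by blast
    then have "x(i := s) \<in> cube d x r" using that r assms(3)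
      by (auto simp: cube_def topspace_Euclidean_space dist_real_def)
    then show ?thesis using r by blast
  qed
  then show ?thesis unfolding eventually_nhds_metric using r by blast
qed

text \<open>Since \<open>Ck_on\<close> only asserts that partial derivatives exist on the set under consideration, a total
  choice of partial derivative is used to state recursions without existential quantifiers.\<close>

definition pd :: "nat \<Rightarrow> ((nat \<Rightarrow> real) \<Rightarrow> real) \<Rightarrow> (nat \<Rightarrow> real) \<Rightarrow> real" where
  "pd i f x = deriv (\<lambda>s. f (x(i := s))) (x i)"

lemma Ck_cont: "eopen d V \<Longrightarrow> Ck_on k d V f \<Longrightarrow> continuous_on V f"
  by (cases k) (auto simp: continuous_map_Ed eopen_subset)

lemma Ck_0: "eopen d V \<Longrightarrow> Ck_on 0 d V f \<longleftrightarrow> continuous_on V f"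
  by (simp add: continuous_map_Ed eopen_subset)

lemma deriv_upd_cong:
  assumes "eopen d V" "x \<in> V" "i < d" "\<And>y. y \<in> V \<Longrightarrow> f y = g y"
  shows "((\<lambda>s. f (x(i := s))) has_real_derivative D) (at (x i))
     \<longleftrightarrow> ((\<lambda>s. g (x(i := s))) has_real_derivative D) (at (x i))"
proof (rule DERIV_cong_ev)
  show "eventually (\<lambda>s. f (x(i := s)) = g (x(i := s))) (nhds (x i))"
    using eventually_upd[OF assms(1-3)] by eventually_elim (rule assms(4))
qed auto

lemma pd_cong:
  assumes "eopen d V" "x \<in> V" "i < d" "\<And>y. y \<in> V \<Longrightarrow> f y = g y"
  shows "pd i f x = pd i g x"
  unfolding pd_def deriv_def
  by (rule arg_cong[of _ _ Eps], rule ext, rule deriv_upd_cong[where f = f and g = g, OF assms])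

lemma Ck_cong:
  assumes "eopen d V" "\<And>y. y \<in> V \<Longrightarrow> f y = g y" "Ck_on k d V f"
  shows "Ck_on k d V g"
proof (cases k)
  case 0
  then show ?thesis using assms Ck_cont continuous_on_cong[of V V f g]
    by (auto simp: continuous_map_Ed eopen_subset)
next
  case (Suc k')
  have "continuous_on V g" using assms Ck_cont continuous_on_cong[of V V f g] by metis
  then have c: "continuous_map (subtopology (Euclidean_space d) V) euclideanreal g"
    by (simp add: assms(1) continuous_map_Ed eopen_subset)
  have "\<exists>f'. (\<forall>x\<in>V. ((\<lambda>s. g (x(i := s))) has_real_derivative f' x) (at (x i))) \<and> Ck_on k' d V f'"
    if i: "i < d" for i
  proof -
    obtain f' where "\<forall>x\<in>V. ((\<lambda>s. f (x(i := s))) has_real_derivative f' x) (at (x i))" "Ck_on k' d V f'"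
      using assms(3)[unfolded Suc Ck_on.simps] i by blast
    then show ?thesis
      using deriv_upd_cong[where f = f and g = g, OF assms(1) _ i assms(2)] by blast
  qed
  with c show ?thesis unfolding Suc by simp
qed

lemma Ck_Suc:
  assumes "eopen d V"
  shows "Ck_on (Suc k) d V f \<longleftrightarrow> continuous_on V f \<and>
    (\<forall>i<d. (\<forall>x\<in>V. ((\<lambda>s. f (x(i := s))) has_real_derivative pd i f x) (at (x i)))
        \<and> Ck_on k d V (pd i f))" (is "?L \<longleftrightarrow> ?R")
proof
  assume L: ?L
  show ?R
  proof (intro conjI allI impI)
    show "continuous_on V f" using L Ck_cont assms by blast
  next
    fix i assume "i < d"
    moreover have "\<forall>i<d. \<exists>f'. (\<forall>x\<in>V. ((\<lambda>s. f (x(i := s))) has_real_derivative f' x) (at (x i))) \<and> Ck_on k d V f'"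
      using L by simp
    ultimately obtain f' where f': "\<And>x. x \<in> V \<Longrightarrow> ((\<lambda>s. f (x(i := s))) has_real_derivative f' x) (at (x i))"
      "Ck_on k d V f'" by blast
    have e: "f' x = pd i f x" if "x \<in> V" for x
      unfolding pd_def using f'(1)[OF that] by (simp add: DERIV_imp_deriv)
    show "Ck_on k d V (pd i f)" by (rule Ck_cong[OF assms e f'(2)])
    show "\<forall>x\<in>V. ((\<lambda>s. f (x(i := s))) has_real_derivative pd i f x) (at (x i))"
      using f'(1) e by simp
  qed
next
  assume ?R
  then have "\<forall>i<d. \<exists>f'. (\<forall>x\<in>V. ((\<lambda>s. f (x(i := s))) has_real_derivative f' x) (at (x i))) \<and> Ck_on k d V f'"
    by blast
  with \<open>?R\<close> show ?L by (simp add: assms continuous_map_Ed eopen_subset)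
qed

lemma Ck_SucI:
  assumes "eopen d V" "continuous_on V f"
    "\<And>i. i < d \<Longrightarrow> \<exists>f'. (\<forall>x\<in>V. ((\<lambda>s. f (x(i := s))) has_real_derivative f' x) (at (x i))) \<and> Ck_on k d V f'"
  shows "Ck_on (Suc k) d V f"
  using assms by (simp add: continuous_map_Ed eopen_subset)

lemma Ck_down: "eopen d V \<Longrightarrow> Ck_on (Suc k) d V f \<Longrightarrow> Ck_on k d V f"
proof (induction k arbitrary: f)
  case 0 then show ?case by simp
next
  case (Suc k)
  then show ?case using Ck_Suc[OF Suc.prems(1), of "Suc k" f] Ck_Suc[OF Suc.prems(1), of k f] by blast
qed

lemma Ck_subset: "V' \<subseteq> V \<Longrightarrow> Ck_on k d V f \<Longrightarrow> Ck_on k d V' f"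
proof (induction k arbitrary: f)
  case 0
  then show ?case using continuous_map_from_subtopology_mono by fastforce
next
  case (Suc k)
  have c: "continuous_map (subtopology (Euclidean_space d) V') euclideanreal f"
    using conjunct1[OF Suc.prems(2)[unfolded Ck_on.simps]] Suc.prems(1)
    by (rule continuous_map_from_subtopology_mono)
  have "\<exists>f'. (\<forall>x\<in>V'. ((\<lambda>s. f (x(i := s))) has_real_derivative f' x) (at (x i))) \<and> Ck_on k d V' f'"
    if i: "i < d" for i
  proof -
    obtain f' where "\<forall>x\<in>V. ((\<lambda>s. f (x(i := s))) has_real_derivative f' x) (at (x i))" "Ck_on k d V f'"
      using Suc.prems(2)[unfolded Ck_on.simps] i by blast
    then show ?thesis using Suc.IH[OF Suc.prems(1)] Suc.prems(1) by blast
  qed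
  with c show ?case by simp
qed

text \<open>The derivatives found near different points agree because each of them is \<open>pd i f\<close>.\<close>

lemma Ck_local:
  assumes "eopen d V" "\<And>x. x \<in> V \<Longrightarrow> \<exists>W. eopen d W \<and> x \<in> W \<and> Ck_on k d W f"
  shows "Ck_on k d V f"
  using assms
proof (induction k arbitrary: f)
  case 0
  have c: "continuous_on V f"
    unfolding continuous_on_Ed[OF eopen_subset[OF 0(1)]]
  proof (intro ballI allI impI)
    fix x e assume x: "x \<in> V" and e: "(e::real) > 0"
    obtain W where W: "eopen d W" "x \<in> W" "Ck_on 0 d W f" using 0 x by blast
    then obtain r where r: "r > 0" "\<forall>y\<in>W \<inter> cube d x r. \<bar>f y - f x\<bar> < e"
      using Ck_cont[OF W(1,3)] e unfolding continuous_on_Ed[OF eopen_subset[OF W(1)]] by blast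
    obtain r' where r': "r' > 0" "cube d x r' \<subseteq> W" using W eopen_imp_cube by blast
    have "y \<in> W \<inter> cube d x r" if "y \<in> cube d x (min r r')" for y
      using that r' by (auto simp: cube_def)
    then show "\<exists>r>0. \<forall>y\<in>V \<inter> cube d x r. \<bar>f y - f x\<bar> < e"
      using r r' by (intro exI[of _ "min r r'"]) auto
  qed
  then show ?case using 0 by (simp add: continuous_map_Ed eopen_subset)
next
  case (Suc k)
  have W: "\<exists>W. eopen d W \<and> x \<in> W \<and> Ck_on (Suc k) d W f" if "x \<in> V" for x using Suc that by blast
  have c0: "Ck_on k d V f" using Suc.IH[of f] Suc.prems(1) W Ck_down by meson
  show ?case
    unfolding Ck_Suc[OF Suc.prems(1)]
  proof (intro conjI allI impI ballI)
    show "continuous_on V f" using c0 Suc.prems(1) Ck_cont by blast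
    fix i assume i: "i < d"
    { fix x assume "x \<in> V"
      then obtain W where "eopen d W" "x \<in> W" "Ck_on (Suc k) d W f" using W by blast
      then show "((\<lambda>s. f (x(i := s))) has_real_derivative pd i f x) (at (x i))"
        using i Ck_Suc by blast }
    show "Ck_on k d V (pd i f)"
    proof (rule Suc.IH[OF Suc.prems(1)])
      fix x assume "x \<in> V"
      then obtain W where "eopen d W" "x \<in> W" "Ck_on (Suc k) d W f" using W by blast
      then show "\<exists>W. eopen d W \<and> x \<in> W \<and> Ck_on k d W (pd i f)"
        using i Ck_Suc by blast
    qed
  qed
qed

lemma Ck_const: "eopen d V \<Longrightarrow> Ck_on k d V (\<lambda>_. c)"
proof (induction k arbitrary: c)
  case (Suc k)
  have "\<forall>x\<in>V. ((\<lambda>s. c) has_real_derivative 0) (at (x i))" for i by simp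
  then show ?case
    using Suc.IH[OF Suc.prems, of 0]
    by (intro Ck_SucI[OF Suc.prems] exI[of _ "\<lambda>_. 0"] continuous_on_const) blast
qed simp

lemma cont_coord: "continuous_on V (\<lambda>y :: nat \<Rightarrow> real. y j)"
  by (rule continuous_on_subset[OF continuous_on_product_coordinates subset_UNIV])

lemma Ck_coord: "eopen d V \<Longrightarrow> Ck_on k d V (\<lambda>y. y j)"
proof (cases k)
  case 0
  assume "eopen d V"
  then show ?thesis using 0
    by (simp add: continuous_map_Ed eopen_subset cont_coord)
next
  case (Suc k')
  assume V: "eopen d V"
  show ?thesis unfolding Suc
  proof (rule Ck_SucI[OF V cont_coord])
    fix i assume "i < d"
    show "\<exists>f'. (\<forall>x\<in>V. ((\<lambda>s. (x(i := s)) j) has_real_derivative f' x) (at (x i))) \<and> Ck_on k' d V f'"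
      by (rule exI[of _ "\<lambda>_. if i = j then 1 else 0"]) (auto intro!: Ck_const[OF V] derivative_eq_intros)
  qed
qed

lemma Ck_add:
  "eopen d V \<Longrightarrow> Ck_on k d V f \<Longrightarrow> Ck_on k d V g \<Longrightarrow> Ck_on k d V (\<lambda>y. f y + g y)"
proof (induction k arbitrary: f g)
  case 0
  then show ?case using continuous_on_add[of V f g] by (simp only: Ck_0)
next
  case (Suc k)
  show ?case
  proof (rule Ck_SucI[OF Suc.prems(1)])
    show "continuous_on V (\<lambda>y. f y + g y)"
      by (rule continuous_on_add[OF Ck_cont[OF Suc.prems(1,2)] Ck_cont[OF Suc.prems(1,3)]])
    fix i assume i: "i < d"
    show "\<exists>f'. (\<forall>x\<in>V. ((\<lambda>s. f (x(i := s)) + g (x(i := s))) has_real_derivative f' x) (at (x i))) \<and> Ck_on k d V f'"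
    proof (intro exI conjI ballI)
      note S = Suc.prems[unfolded Ck_Suc[OF Suc.prems(1)]]
      show "Ck_on k d V (\<lambda>y. pd i f y + pd i g y)"
        using S i by (intro Suc.IH) blast+
      fix x assume "x \<in> V"
      then show "((\<lambda>s. f (x(i := s)) + g (x(i := s))) has_real_derivative pd i f x + pd i g x) (at (x i))"
        using S i by (intro DERIV_add) blast+
    qed
  qed
qed

lemma Ck_mult:
  "eopen d V \<Longrightarrow> Ck_on k d V f \<Longrightarrow> Ck_on k d V g \<Longrightarrow> Ck_on k d V (\<lambda>y. f y * g y)"
proof (induction k arbitrary: f g)
  case 0
  then show ?case using continuous_on_mult[of V f g] by (simp only: Ck_0)
next
  case (Suc k)
  show ?case
  proof (rule Ck_SucI[OF Suc.prems(1)])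
    show "continuous_on V (\<lambda>y. f y * g y)"
      by (rule continuous_on_mult[OF Ck_cont[OF Suc.prems(1,2)] Ck_cont[OF Suc.prems(1,3)]])
    fix i assume i: "i < d"
    note S = Suc.prems[unfolded Ck_Suc[OF Suc.prems(1)]]
    show "\<exists>f'. (\<forall>x\<in>V. ((\<lambda>s. f (x(i := s)) * g (x(i := s))) has_real_derivative f' x) (at (x i))) \<and> Ck_on k d V f'"
    proof (intro exI conjI ballI)
      have 1: "Ck_on k d V (pd i f)" "Ck_on k d V (pd i g)" using S i by blast+
      have 2: "Ck_on k d V f" "Ck_on k d V g" using Ck_down Suc.prems by blast+
      show "Ck_on k d V (\<lambda>y. pd i f y * g y + pd i g y * f y)"
        by (rule Ck_add[OF Suc.prems(1) Suc.IH[OF Suc.prems(1) 1(1) 2(2)] Suc.IH[OF Suc.prems(1) 1(2) 2(1)]])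
      fix x assume x: "x \<in> V"
      have "((\<lambda>s. f (x(i := s))) has_real_derivative pd i f x) (at (x i))"
        "((\<lambda>s. g (x(i := s))) has_real_derivative pd i g x) (at (x i))"
        using S i x by blast+
      from DERIV_mult[OF this]
      show "((\<lambda>s. f (x(i := s)) * g (x(i := s))) has_real_derivative pd i f x * g x + pd i g x * f x) (at (x i))"
        by simp
    qed
  qed
qed

declare Ck_on.simps [simp del]

lemma Ck_sum:
  assumes "eopen d V" "\<And>j. j \<in> I \<Longrightarrow> Ck_on k d V (f j)"
  shows "Ck_on k d V (\<lambda>y. \<Sum>j\<in>I. f j y)"
  using assms(2)
proof (induction I rule: infinite_finite_induct)
  case (insert a I)
  then show ?case using Ck_add[OF assms(1)] by simp
next
  case empty
  show ?case using Ck_const[OF assms(1)] by simp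
next
  case (infinite I)
  then show ?case using Ck_const[OF assms(1)] by simp
qed

lemma Ck_prod:
  assumes "eopen d V" "\<And>j. j \<in> I \<Longrightarrow> Ck_on k d V (f j)"
  shows "Ck_on k d V (\<lambda>y. \<Prod>j\<in>I. f j y)"
  using assms(2)
proof (induction I rule: infinite_finite_induct)
  case (insert a I)
  then show ?case using Ck_mult[OF assms(1)] by simp
next
  case empty
  show ?case using Ck_const[OF assms(1)] by simp
next
  case (infinite I)
  then show ?case using Ck_const[OF assms(1)] by simp
qed

section \<open>Hadamard quotients, the chain rule and bump functions\<close>

text \<open>Walking from z to y parallel to the axes, one coordinate after the other: this is the point at
  time s on the leg along coordinate j. Such paths suit a definition of differentiability by
  partial derivatives better than straight lines do.\<close>

definition hpath :: "nat \<Rightarrow> (nat \<Rightarrow> real) \<Rightarrow> real \<Rightarrow> (nat \<Rightarrow> real) \<Rightarrow> nat \<Rightarrow> real" where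
  "hpath j z s y = (\<lambda>k. if k < j then y k else if k = j then z k + s * (y k - z k) else z k)"

lemma hpath_in:
  assumes "y \<in> cube d z r" "z \<in> topspace (Euclidean_space d)" "s \<in> {0..1}"
  shows "hpath j z s y \<in> cube d z r"
proof -
  have "\<bar>s * (y j - z j)\<bar> < r" if "j < d"
  proof -
    have "\<bar>s * (y j - z j)\<bar> \<le> 1 * \<bar>y j - z j\<bar>"
      unfolding abs_mult using assms(3) by (intro mult_right_mono) auto
    then show ?thesis using assms(1) that by (force simp: cube_def)
  qed
  moreover have "0 < r" if "i < d" for i using assms(1) that by (force simp: cube_def)
  ultimately show ?thesis
    using assms by (auto simp: hpath_def cube_def topspace_Euclidean_space)
qed

lemma hpath_cont:
  assumes "continuous_on (cube d z r) g" "z \<in> topspace (Euclidean_space d)"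
  shows "continuous_on (cube d z r \<times> {0..1}) (\<lambda>(y, s). g (hpath j z s y))"
proof -
  have c: "continuous_on A (\<lambda>q. fst q k)" for A :: "((nat \<Rightarrow> real) \<times> real) set" and k
    by (rule continuous_on_compose2[OF cont_coord[of UNIV k] continuous_on_fst[OF continuous_on_id]]) auto
  have "continuous_on (cube d z r \<times> {0..1}) (\<lambda>q. hpath j z (snd q) (fst q) k)" for k
    unfolding hpath_def
    by (cases "k < j"; cases "k = j") (auto intro!: c continuous_on_add continuous_on_mult
      continuous_on_diff continuous_on_const continuous_on_snd continuous_on_id)
  then have "continuous_on (cube d z r \<times> {0..1}) (\<lambda>q. hpath j z (snd q) (fst q))"
    by (rule continuous_on_coordinatewise_then_product)
  then have "continuous_on (cube d z r \<times> {0..1}) (\<lambda>q. g (hpath j z (snd q) (fst q)))"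
    by (rule continuous_on_compose2[OF assms(1)]) (auto intro: hpath_in assms)
  then show ?thesis by (simp add: split_def)
qed

lemma hpath_integrable:
  assumes "continuous_on (cube d z r) g" "z \<in> topspace (Euclidean_space d)" "y \<in> cube d z r"
  shows "continuous_on {0..1} (\<lambda>s. g (hpath j z s y))"
proof -
  have "continuous_on {0..1::real} (\<lambda>s. (y, s))"
    by (intro continuous_on_Pair continuous_on_const continuous_on_id)
  from continuous_on_compose2[OF hpath_cont[OF assms(1,2), of j] this] assms(3)
  show ?thesis by auto
qed

text \<open>Differentiation under the integral sign. A derivative in direction i multiplies the integrand by
  1, s or 0, according to the position of i relative to j; the powers of s make the statement
  stable under this.\<close>

lemma Ck_integral:
  assumes z: "z \<in> topspace (Euclidean_space d)"
  shows "Ck_on k d (cube d z r) g \<Longrightarrow>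
    Ck_on k d (cube d z r) (\<lambda>y. integral {0..1} (\<lambda>s. s ^ m * g (hpath j z s y)))"
proof (induction k arbitrary: m g)
  have cont: "continuous_on (cube d z r) (\<lambda>y. integral {0..1} (\<lambda>s. s ^ m * g (hpath j z s y)))"
    if "continuous_on (cube d z r) g" for m g
  proof -
    have "continuous_on (cube d z r \<times> {0..1}) (\<lambda>q. snd q ^ m * (\<lambda>(y, s). g (hpath j z s y)) q)"
      by (intro continuous_on_mult hpath_cont that z continuous_on_power continuous_on_snd continuous_on_id)
    then have "continuous_on (cube d z r \<times> cbox 0 1) (\<lambda>(y, s). s ^ m * g (hpath j z s y))"
      by (simp add: split_def)
    from integral_continuous_on_param[OF this] show ?thesis by simp
  qed
  {
    case 0
    then show ?case using cont by (simp only: Ck_0 eopen_cube)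
  next
    case (Suc k)
    note S = Suc.prems[unfolded Ck_Suc[OF eopen_cube]]
    show ?case
    proof (rule Ck_SucI[OF eopen_cube cont])
      show "continuous_on (cube d z r) g" using S by blast
      fix i assume i: "i < d"
      define c :: "real \<Rightarrow> real" where "c = (\<lambda>s. if i < j then 1 else if i = j then s else 0)"
      define f' where "f' = (\<lambda>y. integral {0..1} (\<lambda>s. s ^ m * (c s * pd i g (hpath j z s y))))"
      have gi: "Ck_on k d (cube d z r) (pd i g)" using S i by blast
      have gic: "continuous_on (cube d z r) (pd i g)" using Ck_cont[OF eopen_cube gi] .
      have "Ck_on k d (cube d z r) f'"
      proof -
        consider "i < j" | "i = j" | "i > j" by linarith
        then show ?thesis
        proof cases
          case 1
          then show ?thesis using Suc.IH[OF gi, of m] by (simp add: f'_def c_def)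
        next
          case 2
          then show ?thesis using Suc.IH[OF gi, of "Suc m"]
            by (simp add: f'_def c_def mult.assoc mult.left_commute)
        next
          case 3
          then show ?thesis by (simp add: f'_def c_def Ck_const eopen_cube)
        qed
      qed
      moreover have "((\<lambda>t. integral {0..1} (\<lambda>s. s ^ m * g (hpath j z s (x(i := t)))))
          has_real_derivative f' x) (at (x i))" if x: "x \<in> cube d z r" for x
      proof -
        let ?U = "ball (z i) r"
        have xt: "x(i := t) \<in> cube d z r" if "t \<in> ?U" for t
          using that x i by (auto simp: cube_def topspace_Euclidean_space dist_real_def abs_minus_commute)
        have xi: "x i \<in> ?U" using x i by (auto simp: cube_def dist_real_def abs_minus_commute)
        have der: "((\<lambda>t. g (hpath j z s (x(i := t)))) has_real_derivative
            c s * pd i g (hpath j z s (x(i := t)))) (at t)" if t: "t \<in> ?U" and s: "s \<in> {0..1}" for t s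
        proof -
          define p where "p = hpath j z s (x(i := t))"
          have p: "p \<in> cube d z r" unfolding p_def using hpath_in xt[OF t] z s by blast
          then have D: "((\<lambda>u. g (p(i := u))) has_real_derivative pd i g p) (at (p i))"
            using S i by blast
          have "((\<lambda>u. g (hpath j z s (x(i := u)))) has_real_derivative c s * pd i g p) (at t)"
          proof -
            consider "i < j" | "i = j" | "i > j" by linarith
            then show ?thesis
            proof cases
              case 1
              have e: "hpath j z s (x(i := u)) = p(i := u)" for u
                using 1 by (auto simp: p_def hpath_def)
              have pi: "p i = t" using 1 by (simp add: p_def hpath_def)
              show ?thesis using D[unfolded pi] 1 by (simp add: e c_def)
            next
              case 2
              have e: "hpath j z s (x(i := u)) = p(i := z i + s * (u - z i))" for u
                using 2 by (auto simp: p_def hpath_def)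
              have pi: "p i = z i + s * (t - z i)" using 2 by (simp add: p_def hpath_def)
              have "((\<lambda>u. z i + s * (u - z i)) has_real_derivative s) (at t)"
                by (auto intro!: derivative_eq_intros)
              from DERIV_chain2[OF D[unfolded pi] this] show ?thesis
                unfolding e using 2 by (simp add: c_def mult.commute)
            next
              case 3
              have e: "hpath j z s (x(i := u)) = p" for u using 3 by (auto simp: p_def hpath_def)
              show ?thesis using 3 by (simp add: e c_def)
            qed
          qed
          then show ?thesis by (simp only: p_def)
        qed
        have upd: "continuous_on (?U \<times> {0..1::real}) (\<lambda>q. (x(i := fst q), snd q))"
        proof (intro continuous_on_Pair continuous_on_snd continuous_on_id
            continuous_on_coordinatewise_then_product)
          fix k
          show "continuous_on (?U \<times> {0..1::real}) (\<lambda>q. (x(i := fst q)) k)"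
            by (cases "k = i") (auto intro: continuous_on_fst continuous_on_id)
        qed
        have cc: "continuous_on (?U \<times> {0..1::real}) (\<lambda>q. c (snd q))"
          unfolding c_def by (cases "i < j"; cases "i = j") (auto intro: continuous_on_snd continuous_on_id)
        have "continuous_on (?U \<times> {0..1}) (\<lambda>q. (\<lambda>(y, s). pd i g (hpath j z s y)) (x(i := fst q), snd q))"
          by (rule continuous_on_compose2[OF hpath_cont[OF gic z] upd]) (auto intro: xt)
        then have "continuous_on (?U \<times> {0..1}) (\<lambda>q. snd q ^ m * (c (snd q) * pd i g (hpath j z (snd q) (x(i := fst q)))))"
          by (intro continuous_on_mult cc continuous_on_power continuous_on_snd continuous_on_id) simp
        then have C: "continuous_on (?U \<times> cbox 0 1) (\<lambda>(t, s). s ^ m * (c s * pd i g (hpath j z s (x(i := t)))))"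
          by (simp add: split_def)
        have int: "(\<lambda>s. s ^ m * g (hpath j z s (x(i := t)))) integrable_on cbox 0 1" if "t \<in> ?U" for t
          unfolding box_real using S
          by (intro integrable_continuous_interval continuous_on_mult continuous_on_power continuous_on_id
              hpath_integrable[OF _ z xt[OF that]]) blast
        have "((\<lambda>t. integral (cbox 0 1) (\<lambda>s. s ^ m * g (hpath j z s (x(i := t))))) has_field_derivative
           integral (cbox 0 1) (\<lambda>s. s ^ m * (c s * pd i g (hpath j z s (x(i := x i)))))) (at (x i) within ?U)"
          by (rule leibniz_rule_field_derivative[OF _ int C xi convex_ball])
            (auto intro!: DERIV_cmult has_field_derivative_at_within[OF der])
        then show ?thesis using xi by (simp add: f'_def at_within_open[OF xi open_ball])
      qed
      ultimately show "\<exists>f'. (\<forall>x\<in>cube d z r. ((\<lambda>t. integral {0..1} (\<lambda>s. s ^ m * g (hpath j z s (x(i := t)))))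
          has_real_derivative f' x) (at (x i))) \<and> Ck_on k d (cube d z r) f'"
        by (intro exI[of _ f'] conjI ballI)
    qed
  }
qed

text \<open>The j-th Hadamard quotient of f at z.\<close>

definition hquot :: "nat \<Rightarrow> (nat \<Rightarrow> real) \<Rightarrow> ((nat \<Rightarrow> real) \<Rightarrow> real) \<Rightarrow> (nat \<Rightarrow> real) \<Rightarrow> real" where
  "hquot j z f y = integral {0..1} (\<lambda>s. pd j f (hpath j z s y))"

lemma hquot_Ck:
  assumes "z \<in> topspace (Euclidean_space d)" "Ck_on (Suc k) d (cube d z r) f" "j < d"
  shows "Ck_on k d (cube d z r) (hquot j z f)"
proof -
  have "Ck_on k d (cube d z r) (pd j f)" using assms(2,3) unfolding Ck_Suc[OF eopen_cube] by blast
  from Ck_integral[OF assms(1) this, of 0 j] show ?thesis by (simp add: hquot_def[abs_def])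
qed

lemma hquot_base: "hquot j z f z = pd j f z"
proof -
  have "hpath j z s z = z" for s by (auto simp: hpath_def)
  then show ?thesis by (simp add: hquot_def)
qed

text \<open>Telescoping along the legs of the axis-parallel path; on each leg the difference of values is the
  integral of the partial derivative.\<close>

lemma hquot_expand:
  assumes z: "z \<in> topspace (Euclidean_space d)" and f: "Ck_on (Suc k) d (cube d z r) f"
    and y: "y \<in> cube d z r"
  shows "f y = f z + (\<Sum>j<d. (y j - z j) * hquot j z f y)"
proof -
  have S: "continuous_on (cube d z r) f"
    "\<And>i x. i < d \<Longrightarrow> x \<in> cube d z r \<Longrightarrow> ((\<lambda>s. f (x(i := s))) has_real_derivative pd i f x) (at (x i))"
    "\<And>i. i < d \<Longrightarrow> continuous_on (cube d z r) (pd i f)"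
    using f[unfolded Ck_Suc[OF eopen_cube]] Ck_cont[OF eopen_cube] by blast+
  have step: "f (hpath j z 1 y) - f (hpath j z 0 y) = (y j - z j) * hquot j z f y" if j: "j < d" for j
  proof -
    have "((\<lambda>s. (y j - z j) * pd j f (hpath j z s y)) has_integral f (hpath j z 1 y) - f (hpath j z 0 y)) {0..1}"
    proof (rule fundamental_theorem_of_calculus)
      fix s :: real assume s: "s \<in> {0..1}"
      define p where "p = hpath j z s y"
      have p: "p \<in> cube d z r" unfolding p_def using hpath_in y z s by blast
      have e: "hpath j z u y = p(j := z j + u * (y j - z j))" for u
        by (auto simp: p_def hpath_def)
      have pj: "p j = z j + s * (y j - z j)" by (simp add: p_def hpath_def)
      have D: "((\<lambda>u. f (p(j := u))) has_real_derivative pd j f p) (at (p j))" using S(2) j p by blast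
      have "((\<lambda>u. z j + u * (y j - z j)) has_real_derivative y j - z j) (at s)"
        by (auto intro!: derivative_eq_intros)
      from DERIV_chain2[OF D[unfolded pj] this]
      have "((\<lambda>u. f (hpath j z u y)) has_real_derivative (y j - z j) * pd j f (hpath j z s y)) (at s)"
        by (simp add: e[symmetric] p_def[symmetric] mult.commute)
      then show "((\<lambda>u. f (hpath j z u y)) has_vector_derivative (y j - z j) * pd j f (hpath j z s y)) (at s within {0..1})"
        using has_field_derivative_at_within has_real_derivative_iff_has_vector_derivative by blast
    qed simp
    from integral_unique[OF this] show ?thesis by (simp add: hquot_def)
  qed
  have "(\<Sum>j<d. (y j - z j) * hquot j z f y) = (\<Sum>j<d. f (hpath (Suc j) z 0 y) - f (hpath j z 0 y))"
  proof (rule sum.cong)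
    fix j assume "j \<in> {..<d}"
    moreover have "hpath (Suc j) z 0 y = hpath j z 1 y" by (auto simp: hpath_def)
    ultimately show "(y j - z j) * hquot j z f y = f (hpath (Suc j) z 0 y) - f (hpath j z 0 y)"
      using step by simp
  qed simp
  also have "\<dots> = f (hpath d z 0 y) - f (hpath 0 z 0 y)" by (rule sum_lessThan_telescope)
  also have "hpath 0 z 0 y = z" by (auto simp: hpath_def)
  also have "hpath d z 0 y = y" using y z by (auto simp: hpath_def cube_def topspace_Euclidean_space)
  finally show ?thesis by simp
qed

lemma DERIV_mult_null:
  assumes "(u has_real_derivative c) (at s)" "u s = 0" "isCont w s"
  shows "((\<lambda>x. u x * w x) has_real_derivative c * w s) (at s)"
proof -
  have "((\<lambda>y. ((u y - u s) / (y - s)) * w y) \<longlongrightarrow> c * w s) (at s)"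
    using assms by (intro tendsto_mult) (auto simp: has_field_derivative_iff isCont_def)
  then show ?thesis using assms(2) by (simp add: has_field_derivative_iff)
qed

text \<open>The Hadamard expansion at \<open>\<gamma> s0\<close> writes \<open>f (\<gamma> s) - f (\<gamma> s0)\<close> as a sum of terms
  \<open>(\<gamma> s j - \<gamma> s0 j) * w s\<close> with w continuous at s0, and such a product is differentiable at s0 with
  the expected derivative. This replaces an appeal to total differentiability.\<close>

lemma C1_chain:
  assumes W: "eopen n W" and f: "Ck_on (Suc 0) n W f" and g: "\<gamma> s0 \<in> W"
    "eventually (\<lambda>s. \<gamma> s \<in> topspace (Euclidean_space n)) (nhds s0)"
    and c: "\<And>j. j < n \<Longrightarrow> ((\<lambda>s. \<gamma> s j) has_real_derivative c j) (at s0)"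
  shows "((\<lambda>s. f (\<gamma> s)) has_real_derivative (\<Sum>j<n. c j * pd j f (\<gamma> s0))) (at s0)"
proof -
  define z where "z = \<gamma> s0"
  obtain r where r: "r > 0" "cube n z r \<subseteq> W" using eopen_imp_cube[OF W] g(1) z_def by blast
  have z: "z \<in> topspace (Euclidean_space n)" using eopen_subset[OF W] g(1) z_def by blast
  have fc: "Ck_on (Suc 0) n (cube n z r) f" by (rule Ck_subset[OF r(2) f])
  have ev: "eventually (\<lambda>s. \<gamma> s \<in> cube n z e) (nhds s0)" if e: "e > 0" for e
  proof -
    have "eventually (\<lambda>s. \<bar>\<gamma> s j - z j\<bar> < e) (nhds s0)" if "j < n" for j
    proof -
      have "isCont (\<lambda>s. \<gamma> s j) s0" using DERIV_isCont[OF c[OF that]] .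
      then have "((\<lambda>s. \<gamma> s j) \<longlongrightarrow> z j) (nhds s0)"
        using tendsto_at_iff_tendsto_nhds[of "\<lambda>s. \<gamma> s j" s0] by (simp add: isCont_def z_def)
      from tendstoD[OF this e] show ?thesis by (simp add: dist_real_def)
    qed
    then have "eventually (\<lambda>s. \<forall>j\<in>{..<n}. \<bar>\<gamma> s j - z j\<bar> < e) (nhds s0)"
      by (intro eventually_ball_finite) auto
    with g(2) show ?thesis by eventually_elim (auto simp: cube_def)
  qed
  have w: "isCont (\<lambda>s. hquot j z f (\<gamma> s)) s0" if j: "j < n" for j
  proof -
    have "Ck_on 0 n (cube n z r) (hquot j z f)" by (rule hquot_Ck[OF z fc j])
    then have cq: "continuous_on (cube n z r) (hquot j z f)" by (rule Ck_cont[OF eopen_cube])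
    show ?thesis unfolding isCont_def
    proof (rule tendstoI)
      fix e :: real assume "e > 0"
      then obtain r' where r': "r' > 0"
        "\<forall>y\<in>cube n z r \<inter> cube n z r'. \<bar>hquot j z f y - hquot j z f z\<bar> < e"
        using cq cube_self[OF z r(1)] unfolding continuous_on_Ed[OF eopen_subset[OF eopen_cube]] by blast
      have "eventually (\<lambda>s. dist (hquot j z f (\<gamma> s)) (hquot j z f (\<gamma> s0)) < e) (nhds s0)"
        using ev[OF r(1)] ev[OF r'(1)]
        by eventually_elim (use r'(2) in \<open>auto simp: dist_real_def z_def\<close>)
      then show "eventually (\<lambda>s. dist (hquot j z f (\<gamma> s)) (hquot j z f (\<gamma> s0)) < e) (at s0)"
        by (simp add: eventually_nhds_conv_at)
    qed
  qed
  have "((\<lambda>s. f z + (\<Sum>j<n. (\<gamma> s j - z j) * hquot j z f (\<gamma> s))) has_real_derivative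
      0 + (\<Sum>j<n. c j * hquot j z f (\<gamma> s0))) (at s0)"
  proof (intro DERIV_add DERIV_const DERIV_sum DERIV_mult_null w)
    fix j assume "j \<in> {..<n}"
    then show "((\<lambda>s. \<gamma> s j - z j) has_real_derivative c j) (at s0)"
      using DERIV_diff[OF c DERIV_const[of "z j"]] by simp
  qed (auto simp: z_def)
  moreover have "eventually (\<lambda>s. f (\<gamma> s) = f z + (\<Sum>j<n. (\<gamma> s j - z j) * hquot j z f (\<gamma> s))) (nhds s0)"
    using ev[OF r(1)] by eventually_elim (rule hquot_expand[OF z fc])
  ultimately show ?thesis
    using DERIV_cong_ev[of s0 s0 "\<lambda>s. f (\<gamma> s)"] by (simp add: hquot_base z_def[symmetric])
qed

lemma Ck_compose:
  assumes V: "eopen m V" and W: "eopen n W" and F: "\<And>y. y \<in> V \<Longrightarrow> F y \<in> W"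
    and Fj: "\<And>j. j < n \<Longrightarrow> Ck_on k m V (\<lambda>y. F y j)" and g: "Ck_on k n W g"
  shows "Ck_on k m V (\<lambda>y. g (F y))"
  using Fj g
proof (induction k arbitrary: g)
  have cont: "continuous_on V (\<lambda>y. g (F y))"
    if "\<And>j. j < n \<Longrightarrow> continuous_on V (\<lambda>y. F y j)" "continuous_on W g" for g
  proof -
    have "continuous_on V (\<lambda>y. F y j)" for j
    proof (cases "j < n")
      case False
      then have "\<And>y. y \<in> V \<Longrightarrow> F y j = 0"
        using F eopen_subset[OF W] by (force simp: topspace_Euclidean_space)
      then show ?thesis using continuous_on_cong[of V V "\<lambda>y. F y j" "\<lambda>y. 0"] by simp
    qed (rule that(1))
    then have "continuous_on V F" by (rule continuous_on_coordinatewise_then_product)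
    then show ?thesis by (rule continuous_on_compose2[OF that(2)]) (use F in auto)
  qed
  {
    case 0
    show ?case unfolding Ck_0[OF V]
    proof (rule cont)
      show "continuous_on V (\<lambda>y. F y j)" if "j < n" for j using Ck_cont[OF V 0(1)[OF that]] .
      show "continuous_on W g" using Ck_cont[OF W 0(2)] .
    qed
  next
    case (Suc k)
    have Fk: "Ck_on k m V (\<lambda>y. F y j)" if "j < n" for j
      using Ck_down[OF V Suc.prems(1)[OF that]] .
    note S = Suc.prems(2)[unfolded Ck_Suc[OF W]]
    show ?case
    proof (rule Ck_SucI[OF V cont])
      show "continuous_on V (\<lambda>y. F y j)" if "j < n" for j using Ck_cont[OF V Suc.prems(1)[OF that]] .
      show "continuous_on W g" using S by blast
      fix i assume i: "i < m"
      define f' where "f' = (\<lambda>y. \<Sum>j<n. pd i (\<lambda>y. F y j) y * pd j g (F y))"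
      have "Ck_on k m V f'" unfolding f'_def
      proof (intro Ck_sum Ck_mult V)
        fix j assume "j \<in> {..<n}" then have j: "j < n" by simp
        show "Ck_on k m V (pd i (\<lambda>y. F y j))" using Suc.prems(1)[OF j] i unfolding Ck_Suc[OF V] by blast
        have "Ck_on k n W (pd j g)" using S j by blast
        then show "Ck_on k m V (\<lambda>y. pd j g (F y))" using Suc.IH[OF Fk] by blast
      qed
      moreover have "((\<lambda>s. g (F (x(i := s)))) has_real_derivative f' x) (at (x i))" if x: "x \<in> V" for x
      proof -
        have g1: "Ck_on (Suc 0) n W g" unfolding Ck_Suc[OF W] Ck_0[OF W]
          using S Ck_cont[OF W] by blast
        have "((\<lambda>s. g (F (x(i := s)))) has_real_derivative
            (\<Sum>j<n. pd i (\<lambda>y. F y j) x * pd j g (F (x(i := x i))))) (at (x i))"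
        proof (rule C1_chain[OF W g1])
          show "F (x(i := x i)) \<in> W" using F x by simp
          show "eventually (\<lambda>s. F (x(i := s)) \<in> topspace (Euclidean_space n)) (nhds (x i))"
            using eventually_upd[OF V x i] by eventually_elim (use F eopen_subset[OF W] in blast)
          fix j assume "j < n"
          then show "((\<lambda>s. F (x(i := s)) j) has_real_derivative pd i (\<lambda>y. F y j) x) (at (x i))"
            using Suc.prems(1)[of j] i x unfolding Ck_Suc[OF V] by blast
        qed
        then show ?thesis by (simp add: f'_def)
      qed
      ultimately show "\<exists>f'. (\<forall>x\<in>V. ((\<lambda>s. g (F (x(i := s)))) has_real_derivative f' x) (at (x i))) \<and> Ck_on k m V f'"
        by (intro exI[of _ f'] conjI ballI)
    qed
  }
qed

text \<open>The family \<open>exp (- 1 / x) / x ^ n\<close>, continued by 0, is closed under differentiation, which makes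
  smoothness an induction.\<close>

definition flat_exp :: "nat \<Rightarrow> real \<Rightarrow> real" where
  "flat_exp n x = (if x > 0 then exp (- (1 / x)) / x ^ n else 0)"

text \<open>Quadratic decay at 0 gives derivative 0 there.\<close>

lemma flat_exp_bound: "\<bar>flat_exp n x\<bar> \<le> real (n + 2) ^ (n + 2) * x\<^sup>2"
proof (cases "x > 0")
  case True
  define m where "m = n + 2"
  have "((1 / x) / m) ^ m \<le> (1 + (1 / x) / m) ^ m"
    using True by (intro power_mono) (auto simp: m_def)
  also have "\<dots> \<le> exp (1 / x)"
  proof (rule exp_ge_one_plus_x_over_n_power_n)
    have "0 \<le> 1 / x" using True by simp
    then show "- real m \<le> 1 / x" by linarith
  qed (simp add: m_def)
  finally have "1 / (x ^ m * real m ^ m) \<le> exp (1 / x)" by (simp add: power_divide power_mult_distrib)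
  moreover define K where "K = x ^ m * real m ^ m"
  moreover have "K > 0" using True by (simp add: K_def m_def)
  ultimately have "1 \<le> exp (1 / x) * K" by (simp add: pos_divide_le_eq)
  then have "exp (- (1 / x)) \<le> x ^ m * real m ^ m"
    by (simp add: exp_minus inverse_eq_divide pos_divide_le_eq mult.commute K_def[symmetric])
  then have "exp (- (1 / x)) / x ^ n \<le> x ^ m * real m ^ m / x ^ n"
    using True by (intro divide_right_mono) auto
  also have "x ^ m * real m ^ m / x ^ n = real m ^ m * x\<^sup>2"
    using True by (simp add: m_def power_add power2_eq_square)
  finally show ?thesis using True by (simp add: flat_exp_def m_def)
qed (simp add: flat_exp_def)

lemma flat_exp_deriv:
  "(flat_exp n has_real_derivative flat_exp (n + 2) x - n * flat_exp (n + 1) x) (at x)"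
proof -
  consider "x > 0" | "x = 0" | "x < 0" by linarith
  then show ?thesis
  proof cases
    case 1
    have "((\<lambda>x. exp (- (1 / x)) / x ^ n) has_real_derivative
       (exp (- (1 / x)) * (1 / x\<^sup>2) * x ^ n - exp (- (1 / x)) * (n * x ^ (n - 1))) / (x ^ n * x ^ n)) (at x)"
      using 1 by (auto intro!: derivative_eq_intros simp: power2_eq_square)
    moreover have "(exp (- (1 / x)) * (1 / x\<^sup>2) * x ^ n - exp (- (1 / x)) * (n * x ^ (n - 1))) / (x ^ n * x ^ n)
      = flat_exp (n + 2) x - n * flat_exp (n + 1) x"
      using 1 by (cases n) (simp_all add: flat_exp_def field_simps power2_eq_square)
    moreover have "eventually (\<lambda>y. flat_exp n y = exp (- (1 / y)) / y ^ n) (nhds x)"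
      using eventually_nhds_in_open[of "{0<..}" x] 1 by (auto simp: flat_exp_def elim: eventually_mono)
    ultimately show ?thesis using DERIV_cong_ev[of x x "flat_exp n"] by simp
  next
    case 2
    have "((\<lambda>y. (flat_exp n y - flat_exp n 0) / (y - 0)) \<longlongrightarrow> 0) (at 0)"
    proof (rule Lim_null_comparison[where g = "\<lambda>y. real (n + 2) ^ (n + 2) * \<bar>y\<bar>"])
      have "\<bar>flat_exp n y / y\<bar> \<le> real (n + 2) ^ (n + 2) * \<bar>y\<bar>" if "y \<noteq> 0" for y
      proof -
        have "\<bar>flat_exp n y / y\<bar> = \<bar>flat_exp n y\<bar> / \<bar>y\<bar>" by simp
        also have "\<dots> \<le> real (n + 2) ^ (n + 2) * y\<^sup>2 / \<bar>y\<bar>"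
          using flat_exp_bound by (intro divide_right_mono) auto
        also have "\<dots> = real (n + 2) ^ (n + 2) * \<bar>y\<bar>"
          using that by (simp add: power2_eq_square abs_if)
        finally show ?thesis .
      qed
      then show "eventually (\<lambda>y. norm ((flat_exp n y - flat_exp n 0) / (y - 0)) \<le> real (n + 2) ^ (n + 2) * \<bar>y\<bar>) (at 0)"
        by (auto simp: eventually_at_filter flat_exp_def[of n 0])
      show "((\<lambda>y. real (n + 2) ^ (n + 2) * \<bar>y\<bar>) \<longlongrightarrow> 0) (at 0)"
        by (rule tendsto_mult_right_zero) (rule tendsto_rabs_zero[OF tendsto_ident_at])
    qed
    then show ?thesis using 2 by (simp add: has_field_derivative_iff flat_exp_def)
  next
    case 3
    have "eventually (\<lambda>y. flat_exp n y = 0) (nhds x)"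
      using eventually_nhds_in_open[of "{..<0}" x] 3 by (auto simp: flat_exp_def elim: eventually_mono)
    then show ?thesis using DERIV_cong_ev[of x x "flat_exp n" "\<lambda>_. 0"] 3 by (simp add: flat_exp_def)
  qed
qed

lemma Ck_flat_exp:
  "eopen d V \<Longrightarrow> Ck_on k d V u \<Longrightarrow> Ck_on k d V (\<lambda>y. flat_exp n (u y))"
proof (induction k arbitrary: n u)
  have c: "continuous_on V (\<lambda>y. flat_exp n (u y))" if "continuous_on V u" for n u
    by (rule continuous_on_compose2[OF _ that, of UNIV])
      (auto simp: continuous_on_eq_continuous_at intro: DERIV_isCont[OF flat_exp_deriv])
  { case 0
    then show ?case using c by (simp only: Ck_0) }
  case (Suc k)
  note S = Suc.prems(2)[unfolded Ck_Suc[OF Suc.prems(1)]]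
  show ?case
  proof (rule Ck_SucI[OF Suc.prems(1) c])
    show "continuous_on V u" using S by blast
    fix i assume i: "i < d"
    show "\<exists>f'. (\<forall>x\<in>V. ((\<lambda>s. flat_exp n (u (x(i := s)))) has_real_derivative f' x) (at (x i))) \<and> Ck_on k d V f'"
    proof (intro exI conjI ballI)
      show "Ck_on k d V (\<lambda>y. (flat_exp (n + 2) (u y) + (- real n) * flat_exp (n + 1) (u y)) * pd i u y)"
        using S i Ck_down[OF Suc.prems]
        by (intro Ck_mult Ck_add Ck_const Suc.prems(1) Suc.IH) blast+
      fix x assume "x \<in> V"
      then have D: "((\<lambda>s. u (x(i := s))) has_real_derivative pd i u x) (at (x i))" using S i by blast
      show "((\<lambda>s. flat_exp n (u (x(i := s)))) has_real_derivative
        (flat_exp (n + 2) (u x) + (- real n) * flat_exp (n + 1) (u x)) * pd i u x) (at (x i))"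
        using DERIV_chain2[OF flat_exp_deriv D, of n] by simp
    qed
  qed
qed

text \<open>Equal to 1 for \<open>u \<le> 0\<close>, where the inner flat function vanishes, and to 0 for \<open>u \<ge> 1\<close>, where the inner
  value is at least \<open>exp (- 1)\<close> and the outer argument is not positive.\<close>

definition plateau :: "real \<Rightarrow> real" where
  "plateau u = flat_exp 0 (exp (- 1) - flat_exp 0 u) * inverse (flat_exp 0 (exp (- 1)))"

lemma plateau_1: "u \<le> 0 \<Longrightarrow> plateau u = 1"
  by (simp add: plateau_def flat_exp_def)

lemma plateau_0: "u \<ge> 1 \<Longrightarrow> plateau u = 0"
  by (simp add: plateau_def flat_exp_def)

lemma Ck_plateau:
  assumes "eopen d V" "Ck_on k d V u" shows "Ck_on k d V (\<lambda>y. plateau (u y))"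
proof -
  have "Ck_on k d V (\<lambda>y. flat_exp 0 (exp (- 1) + (- 1) * flat_exp 0 (u y)) * inverse (flat_exp 0 (exp (- 1))))"
    by (intro Ck_mult Ck_const Ck_flat_exp Ck_add assms)
  then show ?thesis by (simp add: plateau_def)
qed

text \<open>The argument \<open>2 * q\<^sup>2 - 1\<close> of the plateau is negative for \<open>q < 1 / 2\<close> and at least 1 for \<open>q \<ge> 1\<close>.\<close>

definition bump :: "nat \<Rightarrow> (nat \<Rightarrow> real) \<Rightarrow> real \<Rightarrow> (nat \<Rightarrow> real) \<Rightarrow> real" where
  "bump d z r y = (\<Prod>i<d. plateau (2 * ((y i - z i) / r)\<^sup>2 - 1))"

lemma bump_1:
  assumes "r > 0" "\<And>i. i < d \<Longrightarrow> \<bar>y i - z i\<bar> < r / 2" shows "bump d z r y = 1"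
proof -
  have "plateau (2 * ((y i - z i) / r)\<^sup>2 - 1) = 1" if "i < d" for i
  proof (rule plateau_1)
    define q where "q = (y i - z i) / r"
    have "\<bar>q\<bar> \<le> 1 / 2" unfolding q_def using assms(1) assms(2)[OF that] by (simp add: field_simps)
    then have "q\<^sup>2 \<le> (1 / 2)\<^sup>2" using abs_le_square_iff[of q "1 / 2"] by simp
    then show "2 * ((y i - z i) / r)\<^sup>2 - 1 \<le> 0" unfolding q_def[symmetric] by (simp add: power_divide)
  qed
  then show ?thesis by (simp add: bump_def)
qed

lemma bump_0:
  assumes "r > 0" "i < d" "\<bar>y i - z i\<bar> \<ge> r" shows "bump d z r y = 0"
proof -
  define q where "q = (y i - z i) / r"
  have "1 \<le> \<bar>q\<bar>" unfolding q_def using assms by (simp add: field_simps)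
  then have "1 \<le> q\<^sup>2" using abs_le_square_iff[of 1 q] by simp
  then have "plateau (2 * ((y i - z i) / r)\<^sup>2 - 1) = 0" unfolding q_def[symmetric] by (intro plateau_0) simp
  then show ?thesis using assms(2) by (auto simp: bump_def)
qed

lemma Ck_bump: "eopen d V \<Longrightarrow> Ck_on k d V (bump d z r)"
proof -
  assume V: "eopen d V"
  have "Ck_on k d V (\<lambda>y. \<Prod>i<d. plateau (2 * (((y i + (- z i)) * inverse r) * ((y i + (- z i)) * inverse r)) + (- 1)))"
    by (intro Ck_prod Ck_plateau Ck_add Ck_mult Ck_const Ck_coord V)
  then show ?thesis by (simp add: bump_def[abs_def] power2_eq_square divide_inverse)
qed

lemma Cinf_D: "Cinf_on d V f \<Longrightarrow> Ck_on k d V f" by (simp add: Cinf_on_def)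

lemma Cinf_subset: "V' \<subseteq> V \<Longrightarrow> Cinf_on d V f \<Longrightarrow> Cinf_on d V' f"
  unfolding Cinf_on_def using Ck_subset by blast

lemma Cinf_cong: "eopen d V \<Longrightarrow> (\<And>y. y \<in> V \<Longrightarrow> f y = g y) \<Longrightarrow> Cinf_on d V f \<Longrightarrow> Cinf_on d V g"
  unfolding Cinf_on_def using Ck_cong[of d V f g] by blast

lemma Cinf_local:
  assumes "eopen d V" "\<And>x. x \<in> V \<Longrightarrow> \<exists>W. eopen d W \<and> x \<in> W \<and> Cinf_on d W f"
  shows "Cinf_on d V f"
  unfolding Cinf_on_def
proof
  fix k show "Ck_on k d V f"
    by (rule Ck_local[OF assms(1)]) (use assms(2) in \<open>force simp: Cinf_on_def\<close>)
qed

lemma Cinf_const: "eopen d V \<Longrightarrow> Cinf_on d V (\<lambda>_. c)" by (simp add: Cinf_on_def Ck_const)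
lemma Cinf_coord: "eopen d V \<Longrightarrow> Cinf_on d V (\<lambda>y. y j)" by (simp add: Cinf_on_def Ck_coord)
lemma Cinf_add: "eopen d V \<Longrightarrow> Cinf_on d V f \<Longrightarrow> Cinf_on d V g \<Longrightarrow> Cinf_on d V (\<lambda>y. f y + g y)"
  by (simp add: Cinf_on_def Ck_add)
lemma Cinf_mult: "eopen d V \<Longrightarrow> Cinf_on d V f \<Longrightarrow> Cinf_on d V g \<Longrightarrow> Cinf_on d V (\<lambda>y. f y * g y)"
  by (simp add: Cinf_on_def Ck_mult)
lemma Cinf_sum: "eopen d V \<Longrightarrow> (\<And>j. j \<in> I \<Longrightarrow> Cinf_on d V (f j)) \<Longrightarrow> Cinf_on d V (\<lambda>y. \<Sum>j\<in>I. f j y)"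
  by (simp add: Cinf_on_def Ck_sum)
lemma Cinf_bump: "eopen d V \<Longrightarrow> Cinf_on d V (bump d z r)" by (simp add: Cinf_on_def Ck_bump)
lemma Cinf_compose:
  "eopen m V \<Longrightarrow> eopen n W \<Longrightarrow> (\<And>y. y \<in> V \<Longrightarrow> F y \<in> W) \<Longrightarrow>
   (\<And>j. j < n \<Longrightarrow> Cinf_on m V (\<lambda>y. F y j)) \<Longrightarrow> Cinf_on n W g \<Longrightarrow> Cinf_on m V (\<lambda>y. g (F y))"
  unfolding Cinf_on_def using Ck_compose by blast
lemma Cinf_pd: "eopen d V \<Longrightarrow> Cinf_on d V f \<Longrightarrow> i < d \<Longrightarrow> Cinf_on d V (pd i f)"
  unfolding Cinf_on_def using Ck_Suc by blast
lemma Cinf_deriv: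
  "eopen d V \<Longrightarrow> Cinf_on d V f \<Longrightarrow> i < d \<Longrightarrow> x \<in> V \<Longrightarrow>
    ((\<lambda>s. f (x(i := s))) has_real_derivative pd i f x) (at (x i))"
  unfolding Cinf_on_def using Ck_Suc by blast
lemma Cinf_hquot:
  "z \<in> topspace (Euclidean_space d) \<Longrightarrow> Cinf_on d (cube d z r) f \<Longrightarrow> j < d \<Longrightarrow>
    Cinf_on d (cube d z r) (hquot j z f)"
  unfolding Cinf_on_def using hquot_Ck by blast

section \<open>Smooth functions on manifolds\<close>

text \<open>The part of the manifold axioms that concerns one chart at a time. It passes to open subsets and
  products by direct constructions and supports all closure properties of smooth functions.\<close>

definition charted :: "('a, 'z) mfd_scheme \<Rightarrow> bool" where
  "charted M \<longleftrightarrow> (\<Union>(U, \<psi>)\<in>atlas M. U) = pts M \<and>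
     (\<forall>(U, \<psi>)\<in>atlas M. openin (mtop M) U \<and>
        (\<exists>V. eopen (mdim M) V \<and>
             homeomorphic_map (subtopology (mtop M) U) (subtopology (Euclidean_space (mdim M)) V) \<psi>))"

lemma smooth_manifold_charted: "smooth_manifold M \<Longrightarrow> charted M"
  unfolding smooth_manifold_def charted_def by blast

lemma charted_cover: "charted M \<Longrightarrow> x \<in> pts M \<Longrightarrow> \<exists>U \<psi>. (U, \<psi>) \<in> atlas M \<and> x \<in> U"
  unfolding charted_def by blast

context
  fixes M :: "('a, 'z) mfd_scheme" and U \<psi>
  assumes M: "charted M" and c: "(U, \<psi>) \<in> atlas M"
begin

lemma chart_open: "openin (mtop M) U" using M c unfolding charted_def by blast
lemma chart_sub: "U \<subseteq> pts M" using chart_open openin_subset by blast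

lemma chart_homeo: obtains V where "eopen (mdim M) V" "V = \<psi> ` U"
  "homeomorphic_map (subtopology (mtop M) U) (subtopology (Euclidean_space (mdim M)) V) \<psi>"
proof -
  obtain V where V: "eopen (mdim M) V"
    and h: "homeomorphic_map (subtopology (mtop M) U) (subtopology (Euclidean_space (mdim M)) V) \<psi>"
    using M c unfolding charted_def by blast
  have "\<psi> ` (pts M \<inter> U) = topspace (Euclidean_space (mdim M)) \<inter> V"
    using homeomorphic_imp_surjective_map[OF h] by (simp add: topspace_subtopology)
  then have "V = \<psi> ` U" using chart_sub eopen_subset[OF V] by (simp add: Int_absorb1)
  with V h that show thesis by blast
qed

lemma chart_inj: "inj_on \<psi> U"
proof -
  obtain V where "homeomorphic_map (subtopology (mtop M) U) (subtopology (Euclidean_space (mdim M)) V) \<psi>"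
    using chart_homeo by blast
  from homeomorphic_imp_injective_map[OF this] show ?thesis
    using chart_sub by (simp add: topspace_subtopology Int_absorb1)
qed

lemma chart_inv: "x \<in> U \<Longrightarrow> inv_into U \<psi> (\<psi> x) = x"
  using chart_inj by (rule inv_into_f_f)

lemma chart_image_open: "openin (mtop M) W \<Longrightarrow> eopen (mdim M) (\<psi> ` (U \<inter> W))"
proof -
  assume W: "openin (mtop M) W"
  obtain V where V: "eopen (mdim M) V" "V = \<psi> ` U"
    "homeomorphic_map (subtopology (mtop M) U) (subtopology (Euclidean_space (mdim M)) V) \<psi>"
    by (rule chart_homeo)
  have "openin (subtopology (mtop M) U) (U \<inter> W)" using W by (simp add: openin_subtopology_Int2)
  then have "openin (subtopology (Euclidean_space (mdim M)) V) (\<psi> ` (U \<inter> W))"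
    using homeomorphic_imp_open_map[OF V(3)] by (simp add: open_map_def)
  then show ?thesis using V(1) openin_open_subtopology by blast
qed

lemma chart_image_open': "eopen (mdim M) (\<psi> ` U)"
  using chart_image_open[OF chart_open] by simp

lemma chart_preimage_open: "eopen (mdim M) V \<Longrightarrow> openin (mtop M) {x \<in> U. \<psi> x \<in> V}"
proof -
  assume V: "eopen (mdim M) V"
  obtain V' where V': "homeomorphic_map (subtopology (mtop M) U) (subtopology (Euclidean_space (mdim M)) V') \<psi>"
    using chart_homeo by blast
  have "continuous_map (subtopology (mtop M) U) (Euclidean_space (mdim M)) \<psi>"
    using homeomorphic_imp_continuous_map[OF V'] continuous_map_in_subtopology by blast
  from openin_continuous_map_preimage[OF this V]
  have "openin (subtopology (mtop M) U) {x \<in> U. \<psi> x \<in> V}"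
    using chart_sub by (simp add: topspace_subtopology Int_absorb1)
  then show ?thesis using chart_open openin_open_subtopology by blast
qed

lemma chart_Ed: "x \<in> U \<Longrightarrow> \<psi> x \<in> topspace (Euclidean_space (mdim M))"
  using eopen_subset[OF chart_image_open'] by blast

end

text \<open>Smoothness on a subset W, read in all charts. As W may contain points outside the space,
  preimages such as \<open>F -` V\<close> can be used as they stand.\<close>

definition smooth_in :: "('a, 'z) mfd_scheme \<Rightarrow> 'a set \<Rightarrow> ('a \<Rightarrow> real) \<Rightarrow> bool" where
  "smooth_in M W f \<longleftrightarrow>
    (\<forall>(U, \<psi>)\<in>atlas M. Cinf_on (mdim M) (\<psi> ` (U \<inter> W)) (\<lambda>y. f (inv_into U \<psi> y)))"

lemma smooth_inI:
  "(\<And>U \<psi>. (U, \<psi>) \<in> atlas M \<Longrightarrow> Cinf_on (mdim M) (\<psi> ` (U \<inter> W)) (\<lambda>y. f (inv_into U \<psi> y)))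
   \<Longrightarrow> smooth_in M W f"
  unfolding smooth_in_def by blast

lemma smooth_inD:
  "smooth_in M W f \<Longrightarrow> (U, \<psi>) \<in> atlas M \<Longrightarrow> Cinf_on (mdim M) (\<psi> ` (U \<inter> W)) (\<lambda>y. f (inv_into U \<psi> y))"
  unfolding smooth_in_def by blast

lemma smooth_map_iff:
  "smooth_map M N F \<longleftrightarrow> continuous_map (mtop M) (mtop N) F \<and>
     (\<forall>(V, \<eta>)\<in>atlas N. \<forall>i<mdim N. smooth_in M (F -` V) (\<lambda>x. \<eta> (F x) i))"
  unfolding smooth_map_def smooth_in_def by blast

lemma smooth_map_cont: "smooth_map M N F \<Longrightarrow> continuous_map (mtop M) (mtop N) F"
  by (simp add: smooth_map_def)

lemma smooth_map_in: "smooth_map M N F \<Longrightarrow> x \<in> pts M \<Longrightarrow> F x \<in> pts N"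
  using smooth_map_cont continuous_map_image_subset_topspace by blast

lemma smooth_map_preimage_open:
  "smooth_map M N F \<Longrightarrow> openin (mtop N) W \<Longrightarrow> openin (mtop M) (pts M \<inter> F -` W)"
  using openin_continuous_map_preimage[OF smooth_map_cont] by (simp add: vimage_def Collect_conj_eq)

lemma smooth_in_subset: "W' \<subseteq> W \<Longrightarrow> smooth_in M W f \<Longrightarrow> smooth_in M W' f"
  unfolding smooth_in_def by (fast elim: Cinf_subset[rotated])

lemma smooth_in_pts:
  assumes "charted M" shows "smooth_in M (pts M \<inter> W) f \<longleftrightarrow> smooth_in M W f"
proof -
  have "U \<inter> (pts M \<inter> W) = U \<inter> W" if "(U, \<psi>) \<in> atlas M" for U \<psi>
    using chart_sub[OF assms that] by blast
  then show ?thesis unfolding smooth_in_def by auto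
qed

context
  fixes M :: "('a, 'z) mfd_scheme" assumes M: "charted M"
begin

lemma smooth_in_cong:
  "openin (mtop M) W \<Longrightarrow> (\<And>x. x \<in> W \<Longrightarrow> f x = g x) \<Longrightarrow> smooth_in M W f \<Longrightarrow> smooth_in M W g"
proof (rule smooth_inI)
  fix U \<psi> assume W: "openin (mtop M) W" and e: "\<And>x. x \<in> W \<Longrightarrow> f x = g x" and f: "smooth_in M W f"
    and c: "(U, \<psi>) \<in> atlas M"
  show "Cinf_on (mdim M) (\<psi> ` (U \<inter> W)) (\<lambda>y. g (inv_into U \<psi> y))"
    by (rule Cinf_cong[OF chart_image_open[OF M c W] _ smooth_inD[OF f c]])
      (auto simp: chart_inv[OF M c] e)
qed

lemma smooth_in_local:
  assumes "openin (mtop M) W"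
    "\<And>x. x \<in> W \<Longrightarrow> \<exists>W'. openin (mtop M) W' \<and> x \<in> W' \<and> smooth_in M W' f"
  shows "smooth_in M W f"
proof (rule smooth_inI)
  fix U \<psi> assume c: "(U, \<psi>) \<in> atlas M"
  show "Cinf_on (mdim M) (\<psi> ` (U \<inter> W)) (\<lambda>y. f (inv_into U \<psi> y))"
  proof (rule Cinf_local[OF chart_image_open[OF M c assms(1)]])
    fix y assume "y \<in> \<psi> ` (U \<inter> W)"
    then obtain x where x: "x \<in> U" "x \<in> W" "y = \<psi> x" by blast
    obtain W' where W': "openin (mtop M) W'" "x \<in> W'" "smooth_in M W' f" using assms(2) x(2) by blast
    show "\<exists>V. eopen (mdim M) V \<and> y \<in> V \<and> Cinf_on (mdim M) V (\<lambda>y. f (inv_into U \<psi> y))"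
      using chart_image_open[OF M c W'(1)] smooth_inD[OF W'(3) c] x W'(2) by blast
  qed
qed

lemma smooth_in_const: "openin (mtop M) W \<Longrightarrow> smooth_in M W (\<lambda>_. k)"
  by (rule smooth_inI, rule Cinf_const, rule chart_image_open[OF M])

lemma smooth_in_add:
  "openin (mtop M) W \<Longrightarrow> smooth_in M W f \<Longrightarrow> smooth_in M W g \<Longrightarrow> smooth_in M W (\<lambda>x. f x + g x)"
  by (rule smooth_inI, rule Cinf_add, rule chart_image_open[OF M]) (auto dest: smooth_inD)

lemma smooth_in_mult:
  "openin (mtop M) W \<Longrightarrow> smooth_in M W f \<Longrightarrow> smooth_in M W g \<Longrightarrow> smooth_in M W (\<lambda>x. f x * g x)"
  by (rule smooth_inI, rule Cinf_mult, rule chart_image_open[OF M]) (auto dest: smooth_inD)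

lemma smooth_in_sum:
  "openin (mtop M) W \<Longrightarrow> (\<And>j. j \<in> I \<Longrightarrow> smooth_in M W (f j)) \<Longrightarrow> smooth_in M W (\<lambda>x. \<Sum>j\<in>I. f j x)"
  by (rule smooth_inI, rule Cinf_sum, rule chart_image_open[OF M]) (auto dest: smooth_inD)

lemma smooth_fun_iff: "f \<in> smooth_fun M \<longleftrightarrow> (\<forall>x. x \<notin> pts M \<longrightarrow> f x = 0) \<and> smooth_in M (pts M) f"
proof -
  have "U \<inter> pts M = U" if "(U, \<psi>) \<in> atlas M" for U \<psi>
    using chart_sub[OF M that] by blast
  then show ?thesis unfolding smooth_fun_def smooth_in_def by auto
qed

lemma smooth_fun_in: "f \<in> smooth_fun M \<Longrightarrow> W \<subseteq> pts M \<Longrightarrow> smooth_in M W f"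
  using smooth_fun_iff smooth_in_subset by blast

lemma smooth_fun_off: "f \<in> smooth_fun M \<Longrightarrow> x \<notin> pts M \<Longrightarrow> f x = 0"
  using smooth_fun_iff by blast

lemma smooth_fun_cutI: "smooth_in M (pts M) f \<Longrightarrow> cut M f \<in> smooth_fun M"
  unfolding smooth_fun_iff using smooth_in_cong[of "pts M" f "cut M f"] by (auto simp: cut_def)

lemma cut_smooth: "f \<in> smooth_fun M \<Longrightarrow> cut M f = f"
  by (auto simp: cut_def smooth_fun_off)

lemma smooth_fun_const: "cut M (\<lambda>_. k) \<in> smooth_fun M"
  by (rule smooth_fun_cutI, rule smooth_in_const) simp

lemma smooth_fun_zero: "(\<lambda>_. 0) \<in> smooth_fun M"
proof -
  have "(\<lambda>_. 0) = cut M (\<lambda>_. 0)" by (auto simp: cut_def)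
  then show ?thesis using smooth_fun_const by metis
qed

lemma smooth_fun_add: "f \<in> smooth_fun M \<Longrightarrow> g \<in> smooth_fun M \<Longrightarrow> (\<lambda>x. f x + g x) \<in> smooth_fun M"
  unfolding smooth_fun_iff by (auto intro: smooth_in_add)

lemma smooth_fun_mult: "f \<in> smooth_fun M \<Longrightarrow> g \<in> smooth_fun M \<Longrightarrow> (\<lambda>x. f x * g x) \<in> smooth_fun M"
  unfolding smooth_fun_iff by (auto intro: smooth_in_mult)

lemma smooth_fun_cmult: "f \<in> smooth_fun M \<Longrightarrow> (\<lambda>x. k * f x) \<in> smooth_fun M"
  unfolding smooth_fun_iff using smooth_in_mult[OF _ smooth_in_const] by auto

lemma smooth_fun_sum: "(\<And>j. j \<in> I \<Longrightarrow> f j \<in> smooth_fun M) \<Longrightarrow> (\<lambda>x. \<Sum>j\<in>I. f j x) \<in> smooth_fun M"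
  unfolding smooth_fun_iff by (auto intro: smooth_in_sum)

lemma smooth_fun_diff: "f \<in> smooth_fun M \<Longrightarrow> g \<in> smooth_fun M \<Longrightarrow> (\<lambda>x. f x - g x) \<in> smooth_fun M"
  using smooth_fun_add[OF _ smooth_fun_cmult, of f g "-1"] by simp

end

lemma smooth_in_pull:
  assumes M: "charted M" and N: "charted N" and F: "smooth_map M N F"
    and W: "openin (mtop N) W" and g: "smooth_in N W g"
  shows "smooth_in M (F -` W) (\<lambda>x. g (F x))"
proof -
  have "smooth_in M (pts M \<inter> F -` W) (\<lambda>x. g (F x))"
  proof (rule smooth_in_local[OF M smooth_map_preimage_open[OF F W]])
    fix x assume x: "x \<in> pts M \<inter> F -` W"
    then obtain V \<eta> where V: "(V, \<eta>) \<in> atlas N" "F x \<in> V"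
      using charted_cover[OF N] smooth_map_in[OF F] by blast
    have VW: "openin (mtop N) (V \<inter> W)" using chart_open[OF N V(1)] W by blast
    define W' where "W' = pts M \<inter> F -` (V \<inter> W)"
    have W': "openin (mtop M) W'" unfolding W'_def by (rule smooth_map_preimage_open[OF F VW])
    have "smooth_in M W' (\<lambda>x. g (F x))"
    proof (rule smooth_inI)
      fix U \<psi> assume U: "(U, \<psi>) \<in> atlas M"
      have oA: "eopen (mdim M) (\<psi> ` (U \<inter> W'))" by (rule chart_image_open[OF M U W'])
      have "Cinf_on (mdim M) (\<psi> ` (U \<inter> W')) (\<lambda>y. g (inv_into V \<eta> (\<eta> (F (inv_into U \<psi> y)))))"
      proof (rule Cinf_compose[OF oA chart_image_open[OF N V(1) W] _ _ smooth_inD[OF g V(1)]])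
        fix y assume "y \<in> \<psi> ` (U \<inter> W')"
        then show "\<eta> (F (inv_into U \<psi> y)) \<in> \<eta> ` (V \<inter> W)"
          by (auto simp: chart_inv[OF M U] W'_def)
      next
        fix j assume j: "j < mdim N"
        have "smooth_in M (F -` V) (\<lambda>x. \<eta> (F x) j)" using F V(1) j unfolding smooth_map_iff by blast
        then have "smooth_in M W' (\<lambda>x. \<eta> (F x) j)" by (rule smooth_in_subset[rotated]) (auto simp: W'_def)
        from smooth_inD[OF this U]
        show "Cinf_on (mdim M) (\<psi> ` (U \<inter> W')) (\<lambda>y. \<eta> (F (inv_into U \<psi> y)) j)" .
      qed
      then show "Cinf_on (mdim M) (\<psi> ` (U \<inter> W')) (\<lambda>y. g (F (inv_into U \<psi> y)))"
        by (rule Cinf_cong[OF oA, rotated]) (auto simp: chart_inv[OF M U] chart_inv[OF N V(1)] W'_def)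
    qed
    then show "\<exists>W'. openin (mtop M) W' \<and> x \<in> W' \<and> smooth_in M W' (\<lambda>x. g (F x))"
      using W' x V(2) by (intro exI[of _ W']) (auto simp: W'_def)
  qed
  then show ?thesis using smooth_in_pts[OF M] by blast
qed

lemma smooth_map_compose:
  assumes M: "charted M" and N: "charted N" and P: "charted P"
    and F: "smooth_map M N F" and G: "smooth_map N P G"
  shows "smooth_map M P (\<lambda>x. G (F x))"
  unfolding smooth_map_iff
proof (intro conjI ballI, safe)
  show "continuous_map (mtop M) (mtop P) (\<lambda>x. G (F x))"
    using continuous_map_compose[OF smooth_map_cont[OF F] smooth_map_cont[OF G]] by (simp add: o_def)
  fix V \<eta> i assume V: "(V, \<eta>) \<in> atlas P" and i: "i < mdim P"
  have "smooth_in N (G -` V) (\<lambda>x. \<eta> (G x) i)" using G V i unfolding smooth_map_iff by blast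
  then have "smooth_in N (pts N \<inter> G -` V) (\<lambda>x. \<eta> (G x) i)" by (rule smooth_in_subset[rotated]) blast
  from smooth_in_pull[OF M N F smooth_map_preimage_open[OF G chart_open[OF P V]] this]
  have "smooth_in M (pts M \<inter> F -` (pts N \<inter> G -` V)) (\<lambda>x. \<eta> (G (F x)) i)" using smooth_in_pts[OF M] by blast
  moreover have "pts M \<inter> F -` (pts N \<inter> G -` V) = pts M \<inter> ((\<lambda>x. G (F x)) -` V)"
    using smooth_map_in[OF F] by auto
  ultimately show "smooth_in M ((\<lambda>x. G (F x)) -` V) (\<lambda>x. \<eta> (G (F x)) i)"
    using smooth_in_pts[OF M] by metis
qed

lemma smooth_fun_pull:
  assumes "charted M" "charted N" "smooth_map M N F" "f \<in> smooth_fun N"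
  shows "cut M (\<lambda>x. f (F x)) \<in> smooth_fun M"
proof (rule smooth_fun_cutI[OF assms(1)])
  have "smooth_in N (pts N) f" using assms smooth_fun_iff by blast
  from smooth_in_pull[OF assms(1-3) _ this]
  have "smooth_in M (F -` pts N) (\<lambda>x. f (F x))" by simp
  then show "smooth_in M (pts M) (\<lambda>x. f (F x))"
    by (rule smooth_in_subset[rotated]) (use smooth_map_in[OF assms(3)] in auto)
qed

text \<open>Here the compatibility of charts enters: a function that is smooth in one chart is smooth.\<close>

lemma smooth_in_chart:
  assumes M: "smooth_manifold M" and U: "(U, \<psi>) \<in> atlas M" and V: "eopen (mdim M) V" "Cinf_on (mdim M) V g"
  shows "smooth_in M {x \<in> U. \<psi> x \<in> V} (\<lambda>x. g (\<psi> x))"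
proof (rule smooth_inI)
  fix U' \<psi>' assume U': "(U', \<psi>') \<in> atlas M"
  have cM: "charted M" by (rule smooth_manifold_charted[OF M])
  let ?W = "{x \<in> U. \<psi> x \<in> V}"
  have oW: "openin (mtop M) ?W" by (rule chart_preimage_open[OF cM U V(1)])
  show "Cinf_on (mdim M) (\<psi>' ` (U' \<inter> ?W)) (\<lambda>y. g (\<psi> (inv_into U' \<psi>' y)))"
  proof (rule Cinf_compose[OF chart_image_open[OF cM U' oW] V(1) _ _ V(2)])
    fix y assume "y \<in> \<psi>' ` (U' \<inter> ?W)"
    then show "\<psi> (inv_into U' \<psi>' y) \<in> V" by (auto simp: chart_inv[OF cM U'])
  next
    fix j assume "j < mdim M"
    then have "Cinf_on (mdim M) (\<psi>' ` (U' \<inter> U)) (\<lambda>y. \<psi> (inv_into U' \<psi>' y) j)"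
      using M U U' unfolding smooth_manifold_def by blast
    then show "Cinf_on (mdim M) (\<psi>' ` (U' \<inter> ?W)) (\<lambda>y. \<psi> (inv_into U' \<psi>' y) j)"
      by (rule Cinf_subset[rotated]) auto
  qed
qed

lemma compactin_closed_cube:
  assumes z: "z \<in> topspace (Euclidean_space d)"
  shows "compactin (Euclidean_space d) {y \<in> topspace (Euclidean_space d). \<forall>i<d. \<bar>y i - z i\<bar> \<le> r}"
proof -
  let ?S = "\<lambda>i. if i < d then {z i - r..z i + r} else {0::real}"
  have e: "{y \<in> topspace (Euclidean_space d). \<forall>i<d. \<bar>y i - z i\<bar> \<le> r} = (\<Pi>\<^sub>E i\<in>UNIV. ?S i)"
    by (auto simp: topspace_Euclidean_space PiE_iff abs_le_iff algebra_simps split: if_splits)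
  have "compactin (powertop_real UNIV) (\<Pi>\<^sub>E i\<in>UNIV. ?S i)"
    by (auto simp: compactin_PiE compactin_euclidean_iff)
  then show ?thesis unfolding Euclidean_space_def compactin_subtopology e[symmetric]
    by (auto simp: topspace_Euclidean_space)
qed

text \<open>A bump function in a chart vanishes off the preimage K of a closed cube. This preimage is compact, hence
  closed in the whole space because the space is Hausdorff, so the extension by 0 is smooth.\<close>

lemma bump_exists:
  assumes M: "smooth_manifold M" and W: "openin (mtop M) W" and x: "x \<in> W"
  obtains \<beta> W' K where "\<beta> \<in> smooth_fun M" "openin (mtop M) W'" "x \<in> W'" "W' \<subseteq> W"
    "\<And>y. y \<in> W' \<Longrightarrow> \<beta> y = 1" "closedin (mtop M) K" "K \<subseteq> W" "\<And>y. y \<notin> K \<Longrightarrow> \<beta> y = 0"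
proof -
  have cM: "charted M" by (rule smooth_manifold_charted[OF M])
  have "x \<in> pts M" using W x openin_subset by blast
  then obtain U \<psi> where U: "(U, \<psi>) \<in> atlas M" "x \<in> U" using charted_cover[OF cM] by blast
  define d where "d = mdim M"
  define z where "z = \<psi> x"
  have zE: "z \<in> topspace (Euclidean_space d)" unfolding z_def d_def by (rule chart_Ed[OF cM U])
  obtain R where R: "R > 0" "cube d z R \<subseteq> \<psi> ` (U \<inter> W)"
    using eopen_imp_cube[OF chart_image_open[OF cM U(1) W], of z] U(2) x unfolding z_def d_def by blast
  define r where "r = R / 2"
  have r: "r > 0" using R by (simp add: r_def)
  define C where "C = {y \<in> topspace (Euclidean_space d). \<forall>i<d. \<bar>y i - z i\<bar> \<le> r}"
  have CR: "C \<subseteq> cube d z R" using R by (force simp: C_def cube_def r_def)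
  define K where "K = inv_into U \<psi> ` C"
  have KW: "K \<subseteq> U \<inter> W"
    unfolding K_def using CR R(2) by (fastforce simp: chart_inv[OF cM U(1)])
  obtain V where V: "eopen d V" "V = \<psi> ` U"
    "homeomorphic_map (subtopology (mtop M) U) (subtopology (Euclidean_space d) V) \<psi>"
    using chart_homeo[OF cM U(1)] unfolding d_def by metis
  obtain \<phi> where \<phi>: "homeomorphic_maps (subtopology (mtop M) U) (subtopology (Euclidean_space d) V) \<psi> \<phi>"
    using V(3) homeomorphic_map_maps by blast
  have CV: "C \<subseteq> V" using CR R(2) V(2) by blast
  have \<phi>e: "\<phi> y = inv_into U \<psi> y" if yV: "y \<in> V" for y
  proof -
    obtain u where u: "u \<in> U" "y = \<psi> u" using yV unfolding V(2) by (rule imageE)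
    then have "\<phi> (\<psi> u) = u" using \<phi> chart_sub[OF cM U(1)] by (auto simp: homeomorphic_maps_def topspace_subtopology)
    then show ?thesis using u chart_inv[OF cM U(1)] by simp
  qed
  have "compactin (subtopology (Euclidean_space d) V) C"
    unfolding compactin_subtopology using compactin_closed_cube[OF zE, of r] CV by (simp add: C_def)
  then have "compactin (subtopology (mtop M) U) (\<phi> ` C)"
    using \<phi> image_compactin homeomorphic_maps_def by metis
  moreover have "\<phi> ` C = K" unfolding K_def using \<phi>e CV by (intro image_cong) auto
  ultimately have "compactin (mtop M) K" by (simp add: compactin_subtopology)
  moreover have "Hausdorff_space (mtop M)" using M by (simp only: smooth_manifold_def)
  ultimately have Kc: "closedin (mtop M) K" by (metis compactin_imp_closedin)
  define \<beta> where "\<beta> = (\<lambda>y. if y \<in> U then bump d z r (\<psi> y) else 0)"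
  have off: "\<beta> y = 0" if "y \<notin> K" for y
  proof (cases "y \<in> U")
    case True
    have "\<psi> y \<notin> C"
    proof
      assume "\<psi> y \<in> C"
      then have "inv_into U \<psi> (\<psi> y) \<in> K" unfolding K_def by blast
      then show False using that chart_inv[OF cM U(1) True] by simp
    qed
    then obtain i where "i < d" "\<bar>\<psi> y i - z i\<bar> > r"
      using chart_Ed[OF cM U(1) True] unfolding C_def d_def by force
    then show ?thesis using bump_0[OF r, of i d "\<psi> y" z] by (simp add: \<beta>_def True)
  qed (simp add: \<beta>_def)
  have s: "smooth_in M (pts M) \<beta>"
  proof (rule smooth_in_local[OF cM])
    fix y assume y: "y \<in> pts M"
    show "\<exists>W'. openin (mtop M) W' \<and> y \<in> W' \<and> smooth_in M W' \<beta>"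
    proof (cases "y \<in> K")
      case True
      have "smooth_in M {x \<in> U. \<psi> x \<in> \<psi> ` U} (\<lambda>x. bump d z r (\<psi> x))"
        unfolding d_def by (intro smooth_in_chart M U Cinf_bump chart_image_open'[OF cM U(1)])
      moreover have "{x \<in> U. \<psi> x \<in> \<psi> ` U} = U" by blast
      ultimately have "smooth_in M U (\<lambda>x. bump d z r (\<psi> x))" by simp
      then have "smooth_in M U \<beta>"
        by (rule smooth_in_cong[OF cM chart_open[OF cM U(1)], rotated]) (simp add: \<beta>_def)
      then show ?thesis using True KW chart_open[OF cM U(1)] by blast
    next
      case False
      have o: "openin (mtop M) (pts M - K)" using Kc by (simp add: closedin_def)
      have "smooth_in M (pts M - K) \<beta>"
        by (rule smooth_in_cong[OF cM o _ smooth_in_const[OF cM o, of 0]]) (simp add: off)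
      then show ?thesis using o y False by blast
    qed
  qed simp
  have Kp: "K \<subseteq> pts M" using KW W openin_subset by blast
  have \<beta>s: "\<beta> \<in> smooth_fun M" unfolding smooth_fun_iff[OF cM] using s off Kp by blast
  define W' where "W' = {y \<in> U. \<psi> y \<in> cube d z (r / 2)}"
  have oW': "openin (mtop M) W'"
    unfolding W'_def d_def by (rule chart_preimage_open[OF cM U(1) eopen_cube])
  have xW': "x \<in> W'" using U(2) cube_self[OF zE, of "r/2"] r by (simp add: W'_def z_def)
  have "W' \<subseteq> W"
  proof
    fix y assume y: "y \<in> W'"
    have "\<psi> y \<in> cube d z R" using y R(1) by (force simp: W'_def cube_def r_def)
    then obtain u where "u \<in> U" "u \<in> W" "\<psi> y = \<psi> u" using R(2) by blast
    then show "y \<in> W" using inj_onD[OF chart_inj[OF cM U(1)]] y by (auto simp: W'_def)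
  qed
  moreover have "\<beta> y = 1" if "y \<in> W'" for y
    using that bump_1[OF r, of d "\<psi> y" z] by (auto simp: \<beta>_def W'_def cube_def)
  ultimately show thesis using that[OF \<beta>s oW' xW' _ _ Kc _ off] KW by blast
qed

lemma extend_smooth:
  assumes M: "charted M" and W: "openin (mtop M) W" and g: "smooth_in M W g"
    and \<beta>: "\<beta> \<in> smooth_fun M" and K: "closedin (mtop M) K" "K \<subseteq> W" "\<And>y. y \<notin> K \<Longrightarrow> \<beta> y = 0"
  shows "(\<lambda>y. if y \<in> W then \<beta> y * g y else 0) \<in> smooth_fun M"
  unfolding smooth_fun_iff[OF M]
proof (intro conjI allI impI)
  show "(if y \<in> W then \<beta> y * g y else 0) = 0" if "y \<notin> pts M" for y
    using smooth_fun_off[OF M \<beta> that] by simp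
  show "smooth_in M (pts M) (\<lambda>y. if y \<in> W then \<beta> y * g y else 0)"
  proof (rule smooth_in_local[OF M])
    fix y assume y: "y \<in> pts M"
    show "\<exists>W'. openin (mtop M) W' \<and> y \<in> W' \<and> smooth_in M W' (\<lambda>y. if y \<in> W then \<beta> y * g y else 0)"
    proof (cases "y \<in> W")
      case True
      have "smooth_in M W (\<lambda>y. \<beta> y * g y)"
        by (intro smooth_in_mult M W g smooth_fun_in[OF M \<beta>] openin_subset)
      then have "smooth_in M W (\<lambda>y. if y \<in> W then \<beta> y * g y else 0)"
        by (rule smooth_in_cong[OF M W, rotated]) simp
      then show ?thesis using True W by blast
    next
      case False
      have o: "openin (mtop M) (pts M - K)" using K by (simp add: closedin_def)
      have "smooth_in M (pts M - K) (\<lambda>y. if y \<in> W then \<beta> y * g y else 0)"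
        by (rule smooth_in_cong[OF M o _ smooth_in_const[OF M o, of 0]]) (simp add: K)
      then show ?thesis using o y False K by blast
    qed
  qed simp
qed

text \<open>Globally defined functions realise all germs; this lets derivations, which act on global functions
  only, be computed locally.\<close>

lemma smooth_fun_germ:
  assumes M: "smooth_manifold M" and W: "openin (mtop M) W" and g: "smooth_in M W g" and x: "x \<in> W"
  obtains h W' where "h \<in> smooth_fun M" "openin (mtop M) W'" "x \<in> W'" "W' \<subseteq> W" "\<And>y. y \<in> W' \<Longrightarrow> h y = g y"
proof -
  obtain \<beta> W' K where b: "\<beta> \<in> smooth_fun M" "openin (mtop M) W'" "x \<in> W'" "W' \<subseteq> W"
    "\<And>y. y \<in> W' \<Longrightarrow> \<beta> y = 1" "closedin (mtop M) K" "K \<subseteq> W" "\<And>y. y \<notin> K \<Longrightarrow> \<beta> y = 0"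
    using bump_exists[OF M W x] by blast
  have e: "(if y \<in> W then \<beta> y * g y else 0) = g y" if "y \<in> W'" for y
    using b(5)[OF that] subsetD[OF b(4) that] by simp
  show thesis
    by (rule that[OF extend_smooth[OF smooth_manifold_charted[OF M] W g b(1,6,7,8)] b(2,3,4) e])
qed

section \<open>Tangent vectors and vector fields\<close>

text \<open>Tangent vectors and vector fields are real-valued functions, so they inherit a vector space
  structure pointwise.\<close>

instantiation "fun" :: (type, scaleR) scaleR
begin
definition "scaleR c f = (\<lambda>x. c *\<^sub>R f x)"
instance ..
end

lemma scaleR_fun_apply [simp]: "(c *\<^sub>R f) x = c *\<^sub>R f x"
  by (simp add: scaleR_fun_def)

instance "fun" :: (type, real_vector) real_vector
  by standard (auto simp: fun_eq_iff algebra_simps)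

lemma sum_fun_apply: "(\<Sum>i\<in>I. f i) x = (\<Sum>i\<in>I. f i x)"
  by (induction I rule: infinite_finite_induct) auto

lemma smooth_fun_linear: "charted M \<Longrightarrow> f \<in> smooth_fun M \<Longrightarrow> h \<in> smooth_fun M \<Longrightarrow> (\<lambda>x. c * f x + h x) \<in> smooth_fun M"
  by (rule smooth_fun_add[OF _ smooth_fun_cmult])

lemma tangent_off: "v \<in> tangent M p \<Longrightarrow> f \<notin> smooth_fun M \<Longrightarrow> v f = 0"
  unfolding tangent_def by blast

lemma tangent_linear:
  "v \<in> tangent M p \<Longrightarrow> f \<in> smooth_fun M \<Longrightarrow> h \<in> smooth_fun M \<Longrightarrow> v (\<lambda>x. c * f x + h x) = c * v f + v h"
  unfolding tangent_def by blast

lemma tangent_mult: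
  "v \<in> tangent M p \<Longrightarrow> f \<in> smooth_fun M \<Longrightarrow> h \<in> smooth_fun M \<Longrightarrow> v (\<lambda>x. f x * h x) = f p * v h + h p * v f"
  unfolding tangent_def by blast

context
  fixes M :: "('a, 'z) mfd_scheme" and p v
  assumes M: "charted M" and v: "v \<in> tangent M p"
begin

lemma tangent_zero: "v (\<lambda>_. 0) = 0"
  using tangent_linear[OF v smooth_fun_zero[OF M] smooth_fun_zero[OF M], of 1] by simp

lemma tangent_add: "f \<in> smooth_fun M \<Longrightarrow> h \<in> smooth_fun M \<Longrightarrow> v (\<lambda>x. f x + h x) = v f + v h"
  using tangent_linear[OF v, of f h 1] by simp

lemma tangent_cmult: "f \<in> smooth_fun M \<Longrightarrow> v (\<lambda>x. c * f x) = c * v f"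
  using tangent_linear[OF v _ smooth_fun_zero[OF M], of f c] tangent_zero by simp

lemma tangent_diff: "f \<in> smooth_fun M \<Longrightarrow> h \<in> smooth_fun M \<Longrightarrow> v (\<lambda>x. f x - h x) = v f - v h"
  using tangent_linear[OF v, of h f "-1"] by simp

lemma tangent_sum:
  "(\<And>j. j \<in> I \<Longrightarrow> f j \<in> smooth_fun M) \<Longrightarrow> v (\<lambda>x. \<Sum>j\<in>I. f j x) = (\<Sum>j\<in>I. v (f j))"
proof (induction I rule: infinite_finite_induct)
  case (insert a I)
  then have "v (\<lambda>x. f a x + (\<Sum>j\<in>I. f j x)) = v (f a) + v (\<lambda>x. \<Sum>j\<in>I. f j x)"
    by (intro tangent_add smooth_fun_sum M) auto
  with insert show ?case by simp
qed (simp_all add: tangent_zero)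

lemma tangent_const: "p \<in> pts M \<Longrightarrow> v (cut M (\<lambda>_. k)) = 0"
proof -
  assume p: "p \<in> pts M"
  let ?u = "cut M (\<lambda>_. 1)"
  have u: "?u \<in> smooth_fun M" by (rule smooth_fun_const[OF M])
  have "(\<lambda>x. ?u x * ?u x) = ?u" by (auto simp: cut_def)
  then have "v ?u = v ?u + v ?u" using tangent_mult[OF v u u] p by (simp add: cut_def)
  then have "v ?u = 0" by simp
  moreover have "cut M (\<lambda>_. k) = (\<lambda>x. k * ?u x)" by (auto simp: cut_def)
  ultimately show ?thesis using tangent_cmult[OF u, of k] by simp
qed

end

text \<open>The difference of f and g is killed by a bump function at p, and the product rule applied to this
  product of functions leaves \<open>v (f - g)\<close>.\<close>

lemma tangent_local:
  assumes M: "smooth_manifold M" and v: "v \<in> tangent M p" and W: "openin (mtop M) W" "p \<in> W"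
    and f: "f \<in> smooth_fun M" and g: "g \<in> smooth_fun M" and e: "\<And>x. x \<in> W \<Longrightarrow> f x = g x"
  shows "v f = v g"
proof -
  have cM: "charted M" by (rule smooth_manifold_charted[OF M])
  obtain \<beta> W' K where b: "\<beta> \<in> smooth_fun M" "p \<in> W'" "K \<subseteq> W"
    "\<And>y. y \<in> W' \<Longrightarrow> \<beta> y = 1" "\<And>y. y \<notin> K \<Longrightarrow> \<beta> y = 0"
    using bump_exists[OF M W] by metis
  have "(f y - g y) * \<beta> y = 0" for y using e[of y] b(5)[of y] b(3) by (cases "y \<in> K") auto
  then have "(\<lambda>x. (f x - g x) * \<beta> x) = (\<lambda>_. 0)" by blast
  then have "0 = v (\<lambda>x. (f x - g x) * \<beta> x)" using tangent_zero[OF cM v] by simp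
  also have "\<dots> = (f p - g p) * v \<beta> + \<beta> p * v (\<lambda>x. f x - g x)"
    by (rule tangent_mult[OF v smooth_fun_diff[OF cM f g] b(1)])
  also have "\<dots> = v f - v g" using e[OF W(2)] b(4)[OF b(2)] tangent_diff[OF cM v f g] by simp
  finally show ?thesis by simp
qed

lemma tangentI:
  assumes "\<And>f. f \<notin> smooth_fun M \<Longrightarrow> v f = 0"
    "\<And>f h c. f \<in> smooth_fun M \<Longrightarrow> h \<in> smooth_fun M \<Longrightarrow> v (\<lambda>x. c * f x + h x) = c * v f + v h"
    "\<And>f h. f \<in> smooth_fun M \<Longrightarrow> h \<in> smooth_fun M \<Longrightarrow> v (\<lambda>x. f x * h x) = f p * v h + h p * v f"
  shows "v \<in> tangent M p"
  using assms unfolding tangent_def by blast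

lemma subspace_tangent:
  assumes "charted M" shows "subspace (tangent M p)"
  unfolding subspace_def
proof (intro conjI ballI allI)
  show "0 \<in> tangent M p" by (rule tangentI) auto
  fix v w c assume v: "v \<in> tangent M p" and w: "w \<in> tangent M p"
  show "v + w \<in> tangent M p"
    by (rule tangentI) (auto simp: tangent_off[OF v] tangent_off[OF w] tangent_linear[OF v]
      tangent_linear[OF w] tangent_mult[OF v] tangent_mult[OF w] ring_distribs)
next
  fix v c assume v: "v \<in> tangent M p"
  show "c *\<^sub>R v \<in> tangent M p"
    by (rule tangentI) (auto simp: tangent_off[OF v] tangent_linear[OF v] tangent_mult[OF v] ring_distribs)
qed

definition chart_pd :: "'a set \<Rightarrow> ('a \<Rightarrow> nat \<Rightarrow> real) \<Rightarrow> nat \<Rightarrow> ('a \<Rightarrow> real) \<Rightarrow> 'a \<Rightarrow> real" where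
  "chart_pd U \<psi> i f x = pd i (\<lambda>y. f (inv_into U \<psi> y)) (\<psi> x)"

lemma chart_pd_deriv:
  assumes M: "charted M" and U: "(U, \<psi>) \<in> atlas M" and x: "x \<in> U" "x \<in> W" and W: "openin (mtop M) W"
    and i: "i < mdim M" and f: "smooth_in M W f"
  shows "((\<lambda>s. f (inv_into U \<psi> ((\<psi> x)(i := s)))) has_real_derivative chart_pd U \<psi> i f x) (at (\<psi> x i))"
  unfolding chart_pd_def
  by (rule Cinf_deriv[OF chart_image_open[OF M U W] smooth_inD[OF f U] i]) (use x in blast)

lemma chart_pd_eqI:
  assumes "((\<lambda>s. f (inv_into U \<psi> ((\<psi> x)(i := s)))) has_real_derivative D) (at (\<psi> x i))"
  shows "chart_pd U \<psi> i f x = D"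
  unfolding chart_pd_def pd_def using assms by (rule DERIV_imp_deriv)

lemma coord_tangent:
  assumes M: "charted M" and U: "(U, \<psi>) \<in> atlas M" and x: "x \<in> U" and i: "i < mdim M"
  shows "(\<lambda>f. if f \<in> smooth_fun M then chart_pd U \<psi> i f x else 0) \<in> tangent M x"
proof (rule tangentI)
  fix f h :: "'a \<Rightarrow> real" and c assume f: "f \<in> smooth_fun M" and h: "h \<in> smooth_fun M"
  have D: "((\<lambda>s. f (inv_into U \<psi> ((\<psi> x)(i := s)))) has_real_derivative chart_pd U \<psi> i f x) (at (\<psi> x i))"
    if "f \<in> smooth_fun M" for f
    by (rule chart_pd_deriv[OF M U x x chart_open[OF M U] i smooth_fun_in[OF M that chart_sub[OF M U]]])
  have "chart_pd U \<psi> i (\<lambda>x. c * f x + h x) x = c * chart_pd U \<psi> i f x + chart_pd U \<psi> i h x"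
    by (rule chart_pd_eqI) (intro DERIV_add DERIV_cmult D f h)
  then show "(if (\<lambda>x. c * f x + h x) \<in> smooth_fun M then chart_pd U \<psi> i (\<lambda>x. c * f x + h x) x else 0) =
      c * (if f \<in> smooth_fun M then chart_pd U \<psi> i f x else 0) + (if h \<in> smooth_fun M then chart_pd U \<psi> i h x else 0)"
    using f h smooth_fun_linear[OF M f h] by simp
  have "chart_pd U \<psi> i (\<lambda>x. f x * h x) x =
      chart_pd U \<psi> i f x * h (inv_into U \<psi> ((\<psi> x)(i := \<psi> x i))) + chart_pd U \<psi> i h x * f (inv_into U \<psi> ((\<psi> x)(i := \<psi> x i)))"
    by (rule chart_pd_eqI) (intro DERIV_mult D f h)
  then show "(if (\<lambda>x. f x * h x) \<in> smooth_fun M then chart_pd U \<psi> i (\<lambda>x. f x * h x) x else 0) =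
      f x * (if h \<in> smooth_fun M then chart_pd U \<psi> i h x else 0) + h x * (if f \<in> smooth_fun M then chart_pd U \<psi> i f x else 0)"
    using f h smooth_fun_mult[OF M f h] chart_inv[OF M U x] by simp
qed simp

lemma chart_pd_smooth:
  assumes M: "smooth_manifold M" and U: "(U, \<psi>) \<in> atlas M" and W: "openin (mtop M) W" "smooth_in M W f"
    and i: "i < mdim M"
  shows "smooth_in M (U \<inter> W) (chart_pd U \<psi> i f)"
proof -
  have cM: "charted M" by (rule smooth_manifold_charted[OF M])
  have o: "eopen (mdim M) (\<psi> ` (U \<inter> W))" by (rule chart_image_open[OF cM U W(1)])
  have "smooth_in M {x \<in> U. \<psi> x \<in> \<psi> ` (U \<inter> W)} (\<lambda>x. pd i (\<lambda>y. f (inv_into U \<psi> y)) (\<psi> x))"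
    by (rule smooth_in_chart[OF M U o Cinf_pd[OF o smooth_inD[OF W(2) U] i]])
  moreover have "{x \<in> U. \<psi> x \<in> \<psi> ` (U \<inter> W)} = U \<inter> W"
    using inj_onD[OF chart_inj[OF cM U]] by auto
  ultimately show ?thesis by (simp add: chart_pd_def[abs_def])
qed

lemma smooth_in_coord:
  assumes M: "smooth_manifold M" and U: "(U, \<psi>) \<in> atlas M"
  shows "smooth_in M U (\<lambda>x. \<psi> x i)"
proof -
  have o: "eopen (mdim M) (\<psi> ` U)" by (rule chart_image_open'[OF smooth_manifold_charted[OF M] U])
  have "{x \<in> U. \<psi> x \<in> \<psi> ` U} = U" by blast
  then show ?thesis using smooth_in_chart[OF M U o Cinf_coord[OF o], of i] by simp
qed

text \<open>The Hadamard expansion of h at y in the chart, applied to a derivation at y: the constant term and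
  the factors \<open>\<psi> j - \<psi> y j\<close> vanish at y, so that only \<open>v (c j)\<close> times a Hadamard quotient at y
  survives, and this quotient is a partial derivative. The functions c are global extensions of the
  coordinates, valid on one neighbourhood W for all y in W.\<close>

lemma tangent_coords:
  assumes M: "smooth_manifold M" and U: "(U, \<psi>) \<in> atlas M" and x0: "x0 \<in> U"
  shows "\<exists>W c. openin (mtop M) W \<and> x0 \<in> W \<and> W \<subseteq> U \<and> (\<forall>i. c i \<in> smooth_fun M) \<and>
    (\<forall>i. \<forall>y\<in>W. c i y = \<psi> y i) \<and>
    (\<forall>y\<in>W. \<forall>v\<in>tangent M y. \<forall>h\<in>smooth_fun M.
       v h = (\<Sum>i<mdim M. v (c i) * chart_pd U \<psi> i h y))"
proof -
  have cM: "charted M" by (rule smooth_manifold_charted[OF M])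
  have oU: "openin (mtop M) U" by (rule chart_open[OF cM U])
  define d where "d = mdim M"
  obtain \<beta> W K where b: "\<beta> \<in> smooth_fun M" "openin (mtop M) W" "x0 \<in> W" "W \<subseteq> U"
    "\<And>y. y \<in> W \<Longrightarrow> \<beta> y = 1" "closedin (mtop M) K" "K \<subseteq> U" "\<And>y. y \<notin> K \<Longrightarrow> \<beta> y = 0"
    using bump_exists[OF M oU x0] by metis
  define c where "c = (\<lambda>i y. if y \<in> U then \<beta> y * \<psi> y i else 0)"
  have c: "c i \<in> smooth_fun M" for i
    unfolding c_def by (rule extend_smooth[OF cM oU smooth_in_coord[OF M U] b(1,6,7,8)])
  have cW: "c i y = \<psi> y i" if "y \<in> W" for i y
    using b(5)[OF that] subsetD[OF b(4) that] by (simp add: c_def)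
  have "v h = (\<Sum>i<d. v (c i) * chart_pd U \<psi> i h y)"
    if y: "y \<in> W" and v: "v \<in> tangent M y" and h: "h \<in> smooth_fun M" for y v h
  proof -
    have yU: "y \<in> U" using y b(4) by blast
    have yp: "y \<in> pts M" using yU chart_sub[OF cM U] by blast
    define z where "z = \<psi> y"
    have zE: "z \<in> topspace (Euclidean_space d)" unfolding z_def d_def by (rule chart_Ed[OF cM U yU])
    obtain r where r: "r > 0" "cube d z r \<subseteq> \<psi> ` (U \<inter> W)"
      using eopen_imp_cube[OF chart_image_open[OF cM U b(2)], of z] y yU unfolding z_def d_def by blast
    define V where "V = {x \<in> U. \<psi> x \<in> cube d z r}"
    have oV: "openin (mtop M) V" unfolding V_def d_def by (rule chart_preimage_open[OF cM U eopen_cube])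
    have yV: "y \<in> V" using yU cube_self[OF zE r(1)] by (simp add: V_def z_def)
    have VW: "V \<subseteq> W" using r(2) inj_onD[OF chart_inj[OF cM U]] unfolding V_def by blast
    define f where "f = (\<lambda>u. h (inv_into U \<psi> u))"
    have f: "Cinf_on d (cube d z r) f"
      unfolding f_def d_def
      by (rule Cinf_subset[OF _ smooth_inD[OF smooth_fun_in[OF cM h chart_sub[OF cM U]] U]])
        (use r(2) in \<open>auto simp: d_def\<close>)
    define q where "q = (\<lambda>j x. hquot j z f (\<psi> x))"
    have qs: "smooth_in M V (q j)" if "j < d" for j
      unfolding q_def V_def d_def
      by (rule smooth_in_chart[OF M U eopen_cube Cinf_hquot[OF zE f that, unfolded d_def]])
    have "\<exists>Q V'. Q \<in> smooth_fun M \<and> openin (mtop M) V' \<and> y \<in> V' \<and> V' \<subseteq> V \<and> (\<forall>x\<in>V'. Q x = q j x)" if "j < d" for j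
      using smooth_fun_germ[OF M oV qs[OF that] yV] by metis
    then obtain Q V' where Q: "\<And>j. j < d \<Longrightarrow> Q j \<in> smooth_fun M"
      "\<And>j. j < d \<Longrightarrow> openin (mtop M) (V' j)" "\<And>j. j < d \<Longrightarrow> y \<in> V' j"
      "\<And>j x. j < d \<Longrightarrow> x \<in> V' j \<Longrightarrow> Q j x = q j x" by metis
    define V'' where "V'' = V \<inter> (\<Inter>j\<in>{..<d}. V' j)"
    have oV'': "openin (mtop M) V''"
    proof (cases "d = 0")
      case True then show ?thesis using oV by (simp add: V''_def)
    next
      case False
      then have "openin (mtop M) (\<Inter>j\<in>{..<d}. V' j)" using Q(2) by (intro openin_Inter) auto
      then show ?thesis unfolding V''_def using oV by blast
    qed
    have yV'': "y \<in> V''" using yV Q(3) by (simp add: V''_def)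
    let ?C = "\<lambda>j x. c j x - cut M (\<lambda>_. z j) x"
    let ?g = "\<lambda>x. cut M (\<lambda>_. h y) x + (\<Sum>j<d. ?C j x * Q j x)"
    have C: "?C j \<in> smooth_fun M" for j by (intro smooth_fun_diff cM c smooth_fun_const)
    have CQ: "(\<lambda>x. ?C j x * Q j x) \<in> smooth_fun M" if "j \<in> {..<d}" for j
      using that by (intro smooth_fun_mult cM C Q) simp
    have g: "?g \<in> smooth_fun M" by (intro smooth_fun_add smooth_fun_sum CQ cM smooth_fun_const)
    have "v h = v ?g"
    proof (rule tangent_local[OF M v oV'' yV'' h g])
      fix x assume x: "x \<in> V''"
      then have xV: "x \<in> V" and xU: "x \<in> U" by (auto simp: V''_def V_def)
      have xp: "x \<in> pts M" using xU chart_sub[OF cM U] by blast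
      have "h x = f (\<psi> x)" by (simp add: f_def chart_inv[OF cM U xU])
      also have "\<dots> = f z + (\<Sum>j<d. (\<psi> x j - z j) * hquot j z f (\<psi> x))"
        by (rule hquot_expand[OF zE Cinf_D[OF f, of "Suc 0"]]) (use xV in \<open>simp add: V_def\<close>)
      also have "f z = h y" by (simp add: f_def z_def chart_inv[OF cM U yU])
      also have "(\<Sum>j<d. (\<psi> x j - z j) * hquot j z f (\<psi> x)) = (\<Sum>j<d. ?C j x * Q j x)"
        using x VW xV xp Q(4) by (intro sum.cong) (auto simp: V''_def cut_def cW q_def subset_iff)
      finally show "h x = ?g x" using xp by (simp add: cut_def)
    qed
    also have "\<dots> = v (cut M (\<lambda>_. h y)) + v (\<lambda>x. \<Sum>j<d. ?C j x * Q j x)"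
      by (intro tangent_add[OF cM v] smooth_fun_sum CQ cM smooth_fun_const)
    also have "v (\<lambda>x. \<Sum>j<d. ?C j x * Q j x) = (\<Sum>j<d. v (\<lambda>x. ?C j x * Q j x))"
      by (rule tangent_sum[OF cM v CQ])
    also have "\<dots> = (\<Sum>j<d. v (c j) * chart_pd U \<psi> j h y)"
    proof (rule sum.cong)
      fix j assume j: "j \<in> {..<d}"
      have "v (\<lambda>x. ?C j x * Q j x) = ?C j y * v (Q j) + Q j y * v (?C j)"
        by (rule tangent_mult[OF v C Q(1)]) (use j in simp)
      moreover have "?C j y = 0" using yp cW[OF y] by (simp add: cut_def z_def)
      moreover have "v (?C j) = v (c j)"
        using tangent_diff[OF cM v c smooth_fun_const[OF cM]] tangent_const[OF cM v yp] by simp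
      moreover have "Q j y = chart_pd U \<psi> j h y"
        using Q(3,4) j by (simp add: q_def z_def[symmetric] hquot_base chart_pd_def f_def)
      ultimately show "v (\<lambda>x. ?C j x * Q j x) = v (c j) * chart_pd U \<psi> j h y" by simp
    qed simp
    finally show ?thesis using tangent_const[OF cM v yp] by simp
  qed
  then show ?thesis unfolding d_def by (intro exI[of _ W] exI[of _ c] conjI ballI allI b(2-4) c cW)
qed

lemma chart_pd_coord:
  assumes M: "charted M" and U: "(U, \<psi>) \<in> atlas M" and W: "openin (mtop M) W" "W \<subseteq> U" "x \<in> W"
    and c: "\<And>y. y \<in> W \<Longrightarrow> c y = \<psi> y j" and i: "i < mdim M"
  shows "chart_pd U \<psi> i c x = (if i = j then 1 else 0)"
proof -
  have "U \<inter> W = W" using W by blast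
  then have o: "eopen (mdim M) (\<psi> ` W)" using chart_image_open[OF M U W(1)] by simp
  have "chart_pd U \<psi> i c x = pd i (\<lambda>y. y j) (\<psi> x)"
    unfolding chart_pd_def
  proof (rule pd_cong[OF o _ i])
    show "\<psi> x \<in> \<psi> ` W" using W by blast
    fix y assume "y \<in> \<psi> ` W"
    then show "c (inv_into U \<psi> y) = y j" using W(2) c by (auto simp: chart_inv[OF M U] subset_iff)
  qed
  also have "\<dots> = (if i = j then 1 else 0)"
    unfolding pd_def by (rule DERIV_imp_deriv) (auto intro!: derivative_eq_intros)
  finally show ?thesis .
qed

lemma vfieldsD:
  assumes "X \<in> vfields M"
  shows "p \<in> pts M \<Longrightarrow> X p \<in> tangent M p" "p \<notin> pts M \<Longrightarrow> X p = 0" "f \<in> smooth_fun M \<Longrightarrow> (\<lambda>p. X p f) \<in> smooth_fun M"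
  using assms by (auto simp: vfields_def zero_fun_def)

lemma vfieldsI:
  assumes "\<And>p. p \<in> pts M \<Longrightarrow> X p \<in> tangent M p" "\<And>p. p \<notin> pts M \<Longrightarrow> X p = 0"
   "\<And>f. f \<in> smooth_fun M \<Longrightarrow> (\<lambda>p. X p f) \<in> smooth_fun M"
  shows "X \<in> vfields M"
  using assms by (auto simp: vfields_def zero_fun_def)

lemma vfield_off: "X \<in> vfields M \<Longrightarrow> f \<notin> smooth_fun M \<Longrightarrow> X p f = 0"
  using vfieldsD(1,2)[of X M p] tangent_off by (cases "p \<in> pts M") auto

text \<open>Constant coefficients in a chart, cut off by a bump function.\<close>

lemma vfield_through:
  assumes M: "smooth_manifold M" and x: "x \<in> pts M" and v: "v \<in> tangent M x"
  obtains Y where "Y \<in> vfields M" "Y x = v"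
proof -
  have cM: "charted M" by (rule smooth_manifold_charted[OF M])
  obtain U \<psi> where U: "(U, \<psi>) \<in> atlas M" "x \<in> U" using charted_cover[OF cM x] by blast
  have oU: "openin (mtop M) U" by (rule chart_open[OF cM U(1)])
  obtain W0 c where c: "x \<in> W0" "\<forall>y\<in>W0. \<forall>v\<in>tangent M y. \<forall>h\<in>smooth_fun M.
       v h = (\<Sum>i<mdim M. v (c i) * chart_pd U \<psi> i h y)"
    using tangent_coords[OF M U] by blast
  obtain \<beta> W K where b: "\<beta> \<in> smooth_fun M" "x \<in> W"
    "\<And>y. y \<in> W \<Longrightarrow> \<beta> y = 1" "closedin (mtop M) K" "K \<subseteq> U" "\<And>y. y \<notin> K \<Longrightarrow> \<beta> y = 0"
    using bump_exists[OF M oU U(2)] by metis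
  define Y where "Y = (\<lambda>y f. if f \<in> smooth_fun M then
     if y \<in> U then \<beta> y * (\<Sum>i<mdim M. v (c i) * chart_pd U \<psi> i f y) else 0 else 0)"
  have "Y \<in> vfields M"
  proof (rule vfieldsI)
    fix y assume y: "y \<in> pts M"
    show "Y y \<in> tangent M y"
    proof (cases "y \<in> U")
      case True
      let ?d = "\<lambda>i f. if f \<in> smooth_fun M then chart_pd U \<psi> i f y else 0"
      have "Y y = \<beta> y *\<^sub>R (\<Sum>i<mdim M. v (c i) *\<^sub>R ?d i)"
        by (rule ext) (simp add: Y_def True sum_fun_apply)
      also have "\<dots> \<in> tangent M y"
        by (intro subspace_scale subspace_sum subspace_tangent cM coord_tangent[OF cM U(1) True]) simp
      finally show ?thesis .
    next
      case False
      then have "Y y = 0" by (auto simp: Y_def)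
      then show ?thesis using subspace_0[OF subspace_tangent[OF cM]] by simp
    qed
  next
    fix y assume "y \<notin> pts M"
    then show "Y y = 0" using chart_sub[OF cM U(1)] by (auto simp: Y_def fun_eq_iff)
  next
    fix f assume f: "f \<in> smooth_fun M"
    have sf: "smooth_in M U f" by (rule smooth_fun_in[OF cM f chart_sub[OF cM U(1)]])
    have cp: "smooth_in M U (chart_pd U \<psi> i f)" if "i < mdim M" for i
      using chart_pd_smooth[OF M U(1) oU sf that] by simp
    have "smooth_in M U (\<lambda>y. \<Sum>i<mdim M. v (c i) * chart_pd U \<psi> i f y)"
      by (intro smooth_in_sum smooth_in_mult smooth_in_const cM oU cp) simp
    from extend_smooth[OF cM oU this b(1,4,5,6)]
    show "(\<lambda>y. Y y f) \<in> smooth_fun M" using f by (simp add: Y_def cong: if_cong)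
  qed
  moreover have "Y x = v"
  proof
    fix f show "Y x f = v f"
      using bspec[OF bspec[OF bspec[OF c(2) c(1)] v], of f] tangent_off[OF v, of f] b(3)[OF b(2)] U(2) by (simp add: Y_def)
  qed
  ultimately show thesis by (rule that)
qed

lemma push_apply: "f \<in> smooth_fun N \<Longrightarrow> push M N F v f = v (cut M (\<lambda>x. f (F x)))"
  by (simp add: push_def)

lemma push_cong: "(\<And>x. x \<in> pts M \<Longrightarrow> F x = G x) \<Longrightarrow> push M N F v = push M N G v"
proof
  fix f assume e: "\<And>x. x \<in> pts M \<Longrightarrow> F x = G x"
  then have "cut M (\<lambda>x. f (F x)) = cut M (\<lambda>x. f (G x))" by (auto simp: cut_def)
  then show "push M N F v f = push M N G v f" by (simp only: push_def)
qed

lemma push_add: "push M N F (v + w) = push M N F v + push M N F w"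
  by (auto simp: push_def)
lemma push_scale: "push M N F (c *\<^sub>R v) = c *\<^sub>R push M N F v"
  by (auto simp: push_def)
lemma push_zero [simp]: "push M N F 0 = 0"
  by (auto simp: push_def)
lemma push_diff: "push M N F (v - w) = push M N F v - push M N F w"
  by (auto simp: push_def)
lemma push_sum: "push M N F (\<Sum>i\<in>I. v i) = (\<Sum>i\<in>I. push M N F (v i))"
  by (auto simp: push_def sum_fun_apply)

lemma push_tangent:
  assumes M: "charted M" and N: "charted N" and F: "smooth_map M N F" and x: "x \<in> pts M"
    and v: "v \<in> tangent M x"
  shows "push M N F v \<in> tangent N (F x)"
proof (rule tangentI)
  fix f h c assume f: "f \<in> smooth_fun N" and h: "h \<in> smooth_fun N"
  have e: "cut M (\<lambda>x. c * f (F x) + h (F x)) = (\<lambda>x. c * cut M (\<lambda>x. f (F x)) x + cut M (\<lambda>x. h (F x)) x)"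
    "cut M (\<lambda>x. f (F x) * h (F x)) = (\<lambda>x. cut M (\<lambda>x. f (F x)) x * cut M (\<lambda>x. h (F x)) x)"
    by (auto simp: cut_def)
  note s = smooth_fun_pull[OF M N F f] smooth_fun_pull[OF M N F h]
  show "push M N F v (\<lambda>x. c * f x + h x) = c * push M N F v f + push M N F v h"
    using tangent_linear[OF v s] by (simp add: push_apply f h smooth_fun_linear[OF N] e)
  show "push M N F v (\<lambda>x. f x * h x) = f (F x) * push M N F v h + h (F x) * push M N F v f"
    using tangent_mult[OF v s] x by (simp add: push_apply f h smooth_fun_mult[OF N] e) (simp add: cut_def)
qed (simp add: push_def)

lemma push_compose:
  assumes N: "charted N" and P: "charted P" and F: "smooth_map M N F" and G: "smooth_map N P G"
  shows "push N P G (push M N F v) = push M P (\<lambda>x. G (F x)) v"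
proof
  fix f show "push N P G (push M N F v) f = push M P (\<lambda>x. G (F x)) v f"
  proof (cases "f \<in> smooth_fun P")
    case True
    have "cut M (\<lambda>x. cut N (\<lambda>x. f (G x)) (F x)) = cut M (\<lambda>x. f (G (F x)))"
      using smooth_map_in[OF F] by (auto simp: cut_def)
    then show ?thesis using True smooth_fun_pull[OF N P G True] by (simp add: push_apply)
  qed (simp add: push_def)
qed

lemma push_id: "charted M \<Longrightarrow> v \<in> tangent M x \<Longrightarrow> push M M (\<lambda>x. x) v = v"
  by (rule ext) (auto simp: push_def cut_smooth tangent_off)

lemma push_const: "charted M \<Longrightarrow> x \<in> pts M \<Longrightarrow> v \<in> tangent M x \<Longrightarrow> push M N (\<lambda>x. q) v = 0"
  by (rule ext) (auto simp: push_def tangent_const)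

lemma bracket_vfields:
  assumes M: "charted M" and X: "X \<in> vfields M" and Y: "Y \<in> vfields M"
  shows "bracket X Y \<in> vfields M"
proof (rule vfieldsI)
  fix p assume p: "p \<in> pts M"
  note Xp = vfieldsD(1)[OF X p] and Yp = vfieldsD(1)[OF Y p]
  show "bracket X Y p \<in> tangent M p"
  proof (rule tangentI)
    fix f assume f: "f \<notin> smooth_fun M"
    have "(\<lambda>q. X q f) = (\<lambda>_. 0)" "(\<lambda>q. Y q f) = (\<lambda>_. 0)"
      by (simp_all only: vfield_off[OF X f] vfield_off[OF Y f])
    then show "bracket X Y p f = 0" by (simp add: bracket_def tangent_zero[OF M Xp] tangent_zero[OF M Yp])
  next
    fix f h c assume f: "f \<in> smooth_fun M" and h: "h \<in> smooth_fun M"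
    note s = vfieldsD(3)[OF X f] vfieldsD(3)[OF Y f] vfieldsD(3)[OF X h] vfieldsD(3)[OF Y h]
    have l: "(\<lambda>q. Z q (\<lambda>x. c * f x + h x)) = (\<lambda>q. c * Z q f + Z q h)"
      and m: "(\<lambda>q. Z q (\<lambda>x. f x * h x)) = (\<lambda>q. f q * Z q h + h q * Z q f)" if Z: "Z \<in> vfields M" for Z
    proof -
      have "Z q (\<lambda>x. c * f x + h x) = c * Z q f + Z q h" "Z q (\<lambda>x. f x * h x) = f q * Z q h + h q * Z q f" for q
        using vfieldsD(1,2)[OF Z, of q] tangent_linear[OF _ f h] tangent_mult[OF _ f h]
        by (cases "q \<in> pts M"; simp)+
      then show "(\<lambda>q. Z q (\<lambda>x. c * f x + h x)) = (\<lambda>q. c * Z q f + Z q h)"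
        "(\<lambda>q. Z q (\<lambda>x. f x * h x)) = (\<lambda>q. f q * Z q h + h q * Z q f)" by blast+
    qed
    show "bracket X Y p (\<lambda>x. c * f x + h x) = c * bracket X Y p f + bracket X Y p h"
      unfolding bracket_def l[OF X] l[OF Y]
      using tangent_linear[OF Xp s(2,4)] tangent_linear[OF Yp s(1,3)] by (simp add: algebra_simps)
    show "bracket X Y p (\<lambda>x. f x * h x) = f p * bracket X Y p h + h p * bracket X Y p f"
      unfolding bracket_def m[OF X] m[OF Y]
      using tangent_add[OF M Xp smooth_fun_mult[OF M f s(4)] smooth_fun_mult[OF M h s(2)]]
        tangent_add[OF M Yp smooth_fun_mult[OF M f s(3)] smooth_fun_mult[OF M h s(1)]]
        tangent_mult[OF Xp f s(4)] tangent_mult[OF Xp h s(2)]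
        tangent_mult[OF Yp f s(3)] tangent_mult[OF Yp h s(1)] by (simp add: algebra_simps)
  qed
next
  fix p assume "p \<notin> pts M"
  then show "bracket X Y p = 0" by (auto simp: bracket_def vfieldsD(2)[OF X] vfieldsD(2)[OF Y])
next
  fix f assume f: "f \<in> smooth_fun M"
  show "(\<lambda>p. bracket X Y p f) \<in> smooth_fun M"
    unfolding bracket_def using f X Y by (intro smooth_fun_diff M) (auto dest: vfieldsD(3))
qed

lemma vfields_add: "charted M \<Longrightarrow> X \<in> vfields M \<Longrightarrow> Y \<in> vfields M \<Longrightarrow> X + Y \<in> vfields M"
  by (rule vfieldsI) (auto simp: vfieldsD intro!: subspace_add subspace_tangent smooth_fun_add dest: vfieldsD)

lemma vfields_mult:
  assumes "charted M" "X \<in> vfields M" "h \<in> smooth_fun M"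
  shows "(\<lambda>p. h p *\<^sub>R X p) \<in> vfields M"
proof (rule vfieldsI)
  show "(\<lambda>p. (h p *\<^sub>R X p) f) \<in> smooth_fun M" if "f \<in> smooth_fun M" for f
    using smooth_fun_mult[OF assms(1,3) vfieldsD(3)[OF assms(2) that]] by simp
qed (auto simp: vfieldsD[OF assms(2)] intro!: subspace_scale subspace_tangent assms)

lemma vfields_scale:
  assumes "charted M" "X \<in> vfields M" shows "c *\<^sub>R X \<in> vfields M"
proof (rule vfieldsI)
  show "(\<lambda>p. (c *\<^sub>R X) p f) \<in> smooth_fun M" if "f \<in> smooth_fun M" for f
    using smooth_fun_cmult[OF assms(1) vfieldsD(3)[OF assms(2) that]] by simp
qed (auto simp: vfieldsD[OF assms(2)] intro!: subspace_scale subspace_tangent assms)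

lemma vfields_zero: "charted M \<Longrightarrow> 0 \<in> vfields M"
  by (rule vfieldsI) (auto simp: subspace_0 subspace_tangent smooth_fun_zero)

definition related ::
  "('a, 'y) mfd_scheme \<Rightarrow> ('b, 'z) mfd_scheme \<Rightarrow> ('a \<Rightarrow> 'b) \<Rightarrow> 'a vfield \<Rightarrow> 'b vfield \<Rightarrow> bool" where
  "related M N F X Y \<longleftrightarrow> (\<forall>p\<in>pts M. push M N F (X p) = Y (F p))"

text \<open>F-related fields have F-related brackets: both iterated derivatives are taken of pulled-back
  functions.\<close>

lemma related_bracket:
  assumes F: "smooth_map M N F"
    and X: "X1 \<in> vfields M" "X2 \<in> vfields M" and Y: "Y1 \<in> vfields N" "Y2 \<in> vfields N"
    and r: "related M N F X1 Y1" "related M N F X2 Y2" and N: "charted N"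
  shows "related M N F (bracket X1 X2) (bracket Y1 Y2)"
  unfolding related_def
proof (intro ballI ext)
  fix p f assume p: "p \<in> pts M"
  show "push M N F (bracket X1 X2 p) f = bracket Y1 Y2 (F p) f"
  proof (cases "f \<in> smooth_fun N")
    case True
    have e: "X p (\<lambda>q. X' q (cut M (\<lambda>x. f (F x)))) = Y (F p) (\<lambda>q. Y' q f)"
      if "X' \<in> vfields M" "Y' \<in> vfields N" "related M N F X Y" "related M N F X' Y'" for X X' Y Y'
    proof -
      have "X' q (cut M (\<lambda>x. f (F x))) = cut M (\<lambda>q. Y' (F q) f) q" for q
        using that(4) vfieldsD(2)[OF that(1), of q] push_apply[OF True, of M F "X' q"]
        by (auto simp: cut_def related_def)
      then have "X p (\<lambda>q. X' q (cut M (\<lambda>x. f (F x)))) = X p (cut M (\<lambda>q. Y' (F q) f))" by presburger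
      also have "\<dots> = push M N F (X p) (\<lambda>q. Y' q f)"
        using push_apply[OF vfieldsD(3)[OF that(2) True], of M F "X p"] by simp
      finally show ?thesis using that(3) p by (simp add: related_def)
    qed
    show ?thesis
      using e[OF X(2) Y(2) r] e[OF X(1) Y(1) r(2,1)] by (simp add: push_apply True bracket_def)
  next
    case False
    then show ?thesis using vfield_off[OF bracket_vfields[OF N Y] False] by (simp add: push_def)
  qed
qed

lemma bracket_swap: "bracket Y X = - bracket X Y"
  by (auto simp: bracket_def fun_eq_iff)

section \<open>Intervals, the circle, open subsets and products\<close>

lemma cont_Ed:
  "continuous_map X (Euclidean_space d) f \<longleftrightarrow>
    (\<forall>i<d. continuous_map X euclideanreal (\<lambda>x. f x i)) \<and> (\<forall>x\<in>topspace X. f x \<in> topspace (Euclidean_space d))"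
    (is "?L \<longleftrightarrow> ?R")
proof
  assume L: ?L
  have "continuous_map X euclideanreal (\<lambda>x. f x i)" for i
    using L by (simp add: Euclidean_space_def continuous_map_in_subtopology continuous_map_componentwise_UNIV)
  then show ?R using L continuous_map_image_subset_topspace by blast
next
  assume R: ?R
  have z: "\<And>x i. x \<in> topspace X \<Longrightarrow> \<not> i < d \<Longrightarrow> f x i = 0"
    using R by (force simp: topspace_Euclidean_space)
  have "continuous_map X (Euclidean_space d) (\<lambda>x i. if i < d then f x i else 0)"
    using R by (simp add: continuous_map_componentwise_Euclidean_space)
  then show ?L by (rule continuous_map_eq) (auto simp: z)
qed

text \<open>Openness of the images of small open sets expresses continuity of the inverse chart without
  naming it.\<close>

lemma chartI:
  assumes U: "openin X U" and inj: "inj_on \<zeta> U"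
    and c: "\<And>i. i < d \<Longrightarrow> continuous_map (subtopology X U) euclideanreal (\<lambda>x. \<zeta> x i)"
    and E: "\<And>x. x \<in> U \<Longrightarrow> \<zeta> x \<in> topspace (Euclidean_space d)"
    and o: "\<And>W x. openin X W \<Longrightarrow> x \<in> W \<Longrightarrow> W \<subseteq> U \<Longrightarrow> \<exists>V. eopen d V \<and> \<zeta> x \<in> V \<and> V \<subseteq> \<zeta> ` W"
  shows "\<exists>V. eopen d V \<and> homeomorphic_map (subtopology X U) (subtopology (Euclidean_space d) V) \<zeta>"
proof -
  have ts: "topspace (subtopology X U) = U" using openin_subset[OF U] by auto
  have im: "eopen d (\<zeta> ` W)" if "openin X W" "W \<subseteq> U" for W
    using o[OF that(1) _ that(2)] by (subst openin_subopen) blast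
  have oU: "eopen d (\<zeta> ` U)" using im U by blast
  have ts2: "topspace (subtopology (Euclidean_space d) (\<zeta> ` U)) = \<zeta> ` U"
    using eopen_subset[OF oU] by auto
  have "homeomorphic_map (subtopology X U) (subtopology (Euclidean_space d) (\<zeta> ` U)) \<zeta>"
  proof (rule bijective_open_imp_homeomorphic_map)
    show "continuous_map (subtopology X U) (subtopology (Euclidean_space d) (\<zeta> ` U)) \<zeta>"
      using c E by (auto simp: continuous_map_in_subtopology cont_Ed ts)
    show "open_map (subtopology X U) (subtopology (Euclidean_space d) (\<zeta> ` U)) \<zeta>"
      unfolding open_map_def
    proof (intro allI impI)
      fix W assume "openin (subtopology X U) W"
      then have W: "openin X W" "W \<subseteq> U" using openin_open_subtopology[OF U] by auto
      then show "openin (subtopology (Euclidean_space d) (\<zeta> ` U)) (\<zeta> ` W)"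
        using openin_open_subtopology[OF oU] im by blast
    qed
  qed (simp_all only: ts ts2 inj)
  with oU show ?thesis by blast
qed

lemma chartedI:
  assumes "\<And>x. x \<in> pts M \<Longrightarrow> \<exists>U \<psi>. (U, \<psi>) \<in> atlas M \<and> x \<in> U" "\<And>U \<psi>. (U, \<psi>) \<in> atlas M \<Longrightarrow> openin (mtop M) U"
    "\<And>U \<psi>. (U, \<psi>) \<in> atlas M \<Longrightarrow> \<exists>V. eopen (mdim M) V \<and>
             homeomorphic_map (subtopology (mtop M) U) (subtopology (Euclidean_space (mdim M)) V) \<psi>"
  shows "charted M"
  unfolding charted_def
proof (intro conjI ballI, safe)
  fix x U \<psi> assume "(U, \<psi>) \<in> atlas M" "x \<in> U"
  then show "x \<in> pts M" using openin_subset[OF assms(2)] by blast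
next
  fix x assume "x \<in> pts M"
  from assms(1)[OF this] obtain U \<psi> where "(U, \<psi>) \<in> atlas M" "x \<in> U" by (elim exE conjE)
  then show "x \<in> (\<Union>(U, \<psi>)\<in>atlas M. U)" by (intro UN_I[of "(U, \<psi>)"]) simp_all
next
  fix U \<psi> assume "(U, \<psi>) \<in> atlas M"
  from assms(2)[OF this] assms(3)[OF this]
  show "openin (mtop M) U" "\<exists>V. eopen (mdim M) V \<and>
      homeomorphic_map (subtopology (mtop M) U) (subtopology (Euclidean_space (mdim M)) V) \<psi>" .
qed

lemma eopen_coord_preimage:
  assumes "eopen d V" "open T" "\<And>y. y \<in> V \<Longrightarrow> isCont g (y j)"
  shows "eopen d {y \<in> V. g (y j) \<in> (T :: 'a::topological_space set)}"
proof (rule eopenI)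
  fix x assume x: "x \<in> {y \<in> V. g (y j) \<in> T}"
  then have xE: "x \<in> topspace (Euclidean_space d)" using eopen_subset[OF assms(1)] by blast
  obtain r where r: "r > 0" "cube d x r \<subseteq> V" using eopen_imp_cube[OF assms(1)] x by blast
  have "eventually (\<lambda>s. g s \<in> T) (nhds (x j))"
  proof -
    have "(g \<longlongrightarrow> g (x j)) (nhds (x j))" using assms(3)[of x] x by (simp add: isCont_def tendsto_at_iff_tendsto_nhds)
    then show ?thesis using assms(2) x by (auto simp: tendsto_def)
  qed
  then obtain e where e: "e > 0" "\<And>s. dist s (x j) < e \<Longrightarrow> g s \<in> T" unfolding eventually_nhds_metric by blast
  have "cube d x (min r e) \<subseteq> {y \<in> V. g (y j) \<in> T}"
  proof
    fix y assume y: "y \<in> cube d x (min r e)"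
    have "y \<in> cube d x r" using y by (auto simp: cube_def)
    moreover have "dist (y j) (x j) < e"
      using y xE e(1) by (cases "j < d") (auto simp: cube_def dist_real_def topspace_Euclidean_space)
    ultimately show "y \<in> {y \<in> V. g (y j) \<in> T}" using r e by blast
  qed
  then show "x \<in> topspace (Euclidean_space d) \<and> (\<exists>r>0. cube d x r \<subseteq> {y \<in> V. g (y j) \<in> T})"
    using xE r e by (intro conjI exI[of _ "min r e"]) auto
qed

subsection \<open>half line and circle\<close>

lemma Ed1: "(\<lambda>k. if k = 0 then t else 0) \<in> topspace (Euclidean_space 1)"
  by (simp add: topspace_Euclidean_space)

lemma Ed1_eq: "y \<in> topspace (Euclidean_space 1) \<Longrightarrow> (\<lambda>k. if k = 0 then y 0 else 0) = y"
  by (auto simp: topspace_Euclidean_space)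

lemma charted_half_line: "charted half_line"
proof (rule chartedI)
  fix U \<psi> assume "(U, \<psi>) \<in> atlas half_line"
  then have U: "U = {0<..}" "\<psi> = (\<lambda>t k. if k = 0 then t else 0)" by (auto simp: half_line_def)
  show "\<exists>V. eopen (mdim half_line) V \<and> homeomorphic_map (subtopology (mtop half_line) U) (subtopology (Euclidean_space (mdim half_line)) V) \<psi>"
  proof (rule chartI)
    show "inj_on \<psi> U" unfolding U by (auto intro!: inj_onI dest: fun_cong[of _ _ 0])
    show "continuous_map (subtopology (mtop half_line) U) euclideanreal (\<lambda>x. \<psi> x i)" for i
      unfolding U half_line_def by (cases "i = 0") (auto simp: subtopology_subtopology)
    fix W x assume W: "openin (mtop half_line) W" "x \<in> W" "W \<subseteq> U"
    then obtain T where T: "open T" "W = {0<..} \<inter> T" by (auto simp: half_line_def openin_open)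
    then have oW: "open W" by auto
    have "eopen 1 {y \<in> topspace (Euclidean_space 1). id (y 0) \<in> W}"
      by (rule eopen_coord_preimage[OF _ oW]) (auto simp: id_def)
    moreover have "\<psi> x \<in> {y \<in> topspace (Euclidean_space 1). id (y 0) \<in> W}"
      using W(2) by (simp add: U topspace_Euclidean_space)
    moreover have "y \<in> \<psi> ` W" if "y \<in> {y \<in> topspace (Euclidean_space 1). id (y 0) \<in> W}" for y
    proof (rule image_eqI)
      show "y = \<psi> (y 0)" using that Ed1_eq[of y] unfolding U by auto
    qed (use that in simp)
    ultimately show "\<exists>V. eopen (mdim half_line) V \<and> \<psi> x \<in> V \<and> V \<subseteq> \<psi> ` W"
      by (intro exI[of _ "{y \<in> topspace (Euclidean_space 1). id (y 0) \<in> W}"]) (auto simp: half_line_def)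
  qed (auto simp: half_line_def U topspace_Euclidean_space)
qed (auto simp: half_line_def)

lemma isCont_cis: "isCont cis t"
  using continuous_on_cis[OF continuous_on_id, of UNIV] by (simp add: continuous_on_eq_continuous_at)

text \<open>On the complement of \<open>- w\<close> the chart \<open>z \<mapsto> Arg (z / w)\<close> has the inverse \<open>t \<mapsto> w * cis t\<close>.\<close>

lemma charted_circle: "charted circle"
proof (rule chartedI)
  fix z assume "z \<in> pts circle"
  then have z: "norm z = 1" by (simp add: circle_def)
  then have "z \<in> sphere 0 1 - {- z}" by auto
  moreover have "(sphere 0 1 - {- z}, \<lambda>y k. if k = 0 then Arg (y / z) else 0) \<in> atlas circle"
    using z by (auto simp: circle_def)
  ultimately show "\<exists>U \<psi>. (U, \<psi>) \<in> atlas circle \<and> z \<in> U" by (intro exI conjI)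
next
  fix U \<psi> assume "(U, \<psi>) \<in> atlas circle"
  then obtain w where w: "norm w = 1" and U: "U = sphere 0 1 - {- w}" "\<psi> = (\<lambda>z k. if k = 0 then Arg (z / w) else 0)"
    by (auto simp: circle_def)
  have w0: "w \<noteq> 0" using w by auto
  show oU: "openin (mtop circle) U"
    unfolding U circle_def by (auto simp: openin_open intro!: exI[of _ "- {- w}"])
  have nn: "z / w \<notin> \<real>\<^sub>\<le>\<^sub>0" if "z \<in> U" for z
  proof
    assume r: "z / w \<in> \<real>\<^sub>\<le>\<^sub>0"
    have "norm (z / w) = 1" using that w by (simp add: U norm_divide)
    with r have "z / w = -1"
      by (auto simp: complex_nonpos_Reals_iff cmod_def complex_eq_iff)
    then have "z = - w" using w0 by (simp add: field_simps)
    then show False using that by (simp add: U)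
  qed
  have cisA: "w * cis (Arg (z / w)) = z" if "z \<in> U" for z
  proof -
    have "norm (z / w) = 1" using that w by (simp add: U norm_divide)
    then have "cis (Arg (z / w)) = z / w" using rcis_cmod_Arg[of "z / w"] by (simp add: rcis_def)
    then show ?thesis using w0 by simp
  qed
  show "\<exists>V. eopen (mdim circle) V \<and> homeomorphic_map (subtopology (mtop circle) U) (subtopology (Euclidean_space (mdim circle)) V) \<psi>"
  proof (rule chartI[OF oU])
    show "inj_on \<psi> U"
    proof (rule inj_onI)
      fix z z' assume z: "z \<in> U" "z' \<in> U" and "\<psi> z = \<psi> z'"
      then have "\<psi> z 0 = \<psi> z' 0" by simp
      then have "Arg (z / w) = Arg (z' / w)" unfolding U by simp
      then show "z = z'" using cisA z by metis
    qed
    have "continuous_on U (\<lambda>z. Arg (z / w))"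
    proof (rule continuous_at_imp_continuous_on, rule ballI)
      fix z assume "z \<in> U"
      then show "isCont (\<lambda>z. Arg (z / w)) z"
        using isCont_o2[where f = "\<lambda>z. z / w" and g = Arg and a = z] continuous_at_Arg[OF nn] w0 by auto
    qed
    then show "continuous_map (subtopology (mtop circle) U) euclideanreal (\<lambda>x. \<psi> x i)" for i
      by (cases "i = 0") (auto simp: U circle_def subtopology_subtopology Int_absorb1 Diff_subset)
    fix W x assume W: "openin (mtop circle) W" "x \<in> W" "W \<subseteq> U"
    then obtain T where T: "open T" "W = sphere 0 1 \<inter> T" by (auto simp: circle_def openin_open)
    have 1: "eopen 1 {y \<in> topspace (Euclidean_space 1). id (y 0) \<in> {-pi<..<pi}}"
      by (rule eopen_coord_preimage) (auto simp: id_def)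
    have 2: "eopen 1 {y \<in> {y \<in> topspace (Euclidean_space 1). id (y 0) \<in> {-pi<..<pi}}. (\<lambda>t. w * cis t) (y 0) \<in> T}"
      by (rule eopen_coord_preimage[OF 1 T(1)]) (rule isCont_mult[OF continuous_const isCont_cis])
    show "\<exists>V. eopen (mdim circle) V \<and> \<psi> x \<in> V \<and> V \<subseteq> \<psi> ` W"
    proof (intro exI conjI)
      show "eopen (mdim circle) {y \<in> {y \<in> topspace (Euclidean_space 1). id (y 0) \<in> {-pi<..<pi}}. (\<lambda>t. w * cis t) (y 0) \<in> T}"
        using 2 by (simp add: circle_def)
      have xU: "x \<in> U" using W by blast
      have "Arg (x / w) \<noteq> pi" using nn[OF xU] Arg_eq_pi by (auto simp: complex_nonpos_Reals_iff)
      then have "Arg (x / w) < pi" "-pi < Arg (x / w)" using Arg_le_pi[of "x / w"] mpi_less_Arg[of "x / w"] by auto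
      then show "\<psi> x \<in> {y \<in> {y \<in> topspace (Euclidean_space 1). id (y 0) \<in> {-pi<..<pi}}. (\<lambda>t. w * cis t) (y 0) \<in> T}"
        using cisA[OF xU] W(2) T(2) by (auto simp: U topspace_Euclidean_space)
      show "{y \<in> {y \<in> topspace (Euclidean_space 1). id (y 0) \<in> {-pi<..<pi}}. (\<lambda>t. w * cis t) (y 0) \<in> T} \<subseteq> \<psi> ` W"
      proof safe
        fix y assume y: "y \<in> topspace (Euclidean_space 1)" "id (y 0) \<in> {-pi<..<pi}" "w * cis (y 0) \<in> T"
        have "w * cis (y 0) \<in> W" using y(3) T(2) w by (simp add: norm_mult)
        moreover have "y = \<psi> (w * cis (y 0))"
          using y(1,2) w0 by (auto simp: U Arg_cis topspace_Euclidean_space)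
        ultimately show "y \<in> \<psi> ` W" by blast
      qed
    qed
  qed (auto simp: circle_def U topspace_Euclidean_space)
qed

subsection \<open>open submanifolds\<close>

lemma open_submfd_simps [simp]:
  "mtop (open_submfd M W) = subtopology (mtop M) W" "mdim (open_submfd M W) = mdim M"
  by (simp_all add: open_submfd_def)

lemma open_submfd_atlas: "z \<in> atlas (open_submfd M W) \<longleftrightarrow> (\<exists>U \<psi>. (U, \<psi>) \<in> atlas M \<and> z = (U \<inter> W, \<psi>))"
  by (auto simp: open_submfd_def)

lemma charted_open_submfd:
  assumes M: "charted M" and Ob: "openin (mtop M) Ob"
  shows "charted (open_submfd M Ob)"
proof (rule chartedI)
  fix x assume x: "x \<in> pts (open_submfd M Ob)"
  then obtain U \<psi> where "(U, \<psi>) \<in> atlas M" "x \<in> U" using charted_cover[OF M, of x] by auto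
  then show "\<exists>U \<psi>. (U, \<psi>) \<in> atlas (open_submfd M Ob) \<and> x \<in> U"
    using x by (intro exI[of _ "U \<inter> Ob"] exI[of _ \<psi>]) (auto simp: open_submfd_def)
next
  fix U' \<psi> assume "(U', \<psi>) \<in> atlas (open_submfd M Ob)"
  then obtain U where U: "(U, \<psi>) \<in> atlas M" "U' = U \<inter> Ob" by (auto simp: open_submfd_def)
  have oU: "openin (mtop M) U" by (rule chart_open[OF M U(1)])
  show o: "openin (mtop (open_submfd M Ob)) U'" using oU U(2) by (simp add: openin_subtopology_Int)
  show "\<exists>V. eopen (mdim (open_submfd M Ob)) V \<and> homeomorphic_map (subtopology (mtop (open_submfd M Ob)) U') (subtopology (Euclidean_space (mdim (open_submfd M Ob))) V) \<psi>"
  proof (rule chartI[OF o])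
    show "inj_on \<psi> U'" using chart_inj[OF M U(1)] U(2) by (auto intro: inj_on_subset)
    obtain V where "homeomorphic_map (subtopology (mtop M) U) (subtopology (Euclidean_space (mdim M)) V) \<psi>"
      using chart_homeo[OF M U(1)] by blast
    then have "continuous_map (subtopology (mtop M) U) (Euclidean_space (mdim M)) \<psi>"
      using homeomorphic_imp_continuous_map continuous_map_in_subtopology by blast
    then have c: "continuous_map (subtopology (mtop M) U) euclideanreal (\<lambda>x. \<psi> x i)" if "i < mdim M" for i
      using that by (simp add: cont_Ed)
    show "continuous_map (subtopology (mtop (open_submfd M Ob)) U') euclideanreal (\<lambda>x. \<psi> x i)"
      if "i < mdim (open_submfd M Ob)" for i
    proof -
      have "U' \<subseteq> U" using U(2) by blast
      from continuous_map_from_subtopology_mono[OF c this, of i] that U(2)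
      show ?thesis by (simp add: subtopology_subtopology Int_commute Int_left_commute)
    qed
    show "\<psi> x \<in> topspace (Euclidean_space (mdim (open_submfd M Ob)))" if "x \<in> U'" for x
      using chart_Ed[OF M U(1)] that U(2) by simp
    fix W x assume W: "openin (mtop (open_submfd M Ob)) W" "x \<in> W" "W \<subseteq> U'"
    then have "openin (mtop M) W" using openin_open_subtopology[OF Ob] by simp
    moreover have "U \<inter> W = W" using W U(2) by blast
    ultimately have "eopen (mdim M) (\<psi> ` W)" using chart_image_open[OF M U(1)] by metis
    then show "\<exists>V. eopen (mdim (open_submfd M Ob)) V \<and> \<psi> x \<in> V \<and> V \<subseteq> \<psi> ` W" using W(2) by auto
  qed
qed

lemma smooth_in_open_submfd:
  assumes M: "charted M" and Ob: "openin (mtop M) Ob" and W: "openin (mtop M) W"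
  shows "smooth_in (open_submfd M Ob) W f \<longleftrightarrow> smooth_in M (Ob \<inter> W) f"
proof -
  have e: "Cinf_on (mdim M) (\<psi> ` (U \<inter> Ob \<inter> W)) (\<lambda>y. f (inv_into (U \<inter> Ob) \<psi> y)) \<longleftrightarrow>
      Cinf_on (mdim M) (\<psi> ` (U \<inter> Ob \<inter> W)) (\<lambda>y. f (inv_into U \<psi> y))" if U: "(U, \<psi>) \<in> atlas M" for U \<psi>
  proof -
    have o: "eopen (mdim M) (\<psi> ` (U \<inter> Ob \<inter> W))"
      using chart_image_open[OF M U openin_Int[OF Ob W]] by (simp add: Int_assoc)
    have "inj_on \<psi> (U \<inter> Ob)" using chart_inj[OF M U] by (auto intro: inj_on_subset)
    then have i: "f (inv_into (U \<inter> Ob) \<psi> y) = f (inv_into U \<psi> y)" if "y \<in> \<psi> ` (U \<inter> Ob \<inter> W)" for y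
      using that by (auto simp: chart_inv[OF M U])
    show ?thesis by (intro iffI; erule Cinf_cong[OF o, rotated]; simp only: i)
  qed
  have "smooth_in (open_submfd M Ob) W f \<longleftrightarrow>
    (\<forall>(U, \<psi>)\<in>atlas M. Cinf_on (mdim M) (\<psi> ` (U \<inter> Ob \<inter> W)) (\<lambda>y. f (inv_into (U \<inter> Ob) \<psi> y)))"
    unfolding smooth_in_def by (auto simp: open_submfd_def)
  also have "\<dots> \<longleftrightarrow> smooth_in M (Ob \<inter> W) f"
    unfolding smooth_in_def using e by (auto simp: Int_assoc)
  finally show ?thesis .
qed

subsection \<open>binary products\<close>

definition prod_chart :: "nat \<Rightarrow> ('a \<Rightarrow> nat \<Rightarrow> real) \<Rightarrow> ('b \<Rightarrow> nat \<Rightarrow> real) \<Rightarrow> 'a \<times> 'b \<Rightarrow> nat \<Rightarrow> real" where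
  "prod_chart m \<psi> \<eta> = (\<lambda>(x, y) k. if k < m then \<psi> x k else \<eta> y (k - m))"

lemma prod_mfd_simps [simp]:
  "mtop (prod_mfd M N) = prod_topology (mtop M) (mtop N)" "mdim (prod_mfd M N) = mdim M + mdim N"
  by (simp_all add: prod_mfd_def)

lemma prod_mfd_atlas:
  "z \<in> atlas (prod_mfd M N) \<longleftrightarrow> (\<exists>U \<psi> V \<eta>. (U, \<psi>) \<in> atlas M \<and> (V, \<eta>) \<in> atlas N \<and> z = (U \<times> V, prod_chart (mdim M) \<psi> \<eta>))"
  unfolding prod_mfd_def prod_chart_def by auto

text \<open>The trivialisations of a circle bundle take values in products with an open subset as first
  factor; this identifies such a product with an open subset of a product.\<close>

lemma prod_open_submfd: "prod_mfd (open_submfd M Ob) N = open_submfd (prod_mfd M N) (Ob \<times> UNIV)"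
proof -
  have "atlas (prod_mfd (open_submfd M Ob) N) = atlas (open_submfd (prod_mfd M N) (Ob \<times> UNIV))"
    (is "?A = ?B")
  proof (rule Set.set_eqI)
    fix z
    have e: "(U \<inter> Ob) \<times> V = (U \<times> V) \<inter> (Ob \<times> UNIV)" for U and V :: "'c set" by blast
    have "z \<in> ?A \<longleftrightarrow> (\<exists>U \<psi> V \<eta>. (U, \<psi>) \<in> atlas M \<and> (V, \<eta>) \<in> atlas N \<and> z = ((U \<inter> Ob) \<times> V, prod_chart (mdim M) \<psi> \<eta>))"
      unfolding prod_mfd_atlas open_submfd_atlas by auto
    also have "\<dots> \<longleftrightarrow> z \<in> ?B"
      unfolding e open_submfd_atlas prod_mfd_atlas by blast
    finally show "z \<in> ?A \<longleftrightarrow> z \<in> ?B" .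
  qed
  then show ?thesis
    using subtopology_Times[of "mtop M" "mtop N" Ob UNIV] by (simp add: prod_mfd_def open_submfd_def)
qed

text \<open>The two halves of a coordinate vector of a product chart.\<close>

definition lo :: "nat \<Rightarrow> (nat \<Rightarrow> real) \<Rightarrow> nat \<Rightarrow> real" where "lo m w = (\<lambda>k. if k < m then w k else 0)"
definition hi :: "nat \<Rightarrow> (nat \<Rightarrow> real) \<Rightarrow> nat \<Rightarrow> real" where "hi m w = (\<lambda>k. w (m + k))"

lemma lo_chart: "\<psi> x \<in> topspace (Euclidean_space m) \<Longrightarrow> lo m (prod_chart m \<psi> \<eta> (x, y)) = \<psi> x"
  by (auto simp: lo_def prod_chart_def topspace_Euclidean_space)
lemma hi_chart: "hi m (prod_chart m \<psi> \<eta> (x, y)) = \<eta> y"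
  by (auto simp: hi_def prod_chart_def)

lemma lo_Ed: "lo m w \<in> topspace (Euclidean_space m)" by (simp add: lo_def topspace_Euclidean_space)
lemma hi_Ed: "w \<in> topspace (Euclidean_space (m + n)) \<Longrightarrow> hi m w \<in> topspace (Euclidean_space n)"
  by (simp add: hi_def topspace_Euclidean_space)

lemma prod_chart_Ed: "\<eta> y \<in> topspace (Euclidean_space n) \<Longrightarrow> prod_chart m \<psi> \<eta> (x, y) \<in> topspace (Euclidean_space (m + n))"
  by (auto simp: prod_chart_def topspace_Euclidean_space)

lemma prod_chart_eqI:
  "lo m w = \<psi> x \<Longrightarrow> hi m w = \<eta> y \<Longrightarrow> prod_chart m \<psi> \<eta> (x, y) = w"
proof
  fix k assume l: "lo m w = \<psi> x" and h: "hi m w = \<eta> y"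
  have "\<psi> x k = (if k < m then w k else 0)" "\<eta> y (k - m) = w (m + (k - m))"
    using fun_cong[OF l[symmetric], of k] fun_cong[OF h[symmetric], of "k - m"] by (simp_all add: lo_def hi_def)
  then show "prod_chart m \<psi> \<eta> (x, y) k = w k" by (simp add: prod_chart_def)
qed

lemma eopen_lo_hi:
  assumes A: "eopen m A" and B: "eopen n B"
  shows "eopen (m + n) {w \<in> topspace (Euclidean_space (m + n)). lo m w \<in> A \<and> hi m w \<in> B}"
proof (rule eopenI)
  fix w assume w: "w \<in> {w \<in> topspace (Euclidean_space (m + n)). lo m w \<in> A \<and> hi m w \<in> B}"
  obtain r where r: "r > 0" "cube m (lo m w) r \<subseteq> A" using eopen_imp_cube[OF A] w by blast
  obtain s where s: "s > 0" "cube n (hi m w) s \<subseteq> B" using eopen_imp_cube[OF B] w by blast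
  have "cube (m + n) w (min r s) \<subseteq> {w \<in> topspace (Euclidean_space (m + n)). lo m w \<in> A \<and> hi m w \<in> B}"
  proof
    fix v assume v: "v \<in> cube (m + n) w (min r s)"
    have "lo m v \<in> cube m (lo m w) r" using v by (auto simp: cube_def lo_def topspace_Euclidean_space)
    moreover have "hi m v \<in> cube n (hi m w) s" using v by (auto simp: cube_def hi_def topspace_Euclidean_space)
    ultimately show "v \<in> {w \<in> topspace (Euclidean_space (m + n)). lo m w \<in> A \<and> hi m w \<in> B}"
      using r s v by (auto simp: cube_def)
  qed
  then show "w \<in> topspace (Euclidean_space (m + n)) \<and> (\<exists>r>0. cube (m + n) w r \<subseteq> {w \<in> topspace (Euclidean_space (m + n)). lo m w \<in> A \<and> hi m w \<in> B})"
    using w r s by (intro conjI exI[of _ "min r s"]) auto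
qed

context
  fixes M :: "('a, 'y) mfd_scheme" and N :: "('b, 'z) mfd_scheme"
  assumes M: "charted M" and N: "charted N"
begin

lemma charted_prod: "charted (prod_mfd M N)"
proof (rule chartedI)
  fix p assume p: "p \<in> pts (prod_mfd M N)"
  obtain U \<psi> where U: "(U, \<psi>) \<in> atlas M" "fst p \<in> U" using charted_cover[OF M, of "fst p"] p by auto
  obtain V \<eta> where V: "(V, \<eta>) \<in> atlas N" "snd p \<in> V" using charted_cover[OF N, of "snd p"] p by auto
  show "\<exists>U \<psi>. (U, \<psi>) \<in> atlas (prod_mfd M N) \<and> p \<in> U"
    using U V by (intro exI[of _ "U \<times> V"] exI[of _ "prod_chart (mdim M) \<psi> \<eta>"]) (auto simp: prod_mfd_atlas mem_Times_iff)
next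
  fix Ob \<zeta> assume "(Ob, \<zeta>) \<in> atlas (prod_mfd M N)"
  then obtain U \<psi> V \<eta> where U: "(U, \<psi>) \<in> atlas M" and V: "(V, \<eta>) \<in> atlas N"
    and Ob: "Ob = U \<times> V" "\<zeta> = prod_chart (mdim M) \<psi> \<eta>" unfolding prod_mfd_atlas by blast
  have cont: "continuous_map (subtopology (mtop K) U) euclideanreal (\<lambda>x. \<psi> x i)"
    if K: "charted K" "(U, \<psi>) \<in> atlas K" "i < mdim K" for K :: "('c, 'x) mfd_scheme" and U \<psi> i
  proof -
    obtain V where "homeomorphic_map (subtopology (mtop K) U) (subtopology (Euclidean_space (mdim K)) V) \<psi>"
      using chart_homeo[OF K(1,2)] by blast
    then have "continuous_map (subtopology (mtop K) U) (Euclidean_space (mdim K)) \<psi>"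
      using homeomorphic_imp_continuous_map continuous_map_in_subtopology by blast
    then show ?thesis using K(3) by (simp add: cont_Ed)
  qed
  show oO: "openin (mtop (prod_mfd M N)) Ob"
    using chart_open[OF M U] chart_open[OF N V] by (simp add: Ob openin_prod_Times_iff)
  show "\<exists>V. eopen (mdim (prod_mfd M N)) V \<and> homeomorphic_map (subtopology (mtop (prod_mfd M N)) Ob) (subtopology (Euclidean_space (mdim (prod_mfd M N))) V) \<zeta>"
  proof (rule chartI[OF oO])
    show "inj_on \<zeta> Ob"
    proof (rule inj_onI, clarsimp simp: Ob)
      fix x y x' y' assume a: "x \<in> U" "y \<in> V" "x' \<in> U" "y' \<in> V"
        "prod_chart (mdim M) \<psi> \<eta> (x, y) = prod_chart (mdim M) \<psi> \<eta> (x', y')"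
      have "\<psi> x = \<psi> x'" using a(5) lo_chart[of \<psi> x, OF chart_Ed[OF M U a(1)]] lo_chart[of \<psi> x', OF chart_Ed[OF M U a(3)]] by metis
      moreover have "\<eta> y = \<eta> y'" using a(5) hi_chart by metis
      ultimately show "x = x' \<and> y = y'" using a chart_inj[OF M U] chart_inj[OF N V] by (meson inj_onD)
    qed
    show "continuous_map (subtopology (mtop (prod_mfd M N)) Ob) euclideanreal (\<lambda>x. \<zeta> x i)"
      if i: "i < mdim (prod_mfd M N)" for i
    proof -
      have e: "subtopology (mtop (prod_mfd M N)) Ob = prod_topology (subtopology (mtop M) U) (subtopology (mtop N) V)"
        by (simp add: Ob subtopology_Times)
      show ?thesis
      proof (cases "i < mdim M")
        case True
        have "continuous_map (prod_topology (subtopology (mtop M) U) (subtopology (mtop N) V)) euclideanreal (\<lambda>p. \<psi> (fst p) i)"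
          using continuous_map_compose[OF continuous_map_fst cont[OF M U True]] by (simp add: o_def)
        then show ?thesis using True by (simp only: e) (simp add: Ob prod_chart_def split_def)
      next
        case False
        then have im: "i - mdim M < mdim N" using i by simp
        have "continuous_map (prod_topology (subtopology (mtop M) U) (subtopology (mtop N) V)) euclideanreal (\<lambda>p. \<eta> (snd p) (i - mdim M))"
          using continuous_map_compose[OF continuous_map_snd cont[OF N V im]] by (simp add: o_def)
        then show ?thesis using False by (simp only: e) (simp add: Ob prod_chart_def split_def)
      qed
    qed
    show "\<zeta> p \<in> topspace (Euclidean_space (mdim (prod_mfd M N)))" if "p \<in> Ob" for p
      using that by (auto simp: Ob intro!: prod_chart_Ed chart_Ed[OF N V])
    fix W p assume W: "openin (mtop (prod_mfd M N)) W" "p \<in> W" "W \<subseteq> Ob"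
    obtain x y where p: "p = (x, y)" by (cases p)
    obtain A B where AB: "openin (mtop M) A" "openin (mtop N) B" "x \<in> A" "y \<in> B" "A \<times> B \<subseteq> W"
    proof -
      have "openin (prod_topology (mtop M) (mtop N)) W" using W(1) by simp
      then show thesis using W(2) that unfolding openin_prod_topology_alt p by metis
    qed
    have xU: "x \<in> U" and yV: "y \<in> V" using W p Ob by auto
    define D where "D = {w \<in> topspace (Euclidean_space (mdim M + mdim N)). lo (mdim M) w \<in> \<psi> ` (U \<inter> A) \<and> hi (mdim M) w \<in> \<eta> ` (V \<inter> B)}"
    have "eopen (mdim (prod_mfd M N)) D"
      unfolding D_def using eopen_lo_hi[OF chart_image_open[OF M U AB(1)] chart_image_open[OF N V AB(2)]] by simp
    moreover have "\<zeta> p \<in> D"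
    proof -
      have "lo (mdim M) (\<zeta> p) = \<psi> x" unfolding Ob(2) p by (rule lo_chart[of \<psi> x, OF chart_Ed[OF M U xU]])
      moreover have "hi (mdim M) (\<zeta> p) = \<eta> y" unfolding Ob(2) p by (rule hi_chart)
      moreover have "\<zeta> p \<in> topspace (Euclidean_space (mdim M + mdim N))"
        unfolding Ob(2) p by (rule prod_chart_Ed[of \<eta> y, OF chart_Ed[OF N V yV]])
      moreover have "\<psi> x \<in> \<psi> ` (U \<inter> A)" "\<eta> y \<in> \<eta> ` (V \<inter> B)" using xU yV AB by blast+
      ultimately show ?thesis by (simp add: D_def)
    qed
    moreover have "D \<subseteq> \<zeta> ` W"
    proof
      fix w assume "w \<in> D"
      then obtain a b where ab: "a \<in> U \<inter> A" "b \<in> V \<inter> B" "lo (mdim M) w = \<psi> a" "hi (mdim M) w = \<eta> b"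
        unfolding D_def by blast
      have "w = \<zeta> (a, b)" unfolding Ob(2) by (rule prod_chart_eqI[where \<psi> = \<psi> and x = a and \<eta> = \<eta> and y = b, OF ab(3,4), symmetric])
      moreover have "(a, b) \<in> W" using ab(1,2) AB(5) by blast
      ultimately show "w \<in> \<zeta> ` W" by blast
    qed
    ultimately show "\<exists>V. eopen (mdim (prod_mfd M N)) V \<and> \<zeta> p \<in> V \<and> V \<subseteq> \<zeta> ` W" by blast
  qed
qed

lemma smooth_in_fst:
  assumes W: "openin (mtop M) W" and f: "smooth_in M W f"
  shows "smooth_in (prod_mfd M N) (W \<times> pts N) (\<lambda>p. f (fst p))"
proof (rule smooth_inI)
  fix Ob \<zeta> assume a: "(Ob, \<zeta>) \<in> atlas (prod_mfd M N)"
  then obtain U \<psi> V \<eta> where U: "(U, \<psi>) \<in> atlas M" and V: "(V, \<eta>) \<in> atlas N"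
    and Ob: "Ob = U \<times> V" "\<zeta> = prod_chart (mdim M) \<psi> \<eta>" unfolding prod_mfd_atlas by blast
  have oW: "openin (mtop (prod_mfd M N)) (W \<times> pts N)" using W by (simp add: openin_prod_Times_iff)
  note o = chart_image_open[OF charted_prod a oW]
  have "Cinf_on (mdim (prod_mfd M N)) (\<zeta> ` (Ob \<inter> W \<times> pts N)) (\<lambda>w. f (inv_into U \<psi> (lo (mdim M) w)))"
  proof (rule Cinf_compose[OF o chart_image_open[OF M U W] _ _ smooth_inD[OF f U]])
    fix w assume "w \<in> \<zeta> ` (Ob \<inter> W \<times> pts N)"
    then show "lo (mdim M) w \<in> \<psi> ` (U \<inter> W)" by (auto simp: Ob lo_chart chart_Ed[OF M U])
  next
    fix j assume "j < mdim M"
    then show "Cinf_on (mdim (prod_mfd M N)) (\<zeta> ` (Ob \<inter> W \<times> pts N)) (\<lambda>w. lo (mdim M) w j)"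
      using Cinf_coord[OF o] by (simp add: lo_def)
  qed
  then show "Cinf_on (mdim (prod_mfd M N)) (\<zeta> ` (Ob \<inter> W \<times> pts N)) (\<lambda>w. f (fst (inv_into Ob \<zeta> w)))"
  proof (rule Cinf_cong[OF o, rotated])
    fix w assume "w \<in> \<zeta> ` (Ob \<inter> W \<times> pts N)"
    then obtain x y where xy: "(x, y) \<in> Ob" "w = \<zeta> (x, y)" by blast
    have x: "x \<in> U" using xy(1) Ob(1) by blast
    have "lo (mdim M) w = \<psi> x" unfolding xy(2) Ob(2) by (rule lo_chart[of \<psi> x, OF chart_Ed[OF M U x]])
    then show "f (inv_into U \<psi> (lo (mdim M) w)) = f (fst (inv_into Ob \<zeta> w))"
      by (simp add: xy(2) chart_inv[OF charted_prod a xy(1)] chart_inv[OF M U x])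
  qed
qed

lemma smooth_in_snd:
  assumes W: "openin (mtop N) W" and f: "smooth_in N W f"
  shows "smooth_in (prod_mfd M N) (pts M \<times> W) (\<lambda>p. f (snd p))"
proof (rule smooth_inI)
  fix Ob \<zeta> assume a: "(Ob, \<zeta>) \<in> atlas (prod_mfd M N)"
  then obtain U \<psi> V \<eta> where U: "(U, \<psi>) \<in> atlas M" and V: "(V, \<eta>) \<in> atlas N"
    and Ob: "Ob = U \<times> V" "\<zeta> = prod_chart (mdim M) \<psi> \<eta>" unfolding prod_mfd_atlas by blast
  have oW: "openin (mtop (prod_mfd M N)) (pts M \<times> W)" using W by (simp add: openin_prod_Times_iff)
  note o = chart_image_open[OF charted_prod a oW]
  have "Cinf_on (mdim (prod_mfd M N)) (\<zeta> ` (Ob \<inter> pts M \<times> W)) (\<lambda>w. f (inv_into V \<eta> (hi (mdim M) w)))"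
  proof (rule Cinf_compose[OF o chart_image_open[OF N V W] _ _ smooth_inD[OF f V]])
    fix w assume "w \<in> \<zeta> ` (Ob \<inter> pts M \<times> W)"
    then show "hi (mdim M) w \<in> \<eta> ` (V \<inter> W)" by (auto simp: Ob hi_chart)
  next
    fix j
    show "Cinf_on (mdim (prod_mfd M N)) (\<zeta> ` (Ob \<inter> pts M \<times> W)) (\<lambda>w. hi (mdim M) w j)"
      using Cinf_coord[OF o] by (simp add: hi_def)
  qed
  then show "Cinf_on (mdim (prod_mfd M N)) (\<zeta> ` (Ob \<inter> pts M \<times> W)) (\<lambda>w. f (snd (inv_into Ob \<zeta> w)))"
  proof (rule Cinf_cong[OF o, rotated])
    fix w assume "w \<in> \<zeta> ` (Ob \<inter> pts M \<times> W)"
    then obtain x y where xy: "(x, y) \<in> Ob" "w = \<zeta> (x, y)" by blast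
    have y: "y \<in> V" using xy(1) Ob(1) by blast
    have "hi (mdim M) w = \<eta> y" unfolding xy(2) Ob(2) by (rule hi_chart)
    then show "f (inv_into V \<eta> (hi (mdim M) w)) = f (snd (inv_into Ob \<zeta> w))"
      by (simp add: xy(2) chart_inv[OF charted_prod a xy(1)] chart_inv[OF N V y])
  qed
qed

lemma smooth_map_pair:
  assumes F: "smooth_map Q M F" and G: "smooth_map Q N G"
  shows "smooth_map Q (prod_mfd M N) (\<lambda>x. (F x, G x))"
  unfolding smooth_map_iff
proof (intro conjI ballI, safe)
  show "continuous_map (mtop Q) (mtop (prod_mfd M N)) (\<lambda>x. (F x, G x))"
    using smooth_map_cont[OF F] smooth_map_cont[OF G] by (simp add: continuous_map_pairedI)
  fix Ob \<zeta> i assume "(Ob, \<zeta>) \<in> atlas (prod_mfd M N)" and i: "i < mdim (prod_mfd M N)"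
  then obtain U \<psi> V \<eta> where U: "(U, \<psi>) \<in> atlas M" and V: "(V, \<eta>) \<in> atlas N"
    and Ob: "Ob = U \<times> V" "\<zeta> = prod_chart (mdim M) \<psi> \<eta>" unfolding prod_mfd_atlas by blast
  show "smooth_in Q ((\<lambda>x. (F x, G x)) -` Ob) (\<lambda>x. \<zeta> (F x, G x) i)"
  proof (cases "i < mdim M")
    case True
    have "smooth_in Q (F -` U) (\<lambda>x. \<psi> (F x) i)" using F U True unfolding smooth_map_iff by blast
    then show ?thesis using True smooth_in_subset[of "(\<lambda>x. (F x, G x)) -` Ob" "F -` U"]
      by (auto simp: Ob prod_chart_def)
  next
    case False
    have "smooth_in Q (G -` V) (\<lambda>x. \<eta> (G x) (i - mdim M))" using G V False i unfolding smooth_map_iff by force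
    then show ?thesis using False smooth_in_subset[of "(\<lambda>x. (F x, G x)) -` Ob" "G -` V"]
      by (auto simp: Ob prod_chart_def)
  qed
qed

end

lemma smooth_map_const:
  assumes Q: "charted Q" and q: "q \<in> pts N" shows "smooth_map Q N (\<lambda>_. q)"
  unfolding smooth_map_iff
proof (intro conjI ballI, safe)
  show "continuous_map (mtop Q) (mtop N) (\<lambda>_. q)" using q by simp
  fix V \<eta> i assume "(V, \<eta>) \<in> atlas N"
  have "smooth_in Q (pts Q \<inter> (\<lambda>_. q) -` V) (\<lambda>x. \<eta> q i)"
    by (rule smooth_in_const[OF Q]) (cases "q \<in> V"; simp)
  then show "smooth_in Q ((\<lambda>_. q) -` V) (\<lambda>x. \<eta> q i)" using smooth_in_pts[OF Q] by blast
qed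

lemma smooth_map_id: "smooth_manifold M \<Longrightarrow> smooth_map M M (\<lambda>x. x)"
  unfolding smooth_map_iff by (auto simp: smooth_in_coord vimage_def)

lemma smooth_map_fst:
  assumes "smooth_manifold M" "charted N" shows "smooth_map (prod_mfd M N) M fst"
proof -
  have M: "charted M" by (rule smooth_manifold_charted[OF assms(1)])
  show ?thesis
    unfolding smooth_map_iff
  proof (intro conjI ballI, safe)
    show "continuous_map (mtop (prod_mfd M N)) (mtop M) fst" by (simp add: continuous_map_fst)
    fix V \<eta> i assume V: "(V, \<eta>) \<in> atlas M"
    from smooth_in_fst[OF M assms(2) chart_open[OF M V] smooth_in_coord[OF assms(1) V]]
    have "smooth_in (prod_mfd M N) (V \<times> pts N) (\<lambda>x. \<eta> (fst x) i)" .
    moreover have "pts (prod_mfd M N) \<inter> fst -` V = V \<times> pts N"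
      using chart_sub[OF M V] by auto
    ultimately show "smooth_in (prod_mfd M N) (fst -` V) (\<lambda>x. \<eta> (fst x) i)"
      using smooth_in_pts[OF charted_prod[OF M assms(2)]] by metis
  qed
qed

lemma smooth_map_snd:
  assumes "smooth_manifold N" "charted M" shows "smooth_map (prod_mfd M N) N snd"
proof -
  have N: "charted N" by (rule smooth_manifold_charted[OF assms(1)])
  show ?thesis
    unfolding smooth_map_iff
  proof (intro conjI ballI, safe)
    show "continuous_map (mtop (prod_mfd M N)) (mtop N) snd" by (simp add: continuous_map_snd)
    fix V \<eta> i assume V: "(V, \<eta>) \<in> atlas N"
    from smooth_in_snd[OF assms(2) N chart_open[OF N V] smooth_in_coord[OF assms(1) V]]
    have "smooth_in (prod_mfd M N) (pts M \<times> V) (\<lambda>x. \<eta> (snd x) i)" .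
    moreover have "pts (prod_mfd M N) \<inter> snd -` V = pts M \<times> V"
      using chart_sub[OF N V] by auto
    ultimately show "smooth_in (prod_mfd M N) (snd -` V) (\<lambda>x. \<eta> (snd x) i)"
      using smooth_in_pts[OF charted_prod[OF assms(2) N]] by metis
  qed
qed

section \<open>Vector fields along the factors of a product\<close>

text \<open>Think of Q as a product, q as the projection to the factor N and \<open>j p\<close> as the inclusion of the
  slice through p. Then f is differentiated along the slices by the field Y. In product charts the
  result is the sum of \<open>Y (c i)\<close> times partial derivatives of f in those coordinates \<open>\<sigma> i\<close> of Q
  that come from N. Both factors of a product are covered by this formulation.\<close>

lemma vfield_partial:
  fixes Q :: "('q, 'y) mfd_scheme" and N :: "('n, 'z) mfd_scheme"
  assumes Q: "charted Q" and N: "smooth_manifold N" and Y: "Y \<in> vfields N" and f: "f \<in> smooth_fun Q"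
    and qW: "\<And>W. openin (mtop N) W \<Longrightarrow> openin (mtop Q) {p \<in> pts Q. q p \<in> W}"
    and qs: "\<And>g. g \<in> smooth_fun N \<Longrightarrow> smooth_in Q (pts Q) (\<lambda>p. g (q p))"
    and sl: "\<And>p. p \<in> pts Q \<Longrightarrow> (\<lambda>y. f (j p y)) \<in> smooth_fun N"
    and ch: "\<And>B \<zeta>. (B, \<zeta>) \<in> atlas Q \<Longrightarrow> \<exists>V \<eta> \<sigma>. (V, \<eta>) \<in> atlas N \<and>
      (\<forall>p\<in>B. q p \<in> V \<and> (\<forall>y\<in>V. j p y \<in> B)) \<and>
      (\<forall>i<mdim N. \<sigma> i < mdim Q \<and> (\<forall>p\<in>B. \<zeta> p (\<sigma> i) = \<eta> (q p) i \<and>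
        (\<forall>y\<in>V. \<forall>s. \<eta> y = (\<eta> (q p))(i := s) \<longrightarrow> \<zeta> (j p y) = (\<zeta> p)(\<sigma> i := s))))"
  shows "smooth_in Q (pts Q) (\<lambda>p. Y (q p) (\<lambda>y. f (j p y)))"
proof (rule smooth_inI)
  have cN: "charted N" by (rule smooth_manifold_charted[OF N])
  fix B \<zeta> assume B: "(B, \<zeta>) \<in> atlas Q"
  from ch[OF B] obtain V \<eta> \<sigma> where V: "(V, \<eta>) \<in> atlas N"
    and c1: "\<forall>p\<in>B. q p \<in> V \<and> (\<forall>y\<in>V. j p y \<in> B)"
    and c2: "\<forall>i<mdim N. \<sigma> i < mdim Q \<and> (\<forall>p\<in>B. \<zeta> p (\<sigma> i) = \<eta> (q p) i \<and>
        (\<forall>y\<in>V. \<forall>s. \<eta> y = (\<eta> (q p))(i := s) \<longrightarrow> \<zeta> (j p y) = (\<zeta> p)(\<sigma> i := s)))"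
    by (elim exE conjE)
  have pB: "\<And>p. p \<in> B \<Longrightarrow> q p \<in> V" "\<And>p y. p \<in> B \<Longrightarrow> y \<in> V \<Longrightarrow> j p y \<in> B"
    using c1 by simp_all
  have \<sigma>: "\<And>i. i < mdim N \<Longrightarrow> \<sigma> i < mdim Q"
      "\<And>i p. i < mdim N \<Longrightarrow> p \<in> B \<Longrightarrow> \<zeta> p (\<sigma> i) = \<eta> (q p) i"
      "\<And>i p y s. i < mdim N \<Longrightarrow> p \<in> B \<Longrightarrow> y \<in> V \<Longrightarrow> \<eta> y = (\<eta> (q p))(i := s) \<Longrightarrow> \<zeta> (j p y) = (\<zeta> p)(\<sigma> i := s)"
    using c2 by simp_all
  have BQ: "B \<subseteq> pts Q" by (rule chart_sub[OF Q B])
  define F where "F = (\<lambda>w. f (inv_into B \<zeta> w))"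
  have oB: "eopen (mdim Q) (\<zeta> ` B)" by (rule chart_image_open'[OF Q B])
  have F: "Cinf_on (mdim Q) (\<zeta> ` B) F"
    using smooth_inD[OF smooth_fun_in[OF Q f BQ] B] by (simp add: F_def)
  have "Cinf_on (mdim Q) (\<zeta> ` B) (\<lambda>w. Y (q (inv_into B \<zeta> w)) (\<lambda>y. f (j (inv_into B \<zeta> w) y)))"
  proof (rule Cinf_local[OF oB])
    fix w assume "w \<in> \<zeta> ` B"
    then obtain p0 where p0: "p0 \<in> B" "w = \<zeta> p0" by blast
    obtain W c where W: "openin (mtop N) W" "q p0 \<in> W" "W \<subseteq> V" "\<forall>i. c i \<in> smooth_fun N"
      "\<forall>y\<in>W. \<forall>v\<in>tangent N y. \<forall>h\<in>smooth_fun N. v h = (\<Sum>i<mdim N. v (c i) * chart_pd V \<eta> i h y)"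
      using tangent_coords[OF N V pB(1)[OF p0(1)]] by blast
    define D where "D = \<zeta> ` (B \<inter> {p \<in> pts Q. q p \<in> W})"
    have oD: "eopen (mdim Q) D" unfolding D_def by (rule chart_image_open[OF Q B qW[OF W(1)]])
    have DB: "D \<subseteq> \<zeta> ` B" unfolding D_def by blast
    have pdF: "chart_pd V \<eta> i (\<lambda>y. f (j p y)) (q p) = pd (\<sigma> i) F (\<zeta> p)" if i: "i < mdim N" and p: "p \<in> B" for i p
    proof (rule chart_pd_eqI)
      have D: "((\<lambda>s. F ((\<zeta> p)(\<sigma> i := s))) has_real_derivative pd (\<sigma> i) F (\<zeta> p)) (at (\<zeta> p (\<sigma> i)))"
        by (rule Cinf_deriv[OF oB F \<sigma>(1)[OF i]]) (use p in blast)
      have "eventually (\<lambda>s. (\<eta> (q p))(i := s) \<in> \<eta> ` V) (nhds (\<eta> (q p) i))"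
        by (rule eventually_upd[OF chart_image_open'[OF cN V] _ i]) (use pB(1)[OF p] in blast)
      then have "eventually (\<lambda>s. f (j p (inv_into V \<eta> ((\<eta> (q p))(i := s)))) = F ((\<zeta> p)(\<sigma> i := s))) (nhds (\<eta> (q p) i))"
      proof eventually_elim
        case (elim s)
        then obtain y where y: "y \<in> V" "(\<eta> (q p))(i := s) = \<eta> y" by blast
        have "\<zeta> (j p y) = (\<zeta> p)(\<sigma> i := s)" using \<sigma>(3)[OF i p y(1)] y(2) by simp
        then have "F ((\<zeta> p)(\<sigma> i := s)) = f (j p y)"
          using chart_inv[OF Q B pB(2)[OF p y(1)]] unfolding F_def by simp
        then show ?case by (simp only: y(2) chart_inv[OF cN V y(1)])
      qed
      from DERIV_cong_ev[OF refl this refl, of "pd (\<sigma> i) F (\<zeta> p)"] D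
      show "((\<lambda>s. f (j p (inv_into V \<eta> ((\<eta> (q p))(i := s))))) has_real_derivative pd (\<sigma> i) F (\<zeta> p)) (at (\<eta> (q p) i))"
        by (simp only: \<sigma>(2)[OF i p])
    qed
    have "Cinf_on (mdim Q) D (\<lambda>w. \<Sum>i<mdim N. Y (q (inv_into B \<zeta> w)) (c i) * pd (\<sigma> i) F w)"
    proof (intro Cinf_sum Cinf_mult oD)
      fix i assume "i \<in> {..<mdim N}"
      then have i: "i < mdim N" by simp
      have "smooth_in Q (pts Q) (\<lambda>p. Y (q p) (c i))" using qs[OF vfieldsD(3)[OF Y]] W(4) by blast
      from smooth_inD[OF this B] show "Cinf_on (mdim Q) D (\<lambda>w. Y (q (inv_into B \<zeta> w)) (c i))"
        by (rule Cinf_subset[rotated]) (use BQ in \<open>auto simp: D_def\<close>)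
      show "Cinf_on (mdim Q) D (pd (\<sigma> i) F)"
        by (rule Cinf_subset[OF DB Cinf_pd[OF oB F \<sigma>(1)[OF i]]])
    qed
    then have "Cinf_on (mdim Q) D (\<lambda>w. Y (q (inv_into B \<zeta> w)) (\<lambda>y. f (j (inv_into B \<zeta> w) y)))"
    proof (rule Cinf_cong[OF oD, rotated])
      fix w assume "w \<in> D"
      then obtain p where p: "p \<in> B" "q p \<in> W" "w = \<zeta> p" unfolding D_def by blast
      have iw: "inv_into B \<zeta> w = p" unfolding p(3) by (rule chart_inv[OF Q B p(1)])
      have pQ: "p \<in> pts Q" using p(1) BQ by blast
      have "q p \<in> pts N" using pB(1)[OF p(1)] chart_sub[OF cN V] by blast
      from vfieldsD(1)[OF Y this] bspec[OF bspec[OF bspec[OF W(5) p(2)]] sl[OF pQ]]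
      have "Y (q p) (\<lambda>y. f (j p y)) = (\<Sum>i<mdim N. Y (q p) (c i) * chart_pd V \<eta> i (\<lambda>y. f (j p y)) (q p))"
        by blast
      also have "\<dots> = (\<Sum>i<mdim N. Y (q p) (c i) * pd (\<sigma> i) F w)"
        using pdF[OF _ p(1)] by (simp add: p(3))
      finally show "(\<Sum>i<mdim N. Y (q (inv_into B \<zeta> w)) (c i) * pd (\<sigma> i) F w)
          = Y (q (inv_into B \<zeta> w)) (\<lambda>y. f (j (inv_into B \<zeta> w) y))" by (simp only: iw)
    qed
    moreover have "w \<in> D" using p0 W(2) BQ by (auto simp: D_def)
    ultimately show "\<exists>V. eopen (mdim Q) V \<and> w \<in> V \<and> Cinf_on (mdim Q) V
      (\<lambda>w. Y (q (inv_into B \<zeta> w)) (\<lambda>y. f (j (inv_into B \<zeta> w) y)))" using oD by blast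
  qed
  moreover have "B \<inter> pts Q = B" using BQ by blast
  ultimately show "Cinf_on (mdim Q) (\<zeta> ` (B \<inter> pts Q)) (\<lambda>w. Y (q (inv_into B \<zeta> w)) (\<lambda>y. f (j (inv_into B \<zeta> w) y)))"
    by simp
qed

lemma slice_snd:
  assumes M: "charted M" and N: "smooth_manifold N" and x: "x \<in> pts M"
  shows "smooth_map N (prod_mfd M N) (\<lambda>y. (x, y))"
proof -
  have cN: "charted N" by (rule smooth_manifold_charted[OF N])
  show ?thesis by (rule smooth_map_pair[OF M cN smooth_map_const[OF cN x] smooth_map_id[OF N]])
qed

lemma slice_fst:
  assumes M: "smooth_manifold M" and N: "charted N" and y: "y \<in> pts N"
  shows "smooth_map M (prod_mfd M N) (\<lambda>x. (x, y))"
proof -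
  have cM: "charted M" by (rule smooth_manifold_charted[OF M])
  show ?thesis by (rule smooth_map_pair[OF cM N smooth_map_id[OF M] smooth_map_const[OF cM y]])
qed

lemma smooth_fun_slice_snd:
  assumes M: "charted M" and N: "smooth_manifold N" and f: "f \<in> smooth_fun (prod_mfd M N)"
  shows "(\<lambda>y. f (x, y)) \<in> smooth_fun N"
proof (cases "x \<in> pts M")
  case True
  have cN: "charted N" by (rule smooth_manifold_charted[OF N])
  note cP = charted_prod[OF M cN]
  have "cut N (\<lambda>y. f (x, y)) = (\<lambda>y. f (x, y))"
    using smooth_fun_off[OF cP f] by (auto simp: cut_def)
  with smooth_fun_pull[OF cN cP slice_snd[OF M N True] f] show ?thesis by simp
next
  case False
  have cN: "charted N" by (rule smooth_manifold_charted[OF N])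
  have "(\<lambda>y. f (x, y)) = (\<lambda>_. 0)" using smooth_fun_off[OF charted_prod[OF M cN] f] False by auto
  then show ?thesis using smooth_fun_zero[OF cN] by simp
qed

lemma smooth_fun_slice_fst:
  assumes M: "smooth_manifold M" and N: "charted N" and f: "f \<in> smooth_fun (prod_mfd M N)"
  shows "(\<lambda>x. f (x, y)) \<in> smooth_fun M"
proof (cases "y \<in> pts N")
  case True
  have cM: "charted M" by (rule smooth_manifold_charted[OF M])
  note cP = charted_prod[OF cM N]
  have "cut M (\<lambda>x. f (x, y)) = (\<lambda>x. f (x, y))"
    using smooth_fun_off[OF cP f] by (auto simp: cut_def)
  with smooth_fun_pull[OF cM cP slice_fst[OF M N True] f] show ?thesis by simp
next
  case False
  have cM: "charted M" by (rule smooth_manifold_charted[OF M])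
  have "(\<lambda>x. f (x, y)) = (\<lambda>_. 0)" using smooth_fun_off[OF charted_prod[OF cM N] f] False by auto
  then show ?thesis using smooth_fun_zero[OF cM] by simp
qed

lemma prod_chart_upd_snd:
  "\<eta> y = (\<eta> y0)(i := s) \<Longrightarrow> prod_chart m \<psi> \<eta> (x, y) = (prod_chart m \<psi> \<eta> (x, y0))(m + i := s)"
  by (rule ext) (auto simp: prod_chart_def)

lemma prod_chart_upd_fst:
  "\<psi> x = (\<psi> x0)(i := s) \<Longrightarrow> i < m \<Longrightarrow> prod_chart m \<psi> \<eta> (x, y) = (prod_chart m \<psi> \<eta> (x0, y))(i := s)"
  by (rule ext) (auto simp: prod_chart_def)

lemma vfield_snd:
  fixes M :: "('a, 'y) mfd_scheme" and N :: "('c, 'z) mfd_scheme"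
  assumes M: "charted M" and N: "smooth_manifold N" and Y: "Y \<in> vfields N" and f: "f \<in> smooth_fun (prod_mfd M N)"
  shows "(\<lambda>p. Y (snd p) (\<lambda>y. f (fst p, y))) \<in> smooth_fun (prod_mfd M N)"
proof -
  have cN: "charted N" by (rule smooth_manifold_charted[OF N])
  note cP = charted_prod[OF M cN]
  have "smooth_in (prod_mfd M N) (pts (prod_mfd M N)) (\<lambda>p. Y (snd p) (\<lambda>y. f (fst p, y)))"
  proof (rule vfield_partial[OF cP N Y f])
    fix W assume W: "openin (mtop N) W"
    have "{p \<in> pts (prod_mfd M N). snd p \<in> W} = pts M \<times> W" using openin_subset[OF W] by auto
    then show "openin (mtop (prod_mfd M N)) {p \<in> pts (prod_mfd M N). snd p \<in> W}"
      using W by (simp add: openin_prod_Times_iff)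
  next
    fix g assume g: "g \<in> smooth_fun N"
    have "smooth_in (prod_mfd M N) (pts M \<times> pts N) (\<lambda>p. g (snd p))"
      by (rule smooth_in_snd[OF M cN]) (use g in \<open>simp_all add: smooth_fun_iff[OF cN]\<close>)
    then show "smooth_in (prod_mfd M N) (pts (prod_mfd M N)) (\<lambda>p. g (snd p))" by simp
  next
    fix B \<zeta> assume "(B, \<zeta>) \<in> atlas (prod_mfd M N)"
    then obtain U \<psi> V \<eta> where UV: "(U, \<psi>) \<in> atlas M" "(V, \<eta>) \<in> atlas N"
      and B: "B = U \<times> V" "\<zeta> = prod_chart (mdim M) \<psi> \<eta>" unfolding prod_mfd_atlas by blast
    show "\<exists>V \<eta> \<sigma>. (V, \<eta>) \<in> atlas N \<and>
      (\<forall>p\<in>B. snd p \<in> V \<and> (\<forall>y\<in>V. (fst p, y) \<in> B)) \<and>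
      (\<forall>i<mdim N. \<sigma> i < mdim (prod_mfd M N) \<and> (\<forall>p\<in>B. \<zeta> p (\<sigma> i) = \<eta> (snd p) i \<and>
        (\<forall>y\<in>V. \<forall>s. \<eta> y = (\<eta> (snd p))(i := s) \<longrightarrow> \<zeta> (fst p, y) = (\<zeta> p)(\<sigma> i := s))))"
    proof (intro exI[of _ V] exI[of _ \<eta>] exI[of _ "\<lambda>i. mdim M + i"] conjI ballI allI impI UV(2))
      fix p :: "'a \<times> 'c" and i y s assume h: "\<eta> y = (\<eta> (snd p))(i := s)"
      show "\<zeta> (fst p, y) = (\<zeta> p)(mdim M + i := s)"
        using prod_chart_upd_snd[OF h, of "mdim M" \<psi> "fst p"] by (simp add: B(2))
    qed (auto simp: B prod_chart_def split_def)
  qed (rule smooth_fun_slice_snd[OF M N f])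
  moreover have "Y (snd p) (\<lambda>y. f (fst p, y)) = 0" if "p \<notin> pts (prod_mfd M N)" for p
  proof (cases "snd p \<in> pts N")
    case True
    then have "(\<lambda>y. f (fst p, y)) = (\<lambda>_. 0)" using that smooth_fun_off[OF cP f] by (auto simp: mem_Times_iff)
    then show ?thesis using tangent_zero[OF cN vfieldsD(1)[OF Y True]] by simp
  qed (simp add: vfieldsD(2)[OF Y])
  ultimately show ?thesis unfolding smooth_fun_iff[OF cP] by blast
qed

lemma vfield_fst:
  fixes M :: "('a, 'y) mfd_scheme" and N :: "('c, 'z) mfd_scheme"
  assumes M: "smooth_manifold M" and N: "charted N" and Y: "Y \<in> vfields M" and f: "f \<in> smooth_fun (prod_mfd M N)"
  shows "(\<lambda>p. Y (fst p) (\<lambda>x. f (x, snd p))) \<in> smooth_fun (prod_mfd M N)"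
proof -
  have cM: "charted M" by (rule smooth_manifold_charted[OF M])
  note cP = charted_prod[OF cM N]
  have "smooth_in (prod_mfd M N) (pts (prod_mfd M N)) (\<lambda>p. Y (fst p) (\<lambda>x. f (x, snd p)))"
  proof (rule vfield_partial[OF cP M Y f])
    fix W assume W: "openin (mtop M) W"
    have "{p \<in> pts (prod_mfd M N). fst p \<in> W} = W \<times> pts N" using openin_subset[OF W] by auto
    then show "openin (mtop (prod_mfd M N)) {p \<in> pts (prod_mfd M N). fst p \<in> W}"
      using W by (simp add: openin_prod_Times_iff)
  next
    fix g assume g: "g \<in> smooth_fun M"
    have "smooth_in (prod_mfd M N) (pts M \<times> pts N) (\<lambda>p. g (fst p))"
      by (rule smooth_in_fst[OF cM N]) (use g in \<open>simp_all add: smooth_fun_iff[OF cM]\<close>)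
    then show "smooth_in (prod_mfd M N) (pts (prod_mfd M N)) (\<lambda>p. g (fst p))" by simp
  next
    fix B \<zeta> assume "(B, \<zeta>) \<in> atlas (prod_mfd M N)"
    then obtain U \<psi> V \<eta> where UV: "(U, \<psi>) \<in> atlas M" "(V, \<eta>) \<in> atlas N"
      and B: "B = U \<times> V" "\<zeta> = prod_chart (mdim M) \<psi> \<eta>" unfolding prod_mfd_atlas by blast
    show "\<exists>V \<eta> \<sigma>. (V, \<eta>) \<in> atlas M \<and>
      (\<forall>p\<in>B. fst p \<in> V \<and> (\<forall>y\<in>V. (y, snd p) \<in> B)) \<and>
      (\<forall>i<mdim M. \<sigma> i < mdim (prod_mfd M N) \<and> (\<forall>p\<in>B. \<zeta> p (\<sigma> i) = \<eta> (fst p) i \<and>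
        (\<forall>y\<in>V. \<forall>s. \<eta> y = (\<eta> (fst p))(i := s) \<longrightarrow> \<zeta> (y, snd p) = (\<zeta> p)(\<sigma> i := s))))"
    proof (intro exI[of _ U] exI[of _ \<psi>] exI[of _ "\<lambda>i. i"] conjI ballI allI impI UV(1))
      fix p :: "'a \<times> 'c" and i y s assume i: "i < mdim M" and h: "\<psi> y = (\<psi> (fst p))(i := s)"
      show "\<zeta> (y, snd p) = (\<zeta> p)(i := s)"
        using prod_chart_upd_fst[OF h i, of \<eta> "snd p"] by (simp add: B(2))
    qed (auto simp: B prod_chart_def split_def)
  qed (rule smooth_fun_slice_fst[OF M N f])
  moreover have "Y (fst p) (\<lambda>x. f (x, snd p)) = 0" if "p \<notin> pts (prod_mfd M N)" for p
  proof (cases "fst p \<in> pts M")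
    case True
    then have "(\<lambda>x. f (x, snd p)) = (\<lambda>_. 0)" using that smooth_fun_off[OF cP f] by (auto simp: mem_Times_iff)
    then show ?thesis using tangent_zero[OF cM vfieldsD(1)[OF Y True]] by simp
  qed (simp add: vfieldsD(2)[OF Y])
  ultimately show ?thesis unfolding smooth_fun_iff[OF cP] by blast
qed

text \<open>A single tangent vector extends to a vector field, to which differentiation along the second factor
  applies. Left-invariant fields are of this form:
  their value on f at x differentiates \<open>y \<mapsto> f (x y)\<close> at the unit.\<close>

lemma vfield_at_snd:
  assumes M: "smooth_manifold M" and N: "smooth_manifold N" and y: "y \<in> pts N" and v: "v \<in> tangent N y"
    and f: "f \<in> smooth_fun (prod_mfd M N)"
  shows "(\<lambda>x. v (\<lambda>y. f (x, y))) \<in> smooth_fun M"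
proof -
  obtain Y where Y: "Y \<in> vfields N" "Y y = v" using vfield_through[OF N y v] by blast
  from smooth_fun_slice_fst[OF M smooth_manifold_charted[OF N]
      vfield_snd[OF smooth_manifold_charted[OF M] N Y(1) f], of y]
  show ?thesis by (simp add: Y(2))
qed

text \<open>In the chart of the circle around 1 the angle is the coordinate, so the derivative is the partial
  derivative with index 0 in a product chart.\<close>

lemma circle_deriv:
  assumes N: "charted N" and K: "K \<in> smooth_fun (prod_mfd circle N)"
  shows "smooth_in N (pts N) (\<lambda>x. deriv (\<lambda>\<theta>. K (cis \<theta>, x)) 0)"
    and "x \<in> pts N \<Longrightarrow> ((\<lambda>\<theta>. K (cis \<theta>, x)) has_real_derivative deriv (\<lambda>\<theta>. K (cis \<theta>, x)) 0) (at 0)"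
proof -
  define V :: "complex set" where "V = sphere 0 1 - {- 1}"
  define \<alpha> :: "complex \<Rightarrow> nat \<Rightarrow> real" where "\<alpha> = (\<lambda>z k. if k = 0 then Arg (z / 1) else 0)"
  have VA: "(V, \<alpha>) \<in> atlas circle" unfolding circle_def mfd.simps
    by (rule CollectI, rule exI[of _ 1]) (simp add: V_def \<alpha>_def)
  have cisV: "cis \<theta> \<in> V" "\<alpha> (cis \<theta>) = (\<lambda>k. if k = 0 then \<theta> else 0)" if "- pi < \<theta>" "\<theta> < pi" for \<theta>
  proof -
    have A: "Arg (cis \<theta>) = \<theta>" using that by (intro Arg_cis) auto
    then show "\<alpha> (cis \<theta>) = (\<lambda>k. if k = 0 then \<theta> else 0)" by (simp only: \<alpha>_def A div_by_1)
    have "cis \<theta> \<noteq> -1" using A that(2) Arg_cis[of pi] cis_pi by auto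
    then show "cis \<theta> \<in> V" by (simp add: V_def)
  qed
  have m1: "mdim circle = 1" by (simp add: circle_def)
  note cP = charted_prod[OF charted_circle N]
  have key: "eopen (1 + mdim N) (prod_chart 1 \<alpha> \<psi> ` (V \<times> U))"
    "Cinf_on (1 + mdim N) (prod_chart 1 \<alpha> \<psi> ` (V \<times> U)) (\<lambda>w. K (inv_into (V \<times> U) (prod_chart 1 \<alpha> \<psi>) w))"
    "x \<in> U \<Longrightarrow> ((\<lambda>\<theta>. K (cis \<theta>, x)) has_real_derivative
        pd 0 (\<lambda>w. K (inv_into (V \<times> U) (prod_chart 1 \<alpha> \<psi>) w)) (prod_chart 1 \<alpha> \<psi> (1, x))) (at 0)"
    if U: "(U, \<psi>) \<in> atlas N" for U \<psi> x
  proof -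
    let ?\<zeta> = "prod_chart 1 \<alpha> \<psi>"
    let ?F = "\<lambda>w. K (inv_into (V \<times> U) ?\<zeta> w)"
    have a: "(V \<times> U, ?\<zeta>) \<in> atlas (prod_mfd circle N)"
      unfolding prod_mfd_atlas m1 using VA U by blast
    show o: "eopen (1 + mdim N) (?\<zeta> ` (V \<times> U))" using chart_image_open'[OF cP a] by (simp add: m1)
    show F: "Cinf_on (1 + mdim N) (?\<zeta> ` (V \<times> U)) ?F"
    proof -
      have "(V \<times> U) \<inter> (V \<times> U) = V \<times> U" by blast
      then show ?thesis using smooth_inD[OF smooth_fun_in[OF cP K chart_sub[OF cP a]] a] by (simp add: m1)
    qed
    assume x: "x \<in> U"
    have V1: "1 \<in> V" "\<alpha> 1 = (\<lambda>k. 0)" using cisV[of 0] by (auto simp: fun_eq_iff)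
    have "((\<lambda>s. ?F ((?\<zeta> (1, x))(0 := s))) has_real_derivative pd 0 ?F (?\<zeta> (1, x))) (at (?\<zeta> (1, x) 0))"
      by (rule Cinf_deriv[OF o F]) (use x V1 in auto)
    moreover have "?\<zeta> (1, x) 0 = 0" using V1 by (simp add: prod_chart_def)
    moreover have "eventually (\<lambda>\<theta>. K (cis \<theta>, x) = ?F ((?\<zeta> (1, x))(0 := \<theta>))) (nhds 0)"
    proof -
      have "eventually (\<lambda>\<theta>::real. \<theta> \<in> {-pi<..<pi}) (nhds 0)" by (rule eventually_nhds_in_open) auto
      then show ?thesis
      proof eventually_elim
        case (elim \<theta>)
        have "(?\<zeta> (1, x))(0 := \<theta>) = ?\<zeta> (cis \<theta>, x)"
          using cisV(2)[of \<theta>] elim by (auto simp: prod_chart_def fun_eq_iff)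
        moreover have "(cis \<theta>, x) \<in> V \<times> U" using cisV(1)[of \<theta>] elim x by auto
        ultimately show ?case using chart_inv[OF cP a, of "(cis \<theta>, x)"] by simp
      qed
    qed
    ultimately show "((\<lambda>\<theta>. K (cis \<theta>, x)) has_real_derivative pd 0 ?F (?\<zeta> (1, x))) (at 0)"
      using DERIV_cong_ev[of 0 0 "\<lambda>\<theta>. K (cis \<theta>, x)" "\<lambda>\<theta>. ?F ((?\<zeta> (1, x))(0 := \<theta>))" "pd 0 ?F (?\<zeta> (1, x))" "pd 0 ?F (?\<zeta> (1, x))"] by simp
  qed
  show "((\<lambda>\<theta>. K (cis \<theta>, x)) has_real_derivative deriv (\<lambda>\<theta>. K (cis \<theta>, x)) 0) (at 0)" if xN: "x \<in> pts N"
  proof -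
    obtain U \<psi> where U: "(U, \<psi>) \<in> atlas N" "x \<in> U" using charted_cover[OF N xN] by blast
    from key(3)[OF U] show ?thesis by (simp only: DERIV_imp_deriv[OF key(3)[OF U]])
  qed
  show "smooth_in N (pts N) (\<lambda>x. deriv (\<lambda>\<theta>. K (cis \<theta>, x)) 0)"
  proof (rule smooth_inI)
    fix U \<psi> assume U: "(U, \<psi>) \<in> atlas N"
    let ?F = "\<lambda>w. K (inv_into (V \<times> U) (prod_chart 1 \<alpha> \<psi>) w)"
    have V1: "1 \<in> V" "\<alpha> 1 = (\<lambda>k. 0)" using cisV[of 0] by (auto simp: fun_eq_iff)
    have oU: "eopen (mdim N) (\<psi> ` U)" by (rule chart_image_open'[OF N U])
    have e: "prod_chart 1 \<alpha> \<psi> (1, x) = (\<lambda>k. if k < 1 then 0 else \<psi> x (k - 1))" for x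
      using V1(2) by (auto simp: prod_chart_def fun_eq_iff)
    have "Cinf_on (mdim N) (\<psi> ` U) (\<lambda>y. pd 0 ?F (\<lambda>k. if k < 1 then 0 else y (k - 1)))"
    proof (rule Cinf_compose[OF oU key(1)[OF U] _ _ Cinf_pd[OF key(1)[OF U] key(2)[OF U]]])
      fix y assume "y \<in> \<psi> ` U"
      then obtain x where x: "x \<in> U" "y = \<psi> x" by blast
      show "(\<lambda>k. if k < 1 then 0 else y (k - 1)) \<in> prod_chart 1 \<alpha> \<psi> ` (V \<times> U)"
        unfolding x(2) using x(1) e[of x] V1(1) by (intro image_eqI[of _ _ "(1, x)"]) simp_all
    next
      fix k show "Cinf_on (mdim N) (\<psi> ` U) (\<lambda>y. if k < 1 then 0 else y (k - 1))"
        using Cinf_const[OF oU] Cinf_coord[OF oU] by (cases "k < 1") auto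
    qed simp
    then have "Cinf_on (mdim N) (\<psi> ` U) (\<lambda>y. deriv (\<lambda>\<theta>. K (cis \<theta>, inv_into U \<psi> y)) 0)"
    proof (rule Cinf_cong[OF oU, rotated])
      fix y assume "y \<in> \<psi> ` U"
      then obtain x where x: "x \<in> U" "y = \<psi> x" by blast
      show "pd 0 ?F (\<lambda>k. if k < 1 then 0 else y (k - 1)) = deriv (\<lambda>\<theta>. K (cis \<theta>, inv_into U \<psi> y)) 0"
        unfolding x(2) chart_inv[OF N U x(1)] e[symmetric] by (rule DERIV_imp_deriv[OF key(3)[OF U x(1)], symmetric])
    qed
    moreover have "U \<inter> pts N = U" using chart_sub[OF N U] by blast
    ultimately show "Cinf_on (mdim N) (\<psi> ` (U \<inter> pts N)) (\<lambda>y. deriv (\<lambda>\<theta>. K (cis \<theta>, inv_into U \<psi> y)) 0)" by simp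
  qed
qed

section \<open>Finite products of manifolds\<close>

text \<open>A predicate rather than an equation, because the product of Kaehler Lie groups is a record with
  further fields.\<close>

definition is_Pi :: "('i \<Rightarrow> 'a, 'y) mfd_scheme \<Rightarrow> 'i set \<Rightarrow> ('i \<Rightarrow> ('a, 'z) mfd_scheme) \<Rightarrow> bool" where
  "is_Pi P I M \<longleftrightarrow> mtop P = mtop (Pi_mfd I M) \<and> mdim P = mdim (Pi_mfd I M) \<and> atlas P = atlas (Pi_mfd I M)"

text \<open>The charts of a finite product, for an enumeration e of all pairs of a factor and one of its
  coordinates.\<close>

definition Pi_chart :: "'i set \<Rightarrow> ('i \<Rightarrow> nat) \<Rightarrow> ('i \<Rightarrow> 'a \<Rightarrow> nat \<Rightarrow> real) \<Rightarrow> (nat \<Rightarrow> 'i \<times> nat) \<Rightarrow> ('i \<Rightarrow> 'a) \<Rightarrow> nat \<Rightarrow> real" where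
  "Pi_chart I d \<psi> e = (\<lambda>x k. if k < sum d I then \<psi> (fst (e k)) (x (fst (e k))) (snd (e k)) else 0)"

text \<open>The coordinates belonging to factor i, recovered from a coordinate vector of the product.\<close>

definition Pi_coord :: "'i set \<Rightarrow> ('i \<Rightarrow> nat) \<Rightarrow> (nat \<Rightarrow> 'i \<times> nat) \<Rightarrow> 'i \<Rightarrow> (nat \<Rightarrow> real) \<Rightarrow> nat \<Rightarrow> real" where
  "Pi_coord I d e i w = (\<lambda>l. if l < d i then w (inv_into {..<sum d I} e (i, l)) else 0)"

context
  fixes I :: "'i set" and d :: "'i \<Rightarrow> nat" and e
  assumes e: "bij_betw e {..<sum d I} (SIGMA i:I. {..<d i})"
begin

lemma Pi_index: "i \<in> I \<Longrightarrow> l < d i \<Longrightarrow>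
  inv_into {..<sum d I} e (i, l) < sum d I \<and> e (inv_into {..<sum d I} e (i, l)) = (i, l)"
proof -
  assume "i \<in> I" "l < d i"
  then have "(i, l) \<in> e ` {..<sum d I}" using bij_betw_imp_surj_on[OF e] by auto
  from inv_into_into[OF this] f_inv_into_f[OF this] show ?thesis by simp
qed

lemma Pi_index': "k < sum d I \<Longrightarrow> fst (e k) \<in> I \<and> snd (e k) < d (fst (e k)) \<and> inv_into {..<sum d I} e (e k) = k"
proof -
  assume k: "k < sum d I"
  then have "e k \<in> (SIGMA i:I. {..<d i})" using bij_betw_imp_surj_on[OF e] by blast
  moreover have "inv_into {..<sum d I} e (e k) = k"
    using k by (intro inv_into_f_f bij_betw_imp_inj_on[OF e]) simp
  ultimately show ?thesis by (cases "e k") auto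
qed

lemma Pi_coord_chart:
  assumes "i \<in> I" "\<psi> i (x i) \<in> topspace (Euclidean_space (d i))"
  shows "Pi_coord I d e i (Pi_chart I d \<psi> e x) = \<psi> i (x i)"
proof
  fix l show "Pi_coord I d e i (Pi_chart I d \<psi> e x) l = \<psi> i (x i) l"
    using Pi_index[OF assms(1), of l] assms(2)
    by (auto simp: Pi_coord_def Pi_chart_def topspace_Euclidean_space)
qed

lemma Pi_chart_eqI:
  assumes "w \<in> topspace (Euclidean_space (sum d I))" "\<And>i. i \<in> I \<Longrightarrow> Pi_coord I d e i w = \<psi> i (x i)"
  shows "Pi_chart I d \<psi> e x = w"
proof
  fix k show "Pi_chart I d \<psi> e x k = w k"
  proof (cases "k < sum d I")
    case True
    note k = Pi_index'[OF True]
    have "\<psi> (fst (e k)) (x (fst (e k))) (snd (e k)) = Pi_coord I d e (fst (e k)) w (snd (e k))"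
      using assms(2)[of "fst (e k)"] k by simp
    also have "\<dots> = w k" using k by (simp add: Pi_coord_def)
    finally show ?thesis using True by (simp add: Pi_chart_def)
  next
    case False
    then show ?thesis using assms(1) by (simp add: Pi_chart_def topspace_Euclidean_space)
  qed
qed

lemma eopen_Pi_coord:
  assumes I: "finite I" and A: "\<And>i. i \<in> I \<Longrightarrow> eopen (d i) (A i)"
  shows "eopen (sum d I) {w \<in> topspace (Euclidean_space (sum d I)). \<forall>i\<in>I. Pi_coord I d e i w \<in> A i}"
proof (rule eopenI)
  fix w assume w: "w \<in> {w \<in> topspace (Euclidean_space (sum d I)). \<forall>i\<in>I. Pi_coord I d e i w \<in> A i}"
  have "\<exists>r>0. cube (d i) (Pi_coord I d e i w) r \<subseteq> A i" if "i \<in> I" for i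
    using eopen_imp_cube[OF A[OF that]] w that by blast
  then obtain r where r: "\<And>i. i \<in> I \<Longrightarrow> r i > 0" "\<And>i. i \<in> I \<Longrightarrow> cube (d i) (Pi_coord I d e i w) (r i) \<subseteq> A i"
    by metis
  define R where "R = Min (insert 1 (r ` I))"
  have R: "R > 0" unfolding R_def using r(1) I by (subst Min_gr_iff) auto
  have Rle: "R \<le> r i" if "i \<in> I" for i unfolding R_def using that I by (intro Min_le) auto
  have "v \<in> {w \<in> topspace (Euclidean_space (sum d I)). \<forall>i\<in>I. Pi_coord I d e i w \<in> A i}"
    if v: "v \<in> cube (sum d I) w R" for v
  proof -
    have "Pi_coord I d e i v \<in> A i" if i: "i \<in> I" for i
    proof -
      have "Pi_coord I d e i v \<in> cube (d i) (Pi_coord I d e i w) (r i)"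
        using v Pi_index[OF i] Rle[OF i] by (force simp: cube_def Pi_coord_def topspace_Euclidean_space)
      then show ?thesis using r(2)[OF i] by blast
    qed
    then show ?thesis using v by (simp add: cube_def)
  qed
  then show "w \<in> topspace (Euclidean_space (sum d I)) \<and> (\<exists>r>0. cube (sum d I) w r \<subseteq> {w \<in> topspace (Euclidean_space (sum d I)). \<forall>i\<in>I. Pi_coord I d e i w \<in> A i})"
    using w R by blast
qed

end

lemma chart_coord_cont:
  assumes K: "charted K" "(U, \<psi>) \<in> atlas K" "i < mdim K"
  shows "continuous_map (subtopology (mtop K) U) euclideanreal (\<lambda>x. \<psi> x i)"
proof -
  obtain V where "homeomorphic_map (subtopology (mtop K) U) (subtopology (Euclidean_space (mdim K)) V) \<psi>"
    using chart_homeo[OF K(1,2)] by blast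
  then have "continuous_map (subtopology (mtop K) U) (Euclidean_space (mdim K)) \<psi>"
    using homeomorphic_imp_continuous_map continuous_map_in_subtopology by blast
  then show ?thesis using K(3) by (simp add: cont_Ed)
qed

context
  fixes P :: "('i \<Rightarrow> 'a, 'y) mfd_scheme" and I :: "'i set" and M :: "'i \<Rightarrow> ('a, 'z) mfd_scheme"
  assumes P: "is_Pi P I M" and I: "finite I" and M: "\<And>i. i \<in> I \<Longrightarrow> charted (M i)"
begin

abbreviation (input) "dm \<equiv> \<lambda>i. mdim (M i)"

lemma Pi_simps:
  "mtop P = product_topology (\<lambda>i. mtop (M i)) I" "mdim P = sum dm I"
  "pts P = (\<Pi>\<^sub>E i\<in>I. pts (M i))"
  using P by (simp_all add: is_Pi_def Pi_mfd_def)

lemma Pi_atlas: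
  "z \<in> atlas P \<longleftrightarrow> (\<exists>U \<psi> e. (\<forall>i\<in>I. (U i, \<psi> i) \<in> atlas (M i)) \<and>
      bij_betw e {..<sum dm I} (SIGMA i:I. {..<dm i}) \<and> z = (\<Pi>\<^sub>E i\<in>I. U i, Pi_chart I dm \<psi> e))"
proof -
  have "atlas P = atlas (Pi_mfd I M)" using P by (simp add: is_Pi_def)
  then show ?thesis by (auto simp: Pi_mfd_def Pi_chart_def)
qed

lemma charted_Pi: "charted P"
proof (rule chartedI)
  fix x assume x: "x \<in> pts P"
  have "\<forall>i\<in>I. \<exists>c. c \<in> atlas (M i) \<and> x i \<in> fst c"
  proof
    fix i assume i: "i \<in> I"
    then have "x i \<in> pts (M i)" using x by (simp add: Pi_simps PiE_iff)
    then obtain U \<psi> where "(U, \<psi>) \<in> atlas (M i)" "x i \<in> U" using charted_cover[OF M[OF i]] by blast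
    then show "\<exists>c. c \<in> atlas (M i) \<and> x i \<in> fst c" by (intro exI[of _ "(U, \<psi>)"]) simp
  qed
  then obtain c where c: "\<And>i. i \<in> I \<Longrightarrow> c i \<in> atlas (M i)" "\<And>i. i \<in> I \<Longrightarrow> x i \<in> fst (c i)" by metis
  have "card (SIGMA i:I. {..<dm i}) = sum dm I" using I by (simp add: card_SigmaI)
  moreover have "finite (SIGMA i:I. {..<dm i})" using I by auto
  ultimately obtain e where e: "bij_betw e {..<sum dm I} (SIGMA i:I. {..<dm i})"
    using ex_bij_betw_nat_finite[of "SIGMA i:I. {..<dm i}"] by (metis atLeast0LessThan)
  have "x \<in> (\<Pi>\<^sub>E i\<in>I. fst (c i))" using x c(2) by (auto simp: Pi_simps PiE_iff)
  moreover have "((\<Pi>\<^sub>E i\<in>I. fst (c i)), Pi_chart I dm (\<lambda>i. snd (c i)) e) \<in> atlas P"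
    unfolding Pi_atlas using c(1) e by (intro exI conjI) auto
  ultimately show "\<exists>U \<psi>. (U, \<psi>) \<in> atlas P \<and> x \<in> U" by (intro exI conjI)
next
  fix B \<zeta> assume "(B, \<zeta>) \<in> atlas P"
  then obtain U \<psi> e where U: "\<And>i. i \<in> I \<Longrightarrow> (U i, \<psi> i) \<in> atlas (M i)"
    and e: "bij_betw e {..<sum dm I} (SIGMA i:I. {..<dm i})"
    and B: "B = (\<Pi>\<^sub>E i\<in>I. U i)" "\<zeta> = Pi_chart I dm \<psi> e" unfolding Pi_atlas by blast
  have UE: "\<psi> i y \<in> topspace (Euclidean_space (dm i))" if "i \<in> I" "y \<in> U i" for i y
    by (rule chart_Ed[OF M[OF that(1)] U[OF that(1)] that(2)])
  show oB: "openin (mtop P) B"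
    unfolding Pi_simps B openin_PiE[OF I] using chart_open[OF M U] by blast
  show "\<exists>V. eopen (mdim P) V \<and> homeomorphic_map (subtopology (mtop P) B) (subtopology (Euclidean_space (mdim P)) V) \<zeta>"
  proof (rule chartI[OF oB])
    show "inj_on \<zeta> B"
    proof (rule inj_onI)
      fix x x' assume x: "x \<in> B" "x' \<in> B" "\<zeta> x = \<zeta> x'"
      show "x = x'"
      proof (rule PiE_ext)
        show "x \<in> (\<Pi>\<^sub>E i\<in>I. U i)" "x' \<in> (\<Pi>\<^sub>E i\<in>I. U i)" using x B by simp_all
        fix i assume i: "i \<in> I"
        have xi: "x i \<in> U i" "x' i \<in> U i" using x(1,2) i by (auto simp: B PiE_iff)
        have "\<psi> i (x i) = \<psi> i (x' i)"
          using Pi_coord_chart[OF e i, of \<psi> x, OF UE[OF i xi(1)]] Pi_coord_chart[OF e i, of \<psi> x', OF UE[OF i xi(2)]] x(3)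
          by (simp add: B(2))
        then show "x i = x' i" using inj_onD[OF chart_inj[OF M[OF i] U[OF i]]] xi by blast
      qed
    qed
    show "continuous_map (subtopology (mtop P) B) euclideanreal (\<lambda>x. \<zeta> x k)" if k: "k < mdim P" for k
    proof -
      have k': "k < sum dm I" using k by (simp add: Pi_simps)
      note ek = Pi_index'[OF e k']
      define i l where "i = fst (e k)" and "l = snd (e k)"
      have il: "i \<in> I" "l < dm i" using ek by (simp_all add: i_def l_def)
      have "continuous_map (product_topology (\<lambda>i. subtopology (mtop (M i)) (U i)) I) euclideanreal (\<lambda>x. \<psi> i (x i) l)"
        using continuous_map_compose[OF continuous_map_product_projection[OF il(1), of "\<lambda>i. subtopology (mtop (M i)) (U i)"]
          chart_coord_cont[OF M[OF il(1)] U[OF il(1)] il(2)]]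
        by (simp add: o_def)
      moreover have "subtopology (mtop P) B = product_topology (\<lambda>i. subtopology (mtop (M i)) (U i)) I"
        by (simp add: Pi_simps B subtopology_product_topology)
      ultimately show ?thesis using k' by (simp add: B(2) Pi_chart_def i_def l_def)
    qed
    show "\<zeta> x \<in> topspace (Euclidean_space (mdim P))" if "x \<in> B" for x
      by (simp add: B(2) Pi_chart_def Pi_simps topspace_Euclidean_space)
    fix W x assume W: "openin (mtop P) W" "x \<in> W" "W \<subseteq> B"
    have "openin (product_topology (\<lambda>i. mtop (M i)) I) W" using W(1) by (simp add: Pi_simps)
    then obtain A where A: "\<forall>i\<in>I. openin (mtop (M i)) (A i)" "x \<in> (\<Pi>\<^sub>E i\<in>I. A i)" "(\<Pi>\<^sub>E i\<in>I. A i) \<subseteq> W"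
      using W(2) unfolding openin_product_topology_alt by metis
    define D where "D = {w \<in> topspace (Euclidean_space (sum dm I)). \<forall>i\<in>I. Pi_coord I dm e i w \<in> \<psi> i ` (U i \<inter> A i)}"
    have xU: "x i \<in> U i" if "i \<in> I" for i using W(2,3) that by (auto simp: B PiE_iff)
    have oD: "eopen (mdim P) D"
      unfolding D_def Pi_simps
      by (rule eopen_Pi_coord[OF e I]) (use chart_image_open[OF M U] A(1) in blast)
    moreover have "\<zeta> x \<in> D"
      unfolding D_def
    proof (intro CollectI conjI ballI)
      show "\<zeta> x \<in> topspace (Euclidean_space (sum dm I))" by (simp add: B(2) Pi_chart_def topspace_Euclidean_space)
      fix i assume i: "i \<in> I"
      have "Pi_coord I dm e i (\<zeta> x) = \<psi> i (x i)"
        unfolding B(2) by (rule Pi_coord_chart[OF e i, where \<psi> = \<psi> and x = x, OF UE[OF i xU[OF i]]])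
      then show "Pi_coord I dm e i (\<zeta> x) \<in> \<psi> i ` (U i \<inter> A i)"
        using xU[OF i] A(2) i by (auto simp: PiE_iff)
    qed
    moreover have "D \<subseteq> \<zeta> ` W"
    proof
      fix w assume w: "w \<in> D"
      then have "\<forall>i\<in>I. \<exists>a. a \<in> U i \<inter> A i \<and> Pi_coord I dm e i w = \<psi> i a" unfolding D_def by blast
      then obtain a where a: "\<And>i. i \<in> I \<Longrightarrow> a i \<in> U i \<inter> A i" "\<And>i. i \<in> I \<Longrightarrow> Pi_coord I dm e i w = \<psi> i (a i)" by metis
      define a' where "a' = restrict a I"
      have "\<zeta> a' = w" unfolding B(2)
        by (rule Pi_chart_eqI[OF e]) (use w a(2) in \<open>auto simp: D_def a'_def\<close>)
      moreover have "a' \<in> W" using a(1) A(3) by (auto simp: a'_def PiE_iff subset_iff)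
      ultimately show "w \<in> \<zeta> ` W" by blast
    qed
    ultimately show "\<exists>V. eopen (mdim P) V \<and> \<zeta> x \<in> V \<and> V \<subseteq> \<zeta> ` W" by blast
  qed
qed

lemma smooth_map_proj:
  assumes i: "i \<in> I" and s: "smooth_manifold (M i)"
  shows "smooth_map P (M i) (\<lambda>x. x i)"
  unfolding smooth_map_iff
proof (intro conjI ballI, safe)
  show "continuous_map (mtop P) (mtop (M i)) (\<lambda>x. x i)"
    unfolding Pi_simps by (rule continuous_map_product_projection[OF i])
  then have pre: "openin (mtop P) {x \<in> pts P. x i \<in> W}" if "openin (mtop (M i)) W" for W
    using openin_continuous_map_preimage that by blast
  fix V \<eta> l assume V: "(V, \<eta>) \<in> atlas (M i)"
  have oV: "openin (mtop (M i)) V" by (rule chart_open[OF M[OF i] V])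
  have "smooth_in P {x \<in> pts P. x i \<in> V} (\<lambda>x. \<eta> (x i) l)"
  proof (rule smooth_inI)
    fix B \<zeta> assume a: "(B, \<zeta>) \<in> atlas P"
    then obtain U \<psi> e where U: "\<And>i. i \<in> I \<Longrightarrow> (U i, \<psi> i) \<in> atlas (M i)"
      and e: "bij_betw e {..<sum dm I} (SIGMA i:I. {..<dm i})"
      and B: "B = (\<Pi>\<^sub>E i\<in>I. U i)" "\<zeta> = Pi_chart I dm \<psi> e" unfolding Pi_atlas by blast
    note o = chart_image_open[OF charted_Pi a pre[OF oV]]
    have cc: "Pi_coord I dm e i (\<zeta> x) = \<psi> i (x i)" if "x \<in> B" for x
    proof -
      have "x i \<in> U i" using that i by (auto simp: B PiE_iff)
      then show ?thesis unfolding B(2) by (intro Pi_coord_chart[OF e i] chart_Ed[OF M[OF i] U[OF i]])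
    qed
    have "Cinf_on (mdim P) (\<zeta> ` (B \<inter> {x \<in> pts P. x i \<in> V})) (\<lambda>w. \<eta> (inv_into (U i) (\<psi> i) (Pi_coord I dm e i w)) l)"
    proof (rule Cinf_compose[OF o chart_image_open[OF M[OF i] U[OF i] oV] _ _ smooth_inD[OF smooth_in_coord[OF s V] U[OF i]]])
      fix w assume "w \<in> \<zeta> ` (B \<inter> {x \<in> pts P. x i \<in> V})"
      then obtain x where x: "x \<in> B" "x i \<in> V" "w = \<zeta> x" by blast
      then have "x i \<in> U i" using i by (auto simp: B PiE_iff)
      then show "Pi_coord I dm e i w \<in> \<psi> i ` (U i \<inter> V)" using x cc by simp
    next
      fix l assume "l < mdim (M i)"
      then show "Cinf_on (mdim P) (\<zeta> ` (B \<inter> {x \<in> pts P. x i \<in> V})) (\<lambda>w. Pi_coord I dm e i w l)"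
        using Cinf_coord[OF o] by (simp add: Pi_coord_def)
    qed
    then show "Cinf_on (mdim P) (\<zeta> ` (B \<inter> {x \<in> pts P. x i \<in> V})) (\<lambda>w. \<eta> (inv_into B \<zeta> w i) l)"
    proof (rule Cinf_cong[OF o, rotated])
      fix w assume "w \<in> \<zeta> ` (B \<inter> {x \<in> pts P. x i \<in> V})"
      then obtain x where x: "x \<in> B" "w = \<zeta> x" by blast
      then have "x i \<in> U i" using i by (auto simp: B PiE_iff)
      then show "\<eta> (inv_into (U i) (\<psi> i) (Pi_coord I dm e i w)) l = \<eta> (inv_into B \<zeta> w i) l"
        by (simp only: x(2) cc[OF x(1)] chart_inv[OF charted_Pi a x(1)] chart_inv[OF M[OF i] U[OF i]])
    qed
  qed
  moreover have "{x \<in> pts P. x i \<in> V} = pts P \<inter> (\<lambda>x. x i) -` V" by blast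
  ultimately show "smooth_in P ((\<lambda>x. x i) -` V) (\<lambda>x. \<eta> (x i) l)" using smooth_in_pts[OF charted_Pi] by metis
qed

text \<open>The universal property of the product; it makes the inclusions of the factors smooth.\<close>

lemma smooth_map_tuple:
  assumes Q: "charted Q" and G: "\<And>i. i \<in> I \<Longrightarrow> smooth_map Q (M i) (G i)"
  shows "smooth_map Q P (\<lambda>x. \<lambda>i\<in>I. G i x)"
  unfolding smooth_map_iff
proof (intro conjI ballI, safe)
  show "continuous_map (mtop Q) (mtop P) (\<lambda>x. \<lambda>i\<in>I. G i x)"
    unfolding Pi_simps continuous_map_componentwise using smooth_map_cont[OF G] by auto
  fix B \<zeta> k assume "(B, \<zeta>) \<in> atlas P" and k: "k < mdim P"
  then obtain U \<psi> e where U: "\<And>i. i \<in> I \<Longrightarrow> (U i, \<psi> i) \<in> atlas (M i)"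
    and e: "bij_betw e {..<sum dm I} (SIGMA i:I. {..<dm i})"
    and B: "B = (\<Pi>\<^sub>E i\<in>I. U i)" "\<zeta> = Pi_chart I dm \<psi> e" unfolding Pi_atlas by blast
  have k': "k < sum dm I" using k by (simp add: Pi_simps)
  note ek = Pi_index'[OF e k']
  define i l where "i = fst (e k)" and "l = snd (e k)"
  have il: "i \<in> I" "l < dm i" using ek by (simp_all add: i_def l_def)
  have "smooth_in Q (G i -` U i) (\<lambda>x. \<psi> i (G i x) l)"
    using G[OF il(1)] U[OF il(1)] il(2) unfolding smooth_map_iff by blast
  moreover have "(\<lambda>x. \<lambda>i\<in>I. G i x) -` B \<subseteq> G i -` U i" using il(1) by (auto simp: B PiE_iff)
  moreover have "\<zeta> (\<lambda>i\<in>I. G i x) k = \<psi> i (G i x) l" for x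
    using il k' by (simp add: B(2) Pi_chart_def i_def l_def)
  ultimately show "smooth_in Q ((\<lambda>x. \<lambda>i\<in>I. G i x) -` B) (\<lambda>x. \<zeta> (\<lambda>i\<in>I. G i x) k)"
    using smooth_in_subset by simp
qed

end

section \<open>Left-invariant vector fields on Kaehler Lie groups\<close>

lemma tangent_lin_eq: "c *\<^sub>R v + w = (\<lambda>f. c * v f + w f)" for v w :: "'a tvec"
  by (simp add: fun_eq_iff)

lemma form_linear:
  "one_form M \<alpha> \<Longrightarrow> p \<in> pts M \<Longrightarrow> v \<in> tangent M p \<Longrightarrow> w \<in> tangent M p \<Longrightarrow>
    \<alpha> p (c *\<^sub>R v + w) = c * \<alpha> p v + \<alpha> p w"
  unfolding one_form_def linear_on_tangent_def tangent_lin_eq by blast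

lemma form_zero: "charted M \<Longrightarrow> one_form M \<alpha> \<Longrightarrow> p \<in> pts M \<Longrightarrow> \<alpha> p 0 = 0"
  using form_linear[of M \<alpha> p 0 0 1] subspace_0[OF subspace_tangent[of M p]] by simp

lemma form_scale:
  "charted M \<Longrightarrow> one_form M \<alpha> \<Longrightarrow> p \<in> pts M \<Longrightarrow> v \<in> tangent M p \<Longrightarrow> \<alpha> p (c *\<^sub>R v) = c * \<alpha> p v"
  using form_linear[of M \<alpha> p v 0 c] form_zero[of M \<alpha> p] subspace_0[OF subspace_tangent[of M p]] by simp

lemma form_smooth: "one_form M \<alpha> \<Longrightarrow> X \<in> vfields M \<Longrightarrow> ev1 M \<alpha> X \<in> smooth_fun M"
  unfolding one_form_def by blast

context
  fixes M :: "('a, 'z) mfd_scheme" and g J assumes pk: "pseudo_kaehler M g J"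
begin

lemma pk_linear:
  assumes "x \<in> pts M" "u \<in> tangent M x" "v \<in> tangent M x" "w \<in> tangent M x"
  shows "g x (c *\<^sub>R v + w) u = c * g x v u + g x w u"
proof -
  have "linear_on_tangent M x (\<lambda>w. g x w u)"
    using pk assms unfolding pseudo_kaehler_def pseudo_riemannian_def bilinear_field_def by blast
  then show ?thesis using assms unfolding linear_on_tangent_def tangent_lin_eq by blast
qed

text \<open>Identities between vectors are proved below by pairing with an arbitrary vector.\<close>

lemma pk_nondeg: "x \<in> pts M \<Longrightarrow> v \<in> tangent M x \<Longrightarrow> (\<And>w. w \<in> tangent M x \<Longrightarrow> g x v w = 0) \<Longrightarrow> v = 0"
  using pk unfolding pseudo_kaehler_def pseudo_riemannian_def zero_fun_def by blast

lemma pk_J_endo: "endo_field M J"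
  using pk unfolding pseudo_kaehler_def complex_structure_def by blast

lemma pk_J_tangent: "x \<in> pts M \<Longrightarrow> v \<in> tangent M x \<Longrightarrow> J x v \<in> tangent M x"
  using pk_J_endo unfolding endo_field_def by blast

lemma pk_J_linear:
  "x \<in> pts M \<Longrightarrow> v \<in> tangent M x \<Longrightarrow> w \<in> tangent M x \<Longrightarrow> J x (c *\<^sub>R v + w) = c *\<^sub>R J x v + J x w"
  using pk_J_endo unfolding endo_field_def tangent_lin_eq by blast

lemma pk_J_field: "A \<in> vfields M \<Longrightarrow> app M J A \<in> vfields M"
  using pk_J_endo unfolding endo_field_def by blast

lemma pk_JJ: "x \<in> pts M \<Longrightarrow> v \<in> tangent M x \<Longrightarrow> J x (J x v) = - v"
proof -
  assume a: "x \<in> pts M" "v \<in> tangent M x"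
  have "\<forall>p\<in>pts M. \<forall>v\<in>tangent M p. J p (J p v) = (\<lambda>f. - v f)"
    using pk unfolding pseudo_kaehler_def complex_structure_def by (elim conjE)
  then have "J x (J x v) = (\<lambda>f. - v f)" using a by blast
  then show ?thesis by (simp add: fun_eq_iff)
qed

end

abbreviation one_of :: "'a klg \<Rightarrow> 'a" where "one_of G \<equiv> \<one>\<^bsub>grp G\<^esub>"
abbreviation alg :: "'a klg \<Rightarrow> 'a tvec set" where "alg G \<equiv> tangent G (one_of G)"

definition linv :: "'a klg \<Rightarrow> 'a tvec \<Rightarrow> 'a vfield" where
  "linv G v = (\<lambda>x. if x \<in> pts G then dL G x v else 0)"

definition gT :: "'a klg \<Rightarrow> 'a tvec \<Rightarrow> 'a tvec \<Rightarrow> real" where "gT G = met G (one_of G)"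
definition JT :: "'a klg \<Rightarrow> 'a tvec \<Rightarrow> 'a tvec" where "JT G = cpx G (one_of G)"
definition lie :: "'a klg \<Rightarrow> 'a tvec \<Rightarrow> 'a tvec \<Rightarrow> 'a tvec" where
  "lie G v w = bracket (linv G v) (linv G w) (one_of G)"

lemma bracket_add_left:
  assumes M: "charted M" and X: "X \<in> vfields M" "Y \<in> vfields M" "Z \<in> vfields M"
  shows "bracket (c *\<^sub>R X + Y) Z = c *\<^sub>R bracket X Z + bracket Y Z"
proof (intro ext)
  fix p f
  show "bracket (c *\<^sub>R X + Y) Z p f = (c *\<^sub>R bracket X Z + bracket Y Z) p f"
  proof (cases "f \<in> smooth_fun M \<and> p \<in> pts M")
    case True
    then have f: "f \<in> smooth_fun M" and p: "p \<in> pts M" by auto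
    show ?thesis
      using tangent_linear[OF vfieldsD(1)[OF X(3) p] vfieldsD(3)[OF X(1) f] vfieldsD(3)[OF X(2) f], of c]
      by (simp add: bracket_def algebra_simps)
  next
    case False
    have "bracket U V p f = 0" if "U \<in> vfields M" "V \<in> vfields M" for U V
      using False vfield_off[OF bracket_vfields[OF M that], of f p] vfieldsD(2)[OF bracket_vfields[OF M that], of p] by auto
    then show ?thesis using X vfields_add[OF M vfields_scale[OF M X(1)] X(2), of c] by simp
  qed
qed

context
  fixes G :: "'a klg" assumes G: "kaehler_lie_group G"
begin

lemma klg_lie: "lie_group G (grp G)" and klg_kaehler: "kaehler G (met G) (cpx G)"
  using G unfolding kaehler_lie_group_def by blast+

lemma klg_smooth: "smooth_manifold G" using klg_lie by (simp add: lie_group_def)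
lemma klg_charted: "charted G" by (rule smooth_manifold_charted[OF klg_smooth])
lemma klg_group: "group (grp G)" using klg_lie by (simp add: lie_group_def)
lemma klg_carrier: "carrier (grp G) = pts G" using klg_lie by (simp add: lie_group_def)
lemma klg_one: "one_of G \<in> pts G"
  using monoid.one_closed[OF group.is_monoid[OF klg_group]] klg_carrier by simp
lemma klg_mult: "x \<in> pts G \<Longrightarrow> y \<in> pts G \<Longrightarrow> x \<otimes>\<^bsub>grp G\<^esub> y \<in> pts G"
  using monoid.m_closed[OF group.is_monoid[OF klg_group]] klg_carrier by simp
lemma klg_l_one: "x \<in> pts G \<Longrightarrow> one_of G \<otimes>\<^bsub>grp G\<^esub> x = x"
  using monoid.l_one[OF group.is_monoid[OF klg_group]] klg_carrier by simp
lemma klg_r_one: "x \<in> pts G \<Longrightarrow> x \<otimes>\<^bsub>grp G\<^esub> one_of G = x"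
  using monoid.r_one[OF group.is_monoid[OF klg_group]] klg_carrier by simp
lemma klg_assoc: "x \<in> pts G \<Longrightarrow> y \<in> pts G \<Longrightarrow> z \<in> pts G \<Longrightarrow>
    x \<otimes>\<^bsub>grp G\<^esub> y \<otimes>\<^bsub>grp G\<^esub> z = x \<otimes>\<^bsub>grp G\<^esub> (y \<otimes>\<^bsub>grp G\<^esub> z)"
  using monoid.m_assoc[OF group.is_monoid[OF klg_group]] klg_carrier by simp
lemma klg_inv: "x \<in> pts G \<Longrightarrow> inv\<^bsub>grp G\<^esub> x \<in> pts G \<and> inv\<^bsub>grp G\<^esub> x \<otimes>\<^bsub>grp G\<^esub> x = one_of G \<and> x \<otimes>\<^bsub>grp G\<^esub> inv\<^bsub>grp G\<^esub> x = one_of G"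
  using group.inv_closed[OF klg_group] group.l_inv[OF klg_group] group.r_inv[OF klg_group] klg_carrier by simp

lemma klg_multmap: "smooth_map (prod_mfd G G) G (\<lambda>(x, y). x \<otimes>\<^bsub>grp G\<^esub> y)"
  using klg_lie by (simp add: lie_group_def)

lemma left_smooth: "a \<in> pts G \<Longrightarrow> smooth_map G G (\<lambda>x. a \<otimes>\<^bsub>grp G\<^esub> x)"
  using smooth_map_compose[OF klg_charted charted_prod[OF klg_charted klg_charted] klg_charted
      slice_snd[OF klg_charted klg_smooth] klg_multmap] by simp

lemma dL_tangent: "a \<in> pts G \<Longrightarrow> x \<in> pts G \<Longrightarrow> v \<in> tangent G x \<Longrightarrow> dL G a v \<in> tangent G (a \<otimes>\<^bsub>grp G\<^esub> x)"
  by (rule push_tangent[OF klg_charted klg_charted left_smooth])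

lemma dL_dL: "a \<in> pts G \<Longrightarrow> b \<in> pts G \<Longrightarrow> dL G a (dL G b v) = dL G (a \<otimes>\<^bsub>grp G\<^esub> b) v"
proof -
  assume a: "a \<in> pts G" and b: "b \<in> pts G"
  have "dL G a (dL G b v) = push G G (\<lambda>x. a \<otimes>\<^bsub>grp G\<^esub> (b \<otimes>\<^bsub>grp G\<^esub> x)) v"
    by (rule push_compose[OF klg_charted klg_charted left_smooth[OF b] left_smooth[OF a]])
  also have "\<dots> = dL G (a \<otimes>\<^bsub>grp G\<^esub> b) v" by (rule push_cong) (simp add: klg_assoc a b)
  finally show ?thesis .
qed

lemma dL_one: "v \<in> tangent G x \<Longrightarrow> dL G (one_of G) v = v"
  using push_cong[of G "\<lambda>x. one_of G \<otimes>\<^bsub>grp G\<^esub> x" "\<lambda>x. x" G v] push_id[OF klg_charted] klg_l_one by simp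

lemma dL_inv:
  assumes "x \<in> pts G" "v \<in> tangent G x"
  shows "dL G x (dL G (inv\<^bsub>grp G\<^esub> x) v) = v" "dL G (inv\<^bsub>grp G\<^esub> x) v \<in> alg G"
  using dL_dL[of x "inv\<^bsub>grp G\<^esub> x" v] klg_inv[OF assms(1)] dL_one[OF assms(2)] assms(1)
    dL_tangent[of "inv\<^bsub>grp G\<^esub> x" x v] assms(2) by simp_all

lemma linv_tangent: "v \<in> alg G \<Longrightarrow> x \<in> pts G \<Longrightarrow> linv G v x \<in> tangent G x"
  using dL_tangent[of x "one_of G" v] klg_one klg_r_one by (simp add: linv_def)

lemma linv_one: "v \<in> alg G \<Longrightarrow> linv G v (one_of G) = v"
  using dL_one klg_one by (simp add: linv_def)

lemma linv_dL: "a \<in> pts G \<Longrightarrow> x \<in> pts G \<Longrightarrow> dL G a (linv G v x) = linv G v (a \<otimes>\<^bsub>grp G\<^esub> x)"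
  by (simp add: linv_def dL_dL klg_mult)

lemma linv_off: "x \<notin> pts G \<Longrightarrow> linv G v x = 0" by (simp add: linv_def)

text \<open>The value on f at x is the derivative at the unit, in the second variable, of the smooth function
  \<open>f (x y)\<close> of two variables.\<close>

lemma linv_vfield:
  assumes v: "v \<in> alg G" shows "linv G v \<in> vfields G"
proof (rule vfieldsI)
  fix f assume f: "f \<in> smooth_fun G"
  let ?K = "cut (prod_mfd G G) (\<lambda>p. f ((\<lambda>(x, y). x \<otimes>\<^bsub>grp G\<^esub> y) p))"
  have "?K \<in> smooth_fun (prod_mfd G G)"
    by (rule smooth_fun_pull[OF charted_prod[OF klg_charted klg_charted] klg_charted klg_multmap f])
  from vfield_at_snd[OF klg_smooth klg_smooth klg_one v this]
  have s: "(\<lambda>x. v (\<lambda>y. ?K (x, y))) \<in> smooth_fun G" .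
  have "v (\<lambda>y. ?K (x, y)) = linv G v x f" for x
  proof (cases "x \<in> pts G")
    case True
    have "(\<lambda>y. ?K (x, y)) = cut G (\<lambda>y. f (x \<otimes>\<^bsub>grp G\<^esub> y))" using True by (auto simp: cut_def)
    then show ?thesis using True f by (simp add: linv_def push_apply)
  next
    case False
    then have "(\<lambda>y. ?K (x, y)) = (\<lambda>_. 0)" by (auto simp: cut_def)
    then show ?thesis using tangent_zero[OF klg_charted v] False by (simp add: linv_def)
  qed
  then show "(\<lambda>x. linv G v x f) \<in> smooth_fun G" using s by simp
qed (simp_all add: linv_tangent v linv_off)

lemma linv_unique:
  assumes X: "\<And>x. x \<notin> pts G \<Longrightarrow> X x = 0" "\<And>a. a \<in> pts G \<Longrightarrow> dL G a (X (one_of G)) = X a"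
  shows "X = linv G (X (one_of G))"
  using X by (auto simp: linv_def fun_eq_iff)

lemma linv_add: "linv G (v + w) = linv G v + linv G w"
  by (auto simp: linv_def push_add fun_eq_iff)
lemma linv_scale: "linv G (c *\<^sub>R v) = c *\<^sub>R linv G v"
  by (auto simp: linv_def push_scale fun_eq_iff)

lemma linv_inj: assumes "v \<in> alg G" "linv G v x = 0" "x \<in> pts G" shows "v = 0"
proof -
  have "dL G (inv\<^bsub>grp G\<^esub> x) (linv G v x) = linv G v (one_of G)"
    using linv_dL[of "inv\<^bsub>grp G\<^esub> x" x v] klg_inv assms(3) by simp
  then show ?thesis using assms(1,2) linv_one by simp
qed

text \<open>Left translations relate invariant fields to themselves, hence they also preserve brackets.\<close>

lemma bracket_linv:
  assumes v: "v \<in> alg G" and w: "w \<in> alg G"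
  shows "bracket (linv G v) (linv G w) = linv G (lie G v w)"
  unfolding lie_def
proof (rule linv_unique)
  note b = bracket_vfields[OF klg_charted linv_vfield[OF v] linv_vfield[OF w]]
  show "bracket (linv G v) (linv G w) x = 0" if "x \<notin> pts G" for x by (rule vfieldsD(2)[OF b that])
  fix a assume a: "a \<in> pts G"
  have r: "related G G (\<lambda>x. a \<otimes>\<^bsub>grp G\<^esub> x) (linv G u) (linv G u)" for u
    unfolding related_def using linv_dL[OF a] by simp
  have "related G G (\<lambda>x. a \<otimes>\<^bsub>grp G\<^esub> x) (bracket (linv G v) (linv G w)) (bracket (linv G v) (linv G w))"
    by (rule related_bracket[OF left_smooth[OF a] _ _ _ _ r r klg_charted]) (simp_all add: linv_vfield v w)
  then show "dL G a (bracket (linv G v) (linv G w) (one_of G)) = bracket (linv G v) (linv G w) a"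
    unfolding related_def using klg_one klg_r_one[OF a] by metis
qed

lemma lie_alg: "v \<in> alg G \<Longrightarrow> w \<in> alg G \<Longrightarrow> lie G v w \<in> alg G"
  unfolding lie_def using vfieldsD(1)[OF bracket_vfields[OF klg_charted linv_vfield linv_vfield] klg_one] by blast

lemma subspace_alg: "subspace (alg G)" by (rule subspace_tangent[OF klg_charted])

lemma lie_left: "v \<in> alg G \<Longrightarrow> w \<in> alg G \<Longrightarrow> u \<in> alg G \<Longrightarrow> lie G (c *\<^sub>R v + w) u = c *\<^sub>R lie G v u + lie G w u"
  unfolding lie_def linv_add linv_scale
  using bracket_add_left[OF klg_charted linv_vfield linv_vfield linv_vfield] by simp

lemma lie_swap: "lie G w v = - lie G v w"
  unfolding lie_def by (subst bracket_swap) simp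

lemma klg_pk: "pseudo_kaehler G (met G) (cpx G)" using klg_kaehler by (simp add: kaehler_def)
lemma klg_pr: "pseudo_riemannian G (met G)" using klg_pk by (simp add: pseudo_kaehler_def)
lemma met_linear1:
  "x \<in> pts G \<Longrightarrow> u \<in> tangent G x \<Longrightarrow> v \<in> tangent G x \<Longrightarrow> w \<in> tangent G x \<Longrightarrow>
    met G x (c *\<^sub>R v + w) u = c * met G x v u + met G x w u"
  by (rule pk_linear[OF klg_pk])

lemma met_sym: "x \<in> pts G \<Longrightarrow> v \<in> tangent G x \<Longrightarrow> w \<in> tangent G x \<Longrightarrow> met G x v w = met G x w v"
  using klg_pr unfolding pseudo_riemannian_def by blast

lemma met_pos: "x \<in> pts G \<Longrightarrow> v \<in> tangent G x \<Longrightarrow> v \<noteq> 0 \<Longrightarrow> 0 < met G x v v"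
  using klg_kaehler unfolding kaehler_def zero_fun_def by blast

lemma cpx_tangent: "x \<in> pts G \<Longrightarrow> v \<in> tangent G x \<Longrightarrow> cpx G x v \<in> tangent G x"
  by (rule pk_J_tangent[OF klg_pk])

lemma cpx_linear:
  "x \<in> pts G \<Longrightarrow> v \<in> tangent G x \<Longrightarrow> w \<in> tangent G x \<Longrightarrow> cpx G x (c *\<^sub>R v + w) = c *\<^sub>R cpx G x v + cpx G x w"
  by (rule pk_J_linear[OF klg_pk])

lemma cpx_cpx: "x \<in> pts G \<Longrightarrow> v \<in> tangent G x \<Longrightarrow> cpx G x (cpx G x v) = - v"
  by (rule pk_JJ[OF klg_pk])

lemma met_cpx: "x \<in> pts G \<Longrightarrow> v \<in> tangent G x \<Longrightarrow> w \<in> tangent G x \<Longrightarrow> met G x (cpx G x v) (cpx G x w) = met G x v w"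
  using klg_pk unfolding pseudo_kaehler_def by blast

lemma klg_invariant:
  assumes a: "a \<in> pts G" and x: "x \<in> pts G" and v: "v \<in> tangent G x"
  shows "cpx G (a \<otimes>\<^bsub>grp G\<^esub> x) (dL G a v) = dL G a (cpx G x v)"
    "w \<in> tangent G x \<Longrightarrow> met G (a \<otimes>\<^bsub>grp G\<^esub> x) (dL G a v) (dL G a w) = met G x v w"
proof -
  have "\<forall>a\<in>pts G. \<forall>x\<in>pts G. \<forall>v\<in>tangent G x.
     cpx G (a \<otimes>\<^bsub>grp G\<^esub> x) (dL G a v) = dL G a (cpx G x v) \<and>
        (\<forall>w\<in>tangent G x. met G (a \<otimes>\<^bsub>grp G\<^esub> x) (dL G a v) (dL G a w) = met G x v w)"
    using G unfolding kaehler_lie_group_def by (elim conjE)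
  from bspec[OF bspec[OF bspec[OF this a] x] v]
  show "cpx G (a \<otimes>\<^bsub>grp G\<^esub> x) (dL G a v) = dL G a (cpx G x v)"
    "w \<in> tangent G x \<Longrightarrow> met G (a \<otimes>\<^bsub>grp G\<^esub> x) (dL G a v) (dL G a w) = met G x v w" by simp_all
qed

lemma met_linv: "x \<in> pts G \<Longrightarrow> v \<in> alg G \<Longrightarrow> w \<in> alg G \<Longrightarrow> met G x (linv G v x) (linv G w x) = gT G v w"
  using klg_invariant(2)[of x "one_of G" v w] klg_one klg_r_one[of x] by (simp add: gT_def linv_def)

lemma cpx_linv: "x \<in> pts G \<Longrightarrow> v \<in> alg G \<Longrightarrow> cpx G x (linv G v x) = linv G (JT G v) x"
  using klg_invariant(1)[of x "one_of G" v] klg_one klg_r_one[of x] by (simp add: JT_def linv_def)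

lemma JT_alg: "v \<in> alg G \<Longrightarrow> JT G v \<in> alg G"
  unfolding JT_def by (rule cpx_tangent[OF klg_one])

lemma linv_at: "x \<in> pts G \<Longrightarrow> v \<in> tangent G x \<Longrightarrow> \<exists>u\<in>alg G. v = linv G u x"
  using dL_inv[of x v] by (intro bexI[of _ "dL G (inv\<^bsub>grp G\<^esub> x) v"]) (simp_all add: linv_def)

end

definition lie_hom :: "'a klg \<Rightarrow> 'b klg \<Rightarrow> ('a \<Rightarrow> 'b) \<Rightarrow> bool" where
  "lie_hom G H h \<longleftrightarrow> smooth_map G H h \<and> h \<in> hom (grp G) (grp H)"

context
  fixes G :: "'a klg" and H :: "'b klg" and h
  assumes G: "kaehler_lie_group G" and H: "kaehler_lie_group H" and h: "lie_hom G H h"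
begin

lemma lie_hom_one: "h (one_of G) = one_of H"
proof -
  have "h \<in> hom (grp G) (grp H)" using h by (simp add: lie_hom_def)
  from hom_one[OF this klg_group[OF G] klg_group[OF H]] show ?thesis .
qed

lemma hom_smooth: "smooth_map G H h" using h by (simp add: lie_hom_def)

lemma hom_alg: "v \<in> alg G \<Longrightarrow> push G H h v \<in> alg H"
  using push_tangent[OF klg_charted[OF G] klg_charted[OF H] hom_smooth klg_one[OF G]] lie_hom_one by simp

text \<open>A homomorphism intertwines left translations, so it relates invariant fields to invariant fields;
  in consequence its derivative at the unit is a homomorphism of Lie algebras.\<close>

lemma hom_linv: "related G H h (linv G v) (linv H (push G H h v))"
  unfolding related_def
proof
  fix x assume x: "x \<in> pts G"
  have hx: "h x \<in> pts H" by (rule smooth_map_in[OF hom_smooth x])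
  have "push G H h (linv G v x) = push G H (\<lambda>y. h (x \<otimes>\<^bsub>grp G\<^esub> y)) v"
    using push_compose[OF klg_charted[OF G] klg_charted[OF H] left_smooth[OF G x] hom_smooth] x by (simp add: linv_def)
  also have "\<dots> = push G H (\<lambda>y. h x \<otimes>\<^bsub>grp H\<^esub> h y) v"
  proof (rule push_cong)
    fix y assume "y \<in> pts G"
    then show "h (x \<otimes>\<^bsub>grp G\<^esub> y) = h x \<otimes>\<^bsub>grp H\<^esub> h y"
      using h x hom_mult[of h "grp G" "grp H" x y] klg_carrier[OF G] unfolding lie_hom_def by simp
  qed
  also have "\<dots> = linv H (push G H h v) (h x)"
    using push_compose[OF klg_charted[OF H] klg_charted[OF H] hom_smooth left_smooth[OF H hx]] hx by (simp add: linv_def)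
  finally show "push G H h (linv G v x) = linv H (push G H h v) (h x)" .
qed

lemma hom_lie:
  assumes v: "v \<in> alg G" and w: "w \<in> alg G"
  shows "push G H h (lie G v w) = lie H (push G H h v) (push G H h w)"
proof -
  have "related G H h (bracket (linv G v) (linv G w)) (bracket (linv H (push G H h v)) (linv H (push G H h w)))"
    by (rule related_bracket[OF hom_smooth _ _ _ _ hom_linv hom_linv klg_charted[OF H]])
      (simp_all add: linv_vfield G H v w hom_alg)
  then show ?thesis unfolding related_def lie_def using klg_one[OF G] lie_hom_one by metis
qed

end

section \<open>The algebra of a special Kaehler connection at a point\<close>

lemma eq_minus_self: fixes x :: "'v::real_vector" assumes "x = - x" shows "x = 0"
proof -
  have "x + x = 0" using assms eq_neg_iff_add_eq_0 by blast
  then have "2 *\<^sub>R x = 0" by (simp add: scaleR_2)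
  then show ?thesis by simp
qed

lemma four_times: fixes x :: "'v::real_vector" shows "x + x + 2 *\<^sub>R x = 4 *\<^sub>R x"
proof -
  have "x + x + 2 *\<^sub>R x = 2 *\<^sub>R x + 2 *\<^sub>R x" by (simp add: scaleR_2)
  also have "\<dots> = (2 + 2) *\<^sub>R x" by (simp only: scaleR_add_left)
  finally show ?thesis by simp
qed

text \<open>The algebraic data carried by the tangent space T at the unit of a Kaehler Lie group. T is a
  subspace of a larger type because tangent spaces are sets of derivations.\<close>

locale hermitian_lie =
  fixes T :: "'v::real_vector set" and g :: "'v \<Rightarrow> 'v \<Rightarrow> real" and J :: "'v \<Rightarrow> 'v" and br :: "'v \<Rightarrow> 'v \<Rightarrow> 'v"
  assumes T: "subspace T"
    and g_lin: "\<And>u v w c. u \<in> T \<Longrightarrow> v \<in> T \<Longrightarrow> w \<in> T \<Longrightarrow> g (c *\<^sub>R v + w) u = c * g v u + g w u"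
    and g_sym: "\<And>v w. v \<in> T \<Longrightarrow> w \<in> T \<Longrightarrow> g v w = g w v"
    and g_pos: "\<And>v. v \<in> T \<Longrightarrow> v \<noteq> 0 \<Longrightarrow> 0 < g v v"
    and J_T: "\<And>v. v \<in> T \<Longrightarrow> J v \<in> T"
    and J_lin: "\<And>v w c. v \<in> T \<Longrightarrow> w \<in> T \<Longrightarrow> J (c *\<^sub>R v + w) = c *\<^sub>R J v + J w"
    and J_J: "\<And>v. v \<in> T \<Longrightarrow> J (J v) = - v"
    and g_J: "\<And>v w. v \<in> T \<Longrightarrow> w \<in> T \<Longrightarrow> g (J v) (J w) = g v w"
    and br_T: "\<And>v w. v \<in> T \<Longrightarrow> w \<in> T \<Longrightarrow> br v w \<in> T"
    and br_lin: "\<And>u v w c. u \<in> T \<Longrightarrow> v \<in> T \<Longrightarrow> w \<in> T \<Longrightarrow> br (c *\<^sub>R v + w) u = c *\<^sub>R br v u + br w u"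
    and br_swap: "\<And>v w. v \<in> T \<Longrightarrow> w \<in> T \<Longrightarrow> br w v = - br v w"
begin

lemma T_add [simp]: "v \<in> T \<Longrightarrow> w \<in> T \<Longrightarrow> v + w \<in> T" by (rule subspace_add[OF T])
lemma T_diff [simp]: "v \<in> T \<Longrightarrow> w \<in> T \<Longrightarrow> v - w \<in> T" by (rule subspace_diff[OF T])
lemma T_scale [simp]: "v \<in> T \<Longrightarrow> c *\<^sub>R v \<in> T" by (rule subspace_scale[OF T])
lemma T_neg [simp]: "v \<in> T \<Longrightarrow> - v \<in> T" by (rule subspace_neg[OF T])
lemma T_zero [simp]: "0 \<in> T" by (rule subspace_0[OF T])
declare J_T [simp] br_T [simp] J_J [simp] g_J [simp]

lemma g_add1: "u \<in> T \<Longrightarrow> v \<in> T \<Longrightarrow> w \<in> T \<Longrightarrow> g (v + w) u = g v u + g w u"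
  using g_lin[of u v w 1] by simp
lemma g_zero1 [simp]: "u \<in> T \<Longrightarrow> g 0 u = 0" using g_add1[of u 0 0] by simp
lemma g_scale1: "u \<in> T \<Longrightarrow> v \<in> T \<Longrightarrow> g (c *\<^sub>R v) u = c * g v u"
  using g_lin[of u v 0 c] by simp
lemma g_neg1: "u \<in> T \<Longrightarrow> v \<in> T \<Longrightarrow> g (- v) u = - g v u"
  using g_scale1[of u v "-1"] by simp
lemma g_diff1: "u \<in> T \<Longrightarrow> v \<in> T \<Longrightarrow> w \<in> T \<Longrightarrow> g (v - w) u = g v u - g w u"
  using g_add1[of u v "- w"] g_neg1[of u w] by simp
lemma g_zero2 [simp]: "u \<in> T \<Longrightarrow> g u 0 = 0" using g_sym[of u 0] by simp
lemma g_add2: "u \<in> T \<Longrightarrow> v \<in> T \<Longrightarrow> w \<in> T \<Longrightarrow> g u (v + w) = g u v + g u w"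
  using g_add1[of u v w] by (simp add: g_sym[of u])
lemma g_scale2: "u \<in> T \<Longrightarrow> v \<in> T \<Longrightarrow> g u (c *\<^sub>R v) = c * g u v"
  using g_scale1[of u v c] by (simp add: g_sym[of u])
lemma g_neg2: "u \<in> T \<Longrightarrow> v \<in> T \<Longrightarrow> g u (- v) = - g u v"
  using g_neg1[of u v] by (simp add: g_sym[of u])
lemma g_diff2: "u \<in> T \<Longrightarrow> v \<in> T \<Longrightarrow> w \<in> T \<Longrightarrow> g u (v - w) = g u v - g u w"
  using g_diff1[of u v w] by (simp add: g_sym[of u])
lemmas g_simps = g_add1 g_scale1 g_neg1 g_diff1 g_add2 g_scale2 g_neg2 g_diff2

lemma J_zero [simp]: "J 0 = 0" using J_lin[of 0 0 1] by simp
lemma J_add: "v \<in> T \<Longrightarrow> w \<in> T \<Longrightarrow> J (v + w) = J v + J w" using J_lin[of v w 1] by simp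
lemma J_scale: "v \<in> T \<Longrightarrow> J (c *\<^sub>R v) = c *\<^sub>R J v" using J_lin[of v 0 c] by simp
lemma J_neg: "v \<in> T \<Longrightarrow> J (- v) = - J v" using J_scale[of v "-1"] by simp
lemma J_diff: "v \<in> T \<Longrightarrow> w \<in> T \<Longrightarrow> J (v - w) = J v - J w"
  using J_add[of v "- w"] J_neg[of w] by simp
lemmas J_simps = J_add J_scale J_neg J_diff

lemma gJ: "v \<in> T \<Longrightarrow> w \<in> T \<Longrightarrow> g v (J w) = - g (J v) w"
  using g_J[of v "J w"] by (simp add: g_simps)

lemma gJ_self [simp]: "v \<in> T \<Longrightarrow> g (J v) v = 0"
  using gJ[of v v] g_sym[of v "J v"] by simp

lemma nondeg: "u \<in> T \<Longrightarrow> (\<And>d. d \<in> T \<Longrightarrow> g u d = 0) \<Longrightarrow> u = 0"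
  using g_pos[of u] by force

lemma eqI: "u \<in> T \<Longrightarrow> v \<in> T \<Longrightarrow> (\<And>d. d \<in> T \<Longrightarrow> g u d = g v d) \<Longrightarrow> u = v"
  using nondeg[of "u - v"] by (simp add: g_simps)

lemma br_zero1 [simp]: "u \<in> T \<Longrightarrow> br 0 u = 0" using br_lin[of u 0 0 1] by simp
lemma br_add1: "u \<in> T \<Longrightarrow> v \<in> T \<Longrightarrow> w \<in> T \<Longrightarrow> br (v + w) u = br v u + br w u" using br_lin[of u v w 1] by simp
lemma br_scale1: "u \<in> T \<Longrightarrow> v \<in> T \<Longrightarrow> br (c *\<^sub>R v) u = c *\<^sub>R br v u" using br_lin[of u v 0 c] by simp
lemma br_add2: "u \<in> T \<Longrightarrow> v \<in> T \<Longrightarrow> w \<in> T \<Longrightarrow> br u (v + w) = br u v + br u w"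
  using br_add1[of u v w] by (simp add: br_swap[of _ u])
lemma br_scale2: "u \<in> T \<Longrightarrow> v \<in> T \<Longrightarrow> br u (c *\<^sub>R v) = c *\<^sub>R br u v"
  using br_scale1[of u v c] by (simp add: br_swap[of _ u])
lemma br_self: "v \<in> T \<Longrightarrow> br v v = 0" 
  by (rule eq_minus_self, rule br_swap)

end

text \<open>\<open>\<Gamma> a b\<close> is the horizontal part of the covariant derivative of \<open>e\<^sub>b\<close> along \<open>e\<^sub>a\<close> at one point of the
  cone. The last three assumptions are what the parallel symplectic form, the vanishing torsion and
  the symmetry of the covariant derivative of J say about it.\<close>

locale special_point = hermitian_lie T g J br
  for T :: "'v::real_vector set" and g J br +
  fixes \<Gamma> :: "'v \<Rightarrow> 'v \<Rightarrow> 'v"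
  assumes \<Gamma>_T: "\<And>a b. a \<in> T \<Longrightarrow> b \<in> T \<Longrightarrow> \<Gamma> a b \<in> T"
    and \<Gamma>_lin1: "\<And>a a' b c. a \<in> T \<Longrightarrow> a' \<in> T \<Longrightarrow> b \<in> T \<Longrightarrow> \<Gamma> (c *\<^sub>R a + a') b = c *\<^sub>R \<Gamma> a b + \<Gamma> a' b"
    and \<Gamma>_lin2: "\<And>a b b' c. a \<in> T \<Longrightarrow> b \<in> T \<Longrightarrow> b' \<in> T \<Longrightarrow> \<Gamma> a (c *\<^sub>R b + b') = c *\<^sub>R \<Gamma> a b + \<Gamma> a b'"
    and symplectic: "\<And>a b c. a \<in> T \<Longrightarrow> b \<in> T \<Longrightarrow> c \<in> T \<Longrightarrow> g (J (\<Gamma> a b)) c + g (J b) (\<Gamma> a c) = 0"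
    and torsion: "\<And>a b. a \<in> T \<Longrightarrow> b \<in> T \<Longrightarrow> \<Gamma> a b - \<Gamma> b a = br a b"
    and special: "\<And>a b. a \<in> T \<Longrightarrow> b \<in> T \<Longrightarrow> \<Gamma> a (J b) - J (\<Gamma> a b) = \<Gamma> b (J a) - J (\<Gamma> b a)"
begin

declare \<Gamma>_T [simp]

text \<open>The parts of \<open>\<Gamma> a\<close> that commute and anticommute with J.\<close>

definition D :: "'v \<Rightarrow> 'v \<Rightarrow> 'v" where "D a b = (1/2) *\<^sub>R (\<Gamma> a b - J (\<Gamma> a (J b)))"
definition S :: "'v \<Rightarrow> 'v \<Rightarrow> 'v" where "S a b = (1/2) *\<^sub>R (\<Gamma> a b + J (\<Gamma> a (J b)))"

lemma D_T [simp]: "a \<in> T \<Longrightarrow> b \<in> T \<Longrightarrow> D a b \<in> T" by (simp add: D_def)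
lemma S_T [simp]: "a \<in> T \<Longrightarrow> b \<in> T \<Longrightarrow> S a b \<in> T" by (simp add: S_def)

lemma \<Gamma>_DS: "\<Gamma> a b = D a b + S a b"
proof -
  have "D a b + S a b = (1/2) *\<^sub>R (\<Gamma> a b + \<Gamma> a b)"
    by (simp add: D_def S_def scaleR_add_right[symmetric] del: scaleR_add_right)
  then show ?thesis by (simp add: scaleR_2[symmetric])
qed

lemma \<Gamma>_neg2: "a \<in> T \<Longrightarrow> b \<in> T \<Longrightarrow> \<Gamma> a (- b) = - \<Gamma> a b"
  using \<Gamma>_lin2[of a b 0 "-1"] \<Gamma>_lin2[of a 0 0 1] by simp

lemma D_J: "a \<in> T \<Longrightarrow> b \<in> T \<Longrightarrow> D a (J b) = J (D a b)"
  by (simp add: D_def J_simps \<Gamma>_neg2)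
lemma S_J2: "a \<in> T \<Longrightarrow> b \<in> T \<Longrightarrow> S a (J b) = - J (S a b)"
  by (simp add: S_def J_simps \<Gamma>_neg2 algebra_simps)

lemma \<Gamma>_conj: "a \<in> T \<Longrightarrow> b \<in> T \<Longrightarrow> c \<in> T \<Longrightarrow> g (J (\<Gamma> a (J b))) c = g b (\<Gamma> a c)"
  using symplectic[of a "J b" c] by (simp add: g_simps)

text \<open>Each \<open>\<Gamma> a\<close> is skew for \<open>\<omega>\<close>. For the part anticommuting with J this is symmetry with
  respect to g, for the part commuting with J it is skewness.\<close>

lemma S_gsym:
  assumes "a \<in> T" "b \<in> T" "c \<in> T" shows "g (S a b) c = g b (S a c)"
  using \<Gamma>_conj[OF assms] \<Gamma>_conj[OF assms(1,3,2)] g_sym[of b "J (\<Gamma> a (J c))"] g_sym[of c "\<Gamma> a b"] assms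
  by (simp add: S_def g_simps)

lemma D_skew:
  assumes "a \<in> T" "b \<in> T" "c \<in> T" shows "g (D a b) c = - g b (D a c)"
  using \<Gamma>_conj[OF assms] \<Gamma>_conj[OF assms(1,3,2)] g_sym[of b "J (\<Gamma> a (J c))"] g_sym[of c "\<Gamma> a b"] assms
  by (simp add: D_def g_simps) (simp add: field_simps)

text \<open>The difference \<open>\<Gamma> a (J b) - J (\<Gamma> a b)\<close> is \<open>- 2 J (S a b)\<close>.\<close>

lemma S_sym: assumes "a \<in> T" "b \<in> T" shows "S a b = S b a"
proof -
  have e: "\<Gamma> a (J b) - J (\<Gamma> a b) = (- 2) *\<^sub>R J (S a b)" if "a \<in> T" "b \<in> T" for a b
    using that by (simp add: S_def J_simps algebra_simps)
  have "(- 2) *\<^sub>R J (S a b) = (- 2) *\<^sub>R J (S b a)" using special[OF assms] e assms by metis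
  then have "J (S a b) = J (S b a)" by simp
  then have "J (J (S a b)) = J (J (S b a))" by simp
  then show ?thesis using assms by simp
qed

lemma S_J1: "a \<in> T \<Longrightarrow> b \<in> T \<Longrightarrow> S (J a) b = - J (S a b)"
  using S_sym[of "J a" b] S_sym[of a b] S_J2[of b a] by simp

lemma D_torsion: "a \<in> T \<Longrightarrow> b \<in> T \<Longrightarrow> D a b - D b a = br a b"
  using torsion[of a b] S_sym[of a b] by (simp add: \<Gamma>_DS)

text \<open>D is metric and torsion-free, so it is determined by g and the bracket. In particular it does not
  depend on the point of the cone, although \<open>\<Gamma>\<close> does.\<close>

lemma koszul:
  assumes "a \<in> T" "b \<in> T" "c \<in> T"
  shows "2 * g (D a b) c = g (br a b) c - g (br b c) a + g (br c a) b"
proof -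
  have 1: "g (br x y) z = g (D x y) z - g (D y x) z" if "x \<in> T" "y \<in> T" "z \<in> T" for x y z
    using D_torsion[OF that(1,2), symmetric] that by (simp add: g_simps)
  have 2: "g (D x y) z = - g (D x z) y" if "x \<in> T" "y \<in> T" "z \<in> T" for x y z
    using D_skew[OF that] g_sym[of y "D x z"] that by simp
  show ?thesis using 1[of a b c] 1[of b c a] 1[of c a b] 2[of a b c] 2[of b c a] 2[of c a b] assms by simp
qed

lemma D_lin1: "a \<in> T \<Longrightarrow> a' \<in> T \<Longrightarrow> b \<in> T \<Longrightarrow> D (c *\<^sub>R a + a') b = c *\<^sub>R D a b + D a' b"
  by (simp only: D_def \<Gamma>_lin1 J_T J_lin \<Gamma>_T) (simp add: algebra_simps)
lemma D_lin2: "a \<in> T \<Longrightarrow> b \<in> T \<Longrightarrow> b' \<in> T \<Longrightarrow> D a (c *\<^sub>R b + b') = c *\<^sub>R D a b + D a b'"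
  by (simp only: D_def \<Gamma>_lin2 J_T J_lin \<Gamma>_T) (simp add: algebra_simps)
lemma S_lin2: "a \<in> T \<Longrightarrow> b \<in> T \<Longrightarrow> b' \<in> T \<Longrightarrow> S a (c *\<^sub>R b + b') = c *\<^sub>R S a b + S a b'"
  by (simp only: S_def \<Gamma>_lin2 J_T J_lin \<Gamma>_T) (simp add: algebra_simps)
lemma D_zero1 [simp]: "b \<in> T \<Longrightarrow> D 0 b = 0" using D_lin1[of 0 0 b 1] by simp
lemma D_zero2 [simp]: "b \<in> T \<Longrightarrow> D b 0 = 0" using D_lin2[of b 0 0 1] by simp
lemma D_scale2: "a \<in> T \<Longrightarrow> b \<in> T \<Longrightarrow> D a (c *\<^sub>R b) = c *\<^sub>R D a b" using D_lin2[of a b 0 c] by simp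
lemma S_zero2 [simp]: "b \<in> T \<Longrightarrow> S b 0 = 0" using S_lin2[of b 0 0 1] by simp
lemma S_scale2: "a \<in> T \<Longrightarrow> b \<in> T \<Longrightarrow> S a (c *\<^sub>R b) = c *\<^sub>R S a b" using S_lin2[of a b 0 c] by simp
lemma S_neg2: "a \<in> T \<Longrightarrow> b \<in> T \<Longrightarrow> S a (- b) = - S a b" using S_scale2[of a b "-1"] by simp
definition R :: "'v \<Rightarrow> 'v \<Rightarrow> 'v \<Rightarrow> 'v" where "R a b c = D a (D b c) - D b (D a c) - D (br a b) c"

lemma R_T [simp]: "a \<in> T \<Longrightarrow> b \<in> T \<Longrightarrow> c \<in> T \<Longrightarrow> R a b c \<in> T" by (simp add: R_def)

lemma J_cancel: assumes "u \<in> T" "v \<in> T" "J u = J v" shows "u = v"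
proof -
  have "J (J u) = J (J v)" using assms(3) by simp
  then show ?thesis using assms(1,2) by simp
qed

text \<open>The number \<open>X a b c d\<close> stands for the derivative along a of \<open>\<omega>(\<Gamma> b c, d)\<close>. Adding the flatness
  equation F for c, d and for \<open>J c\<close>, \<open>J d\<close> extracts the part that commutes with J. There
  only D is differentiated, which does not vary, so the derivatives cancel, and of the quadratic
  terms the mixed products of D and S disappear.\<close>

lemma curvature_identity:
  assumes X: "\<And>a b c d. a \<in> T \<Longrightarrow> b \<in> T \<Longrightarrow> c \<in> T \<Longrightarrow> d \<in> T \<Longrightarrow> X a b c d + X a b (J c) (J d) = (0::real)"
    and F: "\<And>a b c d. a \<in> T \<Longrightarrow> b \<in> T \<Longrightarrow> c \<in> T \<Longrightarrow> d \<in> T \<Longrightarrow>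
      X a b c d - X b a c d
      - (g (J (\<Gamma> b c)) (\<Gamma> a d) + g (J b) c * g a d - g (J a) d * g b c)
      + (g (J (\<Gamma> a c)) (\<Gamma> b d) + g (J a) c * g b d - g (J b) d * g a c)
      - g (J (\<Gamma> (br a b) c)) d + 2 * g (J a) b * g c d = 0"
    and a: "a \<in> T" and b: "b \<in> T" and c: "c \<in> T"
  shows "R a b c + S a (S b c) - S b (S a c) =
    g a c *\<^sub>R b + g (J a) c *\<^sub>R J b - g b c *\<^sub>R a - g (J b) c *\<^sub>R J a + (2 * g (J a) b) *\<^sub>R J c" (is "?L = ?R")
proof (rule J_cancel)
  show "?L \<in> T" "?R \<in> T" using a b c by simp_all
  show "J ?L = J ?R"
  proof (rule eqI)
    show "J ?L \<in> T" "J ?R \<in> T" using a b c by simp_all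
    fix d assume d: "d \<in> T"
    have quad: "g (J (\<Gamma> y c)) (\<Gamma> x d) + g (J (\<Gamma> y (J c))) (\<Gamma> x (J d)) =
        - 2 * g (J (D x (D y c))) d - 2 * g (J (S x (S y c))) d" if x: "x \<in> T" and y: "y \<in> T" for x y
    proof -
      have "g (J (\<Gamma> y c)) (\<Gamma> x d) + g (J (\<Gamma> y (J c))) (\<Gamma> x (J d)) = 2 * g (J (D y c)) (D x d) + 2 * g (J (S y c)) (S x d)"
        using x y c d by (simp add: \<Gamma>_DS D_J S_J2 g_simps J_simps gJ)
      moreover have "g (J (D y c)) (D x d) = - g (J (D x (D y c))) d"
        using D_skew[of x "J (D y c)" d] x y c d by (simp add: D_J)
      moreover have "g (J (S y c)) (S x d) = - g (J (S x (S y c))) d"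
        using S_gsym[of x "J (S y c)" d] x y c d by (simp add: S_J2 g_simps)
      ultimately show ?thesis by simp
    qed
    have lin: "g (J (\<Gamma> (br a b) c)) d + g (J (\<Gamma> (br a b) (J c))) (J d) = 2 * g (J (D (br a b) c)) d"
      using a b c d by (simp add: \<Gamma>_DS D_J S_J2 g_simps J_simps gJ)
    have JJ: "g (J x) (J y) = g x y" "g x (J y) = - g (J x) y" if "x \<in> T" "y \<in> T" for x y using that by (simp_all add: gJ g_simps)
    have "X a b c d - X b a c d + (X a b (J c) (J d) - X b a (J c) (J d)) = 0"
      using X[OF a b c d] X[OF b a c d] by simp
    then have "g (J (R a b c)) d + g (J (S a (S b c))) d - g (J (S b (S a c))) d =
      g (J b) c * g a d - g (J a) d * g b c - g (J a) c * g b d + g (J b) d * g a c - 2 * g (J a) b * g c d"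
      using F[OF a b c d] F[OF a b J_T[OF c] J_T[OF d]] quad[OF a b] quad[OF b a] lin a b c d
      by (simp add: R_def J_simps g_simps JJ) (auto simp: algebra_simps)
    then show "g (J ?L) d = g (J ?R) d"
      using a b c d by (simp add: J_simps g_simps)
  qed
qed

end

text \<open>K is the consequence of flatness; the subspaces \<open>V i\<close> are the factors of the Lie algebra.\<close>

locale special_product = special_point T g J br \<Gamma>
  for T :: "'v::real_vector set" and g J br \<Gamma> +
  fixes V :: "nat \<Rightarrow> 'v set" and r :: nat
  assumes r: "3 \<le> r"
    and V_sub: "\<And>i. i < r \<Longrightarrow> subspace (V i)"
    and V_T: "\<And>i v. i < r \<Longrightarrow> v \<in> V i \<Longrightarrow> v \<in> T"
    and V_J: "\<And>i v. i < r \<Longrightarrow> v \<in> V i \<Longrightarrow> J v \<in> V i"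
    and V_orth: "\<And>i j u v. i < r \<Longrightarrow> j < r \<Longrightarrow> i \<noteq> j \<Longrightarrow> u \<in> V i \<Longrightarrow> v \<in> V j \<Longrightarrow> g u v = 0"
    and V_br0: "\<And>i j u v. i < r \<Longrightarrow> j < r \<Longrightarrow> i \<noteq> j \<Longrightarrow> u \<in> V i \<Longrightarrow> v \<in> V j \<Longrightarrow> br u v = 0"
    and V_br: "\<And>i u v. i < r \<Longrightarrow> u \<in> V i \<Longrightarrow> v \<in> V i \<Longrightarrow> br u v \<in> V i"
    and V_span: "\<And>u. u \<in> T \<Longrightarrow> \<exists>w. (\<forall>i<r. w i \<in> V i) \<and> u = (\<Sum>i<r. w i)"
    and V_ne: "\<And>i. i < r \<Longrightarrow> \<exists>a\<in>V i. a \<noteq> 0"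
    and K: "\<And>a b c. a \<in> T \<Longrightarrow> b \<in> T \<Longrightarrow> c \<in> T \<Longrightarrow> R a b c + S a (S b c) - S b (S a c) =
      g a c *\<^sub>R b + g (J a) c *\<^sub>R J b - g b c *\<^sub>R a - g (J b) c *\<^sub>R J a + (2 * g (J a) b) *\<^sub>R J c"
begin

lemma g_sum1: "u \<in> T \<Longrightarrow> (\<And>i. i \<in> A \<Longrightarrow> w i \<in> T) \<Longrightarrow> g (\<Sum>i\<in>A. w i) u = (\<Sum>i\<in>A. g (w i) u)"
proof (induction A rule: infinite_finite_induct)
  case (insert x A)
  have "(\<Sum>i\<in>A. w i) \<in> T" using insert.prems by (intro subspace_sum[OF T]) auto
  then show ?case using insert by (simp add: g_add1)
qed simp_all

text \<open>The components of u in the other factors are orthogonal to themselves, hence zero.\<close>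

lemma V_detect:
  assumes u: "u \<in> T" and i: "i < r" and o: "\<And>k c. k < r \<Longrightarrow> k \<noteq> i \<Longrightarrow> c \<in> V k \<Longrightarrow> g u c = 0"
  shows "u \<in> V i"
proof -
  obtain w where w: "\<And>k. k < r \<Longrightarrow> w k \<in> V k" "u = (\<Sum>k<r. w k)" using V_span[OF u] by blast
  have z: "w k = 0" if k: "k < r" "k \<noteq> i" for k
  proof -
    have wT: "w l \<in> T" if "l < r" for l using V_T[OF that w(1)[OF that]] .
    have "0 = g u (w k)" using o[OF k w(1)[OF k(1)]] by simp
    also have "\<dots> = (\<Sum>l<r. g (w l) (w k))" unfolding w(2) using wT k by (intro g_sum1) auto
    also have "\<dots> = (\<Sum>l<r. if l = k then g (w k) (w k) else 0)"
      using V_orth[OF _ k(1) _ w(1) w(1)[OF k(1)]] by (intro sum.cong) auto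
    also have "\<dots> = g (w k) (w k)" using k by simp
    finally show ?thesis using g_pos[OF wT[OF k(1)]] by force
  qed
  have "u = (\<Sum>k<r. if k = i then w i else 0)" unfolding w(2) using z by (intro sum.cong) auto
  also have "\<dots> = w i" using i by simp
  finally show ?thesis using w(1)[OF i] by simp
qed

lemma V_disjoint: assumes "i < r" "j < r" "i \<noteq> j" "u \<in> V i" "u \<in> V j" shows "u = 0"
  using V_orth[OF assms] g_pos[OF V_T[OF assms(1,4)]] by force

lemma V_zero:
  assumes u: "u \<in> T" and o: "\<And>k c. k < r \<Longrightarrow> c \<in> V k \<Longrightarrow> g u c = 0" shows "u = 0"
proof -
  have "u \<in> V 0" "u \<in> V 1" using V_detect[OF u, of 0] V_detect[OF u, of 1] o r by auto
  then show ?thesis using V_disjoint[of 0 1 u] r by simp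
qed

text \<open>All three brackets in the Koszul formula vanish or are orthogonal to the remaining vector.\<close>

lemma D_other:
  assumes i: "i < r" and j: "j < r" and ij: "i \<noteq> j" and a: "a \<in> V i" and b: "b \<in> V j"
  shows "D a b = 0"
proof (rule V_zero)
  have aT: "a \<in> T" and bT: "b \<in> T" using V_T i j a b by blast+
  then show "D a b \<in> T" by simp
  fix k c assume k: "k < r" and c: "c \<in> V k"
  have cT: "c \<in> T" by (rule V_T[OF k c])
  have "g (br a b) c = 0" using V_br0[OF i j ij a b] cT by simp
  moreover have "g (br b c) a = 0"
  proof (cases "k = j")
    case True then show ?thesis using V_orth[OF j i ij[symmetric] V_br[OF j b] a] c by simp
  next
    case False then show ?thesis using V_br0[OF j k _ b c] aT by simp
  qed
  moreover have "g (br c a) b = 0"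
  proof (cases "k = i")
    case True then show ?thesis using V_orth[OF i j ij V_br[OF i _ a] b] c by simp
  next
    case False then show ?thesis using V_br0[OF k i _ c a] bT by simp
  qed
  ultimately show "g (D a b) c = 0" using koszul[OF aT bT cT] by simp
qed

lemma D_same:
  assumes i: "i < r" and a: "a \<in> V i" and b: "b \<in> V i" shows "D a b \<in> V i"
proof (rule V_detect[OF _ i])
  have aT: "a \<in> T" and bT: "b \<in> T" using V_T i a b by blast+
  then show "D a b \<in> T" by simp
  fix k c assume k: "k < r" "k \<noteq> i" and c: "c \<in> V k"
  have cT: "c \<in> T" by (rule V_T[OF k(1) c])
  show "g (D a b) c = 0"
    using koszul[OF aT bT cT] V_orth[OF i k(1) k(2)[symmetric] V_br[OF i a b] c]
      V_br0[OF i k(1) k(2)[symmetric] b c] V_br0[OF k(1) i k(2) c a] aT bT by simp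
qed

lemma R_mixed:
  assumes i: "i < r" and j: "j < r" and ij: "i \<noteq> j" and k: "k < r" and a: "a \<in> V i" and b: "b \<in> V j" and c: "c \<in> V k"
  shows "R a b c = 0"
proof -
  have aT: "a \<in> T" and bT: "b \<in> T" and cT: "c \<in> T" using V_T i j k a b c by blast+
  have "D a (D b c) = 0"
    using D_other[OF j k _ b c] D_other[OF i j ij a D_same[OF j b]] c aT by (cases "j = k") auto
  moreover have "D b (D a c) = 0"
    using D_other[OF i k _ a c] D_other[OF j i ij[symmetric] b D_same[OF i a]] c bT by (cases "i = k") auto
  ultimately show ?thesis using V_br0[OF i j ij a b] cT by (simp add: R_def)
qed

lemma R_other:
  assumes i: "i < r" and j: "j < r" and ij: "i \<noteq> j" and a: "a \<in> V i" and b: "b \<in> V i" and c: "c \<in> V j"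
  shows "R a b c = 0"
proof -
  have aT: "a \<in> T" and bT: "b \<in> T" and cT: "c \<in> T" using V_T i j a b c by blast+
  show ?thesis
    using D_other[OF i j ij a c] D_other[OF i j ij b c] D_other[OF i j ij V_br[OF i a b] c] aT bT by (simp add: R_def)
qed

lemma omega_orth: "i < r \<Longrightarrow> j < r \<Longrightarrow> i \<noteq> j \<Longrightarrow> u \<in> V i \<Longrightarrow> v \<in> V j \<Longrightarrow> g (J u) v = 0"
  using V_orth[OF _ _ _ V_J] by blast

text \<open>The identity K for the pair a, \<open>J a\<close>: as S anticommutes with J in either argument,
  the commutator of \<open>S\<^sub>a\<close> and \<open>S\<^bsub>J a\<^esub>\<close> is twice \<open>J S\<^sub>a S\<^sub>a\<close>.\<close>

lemma S_square:
  assumes i: "i < r" and j: "j < r" and ij: "i \<noteq> j" and a: "a \<in> V i" and c: "c \<in> V j"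
  shows "S a (S a c) = g a a *\<^sub>R c"
proof -
  have aT: "a \<in> T" and cT: "c \<in> T" using V_T i j a c by blast+
  have "S a (S (J a) c) - S (J a) (S a c) = (2 * g (J a) (J a)) *\<^sub>R J c"
    using K[OF aT J_T[OF aT] cT] R_other[OF i j ij a V_J[OF i a] c] V_orth[OF i j ij a c]
      omega_orth[OF i j ij a c] omega_orth[OF i j ij V_J[OF i a] c] aT cT by simp
  then have "2 *\<^sub>R J (S a (S a c)) = 2 *\<^sub>R (g a a *\<^sub>R J c)"
    using aT cT by (simp add: S_J1 S_J2 S_neg2 scaleR_2)
  then have "J (S a (S a c)) = g a a *\<^sub>R J c" by (rule scaleR_left_imp_eq[rotated]) simp
  then have "J (S a (S a c)) = J (g a a *\<^sub>R c)" using cT by (simp add: J_simps)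
  then show ?thesis using J_cancel[of "S a (S a c)" "g a a *\<^sub>R c"] aT cT by simp
qed

text \<open>By K the operators \<open>S\<^sub>a\<close> and \<open>S\<^sub>b\<close> commute on c, and so do \<open>S\<^bsub>J a\<^esub>\<close> and \<open>S\<^sub>b\<close>. Since
  \<open>S\<^bsub>J a\<^esub> S\<^sub>b = - J S\<^sub>a S\<^sub>b\<close> but \<open>S\<^sub>b S\<^bsub>J a\<^esub> = J S\<^sub>b S\<^sub>a\<close>, the common value is its own negative.\<close>

lemma S_three:
  assumes i: "i < r" and j: "j < r" and k: "k < r" and d: "i \<noteq> j" "i \<noteq> k" "j \<noteq> k"
    and a: "a \<in> V i" and b: "b \<in> V j" and c: "c \<in> V k"
  shows "S a (S b c) = 0"
proof -
  have aT: "a \<in> T" and bT: "b \<in> T" and cT: "c \<in> T" using V_T i j k a b c by blast+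
  have *: "S x (S b c) - S b (S x c) = 0" if x: "x \<in> V i" for x
    using K[OF V_T[OF i x] bT cT] R_mixed[OF i j d(1) k x b c] V_orth[OF i k d(2) x c] V_orth[OF j k d(3) b c]
      omega_orth[OF i k d(2) x c] omega_orth[OF j k d(3) b c] omega_orth[OF i j d(1) x b] by simp
  have 1: "S a (S b c) = S b (S a c)" using *[OF a] by simp
  have "- J (S a (S b c)) = J (S b (S a c))"
    using *[OF V_J[OF i a]] aT bT cT by (simp add: S_J1 S_J2 S_neg2)
  then have "J (S a (S b c)) = - J (S a (S b c))" using 1 by (metis minus_minus)
  then have "J (S a (S b c)) = J 0" using eq_minus_self J_zero by metis
  then show ?thesis using J_cancel[of "S a (S b c)" 0] aT bT cT by simp
qed

text \<open>The same comparison of a with \<open>J a\<close>, now with a right-hand side: it determines the sum of the two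
  products where K determines their difference.\<close>

lemma S_two:
  assumes i: "i < r" and j: "j < r" and ij: "i \<noteq> j" and a: "a \<in> V i" and c: "c \<in> V i" and b: "b \<in> V j"
  shows "S b (S a c) = 0" "S a (S b c) = g a c *\<^sub>R b + g (J a) c *\<^sub>R J b"
proof -
  have aT: "a \<in> T" and bT: "b \<in> T" and cT: "c \<in> T" using V_T i j a b c by blast+
  have *: "S x (S b c) - S b (S x c) = g x c *\<^sub>R b + g (J x) c *\<^sub>R J b" if x: "x \<in> V i" for x
    using K[OF V_T[OF i x] bT cT] R_mixed[OF i j ij i x b c] V_orth[OF j i ij[symmetric] b c]
      omega_orth[OF j i ij[symmetric] b c] omega_orth[OF i j ij x b] by simp
  have "- J (S a (S b c)) - J (S b (S a c)) = g (J a) c *\<^sub>R b - g a c *\<^sub>R J b"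
    using *[OF V_J[OF i a]] aT bT cT by (simp add: S_J1 S_J2 S_neg2 g_simps)
  then have "J (- J (S a (S b c)) - J (S b (S a c))) = J (g (J a) c *\<^sub>R b - g a c *\<^sub>R J b)" by simp
  then have 2: "S a (S b c) + S b (S a c) = g a c *\<^sub>R b + g (J a) c *\<^sub>R J b"
    using aT bT cT by (simp add: J_simps algebra_simps)
  have "2 *\<^sub>R S b (S a c) = 0" using 2 *[OF a] by (simp add: scaleR_2 algebra_simps)
  then show z: "S b (S a c) = 0" by simp
  show "S a (S b c) = g a c *\<^sub>R b + g (J a) c *\<^sub>R J b" using 2 z by simp
qed

text \<open>On the other factors \<open>S\<^sub>b\<close> squares to \<open>|b|\<^sup>2\<close> and is symmetric, so w is orthogonal to all of them.\<close>

lemma S_kernel: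
  assumes j: "j < r" and b: "b \<in> V j" "b \<noteq> 0" and w: "w \<in> T" "S b w = 0"
  shows "w \<in> V j"
proof (rule V_detect[OF w(1) j])
  fix k c assume k: "k < r" "k \<noteq> j" and c: "c \<in> V k"
  have bT: "b \<in> T" and cT: "c \<in> T" using V_T j k b c by blast+
  have "0 = g (S b w) (S b c)" using w bT cT by simp
  also have "\<dots> = g w (S b (S b c))" using S_gsym[OF bT w(1)] bT cT by simp
  also have "\<dots> = g b b * g w c" using S_square[OF j k(1) k(2)[symmetric] b(1) c] w cT by (simp add: g_simps)
  finally show "g w c = 0" using g_pos[OF bT b(2)] by simp
qed

lemma S_norm:
  assumes i: "i < r" and j: "j < r" and ij: "i \<noteq> j" and a: "a \<in> V i" and c: "c \<in> V j" and z: "S a c = 0" "a \<noteq> 0"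
  shows "c = 0"
  using S_square[OF i j ij a c] z V_T[OF i a] g_pos[OF V_T[OF i a] z(2)] by simp

text \<open>The value lies in each factor other than \<open>V i\<close>, and there are at least two of these.\<close>

lemma S_self:
  assumes i: "i < r" and a: "a \<in> V i" and c: "c \<in> V i" shows "S a c = 0"
proof -
  have aT: "a \<in> T" and cT: "c \<in> T" using V_T i a c by blast+
  have *: "S a c \<in> V j" if j: "j < r" "j \<noteq> i" for j
  proof -
    obtain b where b: "b \<in> V j" "b \<noteq> 0" using V_ne[OF j(1)] by blast
    show ?thesis by (rule S_kernel[OF j(1) b _ S_two(1)[OF i j(1) j(2)[symmetric] a c b(1)]]) (simp add: aT cT)
  qed
  have "\<exists>j k. j < r \<and> k < r \<and> j \<noteq> i \<and> k \<noteq> i \<and> j \<noteq> k"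
  proof -
    have "(i = 0 \<and> 1 \<noteq> i \<and> 2 \<noteq> i) \<or> (i = 1 \<and> 0 \<noteq> i \<and> 2 \<noteq> i) \<or> (0 \<noteq> i \<and> 1 \<noteq> i)" by auto
    then show ?thesis using r
      by (elim disjE) (rule exI[of _ 1], rule exI[of _ 2], simp, rule exI[of _ 0], rule exI[of _ 2], simp,
        rule exI[of _ 0], rule exI[of _ 1], simp)
  qed
  then obtain j k where jk: "j < r" "k < r" "j \<noteq> i" "k \<noteq> i" "j \<noteq> k" by blast
  show ?thesis by (rule V_disjoint[OF jk(1,2,5) *[OF jk(1,3)] *[OF jk(2,4)]])
qed

text \<open>A vector c of the third factor annihilates \<open>S a b\<close>, so \<open>S_kernel\<close> applies to c.\<close>

lemma S_third:
  assumes i: "i < r" and j: "j < r" and k: "k < r" and d: "i \<noteq> j" "i \<noteq> k" "j \<noteq> k" and a: "a \<in> V i" and b: "b \<in> V j"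
  shows "S a b \<in> V k"
proof -
  have aT: "a \<in> T" and bT: "b \<in> T" using V_T i j a b by blast+
  obtain c where c: "c \<in> V k" "c \<noteq> 0" using V_ne[OF k] by blast
  show ?thesis
    by (rule S_kernel[OF k c _ S_three[OF k i j d(2)[symmetric] d(3)[symmetric] d(1) c(1) a b]]) (simp add: aT bT)
qed

text \<open>With a fourth factor the value of S on the first two would lie in the third and in the fourth.\<close>

lemma three_factors: "r = 3"
proof (rule ccontr)
  assume "r \<noteq> 3"
  then have r4: "0 < r" "1 < r" "2 < r" "3 < r" using r by auto
  obtain a b where a: "a \<in> V 0" "a \<noteq> 0" and b: "b \<in> V 1" "b \<noteq> 0" using V_ne r4 by meson
  have "S a b \<in> V 2" "S a b \<in> V 3" by (rule S_third[OF r4(1,2) _ _ _ _ a(1) b(1)]; simp add: r4)+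
  then have "S a b = 0" using V_disjoint[OF r4(3,4)] by simp
  then show False using S_norm[OF r4(1,2) _ a(1) b(1) _ a(2)] b(2) by simp
qed

text \<open>For \<open>c'\<close> in \<open>V i\<close> orthogonal to a and \<open>J a\<close> the operator \<open>S\<^sub>a\<close> kills \<open>S b c'\<close>, by \<open>S_two\<close>; as it
  is injective on the third factor, where \<open>S b c'\<close> lies, and \<open>S\<^sub>b\<close> is injective on \<open>V i\<close>, the vector
  \<open>c'\<close> is 0.\<close>

lemma factor_span:
  assumes i: "i < r" and a: "a \<in> V i" "g a a = 1" and c: "c \<in> V i"
  shows "c = g a c *\<^sub>R a + g (J a) c *\<^sub>R J a"
proof -
  obtain j k where jk: "j < r" "k < r" "j \<noteq> i" "k \<noteq> i" "j \<noteq> k"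
  proof -
    consider "i = 0" | "i = 1" | "i = 2" using i three_factors by linarith
    then show thesis using that[of 1 2] that[of 0 2] that[of 0 1] r by cases auto
  qed
  have aT: "a \<in> T" and cT: "c \<in> T" using V_T i a c by blast+
  define c' where "c' = c - (g a c *\<^sub>R a + g (J a) c *\<^sub>R J a)"
  have c'V: "c' \<in> V i" unfolding c'_def
    using a c V_J[OF i a(1)] by (intro subspace_diff subspace_add subspace_scale V_sub i)
  have c'T: "c' \<in> T" by (rule V_T[OF i c'V])
  have o: "g a c' = 0" "g (J a) c' = 0"
    using a(2) aT cT gJ[of a a] by (simp_all add: c'_def g_simps)
  obtain b where b: "b \<in> V j" "b \<noteq> 0" using V_ne[OF jk(1)] by blast
  have bT: "b \<in> T" by (rule V_T[OF jk(1) b(1)])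
  have "S a (S b c') = 0" using S_two(2)[OF i jk(1) jk(3)[symmetric] a(1) c'V b(1)] o by simp
  moreover have "S b c' \<in> V k" by (rule S_third[OF jk(1) i jk(2) jk(3) jk(5) jk(4)[symmetric] b(1) c'V])
  moreover have "a \<noteq> 0" using a(2) aT by auto
  ultimately have "S b c' = 0" using S_norm[OF i jk(2) jk(4)[symmetric] a(1)] by blast
  then have "c' = 0" using S_norm[OF jk(1) i jk(3) b(1) c'V _ b(2)] by blast
  then show ?thesis by (simp add: c'_def)
qed

text \<open>Within a factor S vanishes, so K is a formula for the curvature.\<close>

lemma factor_curvature:
  assumes i: "i < r" and a: "a \<in> V i" "g a a = 1"
  shows "R a (J a) a = 4 *\<^sub>R J a"
proof -
  have aT: "a \<in> T" using V_T i a by blast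
  have "g a (J a) = 0" "g (J a) (J a) = 1" "g (J (J a)) a = -1" using aT a(2) gJ[of a a] by (simp_all add: g_simps)
  then show ?thesis using K[OF aT J_T[OF aT] aT] S_self[OF i a(1) a(1)] S_self[OF i V_J[OF i a(1)] a(1)] a(2) aT
    by (simp add: g_simps four_times)
qed

text \<open>In a plane with orthonormal basis a, \<open>J a\<close> and bracket \<open>[a, J a] = \<alpha> a + \<beta> J a\<close> the curvature is
  \<open>R(a, J a) a = (\<alpha>\<^sup>2 + \<beta>\<^sup>2) J a\<close>. Hence \<open>\<alpha>\<^sup>2 + \<beta>\<^sup>2 = 4\<close>, and the basis can be rotated until the
  bracket is twice its second vector.\<close>

theorem factor_structure:
  assumes i: "i < r"
  shows "\<exists>u\<in>V i. g u u = 1 \<and> (\<forall>c\<in>V i. c = g u c *\<^sub>R u + g (J u) c *\<^sub>R J u) \<and> br u (J u) = 2 *\<^sub>R J u"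
proof -
  obtain a0 where a0: "a0 \<in> V i" "a0 \<noteq> 0" using V_ne[OF i] by blast
  define a where "a = (1 / sqrt (g a0 a0)) *\<^sub>R a0"
  have a0T: "a0 \<in> T" by (rule V_T[OF i a0(1)])
  have p0: "g a0 a0 > 0" by (rule g_pos[OF a0T a0(2)])
  have a: "a \<in> V i" unfolding a_def by (intro subspace_scale V_sub i a0)
  have aT: "a \<in> T" by (rule V_T[OF i a])
  have ga: "g a a = 1" using p0 a0T by (simp add: a_def g_simps)
  have Ja: "J a \<in> V i" by (rule V_J[OF i a])
  have gaJ: "g a (J a) = 0" using gJ[of a a] aT by simp
  define \<alpha> \<beta> where "\<alpha> = g a (br a (J a))" and "\<beta> = g (J a) (br a (J a))"
  have brs: "br a (J a) = \<alpha> *\<^sub>R a + \<beta> *\<^sub>R J a"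
    unfolding \<alpha>_def \<beta>_def by (rule factor_span[OF i a ga V_br[OF i a Ja]])
  define lam mu where "lam = g (J a) (D a a)" and "mu = g (J a) (D (J a) a)"
  have skew0: "g a (D x a) = 0" if "x \<in> T" for x
    using D_skew[OF that aT aT] g_sym[of a "D x a"] that aT by simp
  have Daa: "D a a = lam *\<^sub>R J a"
    using factor_span[OF i a ga D_same[OF i a a]] skew0[OF aT] by (simp add: lam_def)
  have DJa: "D (J a) a = mu *\<^sub>R J a"
    using factor_span[OF i a ga D_same[OF i Ja a]] skew0[of "J a"] aT by (simp add: mu_def)
  have DaJ: "D a (J a) = (- lam) *\<^sub>R a" using aT by (simp add: D_J Daa J_simps)
  have DJJ: "D (J a) (J a) = (- mu) *\<^sub>R a" using aT by (simp add: D_J DJa J_simps)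
  have t: "(- lam) *\<^sub>R a - mu *\<^sub>R J a = \<alpha> *\<^sub>R a + \<beta> *\<^sub>R J a"
    using D_torsion[of a "J a"] aT by (simp add: DaJ DJa brs)
  have "g a ((- lam) *\<^sub>R a - mu *\<^sub>R J a) = g a (\<alpha> *\<^sub>R a + \<beta> *\<^sub>R J a)"
    "g (J a) ((- lam) *\<^sub>R a - mu *\<^sub>R J a) = g (J a) (\<alpha> *\<^sub>R a + \<beta> *\<^sub>R J a)" using t by simp_all
  then have lm: "lam = - \<alpha>" "mu = - \<beta>" using aT ga gaJ by (simp_all add: g_simps)
  have "D (br a (J a)) a = (- (\<alpha> * \<alpha> + \<beta> * \<beta>)) *\<^sub>R J a"
  proof -
    have "D (br a (J a)) a = \<alpha> *\<^sub>R D a a + D (\<beta> *\<^sub>R J a) a" unfolding brs using aT by (intro D_lin1) simp_all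
    also have "D (\<beta> *\<^sub>R J a) a = \<beta> *\<^sub>R D (J a) a" using D_lin1[of "J a" 0 a \<beta>] aT by simp
    finally show ?thesis by (simp add: Daa DJa lm algebra_simps)
  qed
  moreover have "D a (mu *\<^sub>R J a) = (- (mu * lam)) *\<^sub>R a" "D (J a) (lam *\<^sub>R J a) = (- (mu * lam)) *\<^sub>R a"
    using aT by (simp_all add: D_scale2 DaJ DJJ)
  ultimately have "R a (J a) a = (\<alpha> * \<alpha> + \<beta> * \<beta>) *\<^sub>R J a"
    unfolding R_def Daa DJa by (simp add: scaleR_minus_left[symmetric] del: scaleR_minus_left)
  then have "g (J a) ((\<alpha> * \<alpha> + \<beta> * \<beta>) *\<^sub>R J a) = g (J a) (4 *\<^sub>R J a)"
    using factor_curvature[OF i a ga] by metis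
  then have ab: "\<alpha> * \<alpha> + \<beta> * \<beta> = 4" using aT ga by (simp add: g_simps)
  \<comment> \<open>rotate the frame so that the second vector spans the derived algebra\<close>
  define u where "u = (\<beta> / 2) *\<^sub>R a - (\<alpha> / 2) *\<^sub>R J a"
  have u: "u \<in> V i" unfolding u_def using a Ja by (intro subspace_diff subspace_scale V_sub i)
  have Ju: "J u = (\<alpha> / 2) *\<^sub>R a + (\<beta> / 2) *\<^sub>R J a" using aT by (simp add: u_def J_simps)
  have gu: "g u u = 1"
    using ab aT ga gaJ by (simp add: u_def g_simps field_simps)
  have "br u (J u) = (\<beta> / 2 * (\<beta> / 2)) *\<^sub>R br a (J a) - (\<alpha> / 2 * (\<alpha> / 2)) *\<^sub>R br (J a) a"
  proof -
    have JuT: "J u \<in> T" and JaT: "J a \<in> T" using V_T[OF i u] aT by simp_all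
    have "u = (\<beta> / 2) *\<^sub>R a + (- (\<alpha> / 2)) *\<^sub>R J a" by (simp add: u_def)
    then have "br u (J u) = br ((\<beta> / 2) *\<^sub>R a + (- (\<alpha> / 2)) *\<^sub>R J a) (J u)" by simp
    also have "\<dots> = (\<beta> / 2) *\<^sub>R br a (J u) + (- (\<alpha> / 2)) *\<^sub>R br (J a) (J u)"
      using JuT JaT aT by (simp only: br_lin T_scale br_scale1)
    also have "br a (J u) = (\<beta> / 2) *\<^sub>R br a (J a)"
      unfolding Ju using aT JaT by (simp add: br_add2 br_scale2 br_self)
    also have "br (J a) (J u) = (\<alpha> / 2) *\<^sub>R br (J a) a"
      unfolding Ju using aT JaT by (simp add: br_add2 br_scale2 br_self)
    finally show ?thesis by simp
  qed
  also have "br (J a) a = - br a (J a)" using aT by (intro br_swap) simp_all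
  also have "(\<beta> / 2 * (\<beta> / 2)) *\<^sub>R br a (J a) - (\<alpha> / 2 * (\<alpha> / 2)) *\<^sub>R - br a (J a) = ((\<alpha> * \<alpha> + \<beta> * \<beta>) / 4) *\<^sub>R br a (J a)"
    by (simp add: scaleR_add_left[symmetric] add_divide_distrib)
  also have "\<dots> = 2 *\<^sub>R J u" by (simp add: ab brs Ju scaleR_add_right)
  finally show ?thesis using u gu factor_span[OF i u gu] by (intro bexI[of _ u]) auto
qed

end

section \<open>Horizontal lifts in circle bundles\<close>

lemma open_submfd_Int:
  assumes "charted Q" shows "open_submfd Q (pts Q \<inter> W) = open_submfd Q W"
proof -
  have e: "B \<inter> (pts Q \<inter> W) = B \<inter> W" if "(B, \<psi>) \<in> atlas Q" for B \<psi>
    using chart_sub[OF assms that] by blast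
  have "atlas (open_submfd Q (pts Q \<inter> W)) = atlas (open_submfd Q W)"
  proof (rule Set.set_eqI)
    fix z
    have "z \<in> atlas (open_submfd Q (pts Q \<inter> W)) \<longleftrightarrow> (\<exists>U \<psi>. (U, \<psi>) \<in> atlas Q \<and> z = (U \<inter> (pts Q \<inter> W), \<psi>))"
      by (rule open_submfd_atlas)
    also have "\<dots> \<longleftrightarrow> (\<exists>U \<psi>. (U, \<psi>) \<in> atlas Q \<and> z = (U \<inter> W, \<psi>))"
    proof (intro iffI; elim exE conjE)
      fix U \<psi> assume "(U, \<psi>) \<in> atlas Q" "z = (U \<inter> (pts Q \<inter> W), \<psi>)"
      then show "\<exists>U \<psi>. (U, \<psi>) \<in> atlas Q \<and> z = (U \<inter> W, \<psi>)"
        by (intro exI[of _ U] exI[of _ \<psi>]) (simp add: e)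
    next
      fix U \<psi> assume "(U, \<psi>) \<in> atlas Q" "z = (U \<inter> W, \<psi>)"
      then show "\<exists>U \<psi>. (U, \<psi>) \<in> atlas Q \<and> z = (U \<inter> (pts Q \<inter> W), \<psi>)"
        by (intro exI[of _ U] exI[of _ \<psi>]) (simp add: e)
    qed
    also have "\<dots> \<longleftrightarrow> z \<in> atlas (open_submfd Q W)" by (rule open_submfd_atlas[symmetric])
    finally show "z \<in> atlas (open_submfd Q (pts Q \<inter> W)) \<longleftrightarrow> z \<in> atlas (open_submfd Q W)" .
  qed
  then show ?thesis using subtopology_restrict[of "mtop Q" W] by (simp add: open_submfd_def)
qed

text \<open>The assumption \<open>uniq\<close> says that a vector is determined by its projection and its vertical
  component. For the bundles below it follows from the non-degeneracy of the cone metric.\<close>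

locale circle_bundle =
  fixes C0 :: "('c, 'y) mfd_scheme" and S :: "('a, 'z) mfd_scheme" and \<pi> :: "'c \<Rightarrow> 'a"
    and act :: "complex \<Rightarrow> 'c \<Rightarrow> 'c" and \<phi> :: "'c form1"
  assumes S: "smooth_manifold S" and bdl: "principal_circle_bundle C0 S \<pi> act"
    and conn: "connection_form C0 act \<phi>"
    and uniq: "\<And>x v. x \<in> pts C0 \<Longrightarrow> v \<in> tangent C0 x \<Longrightarrow> push C0 S \<pi> v = 0 \<Longrightarrow> \<phi> x v = 0 \<Longrightarrow> v = 0"
begin

lemma cS: "charted S" by (rule smooth_manifold_charted[OF S])
lemma sC0: "smooth_manifold C0" using bdl unfolding principal_circle_bundle_def by (elim conjE)
lemma cC0: "charted C0" by (rule smooth_manifold_charted[OF sC0])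
lemma s\<pi>: "smooth_map C0 S \<pi>" using bdl unfolding principal_circle_bundle_def by (elim conjE)
lemma sact: "smooth_map (prod_mfd circle C0) C0 (\<lambda>(z, x). act z x)"
  using bdl unfolding principal_circle_bundle_def by (elim conjE)
lemma act_rules: "x \<in> pts C0 \<Longrightarrow> act 1 x = x" "x \<in> pts C0 \<Longrightarrow> z \<in> pts circle \<Longrightarrow> \<pi> (act z x) = \<pi> x"
proof -
  have "\<forall>x\<in>pts C0. act 1 x = x \<and> (\<forall>z\<in>pts circle. \<pi> (act z x) = \<pi> x \<and>
           (\<forall>w\<in>pts circle. act (z * w) x = act z (act w x)))"
    using bdl unfolding principal_circle_bundle_def by (elim conjE)
  then show "x \<in> pts C0 \<Longrightarrow> act 1 x = x" "x \<in> pts C0 \<Longrightarrow> z \<in> pts circle \<Longrightarrow> \<pi> (act z x) = \<pi> x" by simp_all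
qed

lemma triv: "s \<in> pts S \<Longrightarrow> \<exists>U \<Phi>. openin (mtop S) U \<and> s \<in> U \<and>
        diffeo (open_submfd C0 (pts C0 \<inter> \<pi> -` U)) (prod_mfd (open_submfd S U) circle) \<Phi> \<and>
        (\<forall>x\<in>pts C0 \<inter> \<pi> -` U. fst (\<Phi> x) = \<pi> x)"
proof -
  assume s: "s \<in> pts S"
  have "\<forall>s\<in>pts S. \<exists>U \<Phi>. openin (mtop S) U \<and> s \<in> U \<and>
        diffeo (open_submfd C0 (pts C0 \<inter> \<pi> -` U)) (prod_mfd (open_submfd S U) circle) \<Phi> \<and>
        (\<forall>x\<in>pts C0 \<inter> \<pi> -` U. fst (\<Phi> x) = \<pi> x \<and>
           (\<forall>z\<in>pts circle. \<Phi> (act z x) = (\<pi> x, z * snd (\<Phi> x))))"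
    using bdl unfolding principal_circle_bundle_def by (elim conjE)
  from bspec[OF this s] obtain U \<Phi> where "openin (mtop S) U" "s \<in> U"
    "diffeo (open_submfd C0 (pts C0 \<inter> \<pi> -` U)) (prod_mfd (open_submfd S U) circle) \<Phi>"
    "\<forall>x\<in>pts C0 \<inter> \<pi> -` U. fst (\<Phi> x) = \<pi> x \<and> (\<forall>z\<in>pts circle. \<Phi> (act z x) = (\<pi> x, z * snd (\<Phi> x)))"
    by (elim exE conjE)
  then show ?thesis by (intro exI[of _ U] exI[of _ \<Phi>] conjI) simp_all
qed

lemma cis_circle: "cis \<theta> \<in> pts circle" by (simp add: circle_def)

abbreviation "X0 \<equiv> circle_generator C0 act"

lemma gen_deriv:
  assumes f: "f \<in> smooth_fun C0"
  shows "smooth_in C0 (pts C0) (\<lambda>x. deriv (\<lambda>\<theta>. f (act (cis \<theta>) x)) 0)"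
    and "x \<in> pts C0 \<Longrightarrow> ((\<lambda>\<theta>. f (act (cis \<theta>) x)) has_real_derivative X0 x f) (at 0)"
proof -
  let ?K = "cut (prod_mfd circle C0) (\<lambda>p. f ((\<lambda>(z, x). act z x) p))"
  have K: "?K \<in> smooth_fun (prod_mfd circle C0)"
    by (rule smooth_fun_pull[OF charted_prod[OF charted_circle cC0] cC0 sact f])
  have e: "(\<lambda>\<theta>. ?K (cis \<theta>, x)) = (\<lambda>\<theta>. f (act (cis \<theta>) x))" if "x \<in> pts C0" for x
    using that cis_circle by (auto simp: cut_def)
  show "smooth_in C0 (pts C0) (\<lambda>x. deriv (\<lambda>\<theta>. f (act (cis \<theta>) x)) 0)"
    by (rule smooth_in_cong[OF cC0 _ _ circle_deriv(1)[OF cC0 K]]) (simp_all add: e)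
  show "((\<lambda>\<theta>. f (act (cis \<theta>) x)) has_real_derivative X0 x f) (at 0)" if x: "x \<in> pts C0"
    using circle_deriv(2)[OF cC0 K x] unfolding e[OF x] by (simp add: circle_generator_def x f)
qed

lemma X0_vfield: "X0 \<in> vfields C0"
proof (rule vfieldsI)
  fix x assume x: "x \<in> pts C0"
  have cis0: "act (cis 0) x = x" using act_rules(1)[OF x] by simp
  show "X0 x \<in> tangent C0 x"
  proof (rule tangentI)
    fix f h c assume f: "f \<in> smooth_fun C0" and h: "h \<in> smooth_fun C0"
    note D = gen_deriv(2)[OF _ x]
    show "X0 x (\<lambda>x. c * f x + h x) = c * X0 x f + X0 x h"
      by (rule DERIV_unique[OF D[OF smooth_fun_linear[OF cC0 f h]]])
        (intro DERIV_add DERIV_cmult D f h)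
    show "X0 x (\<lambda>x. f x * h x) = f x * X0 x h + h x * X0 x f"
      using DERIV_unique[OF D[OF smooth_fun_mult[OF cC0 f h]] DERIV_mult[OF D[OF f] D[OF h]]] cis0
      by (simp add: algebra_simps)
  qed (simp add: circle_generator_def)
next
  fix f assume f: "f \<in> smooth_fun C0"
  have "cut C0 (\<lambda>x. deriv (\<lambda>\<theta>. f (act (cis \<theta>) x)) 0) \<in> smooth_fun C0"
    by (rule smooth_fun_cutI[OF cC0 gen_deriv(1)[OF f]])
  moreover have "cut C0 (\<lambda>x. deriv (\<lambda>\<theta>. f (act (cis \<theta>) x)) 0) = (\<lambda>x. X0 x f)"
    by (rule ext) (simp add: cut_def circle_generator_def f)
  ultimately show "(\<lambda>x. X0 x f) \<in> smooth_fun C0" by simp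
qed (simp add: circle_generator_def fun_eq_iff)

lemma act_in: "x \<in> pts C0 \<Longrightarrow> z \<in> pts circle \<Longrightarrow> act z x \<in> pts C0"
  using smooth_map_in[OF sact, of "(z, x)"] by simp

lemma X0_vertical: "x \<in> pts C0 \<Longrightarrow> push C0 S \<pi> (X0 x) = 0"
proof
  fix f assume x: "x \<in> pts C0"
  show "push C0 S \<pi> (X0 x) f = 0 f"
  proof (cases "f \<in> smooth_fun S")
    case True
    note f = smooth_fun_pull[OF cC0 cS s\<pi> True]
    have "(\<lambda>\<theta>. cut C0 (\<lambda>x. f (\<pi> x)) (act (cis \<theta>) x)) = (\<lambda>\<theta>. f (\<pi> x))"
      using act_in[OF x cis_circle] act_rules(2)[OF x cis_circle] by (simp add: cut_def)
    then have "X0 x (cut C0 (\<lambda>x. f (\<pi> x))) = 0"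
      using DERIV_unique[OF gen_deriv(2)[OF f x], of 0] by simp
    then show ?thesis by (simp add: push_apply True)
  qed (simp add: push_def)
qed

lemma \<phi>_X0: "x \<in> pts C0 \<Longrightarrow> \<phi> x (X0 x) = 1" using conn unfolding connection_form_def by blast
lemma \<phi>_form: "one_form C0 \<phi>" using conn unfolding connection_form_def by blast

lemma \<phi>_linear:
  "x \<in> pts C0 \<Longrightarrow> v \<in> tangent C0 x \<Longrightarrow> w \<in> tangent C0 x \<Longrightarrow> \<phi> x (c *\<^sub>R v + w) = c * \<phi> x v + \<phi> x w"
  by (rule form_linear[OF \<phi>_form])

lemma \<phi>_smooth: "A \<in> vfields C0 \<Longrightarrow> ev1 C0 \<phi> A \<in> smooth_fun C0"
  by (rule form_smooth[OF \<phi>_form])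

text \<open>On a trivialisation the field A lifts to a field along the base directions. To transport it to the
  total space while working with global functions only, a function f is multiplied by a bump
  function \<open>\<rho>\<close> of the base before it is carried over to the product, and the product rule removes
  the effect of \<open>\<rho>\<close> again.\<close>

lemma local_lift:
  assumes A: "A \<in> vfields S" and x0: "x0 \<in> pts C0"
  obtains V N where "V \<in> vfields C0" "openin (mtop C0) N" "x0 \<in> N" "\<And>x. x \<in> N \<Longrightarrow> push C0 S \<pi> (V x) = A (\<pi> x)"
proof -
  have s0: "\<pi> x0 \<in> pts S" by (rule smooth_map_in[OF s\<pi> x0])
  obtain U \<Phi> where U: "openin (mtop S) U" "\<pi> x0 \<in> U"
    and \<Phi>: "diffeo (open_submfd C0 (pts C0 \<inter> \<pi> -` U)) (prod_mfd (open_submfd S U) circle) \<Phi>"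
    and fst\<Phi>: "\<And>x. x \<in> pts C0 \<inter> \<pi> -` U \<Longrightarrow> fst (\<Phi> x) = \<pi> x"
    using triv[OF s0] by metis
  obtain \<rho> W K where \<rho>: "\<rho> \<in> smooth_fun S" and W: "openin (mtop S) W" "\<pi> x0 \<in> W" "W \<subseteq> U"
    and \<rho>1: "\<And>y. y \<in> W \<Longrightarrow> \<rho> y = 1" and K: "closedin (mtop S) K" "K \<subseteq> U" and \<rho>0: "\<And>y. y \<notin> K \<Longrightarrow> \<rho> y = 0"
    using bump_exists[OF S U] by metis
  define B where "B = pts C0 \<inter> \<pi> -` U"
  have oB: "openin (mtop C0) B" unfolding B_def by (rule smooth_map_preimage_open[OF s\<pi> U(1)])
  have Up: "U \<subseteq> pts S" by (rule openin_subset[OF U(1)])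
  let ?Q = "prod_mfd S circle"
  let ?N = "prod_mfd (open_submfd S U) circle"
  let ?B = "open_submfd C0 B"
  have cQ: "charted ?Q" by (rule charted_prod[OF cS charted_circle])
  have cN: "charted ?N" by (rule charted_prod[OF charted_open_submfd[OF cS U(1)] charted_circle])
  have cB: "charted ?B" by (rule charted_open_submfd[OF cC0 oB])
  have oUQ: "openin (mtop ?Q) (U \<times> pts circle)" using U(1) by (simp add: openin_prod_Times_iff)
  have NQ: "?N = open_submfd ?Q (U \<times> pts circle)"
  proof -
    have "pts ?Q \<inter> (U \<times> UNIV) = U \<times> pts circle" using Up by auto
    then show ?thesis using open_submfd_Int[OF cQ, of "U \<times> UNIV"] by (simp add: prod_open_submfd)
  qed
  have pB: "pts ?B = B" using openin_subset[OF oB] by auto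
  have pN: "pts ?N = U \<times> pts circle" using Up by auto
  define \<Psi> where "\<Psi> = inv_into B \<Phi>"
  have bij: "bij_betw \<Phi> B (U \<times> pts circle)" and s\<Phi>: "smooth_map ?B ?N \<Phi>" and s\<Psi>: "smooth_map ?N ?B \<Psi>"
    using \<Phi> unfolding diffeo_def B_def[symmetric] pB pN \<Psi>_def by simp_all
  have \<Psi>\<Phi>: "\<Psi> (\<Phi> x) = x" if "x \<in> B" for x
    unfolding \<Psi>_def using bij that by (simp add: bij_betw_def inv_into_f_f)
  have \<Phi>\<Psi>: "\<Phi> (\<Psi> p) = p" "\<Psi> p \<in> B" if "p \<in> U \<times> pts circle" for p
    unfolding \<Psi>_def using bij that by (auto simp: bij_betw_def f_inv_into_f inv_into_into)
  have \<Phi>in: "\<Phi> x \<in> U \<times> pts circle" if "x \<in> B" for x using bij that by (auto simp: bij_betw_def)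
  have \<pi>\<Psi>: "\<pi> (\<Psi> p) = fst p" if "p \<in> U \<times> pts circle" for p
    using fst\<Phi>[of "\<Psi> p"] \<Phi>\<Psi>[OF that] by (simp add: B_def)
  \<comment> \<open>functions on the trivialisation, cut off to global functions\<close>
  define G where "G = (\<lambda>f p. if p \<in> U \<times> pts circle then \<rho> (fst p) * f (\<Psi> p) else 0)"
  have G: "G f \<in> smooth_fun ?Q" if f: "f \<in> smooth_fun C0" for f
  proof -
    have "smooth_in ?B B f"
      using smooth_in_open_submfd[OF cC0 oB oB, of f] smooth_fun_in[OF cC0 f openin_subset[OF oB]] by simp
    moreover have "openin (mtop ?B) B" using oB openin_open_subtopology[OF oB, of B] by simp
    ultimately have "smooth_in ?N (\<Psi> -` B) (\<lambda>p. f (\<Psi> p))" by (intro smooth_in_pull[OF cN cB s\<Psi>])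
    then have "smooth_in ?N (U \<times> pts circle) (\<lambda>p. f (\<Psi> p))"
      by (rule smooth_in_subset[rotated]) (use \<Phi>\<Psi>(2) in auto)
    then have s: "smooth_in ?Q (U \<times> pts circle) (\<lambda>p. f (\<Psi> p))"
      unfolding NQ using smooth_in_open_submfd[OF cQ oUQ oUQ] by simp
    let ?\<beta> = "cut ?Q (\<lambda>p. \<rho> (fst p))"
    have \<beta>: "?\<beta> \<in> smooth_fun ?Q"
      by (rule smooth_fun_pull[OF cQ cS smooth_map_fst[OF S charted_circle] \<rho>])
    have "closedin (mtop ?Q) (K \<times> pts circle)" using K(1) by (simp add: closedin_prod_Times_iff)
    moreover have "K \<times> pts circle \<subseteq> U \<times> pts circle" using K(2) by blast
    moreover have "?\<beta> p = 0" if "p \<notin> K \<times> pts circle" for p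
      using that \<rho>0[of "fst p"] by (cases p) (auto simp: cut_def)
    ultimately have "(\<lambda>p. if p \<in> U \<times> pts circle then ?\<beta> p * f (\<Psi> p) else 0) \<in> smooth_fun ?Q"
      by (rule extend_smooth[OF cQ oUQ s \<beta>])
    moreover have "(\<lambda>p. if p \<in> U \<times> pts circle then ?\<beta> p * f (\<Psi> p) else 0) = G f"
      using Up by (auto simp: G_def cut_def fun_eq_iff)
    ultimately show ?thesis by simp
  qed
  \<comment> \<open>the derivative along A in the base directions of the product\<close>
  define H where "H = (\<lambda>f p. A (fst p) (\<lambda>u. G f (u, snd p)))"
  have H: "H f \<in> smooth_fun ?Q" if f: "f \<in> smooth_fun C0" for f
    unfolding H_def by (rule vfield_fst[OF S charted_circle A G[OF f]])
  \<comment> \<open>a derivation once more: the second term compensates the derivative of the cut-off \<open>\<rho>\<close>\<close>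
  define L where "L = (\<lambda>f p. \<rho> (fst p) * H f p - G f p * A (fst p) \<rho>)"
  have L: "smooth_in ?Q (pts ?Q) (L f)" if f: "f \<in> smooth_fun C0" for f
  proof -
    have c1: "smooth_in ?Q (pts ?Q) (\<lambda>p. \<rho> (fst p))" "smooth_in ?Q (pts ?Q) (\<lambda>p. A (fst p) \<rho>)"
      using smooth_in_fst[OF cS charted_circle _ smooth_fun_in[OF cS \<rho> subset_refl]]
        smooth_in_fst[OF cS charted_circle _ smooth_fun_in[OF cS vfieldsD(3)[OF A \<rho>] subset_refl]] by simp_all
    have oP: "openin (mtop ?Q) (pts ?Q)" by (rule openin_topspace)
    have "smooth_in ?Q (pts ?Q) (\<lambda>p. \<rho> (fst p) * H f p + (- 1) * (G f p * A (fst p) \<rho>))"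
      by (intro smooth_in_add smooth_in_mult smooth_in_const cQ oP c1 smooth_fun_in[OF cQ H[OF f]] smooth_fun_in[OF cQ G[OF f]] subset_refl)
    then show ?thesis by (simp add: L_def)
  qed
  define V where "V = (\<lambda>x f. if f \<in> smooth_fun C0 \<and> x \<in> B then L f (\<Phi> x) else 0)"
  have Vf: "V x f = \<rho> (\<pi> x) * A (\<pi> x) (\<lambda>u. G f (u, snd (\<Phi> x))) - \<rho> (\<pi> x) * f x * A (\<pi> x) \<rho>"
    if f: "f \<in> smooth_fun C0" and x: "x \<in> B" for x f
  proof -
    have "G f (\<Phi> x) = \<rho> (\<pi> x) * f x" using \<Phi>in[OF x] \<Psi>\<Phi>[OF x] fst\<Phi>[of x] x by (simp add: G_def B_def)
    then show ?thesis using f x fst\<Phi>[of x] by (simp add: V_def L_def H_def B_def)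
  qed
  have Gs: "(\<lambda>u. G f (u, z)) \<in> smooth_fun S" if "f \<in> smooth_fun C0" for f z
    by (rule smooth_fun_slice_fst[OF S charted_circle G[OF that]])
  have Gval: "G f (\<pi> x, snd (\<Phi> x)) = \<rho> (\<pi> x) * f x" if x: "x \<in> B" for f x
  proof -
    have e: "(\<pi> x, snd (\<Phi> x)) = \<Phi> x" using fst\<Phi>[of x] x by (simp add: B_def prod_eq_iff)
    show ?thesis unfolding e using \<Phi>in[OF x] \<Psi>\<Phi>[OF x] fst\<Phi>[of x] x by (simp add: G_def B_def)
  qed
  have V: "V \<in> vfields C0"
  proof (rule vfieldsI)
    fix x assume xp: "x \<in> pts C0"
    show "V x \<in> tangent C0 x"
    proof (cases "x \<in> B")
      case False
      then have "V x = 0" by (auto simp: V_def fun_eq_iff)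
      then show ?thesis using subspace_0[OF subspace_tangent[OF cC0]] by simp
    next
      case x: True
      have a: "A (\<pi> x) \<in> tangent S (\<pi> x)" by (rule vfieldsD(1)[OF A smooth_map_in[OF s\<pi> xp]])
      let ?a = "A (\<pi> x)" and ?z = "snd (\<Phi> x)" and ?s = "\<pi> x"
      show ?thesis
      proof (rule tangentI)
        fix f h c assume f: "f \<in> smooth_fun C0" and h: "h \<in> smooth_fun C0"
        have "(\<lambda>u. G (\<lambda>x. c * f x + h x) (u, ?z)) = (\<lambda>u. c * G f (u, ?z) + G h (u, ?z))"
          by (auto simp: G_def algebra_simps)
        then have "?a (\<lambda>u. G (\<lambda>x. c * f x + h x) (u, ?z)) = c * ?a (\<lambda>u. G f (u, ?z)) + ?a (\<lambda>u. G h (u, ?z))"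
          using tangent_linear[OF a Gs[OF f] Gs[OF h], of c ?z ?z] by simp
        then show "V x (\<lambda>x. c * f x + h x) = c * V x f + V x h"
          by (simp only: Vf[OF smooth_fun_linear[OF cC0 f h] x, of c] Vf[OF f x] Vf[OF h x]) (simp add: algebra_simps)
        let ?P = "\<lambda>u. G (\<lambda>x. f x * h x) (u, ?z)"
        have P: "?P \<in> smooth_fun S" by (rule Gs[OF smooth_fun_mult[OF cC0 f h]])
        \<comment> \<open>\<open>G (f h)\<close> carries one factor \<open>\<rho>\<close>, the product of \<open>G f\<close> and \<open>G h\<close> carries two\<close>
        have "(\<lambda>u. \<rho> u * ?P u) = (\<lambda>u. G f (u, ?z) * G h (u, ?z))"
          by (auto simp: G_def)
        then have "\<rho> ?s * ?a ?P + ?P ?s * ?a \<rho> = G f (?s, ?z) * ?a (\<lambda>u. G h (u, ?z)) + G h (?s, ?z) * ?a (\<lambda>u. G f (u, ?z))"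
          using tangent_mult[OF a \<rho> P] tangent_mult[OF a Gs[OF f] Gs[OF h], of ?z ?z] by simp
        then have "\<rho> ?s * ?a ?P = \<rho> ?s * f x * ?a (\<lambda>u. G h (u, ?z)) + \<rho> ?s * h x * ?a (\<lambda>u. G f (u, ?z)) - \<rho> ?s * (f x * h x) * ?a \<rho>"
          by (simp add: Gval[OF x])
        then show "V x (\<lambda>x. f x * h x) = f x * V x h + h x * V x f"
          by (simp only: Vf[OF smooth_fun_mult[OF cC0 f h] x] Vf[OF f x] Vf[OF h x]) (simp add: algebra_simps)
      qed (simp add: V_def)
    qed
  next
    fix x assume "x \<notin> pts C0"
    then show "V x = 0" by (auto simp: V_def B_def fun_eq_iff)
  next
    fix f assume f: "f \<in> smooth_fun C0"
    have "smooth_in C0 (pts C0) (\<lambda>x. V x f)"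
    proof (rule smooth_in_local[OF cC0])
      fix x assume x: "x \<in> pts C0"
      show "\<exists>W'. openin (mtop C0) W' \<and> x \<in> W' \<and> smooth_in C0 W' (\<lambda>x. V x f)"
      proof (cases "\<pi> x \<in> K")
        case True
        then have xB: "x \<in> B" using x K(2) by (auto simp: B_def)
        have "smooth_in ?Q ((U \<times> pts circle) \<inter> (U \<times> pts circle)) (L f)"
          by (rule smooth_in_subset[OF _ L[OF f]]) (use Up in auto)
        then have "smooth_in ?N (U \<times> pts circle) (L f)"
          unfolding NQ using smooth_in_open_submfd[OF cQ oUQ oUQ] by blast
        moreover have "openin (mtop ?N) (U \<times> pts circle)" using pN openin_topspace[of "mtop ?N"] by simp
        ultimately have "smooth_in ?B (\<Phi> -` (U \<times> pts circle)) (\<lambda>x. L f (\<Phi> x))"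
          by (intro smooth_in_pull[OF cB cN s\<Phi>])
        then have "smooth_in ?B B (\<lambda>x. L f (\<Phi> x))"
          by (rule smooth_in_subset[rotated]) (use \<Phi>in in auto)
        then have "smooth_in C0 B (\<lambda>x. L f (\<Phi> x))"
          using smooth_in_open_submfd[OF cC0 oB oB] by simp
        then have "smooth_in C0 B (\<lambda>x. V x f)"
          by (rule smooth_in_cong[OF cC0 oB, rotated]) (simp add: V_def f)
        then show ?thesis using oB xB by blast
      next
        case False
        have o: "openin (mtop C0) (pts C0 \<inter> \<pi> -` (pts S - K))"
          by (rule smooth_map_preimage_open[OF s\<pi>]) (use K(1) in \<open>simp add: closedin_def\<close>)
        have "smooth_in C0 (pts C0 \<inter> \<pi> -` (pts S - K)) (\<lambda>x. V x f)"
        proof (rule smooth_in_cong[OF cC0 o _ smooth_in_const[OF cC0 o, of 0]])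
          fix y assume y: "y \<in> pts C0 \<inter> \<pi> -` (pts S - K)"
          show "0 = V y f"
          proof (cases "y \<in> B")
            case True
            then show ?thesis using Vf[OF f True] \<rho>0[of "\<pi> y"] y by simp
          qed (simp add: V_def)
        qed
        then show ?thesis using o x False smooth_map_in[OF s\<pi> x] by blast
      qed
    qed simp
    moreover have "V x f = 0" if "x \<notin> pts C0" for x using that by (auto simp: V_def B_def)
    ultimately show "(\<lambda>x. V x f) \<in> smooth_fun C0" unfolding smooth_fun_iff[OF cC0] by blast
  qed
  have "push C0 S \<pi> (V x) = A (\<pi> x)" if xN: "x \<in> pts C0 \<inter> \<pi> -` W" for x
  proof
    fix f
    have xp: "x \<in> pts C0" and xB: "x \<in> B" using xN W(3) by (auto simp: B_def)
    have sp: "\<pi> x \<in> pts S" by (rule smooth_map_in[OF s\<pi> xp])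
    have a: "A (\<pi> x) \<in> tangent S (\<pi> x)" by (rule vfieldsD(1)[OF A sp])
    show "push C0 S \<pi> (V x) f = A (\<pi> x) f"
    proof (cases "f \<in> smooth_fun S")
      case True
      let ?f = "cut C0 (\<lambda>x. f (\<pi> x))"
      have f: "?f \<in> smooth_fun C0" by (rule smooth_fun_pull[OF cC0 cS s\<pi> True])
      have "G ?f (u, snd (\<Phi> x)) = \<rho> u * f u" for u
      proof (cases "u \<in> U")
        case uU: True
        then have p: "(u, snd (\<Phi> x)) \<in> U \<times> pts circle" using \<Phi>in[OF xB] by (auto simp: mem_Times_iff)
        then show ?thesis using \<pi>\<Psi>[OF p] \<Phi>\<Psi>(2)[OF p] by (auto simp: G_def cut_def B_def)
      next
        case False
        then show ?thesis using \<rho>0[of u] K(2) by (auto simp: G_def)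
      qed
      then have "A (\<pi> x) (\<lambda>u. G ?f (u, snd (\<Phi> x))) = A (\<pi> x) (\<lambda>u. \<rho> u * f u)" by simp
      also have "\<dots> = \<rho> (\<pi> x) * A (\<pi> x) f + f (\<pi> x) * A (\<pi> x) \<rho>" by (rule tangent_mult[OF a \<rho> True])
      finally have "V x ?f = A (\<pi> x) f"
        using Vf[OF f xB] \<rho>1[of "\<pi> x"] xN by (simp add: cut_def)
      then show ?thesis by (simp add: push_apply True)
    next
      case False
      then show ?thesis using vfield_off[OF A False] by (simp add: push_def)
    qed
  qed
  then show thesis
    using that[OF V smooth_map_preimage_open[OF s\<pi> W(1)]] x0 W(2) by blast
qed

definition hlift :: "'a vfield \<Rightarrow> 'c vfield" where
  "hlift A x = (if x \<in> pts C0 then THE w. w \<in> tangent C0 x \<and> push C0 S \<pi> w = A (\<pi> x) \<and> \<phi> x w = 0 else 0)"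

lemma hlift_eqI:
  assumes x: "x \<in> pts C0" and w: "w \<in> tangent C0 x" "push C0 S \<pi> w = A (\<pi> x)" "\<phi> x w = 0"
  shows "hlift A x = w"
proof -
  have "(THE w. w \<in> tangent C0 x \<and> push C0 S \<pi> w = A (\<pi> x) \<and> \<phi> x w = 0) = w"
  proof (rule the_equality)
    fix w' assume w': "w' \<in> tangent C0 x \<and> push C0 S \<pi> w' = A (\<pi> x) \<and> \<phi> x w' = 0"
    have e: "w' - w = (- 1) *\<^sub>R w + w'" by simp
    have "w' - w = 0"
    proof (rule uniq[OF x])
      show "w' - w \<in> tangent C0 x" using w w' by (intro subspace_diff subspace_tangent cC0) auto
      show "push C0 S \<pi> (w' - w) = 0" using w w' by (simp add: push_diff)
      show "\<phi> x (w' - w) = 0" unfolding e using \<phi>_linear[OF x w(1), of w' "- 1"] w w' by simp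
    qed
    then show "w' = w" by simp
  qed (use w in simp)
  then show ?thesis using x by (simp add: hlift_def)
qed

text \<open>Subtracting the vertical component from a local lift makes it horizontal; horizontal lifts are
  unique, so the local ones fit together.\<close>

lemma hlift:
  assumes A: "A \<in> vfields S"
  shows "hlift A \<in> vfields C0"
    and "x \<in> pts C0 \<Longrightarrow> push C0 S \<pi> (hlift A x) = A (\<pi> x)"
    and "x \<in> pts C0 \<Longrightarrow> \<phi> x (hlift A x) = 0"
proof -
  have loc: "\<exists>V N. V \<in> vfields C0 \<and> openin (mtop C0) N \<and> x0 \<in> N \<and> (\<forall>x\<in>N. hlift A x = (- ev1 C0 \<phi> V x) *\<^sub>R X0 x + V x
      \<and> push C0 S \<pi> (hlift A x) = A (\<pi> x) \<and> \<phi> x (hlift A x) = 0)"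
    if x0: "x0 \<in> pts C0" for x0
  proof -
    obtain V N where V: "V \<in> vfields C0" and N: "openin (mtop C0) N" "x0 \<in> N"
      and p: "\<And>x. x \<in> N \<Longrightarrow> push C0 S \<pi> (V x) = A (\<pi> x)"
      using local_lift[OF A x0] by metis
    have "hlift A x = (- ev1 C0 \<phi> V x) *\<^sub>R X0 x + V x \<and> push C0 S \<pi> (hlift A x) = A (\<pi> x) \<and> \<phi> x (hlift A x) = 0"
      if xN: "x \<in> N" for x
    proof -
      have x: "x \<in> pts C0" using xN openin_subset[OF N(1)] by blast
      let ?w = "(- ev1 C0 \<phi> V x) *\<^sub>R X0 x + V x"
      have 1: "?w \<in> tangent C0 x"
        by (intro subspace_add subspace_scale subspace_tangent cC0 vfieldsD(1)[OF X0_vfield x] vfieldsD(1)[OF V x])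
      have 2: "push C0 S \<pi> ?w = A (\<pi> x)"
        by (simp only: push_add push_scale X0_vertical[OF x] p[OF xN] scaleR_zero_right add_0_left)
      have 3: "\<phi> x ?w = 0"
        using \<phi>_linear[OF x vfieldsD(1)[OF X0_vfield x] vfieldsD(1)[OF V x], of "- ev1 C0 \<phi> V x"] \<phi>_X0[OF x]
        by (simp add: ev1_def cut_def x)
      show ?thesis using hlift_eqI[where A = A, OF x 1 2 3] 2 3 by simp
    qed
    then show ?thesis using V N by blast
  qed
  show "push C0 S \<pi> (hlift A x) = A (\<pi> x)" "\<phi> x (hlift A x) = 0" if "x \<in> pts C0" for x
    using loc[OF that] by blast+
  show "hlift A \<in> vfields C0"
  proof (rule vfieldsI)
    fix x assume x: "x \<in> pts C0"
    obtain V where V: "V \<in> vfields C0" "hlift A x = (- ev1 C0 \<phi> V x) *\<^sub>R X0 x + V x" using loc[OF x] by blast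
    show "hlift A x \<in> tangent C0 x" unfolding V(2)
      by (intro subspace_add subspace_scale subspace_tangent cC0 vfieldsD(1)[OF X0_vfield x] vfieldsD(1)[OF V(1) x])
  next
    fix f assume f: "f \<in> smooth_fun C0"
    have "smooth_in C0 (pts C0) (\<lambda>x. hlift A x f)"
    proof (rule smooth_in_local[OF cC0])
      fix x0 assume "x0 \<in> pts C0"
      then obtain V N where V: "V \<in> vfields C0" "openin (mtop C0) N" "x0 \<in> N"
        "\<forall>x\<in>N. hlift A x = (- ev1 C0 \<phi> V x) *\<^sub>R X0 x + V x" using loc by blast
      have "smooth_in C0 N (\<lambda>x. (- 1) * (ev1 C0 \<phi> V x * X0 x f) + V x f)"
        by (intro smooth_in_add smooth_in_mult smooth_in_const cC0 V(2) smooth_fun_in[OF cC0] openin_subset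
            \<phi>_smooth V(1) vfieldsD(3)[OF X0_vfield f] vfieldsD(3)[OF V(1) f])
      then have "smooth_in C0 N (\<lambda>x. hlift A x f)"
        by (rule smooth_in_cong[OF cC0 V(2), rotated]) (use V(4) in simp)
      then show "\<exists>W'. openin (mtop C0) W' \<and> x0 \<in> W' \<and> smooth_in C0 W' (\<lambda>x. hlift A x f)" using V by blast
    qed simp
    then show "(\<lambda>x. hlift A x f) \<in> smooth_fun C0" unfolding smooth_fun_iff[OF cC0] by (simp add: hlift_def)
  qed (simp add: hlift_def)
qed

end

section \<open>The frame of horizontal lifts on the cone\<close>

text \<open>The extension of S to a projective special Kaehler structure, with the existentially quantified
  data as parameters.\<close>

locale psk =
  fixes S :: "'a klg" and C0 :: "'c mfd" and \<pi> :: "'c \<Rightarrow> 'a"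
    and act :: "complex \<Rightarrow> 'c \<Rightarrow> 'c" and \<phi> :: "'c form1" and J :: "(real \<times> 'c) endo"
    and nabla :: "(real \<times> 'c) vfield \<Rightarrow> (real \<times> 'c) vfield \<Rightarrow> (real \<times> 'c) vfield"
  assumes S: "kaehler_lie_group S" and bdl: "principal_circle_bundle C0 S \<pi> act"
    and conn: "connection_form C0 act \<phi>"
    and d\<phi>: "has_d1 C0 \<phi> (\<lambda>x v w. 2 * kform (met S) (cpx S) (\<pi> x) (push C0 S \<pi> v) (push C0 S \<pi> w))"
    and pkC: "pseudo_kaehler (cone_mfd C0) (cone_metric S C0 \<pi> \<phi>) J"
    and omC: "\<And>p v w. p \<in> pts (cone_mfd C0) \<Longrightarrow> v \<in> tangent (cone_mfd C0) p \<Longrightarrow> w \<in> tangent (cone_mfd C0) p \<Longrightarrow>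
      cone_kform S C0 \<pi> \<phi> p v w = kform (cone_metric S C0 \<pi> \<phi>) J p v w"
    and JX: "app (cone_mfd C0) J (circle_generator (cone_mfd C0) (cone_act act)) = cone_t_ddt C0"
    and aff: "affine_connection (cone_mfd C0) nabla" and tors: "torsion_free (cone_mfd C0) nabla"
    and fl: "flat (cone_mfd C0) nabla" and par: "parallel2 (cone_mfd C0) nabla (cone_kform S C0 \<pi> \<phi>)"
    and spec: "\<And>A B. A \<in> vfields (cone_mfd C0) \<Longrightarrow> B \<in> vfields (cone_mfd C0) \<Longrightarrow>
      cov_endo (cone_mfd C0) nabla J A B = cov_endo (cone_mfd C0) nabla J B A"
    and nabX: "\<And>A. A \<in> vfields (cone_mfd C0) \<Longrightarrow>
      nabla A (circle_generator (cone_mfd C0) (cone_act act)) = (\<lambda>p f. - app (cone_mfd C0) J A p f)"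
begin

abbreviation "C \<equiv> cone_mfd C0"
abbreviation "X \<equiv> circle_generator C (cone_act act)"
abbreviation "E \<equiv> cone_t_ddt C0"
abbreviation "gC \<equiv> cone_metric S C0 \<pi> \<phi>"
abbreviation "\<omega>C \<equiv> cone_kform S C0 \<pi> \<phi>"
abbreviation "tC \<equiv> cut C fst"
abbreviation "base W \<equiv> push C S (\<lambda>q. \<pi> (snd q)) W"
abbreviation "mid W \<equiv> push C C0 snd W"
abbreviation "sC p \<equiv> \<pi> (snd p)"

lemma smooth_C0: "smooth_manifold C0" using bdl unfolding principal_circle_bundle_def by (elim conjE)
lemma charted_C0: "charted C0" by (rule smooth_manifold_charted[OF smooth_C0])
lemma cC: "charted C" by (rule charted_prod[OF charted_half_line charted_C0])
lemma cS': "charted S" by (rule klg_charted[OF S])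
lemma smooth_\<pi>: "smooth_map C0 S \<pi>" using bdl unfolding principal_circle_bundle_def by (elim conjE)
lemma smooth_snd: "smooth_map C C0 snd" by (rule smooth_map_snd[OF smooth_C0 charted_half_line])
lemma smooth_base: "smooth_map C S (\<lambda>q. \<pi> (snd q))"
  by (rule smooth_map_compose[OF cC charted_C0 cS' smooth_snd smooth_\<pi>])

lemma pts_C_iff: "p \<in> pts C \<longleftrightarrow> 0 < fst p \<and> snd p \<in> pts C0"
  by (cases p) (simp add: half_line_def)
lemma pts_half [simp]: "t \<in> pts half_line \<longleftrightarrow> 0 < t"
  by (simp add: half_line_def)
lemmas pts_C = pts_C_iff mem_Times_iff

lemma sC_in: "p \<in> pts C \<Longrightarrow> sC p \<in> pts S" by (rule smooth_map_in[OF smooth_base])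

lemma base_mid: "base W = push C0 S \<pi> (mid W)"
  by (rule push_compose[OF charted_C0 cS' smooth_snd smooth_\<pi>, symmetric])

lemma base_tangent: "p \<in> pts C \<Longrightarrow> W \<in> tangent C p \<Longrightarrow> base W \<in> tangent S (sC p)"
  by (rule push_tangent[OF cC cS' smooth_base])
lemma gC_eq: "gC p v w = (fst p)\<^sup>2 * met S (sC p) (base v) (base w)
    - (fst p)\<^sup>2 * (\<phi> (snd p) (mid v) * \<phi> (snd p) (mid w)) - v tC * w tC"
  by (simp add: cone_metric_def cone_pull_def cone_form_def cone_dt_def)

lemma \<omega>C_eq: "\<omega>C p v w = (fst p)\<^sup>2 * met S (sC p) (cpx S (sC p) (base v)) (base w)
    - fst p * (\<phi> (snd p) (mid v) * w tC - \<phi> (snd p) (mid w) * v tC)"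
  by (simp add: cone_kform_def cone_pull_def cone_form_def cone_dt_def kform_def wedge_def)

lemma \<omega>C_J: "p \<in> pts C \<Longrightarrow> v \<in> tangent C p \<Longrightarrow> w \<in> tangent C p \<Longrightarrow> \<omega>C p v w = gC p (J p v) w"
  using omC by (simp add: kform_def)

lemma met_zero1: "s \<in> pts S \<Longrightarrow> u \<in> tangent S s \<Longrightarrow> met S s 0 u = 0"
  using met_linear1[OF S, of s u 0 0 1] subspace_0[OF subspace_tangent[OF cS']] by simp

text \<open>A vector of the cone is determined by its base, vertical and radial components, because these are all
  that the non-degenerate cone metric sees of it.\<close>

lemma unique_C:
  assumes p: "p \<in> pts C" and W: "W \<in> tangent C p" and z: "base W = 0" "\<phi> (snd p) (mid W) = 0" "W tC = 0"
  shows "W = 0"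
proof (rule pk_nondeg[OF pkC p W])
  fix w assume w: "w \<in> tangent C p"
  show "gC p W w = 0" using met_zero1[OF sC_in[OF p] base_tangent[OF p w]] z by (simp add: gC_eq)
qed

lemma smooth_tC: "tC \<in> smooth_fun C"
proof (rule smooth_fun_cutI[OF cC])
  have o: "openin (mtop half_line) {0<..}" by (simp add: half_line_def)
  have "smooth_in half_line {0<..} (\<lambda>t. t)"
  proof (rule smooth_inI)
    fix U \<psi> assume U: "(U, \<psi>) \<in> atlas half_line"
    then have e: "\<psi> = (\<lambda>t k. if k = 0 then t else 0)" by (simp add: half_line_def)
    note oi = chart_image_open[OF charted_half_line U o]
    show "Cinf_on (mdim half_line) (\<psi> ` (U \<inter> {0<..})) (inv_into U \<psi>)"
    proof (rule Cinf_cong[OF oi _ Cinf_coord[OF oi, of 0]])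
      fix y assume "y \<in> \<psi> ` (U \<inter> {0<..})"
      then obtain t where t: "t \<in> U" "y = \<psi> t" by blast
      then show "y 0 = inv_into U \<psi> y" using chart_inv[OF charted_half_line U t(1)] by (simp add: e)
    qed
  qed
  from smooth_in_fst[OF charted_half_line charted_C0 o this]
  show "smooth_in C (pts C) fst" by (simp add: half_line_def)
qed

lemma slice_C: "0 < t \<Longrightarrow> smooth_map C0 C (\<lambda>y. (t, y))"
  by (rule slice_snd[OF charted_half_line smooth_C0]) (simp add: half_line_def)

lemma mid_slice:
  assumes t: "0 < t" and x: "x \<in> pts C0" and v: "v \<in> tangent C0 x"
  shows "mid (push C0 C (\<lambda>y. (t, y)) v) = v"
  using push_compose[OF cC charted_C0 slice_C[OF t] smooth_snd, of v] push_id[OF charted_C0 v] by simp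

lemma slice_tC:
  assumes t: "0 < t" and x: "x \<in> pts C0" and v: "v \<in> tangent C0 x"
  shows "push C0 C (\<lambda>y. (t, y)) v tC = 0"
proof -
  have "cut C0 (\<lambda>y. tC (t, y)) = cut C0 (\<lambda>_. t)"
    using t by (auto simp: cut_def pts_C fun_eq_iff)
  then show ?thesis using tangent_const[OF charted_C0 v x, of t] smooth_tC by (simp add: push_apply)
qed

text \<open>Embed the bundle in the cone at \<open>t = 1\<close>.\<close>

lemma unique_C0:
  assumes x: "x \<in> pts C0" and v: "v \<in> tangent C0 x" and z: "push C0 S \<pi> v = 0" "\<phi> x v = 0"
  shows "v = 0"
proof -
  let ?W = "push C0 C (\<lambda>y. (1, y)) v"
  have p: "(1, x) \<in> pts C" using x by (simp add: pts_C)
  have W: "?W \<in> tangent C (1, x)"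
    using push_tangent[OF charted_C0 cC slice_C x v, of 1] by simp
  have m: "mid ?W = v" by (rule mid_slice[OF _ x v]) simp
  have "?W = 0"
    by (rule unique_C[OF p W]) (use z m slice_tC[OF _ x v, of 1] in \<open>simp_all add: base_mid\<close>)
  then show ?thesis using m by simp
qed

end

sublocale psk \<subseteq> circle_bundle C0 S \<pi> act \<phi>
  by standard (use klg_smooth[OF S] bdl conn unique_C0 in auto)

context psk
begin

text \<open>The field on the cone that is tangent to the slices of constant t and equals Y on each of them.\<close>

definition clift :: "'c vfield \<Rightarrow> (real \<times> 'c) vfield" where
  "clift Y p f = (if f \<in> smooth_fun C then Y (snd p) (\<lambda>y. f (fst p, y)) else 0)"

lemma slice_fun: "f \<in> smooth_fun C \<Longrightarrow> (\<lambda>y. f (t, y)) \<in> smooth_fun C0"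
  by (rule smooth_fun_slice_snd[OF charted_half_line smooth_C0])

lemma clift_off:
  assumes Y: "Y \<in> vfields C0" and p: "p \<notin> pts C"
  shows "clift Y p = 0"
proof
  fix f :: "real \<times> 'c \<Rightarrow> real"
  show "clift Y p f = 0 f"
  proof (cases "f \<in> smooth_fun C \<and> snd p \<in> pts C0")
    case True
    then have f: "f \<in> smooth_fun C" and x: "snd p \<in> pts C0" by auto
    have "(fst p, y) \<notin> pts C" for y using p x by (simp add: pts_C)
    then have "f (fst p, y) = 0" for y by (rule smooth_fun_off[OF cC f])
    then have "(\<lambda>y. f (fst p, y)) = (\<lambda>_. 0)" by simp
    then show ?thesis using tangent_zero[OF charted_C0 vfieldsD(1)[OF Y x]] by (simp add: clift_def)
  next
    case False
    then show ?thesis using vfieldsD(2)[OF Y] by (auto simp: clift_def)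
  qed
qed

lemma clift_push: "p \<in> pts C \<Longrightarrow> clift Y p = push C0 C (\<lambda>y. (fst p, y)) (Y (snd p))"
proof
  fix f assume p: "p \<in> pts C"
  show "clift Y p f = push C0 C (\<lambda>y. (fst p, y)) (Y (snd p)) f"
    using cut_smooth[OF charted_C0 slice_fun] by (auto simp: clift_def push_def)
qed

lemma clift_vfield:
  assumes Y: "Y \<in> vfields C0" shows "clift Y \<in> vfields C"
proof (rule vfieldsI)
  fix p assume p: "p \<in> pts C"
  then have "0 < fst p" "snd p \<in> pts C0" by (simp_all add: pts_C)
  from push_tangent[OF charted_C0 cC slice_C[OF this(1)] this(2) vfieldsD(1)[OF Y this(2)]]
  show "clift Y p \<in> tangent C p" by (simp add: clift_push[OF p])
next
  fix f assume f: "f \<in> smooth_fun C"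
  from vfield_snd[OF charted_half_line smooth_C0 Y f] show "(\<lambda>p. clift Y p f) \<in> smooth_fun C"
    using f by (simp add: clift_def)
qed (rule clift_off[OF Y])

lemma clift_mid: "Y \<in> vfields C0 \<Longrightarrow> p \<in> pts C \<Longrightarrow> mid (clift Y p) = Y (snd p)"
  using mid_slice[of "fst p" "snd p" "Y (snd p)"] vfieldsD(1)[of Y C0 "snd p"] by (simp add: clift_push pts_C)
lemma clift_base: "Y \<in> vfields C0 \<Longrightarrow> p \<in> pts C \<Longrightarrow> base (clift Y p) = push C0 S \<pi> (Y (snd p))"
  by (simp add: base_mid clift_mid)
lemma clift_tC: "Y \<in> vfields C0 \<Longrightarrow> clift Y p tC = 0"
proof (cases "p \<in> pts C")
  assume Y: "Y \<in> vfields C0"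
  case True
  then show ?thesis using slice_tC[of "fst p" "snd p"] vfieldsD(1)[OF Y] by (simp add: clift_push pts_C)
qed (simp add: clift_off)

lemma clift_lin: "clift (c *\<^sub>R Y + Z) = c *\<^sub>R clift Y + clift Z"
  by (auto simp: clift_def fun_eq_iff)

lemma clift_zero: "clift 0 = 0" by (auto simp: clift_def fun_eq_iff)

lemma clift_bracket:
  assumes Y: "Y \<in> vfields C0" and Z: "Z \<in> vfields C0"
  shows "bracket (clift Y) (clift Z) = clift (bracket Y Z)"
proof (intro ext)
  fix p f
  show "bracket (clift Y) (clift Z) p f = clift (bracket Y Z) p f"
  proof (cases "f \<in> smooth_fun C")
    case True
    note s = vfieldsD(3)[OF clift_vfield[OF Y] True] vfieldsD(3)[OF clift_vfield[OF Z] True]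
    have "clift Y p (\<lambda>q. clift Z q f) = Y (snd p) (\<lambda>y. Z y (\<lambda>y. f (fst p, y)))"
      unfolding clift_def[of Y] using s(2) by (simp add: clift_def True)
    moreover have "clift Z p (\<lambda>q. clift Y q f) = Z (snd p) (\<lambda>y. Y y (\<lambda>y. f (fst p, y)))"
      unfolding clift_def[of Z] using s(1) by (simp add: clift_def True)
    ultimately show ?thesis unfolding bracket_def clift_def[of "\<lambda>x f. Y x (\<lambda>y. Z y f) - Z x (\<lambda>y. Y y f)"] by (simp only: True if_True)
  next
    case False
    then show ?thesis using vfield_off[OF bracket_vfields[OF cC clift_vfield[OF Y] clift_vfield[OF Z]] False]
      by (simp add: clift_def)
  qed
qed

text \<open>The circle acts on the second component of the cone only.\<close>

lemma X_clift: "X = clift X0"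
proof (intro ext)
  fix p f
  show "X p f = clift X0 p f"
  proof (cases "f \<in> smooth_fun C")
    case f: True
    show ?thesis
    proof (cases "p \<in> pts C")
      case True
      then show ?thesis using f slice_fun[OF f]
        by (cases p) (simp add: circle_generator_def clift_def cone_act_def pts_C)
    next
      case False
      then show ?thesis using clift_off[OF X0_vfield False] by (simp add: circle_generator_def)
    qed
  qed (simp add: circle_generator_def clift_def)
qed

lemma X_vf: "X \<in> vfields C" unfolding X_clift by (rule clift_vfield[OF X0_vfield])
lemma E_vf: "E \<in> vfields C" using pk_J_field[OF pkC X_vf] JX by simp

lemma X_comp:
  assumes "p \<in> pts C" shows "base (X p) = 0" "\<phi> (snd p) (mid (X p)) = 1" "X p tC = 0"
  using assms unfolding X_clift
  by (simp_all add: clift_base clift_mid clift_tC X0_vfield X0_vertical \<phi>_X0 pts_C)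

lemma E_tC: "p \<in> pts C \<Longrightarrow> E p tC = fst p"
proof -
  assume p: "p \<in> pts C"
  obtain t x where tx: "p = (t, x)" by (cases p)
  have t: "0 < t" and x: "x \<in> pts C0" using p by (simp_all add: tx pts_C)
  have "eventually (\<lambda>s. tC (s, x) = s) (nhds t)"
    using eventually_nhds_in_open[of "{0<..}" t] t x by (auto simp: cut_def pts_C elim: eventually_mono)
  then have "((\<lambda>s. tC (s, x)) has_real_derivative 1) (at t)"
    using DERIV_cong_ev[of t t "\<lambda>s. tC (s, x)" "\<lambda>s. s" 1 1] by simp
  then have "deriv (\<lambda>s. tC (s, x)) t = 1" by (rule DERIV_imp_deriv)
  then show ?thesis using p smooth_tC by (simp add: cone_t_ddt_def tx)
qed

lemma E_mid: "p \<in> pts C \<Longrightarrow> mid (E p) = 0"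
proof
  fix f assume p: "p \<in> pts C"
  obtain t x where tx: "p = (t, x)" by (cases p)
  have t: "0 < t" and x: "x \<in> pts C0" using p by (simp_all add: tx pts_C)
  show "mid (E p) f = 0 f"
  proof (cases "f \<in> smooth_fun C0")
    case True
    have "eventually (\<lambda>s. 0 < s) (nhds t)" using eventually_nhds_in_open[of "{0<..}" t] t by simp
    then have "eventually (\<lambda>s. cut C (\<lambda>q. f (snd q)) (s, x) = f x) (nhds t)"
      by (rule eventually_mono) (use x in \<open>simp add: cut_def pts_C_iff\<close>)
    then have "((\<lambda>s. cut C (\<lambda>q. f (snd q)) (s, x)) has_real_derivative 0) (at t)"
      using DERIV_cong_ev[of t t "\<lambda>s. cut C (\<lambda>q. f (snd q)) (s, x)" "\<lambda>s. f x" 0 0] by simp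
    then have "deriv (\<lambda>s. cut C (\<lambda>q. f (snd q)) (s, x)) t = 0" by (rule DERIV_imp_deriv)
    then show ?thesis using True by (simp add: push_apply cone_t_ddt_def tx)
  qed (simp add: push_def)
qed

lemma \<phi>_zero: "x \<in> pts C0 \<Longrightarrow> \<phi> x 0 = 0"
  by (rule form_zero[OF charted_C0 \<phi>_form])

lemma E_comp:
  assumes "p \<in> pts C" shows "base (E p) = 0" "\<phi> (snd p) (mid (E p)) = 0" "E p tC = fst p"
  using assms E_mid[OF assms] E_tC[OF assms] \<phi>_zero by (simp_all add: base_mid pts_C)

definition h0 :: "'a tvec \<Rightarrow> 'c vfield" where "h0 a = hlift (linv S a)"
definition e :: "'a tvec \<Rightarrow> (real \<times> 'c) vfield" where "e a = clift (h0 a)"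

lemma h0: assumes a: "a \<in> alg S"
  shows "h0 a \<in> vfields C0" "x \<in> pts C0 \<Longrightarrow> push C0 S \<pi> (h0 a x) = linv S a (\<pi> x)" "x \<in> pts C0 \<Longrightarrow> \<phi> x (h0 a x) = 0"
  unfolding h0_def using hlift[OF linv_vfield[OF S a]] by blast+

lemma h0_eqI: "x \<in> pts C0 \<Longrightarrow> w \<in> tangent C0 x \<Longrightarrow> push C0 S \<pi> w = linv S a (\<pi> x) \<Longrightarrow> \<phi> x w = 0 \<Longrightarrow> h0 a x = w"
  unfolding h0_def by (rule hlift_eqI)

lemma h0_lin: assumes a: "a \<in> alg S" and b: "b \<in> alg S" shows "h0 (c *\<^sub>R a + b) = c *\<^sub>R h0 a + h0 b"
proof
  fix x show "h0 (c *\<^sub>R a + b) x = (c *\<^sub>R h0 a + h0 b) x"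
  proof (cases "x \<in> pts C0")
    case True
    note ta = vfieldsD(1)[OF h0(1)[OF a] True] and tb = vfieldsD(1)[OF h0(1)[OF b] True]
    have "h0 (c *\<^sub>R a + b) x = c *\<^sub>R h0 a x + h0 b x"
    proof (rule h0_eqI[OF True])
      show "c *\<^sub>R h0 a x + h0 b x \<in> tangent C0 x" by (intro subspace_add subspace_scale subspace_tangent cC0 ta tb)
      show "push C0 S \<pi> (c *\<^sub>R h0 a x + h0 b x) = linv S (c *\<^sub>R a + b) (\<pi> x)"
        by (simp only: push_add push_scale h0(2)[OF a True] h0(2)[OF b True] linv_add[OF S] linv_scale[OF S]) simp
      show "\<phi> x (c *\<^sub>R h0 a x + h0 b x) = 0" using \<phi>_linear[OF True ta tb] h0(3)[OF a True] h0(3)[OF b True] by simp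
    qed
    then show ?thesis by simp
  qed (simp add: h0_def hlift_def)
qed

lemma e_vf: "a \<in> alg S \<Longrightarrow> e a \<in> vfields C" unfolding e_def by (rule clift_vfield[OF h0(1)])
lemma e_lin: "a \<in> alg S \<Longrightarrow> b \<in> alg S \<Longrightarrow> e (c *\<^sub>R a + b) = c *\<^sub>R e a + e b"
  unfolding e_def by (simp add: h0_lin clift_lin)
lemma e_comp:
  assumes "a \<in> alg S" "p \<in> pts C"
  shows "base (e a p) = linv S a (sC p)" "\<phi> (snd p) (mid (e a p)) = 0"
  using assms h0(1)[OF assms(1)] h0(2,3)[OF assms(1), of "snd p"] by (simp_all add: e_def clift_base clift_mid pts_C)
lemma e_tC: "a \<in> alg S \<Longrightarrow> e a p tC = 0" by (simp add: e_def clift_tC h0)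

lemma alg_closed:
  shows "a \<in> alg S \<Longrightarrow> b \<in> alg S \<Longrightarrow> a + b \<in> alg S" "a \<in> alg S \<Longrightarrow> c *\<^sub>R a \<in> alg S" "a \<in> alg S \<Longrightarrow> - a \<in> alg S" "0 \<in> alg S"
  using subspace_alg[OF S] by (auto simp: subspace_add subspace_scale subspace_neg subspace_0)

lemma e_neg: "a \<in> alg S \<Longrightarrow> e (- a) = - e a"
  using e_lin[of a 0 "- 1"] e_lin[of 0 0 1] alg_closed(4) by simp

text \<open>The bracket of two horizontal lifts lifts the bracket; its vertical component is the negative of
  \<open>d\<phi>\<close>, that is \<open>- 2 \<omega>\<close>.\<close>

lemma h0_bracket:
  assumes a: "a \<in> alg S" and b: "b \<in> alg S"
  shows "bracket (h0 a) (h0 b) = (- 2 * gT S (JT S a) b) *\<^sub>R X0 + h0 (lie S a b)"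
proof
  fix x show "bracket (h0 a) (h0 b) x = ((- 2 * gT S (JT S a) b) *\<^sub>R X0 + h0 (lie S a b)) x"
  proof (cases "x \<in> pts C0")
    case x: True
    have bv: "bracket (h0 a) (h0 b) \<in> vfields C0" by (rule bracket_vfields[OF cC0 h0(1)[OF a] h0(1)[OF b]])
    have l: "lie S a b \<in> alg S" by (rule lie_alg[OF S a b])
    let ?k = "2 * gT S (JT S a) b"
    have sp: "\<pi> x \<in> pts S" by (rule smooth_map_in[OF smooth_\<pi> x])
    note bt = vfieldsD(1)[OF bv x] and xt = vfieldsD(1)[OF X0_vfield x]
    have r: "related C0 S \<pi> (h0 u) (linv S u)" if "u \<in> alg S" for u
      unfolding related_def using h0(2)[OF that] by blast
    have "related C0 S \<pi> (bracket (h0 a) (h0 b)) (bracket (linv S a) (linv S b))"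
      by (rule related_bracket[OF smooth_\<pi> h0(1)[OF a] h0(1)[OF b] linv_vfield[OF S a] linv_vfield[OF S b] r[OF a] r[OF b] cS'])
    then have p1: "push C0 S \<pi> (bracket (h0 a) (h0 b) x) = linv S (lie S a b) (\<pi> x)"
      using x by (simp add: related_def bracket_linv[OF S a b])
    have z: "ev1 C0 \<phi> (h0 u) = (\<lambda>_. 0)" if "u \<in> alg S" for u
      using h0(3)[OF that] by (auto simp: ev1_def cut_def)
    have "d1 C0 \<phi> (h0 a) (h0 b) x = 2 * kform (met S) (cpx S) (\<pi> x) (push C0 S \<pi> (h0 a x)) (push C0 S \<pi> (h0 b x))"
      using d\<phi> h0(1)[OF a] h0(1)[OF b] x unfolding has_d1_def by blast
    also have "\<dots> = ?k"
      using h0(2)[OF a x] h0(2)[OF b x] cpx_linv[OF S sp a] met_linv[OF S sp JT_alg[OF S a] b] by (simp add: kform_def)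
    finally have p2: "\<phi> x (bracket (h0 a) (h0 b) x) = - ?k"
      using tangent_zero[OF cC0 vfieldsD(1)[OF h0(1)[OF a] x]] tangent_zero[OF cC0 vfieldsD(1)[OF h0(1)[OF b] x]]
      by (simp add: d1_def z[OF a] z[OF b])
    have "h0 (lie S a b) x = ?k *\<^sub>R X0 x + bracket (h0 a) (h0 b) x"
    proof (rule h0_eqI[OF x])
      show "?k *\<^sub>R X0 x + bracket (h0 a) (h0 b) x \<in> tangent C0 x" by (intro subspace_add subspace_scale subspace_tangent cC0 bt xt)
      show "push C0 S \<pi> (?k *\<^sub>R X0 x + bracket (h0 a) (h0 b) x) = linv S (lie S a b) (\<pi> x)"
        by (simp only: push_add push_scale X0_vertical[OF x] p1) simp
      show "\<phi> x (?k *\<^sub>R X0 x + bracket (h0 a) (h0 b) x) = 0" using \<phi>_linear[OF x xt bt] \<phi>_X0[OF x] p2 by simp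
    qed
    then show ?thesis by simp
  next
    case False
    have "bracket (h0 a) (h0 b) x = 0" by (rule vfieldsD(2)[OF bracket_vfields[OF cC0 h0(1)[OF a] h0(1)[OF b]] False])
    then show ?thesis using vfieldsD(2)[OF X0_vfield False] vfieldsD(2)[OF h0(1)[OF lie_alg[OF S a b]] False] by simp
  qed
qed

lemma e_bracket:
  assumes a: "a \<in> alg S" and b: "b \<in> alg S"
  shows "bracket (e a) (e b) = (- 2 * gT S (JT S a) b) *\<^sub>R X + e (lie S a b)"
  unfolding e_def clift_bracket[OF h0(1)[OF a] h0(1)[OF b]] h0_bracket[OF a b] clift_lin X_clift ..

lemma zero_vf: "0 \<in> vfields S" by (rule vfields_zero[OF cS'])

text \<open>The bracket projects to 0, and \<open>d\<phi>\<close> has no vertical component.\<close>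

lemma X_e_bracket:
  assumes a: "a \<in> alg S" shows "bracket X (e a) = 0"
proof -
  have "bracket X0 (h0 a) x = 0" for x
  proof (cases "x \<in> pts C0")
    case x: True
    have bv: "bracket X0 (h0 a) \<in> vfields C0" by (rule bracket_vfields[OF cC0 X0_vfield h0(1)[OF a]])
    have "related C0 S \<pi> (bracket X0 (h0 a)) (bracket 0 (linv S a))"
      by (rule related_bracket[OF smooth_\<pi> X0_vfield h0(1)[OF a] zero_vf linv_vfield[OF S a] _ _ cS'])
        (simp_all add: related_def X0_vertical h0(2)[OF a])
    moreover have "bracket 0 (linv S a) (\<pi> x) = 0"
      using tangent_zero[OF cS' vfieldsD(1)[OF linv_vfield[OF S a] smooth_map_in[OF smooth_\<pi> x]]]
      by (auto simp: bracket_def fun_eq_iff)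
    ultimately have p1: "push C0 S \<pi> (bracket X0 (h0 a) x) = 0" using x by (simp add: related_def)
    have z: "ev1 C0 \<phi> (h0 a) = (\<lambda>_. 0)" "ev1 C0 \<phi> X0 = cut C0 (\<lambda>_. 1)"
      using h0(3)[OF a] \<phi>_X0 by (auto simp: ev1_def cut_def)
    have "d1 C0 \<phi> X0 (h0 a) x = 2 * kform (met S) (cpx S) (\<pi> x) (push C0 S \<pi> (X0 x)) (push C0 S \<pi> (h0 a x))"
      using d\<phi> h0(1)[OF a] X0_vfield x unfolding has_d1_def by blast
    also have "\<dots> = 0"
    proof -
      have sp: "\<pi> x \<in> pts S" by (rule smooth_map_in[OF smooth_\<pi> x])
      have 0: "0 \<in> tangent S (\<pi> x)" by (rule subspace_0[OF subspace_tangent[OF cS']])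
      have "cpx S (\<pi> x) 0 = 0" using cpx_linear[OF S sp 0 0, of 1] by simp
      then show ?thesis using X0_vertical[OF x] h0(2)[OF a x] met_zero1[OF sp linv_tangent[OF S a sp]] by (simp add: kform_def)
    qed
    finally have p2: "\<phi> x (bracket X0 (h0 a) x) = 0"
      using tangent_zero[OF cC0 vfieldsD(1)[OF X0_vfield x]] tangent_const[OF cC0 vfieldsD(1)[OF h0(1)[OF a] x] x]
      by (simp add: d1_def z)
    show ?thesis by (rule unique_C0[OF x vfieldsD(1)[OF bv x] p1 p2])
  next
    case False
    then show ?thesis by (rule vfieldsD(2)[OF bracket_vfields[OF cC0 X0_vfield h0(1)[OF a]]])
  qed
  then have "bracket X0 (h0 a) = 0" by (simp add: fun_eq_iff)
  then show ?thesis unfolding e_def X_clift clift_bracket[OF X0_vfield h0(1)[OF a]] by (simp add: clift_zero)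
qed

end

section \<open>The special connection in the horizontal frame\<close>

text \<open>Membership in the cone is treated as an atomic fact from here on, not as membership in a Cartesian
  product.\<close>

declare prod_mfd_simps [simp del]

lemma klg_hermitian_lie:
  assumes G: "kaehler_lie_group G" shows "hermitian_lie (alg G) (gT G) (JT G) (lie G)"
proof
  show "subspace (alg G)" by (rule subspace_alg[OF G])
  fix u v w :: "'a tvec" and c :: real
  note one = klg_one[OF G]
  show "gT G (c *\<^sub>R v + w) u = c * gT G v u + gT G w u" if "u \<in> alg G" "v \<in> alg G" "w \<in> alg G"
    unfolding gT_def by (rule met_linear1[OF G one that])
  show "gT G v w = gT G w v" if "v \<in> alg G" "w \<in> alg G"
    unfolding gT_def by (rule met_sym[OF G one that])
  show "0 < gT G v v" if "v \<in> alg G" "v \<noteq> 0"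
    unfolding gT_def by (rule met_pos[OF G one that])
  show "JT G v \<in> alg G" if "v \<in> alg G" by (rule JT_alg[OF G that])
  show "JT G (c *\<^sub>R v + w) = c *\<^sub>R JT G v + JT G w" if "v \<in> alg G" "w \<in> alg G"
    unfolding JT_def by (rule cpx_linear[OF G one that])
  show "JT G (JT G v) = - v" if "v \<in> alg G"
    unfolding JT_def by (rule cpx_cpx[OF G one that])
  show "gT G (JT G v) (JT G w) = gT G v w" if "v \<in> alg G" "w \<in> alg G"
    unfolding gT_def JT_def by (rule met_cpx[OF G one that])
  show "lie G v w \<in> alg G" if "v \<in> alg G" "w \<in> alg G" by (rule lie_alg[OF G that])
  show "lie G (c *\<^sub>R v + w) u = c *\<^sub>R lie G v u + lie G w u" if "u \<in> alg G" "v \<in> alg G" "w \<in> alg G"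
    by (rule lie_left[OF G that(2,3,1)])
  show "lie G w v = - lie G v w" if "v \<in> alg G" "w \<in> alg G" by (rule lie_swap[OF G])
qed

lemma ev2_at: "p \<in> pts M \<Longrightarrow> ev2 M b A B p = b p (A p) (B p)"
  and ev2_off: "p \<notin> pts M \<Longrightarrow> ev2 M b A B p = 0"
  and app_at: "p \<in> pts M \<Longrightarrow> app M I A p = I p (A p)"
  by (simp_all add: ev2_def app_def cut_def)

context psk
begin

interpretation L: hermitian_lie "alg S" "gT S" "JT S" "lie S" by (rule klg_hermitian_lie[OF S])

lemma nab_vf: "A \<in> vfields C \<Longrightarrow> B \<in> vfields C \<Longrightarrow> nabla A B \<in> vfields C"
  using aff unfolding affine_connection_def by blast

lemma aff_rules:
  assumes "A \<in> vfields C" "B \<in> vfields C" "D \<in> vfields C" "h \<in> smooth_fun C"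
  shows "nabla (\<lambda>p f. h p * A p f + B p f) D = (\<lambda>p f. h p * nabla A D p f + nabla B D p f)"
    "nabla A (\<lambda>p f. h p * B p f + D p f) = (\<lambda>p f. A p h * B p f + h p * nabla A B p f + nabla A D p f)"
  using bspec[OF bspec[OF conjunct2[OF bspec[OF bspec[OF aff[unfolded affine_connection_def] assms(1)] assms(2)]] assms(3)] assms(4)]
  by simp_all

lemma cut_const_field:
  assumes A: "A \<in> vfields C"
  shows "(\<lambda>p f. cut C (\<lambda>_. c) p * A p f + B p f) = c *\<^sub>R A + B"
proof (intro ext)
  fix p f show "cut C (\<lambda>_. c) p * A p f + B p f = (c *\<^sub>R A + B) p f"
    using vfieldsD(2)[OF A, of p] by (cases "p \<in> pts C") (simp_all add: cut_def)
qed

lemma nab_lin1: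
  assumes "A \<in> vfields C" "B \<in> vfields C" "D \<in> vfields C"
  shows "nabla (c *\<^sub>R A + B) D = c *\<^sub>R nabla A D + nabla B D"
  using aff_rules(1)[OF assms smooth_fun_const[OF cC, of c]]
  unfolding cut_const_field[OF assms(1)] cut_const_field[OF nab_vf[OF assms(1,3)]] .

lemma nab_lin2:
  assumes "A \<in> vfields C" "B \<in> vfields C" "D \<in> vfields C"
  shows "nabla A (c *\<^sub>R B + D) = c *\<^sub>R nabla A B + nabla A D"
proof -
  have "A p (cut C (\<lambda>_. c)) = 0" for p
    using tangent_const[OF cC vfieldsD(1)[OF assms(1)], of p] vfieldsD(2)[OF assms(1), of p] by (cases "p \<in> pts C") auto
  then have "nabla A (c *\<^sub>R B + D) = (\<lambda>p f. cut C (\<lambda>_. c) p * nabla A B p f + nabla A D p f)"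
    using aff_rules(2)[OF assms smooth_fun_const[OF cC, of c]] unfolding cut_const_field[OF assms(2)] by simp
  then show ?thesis unfolding cut_const_field[OF nab_vf[OF assms(1,2)]] .
qed

lemma nab_swap:
  assumes "A \<in> vfields C" "B \<in> vfields C" shows "nabla A B = nabla B A + bracket A B"
proof (intro ext)
  fix p f
  have "nabla A B p f - nabla B A p f = bracket A B p f"
    using tors assms unfolding torsion_free_def by blast
  then show "nabla A B p f = (nabla B A + bracket A B) p f" by simp
qed

lemma alg_J: "a \<in> alg S \<Longrightarrow> JT S a \<in> alg S" by (rule JT_alg[OF S])
lemma alg_lie: "a \<in> alg S \<Longrightarrow> b \<in> alg S \<Longrightarrow> lie S a b \<in> alg S" by (rule lie_alg[OF S])

lemma met_zero2: "s \<in> pts S \<Longrightarrow> u \<in> tangent S s \<Longrightarrow> met S s u 0 = 0"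
  using met_sym[OF S, of s u 0] met_zero1[of s u] subspace_0[OF subspace_tangent[OF cS']] by simp

lemma \<omega>C_lin:
  assumes "p \<in> pts C" "v \<in> tangent C p" "w \<in> tangent C p" "u \<in> tangent C p"
  shows "\<omega>C p (c *\<^sub>R v + w) u = c * \<omega>C p v u + \<omega>C p w u"
proof -
  have "c *\<^sub>R v + w \<in> tangent C p" using assms by (intro subspace_add subspace_scale subspace_tangent cC)
  then show ?thesis
    using assms pk_linear[OF pkC assms(1,4) pk_J_tangent[OF pkC assms(1,2)] pk_J_tangent[OF pkC assms(1,3)]]
    by (simp add: \<omega>C_J pk_J_linear[OF pkC])
qed

lemma e_tan: "a \<in> alg S \<Longrightarrow> p \<in> pts C \<Longrightarrow> e a p \<in> tangent C p" by (rule vfieldsD(1)[OF e_vf])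

lemma J_e:
  assumes a: "a \<in> alg S" and p: "p \<in> pts C" shows "J p (e a p) = e (JT S a) p"
proof -
  note j = pk_J_tangent[OF pkC p e_tan[OF a p]] and k = e_tan[OF alg_J[OF a] p]
  have "(- 1) *\<^sub>R e (JT S a) p + J p (e a p) = 0"
  proof (rule pk_nondeg[OF pkC p])
    show "(- 1) *\<^sub>R e (JT S a) p + J p (e a p) \<in> tangent C p"
      by (intro subspace_add subspace_scale subspace_tangent cC j k)
    fix w assume w: "w \<in> tangent C p"
    have "gC p (J p (e a p)) w = gC p (e (JT S a) p) w"
      using \<omega>C_J[OF p e_tan[OF a p] w] e_comp[OF a p] e_comp[OF alg_J[OF a] p] cpx_linv[OF S sC_in[OF p] a]
      by (simp add: \<omega>C_eq gC_eq e_tC a alg_J)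
    then show "gC p ((- 1) *\<^sub>R e (JT S a) p + J p (e a p)) w = 0"
      using pk_linear[OF pkC p w k j, of "- 1"] by simp
  qed
  then show ?thesis by (simp add: algebra_simps)
qed

lemma app_e: assumes a: "a \<in> alg S" shows "app C J (e a) = e (JT S a)"
proof
  fix p show "app C J (e a) p = e (JT S a) p"
    using J_e[OF a, of p] vfieldsD(2)[OF e_vf[OF alg_J[OF a]], of p]
    by (cases "p \<in> pts C") (simp_all add: app_def zero_fun_def)
qed

lemma nab_e_X: "a \<in> alg S \<Longrightarrow> nabla (e a) X = - e (JT S a)"
  using nabX[OF e_vf] app_e by (simp add: fun_eq_iff)

lemma nab_X_e: "a \<in> alg S \<Longrightarrow> nabla X (e a) = - e (JT S a)"
  using nab_swap[OF X_vf e_vf] nab_e_X X_e_bracket by simp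

lemma cov_endo_eq: "cov_endo C nabla J A B = nabla A (app C J B) - app C J (nabla A B)"
  by (simp add: cov_endo_def fun_eq_iff)

text \<open>The symmetry of \<open>\<nabla>J\<close> for the pair \<open>e\<^sub>a\<close>, X, with \<open>\<nabla>X = - J\<close> inserted.\<close>

lemma nab_e_E: assumes a: "a \<in> alg S" shows "nabla (e a) E = e a"
proof -
  note Ja = alg_J[OF a]
  have "nabla (e a) E - app C J (- e (JT S a)) = nabla X (e (JT S a)) - app C J (- e (JT S a))"
    using spec[OF e_vf[OF a] X_vf] by (simp add: cov_endo_eq JX nab_e_X nab_X_e a app_e)
  then have "nabla (e a) E = - e (JT S (JT S a))" using nab_X_e[OF Ja] by simp
  also have "\<dots> = e a" using a e_neg[OF a] by simp
  finally show ?thesis .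
qed

abbreviation "W a b \<equiv> nabla (e a) (e b)"

lemma W_vf: "a \<in> alg S \<Longrightarrow> b \<in> alg S \<Longrightarrow> W a b \<in> vfields C" by (intro nab_vf e_vf)
lemma W_tan: "a \<in> alg S \<Longrightarrow> b \<in> alg S \<Longrightarrow> p \<in> pts C \<Longrightarrow> W a b p \<in> tangent C p" by (rule vfieldsD(1)[OF W_vf])

lemma par_rule:
  "A \<in> vfields C \<Longrightarrow> B \<in> vfields C \<Longrightarrow> D \<in> vfields C \<Longrightarrow> p \<in> pts C \<Longrightarrow>
   A p (ev2 C \<omega>C B D) = \<omega>C p (nabla A B p) (D p) + \<omega>C p (B p) (nabla A D p)"
  using par unfolding parallel2_def by (simp add: algebra_simps)

lemma \<omega>C_e_e:
  "a \<in> alg S \<Longrightarrow> b \<in> alg S \<Longrightarrow> p \<in> pts C \<Longrightarrow> \<omega>C p (e a p) (e b p) = (fst p)\<^sup>2 * gT S (JT S a) b"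
  by (simp add: \<omega>C_eq e_comp e_tC cpx_linv[OF S sC_in] met_linv[OF S sC_in] alg_J)

lemma fst_pos: "p \<in> pts C \<Longrightarrow> 0 < fst p" by (simp add: pts_C)

lemma e_const: "a \<in> alg S \<Longrightarrow> p \<in> pts C \<Longrightarrow> e a p (\<lambda>_. 0) = 0"
  by (rule tangent_zero[OF cC e_tan])

text \<open>The vertical component is read off by pairing with E: as \<open>\<omega>(e\<^sub>b, E) = 0\<close> and \<open>\<nabla>\<omega> = 0\<close>, it is
  determined by the derivative of E.\<close>

lemma W_\<phi>:
  assumes a: "a \<in> alg S" and b: "b \<in> alg S" and p: "p \<in> pts C"
  shows "\<phi> (snd p) (mid (W a b p)) = gT S (JT S b) a"
proof -
  have 0: "ev2 C \<omega>C (e b) E = (\<lambda>_. 0)"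
  proof
    fix q show "ev2 C \<omega>C (e b) E q = 0"
    proof (cases "q \<in> pts C")
      case True
      then show ?thesis
        using met_zero2[OF sC_in[OF True] linv_tangent[OF S alg_J[OF b] sC_in[OF True]]]
        by (simp add: ev2_at \<omega>C_eq E_comp e_comp e_tC b cpx_linv[OF S sC_in])
    qed (simp add: ev2_off)
  qed
  note sp = sC_in[OF p]
  note bt = cpx_tangent[OF S sp base_tangent[OF p W_tan[OF a b p]]]
  have "\<omega>C p (W a b p) (E p) = - ((fst p)\<^sup>2 * \<phi> (snd p) (mid (W a b p)))"
    using met_zero2[OF sp bt] by (simp add: \<omega>C_eq E_comp p power2_eq_square)
  then have "(fst p)\<^sup>2 * \<phi> (snd p) (mid (W a b p)) = (fst p)\<^sup>2 * gT S (JT S b) a"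
    using par_rule[OF e_vf[OF a] e_vf[OF b] E_vf p] by (auto simp: 0 nab_e_E a e_const p \<omega>C_e_e b)
  then show ?thesis using fst_pos[OF p] by auto
qed

text \<open>The radial component is read off by pairing with X.\<close>

lemma W_tC:
  assumes a: "a \<in> alg S" and b: "b \<in> alg S" and p: "p \<in> pts C"
  shows "W a b p tC = fst p * gT S a b"
proof -
  have 0: "ev2 C \<omega>C (e b) X = (\<lambda>_. 0)"
  proof
    fix q show "ev2 C \<omega>C (e b) X q = 0"
    proof (cases "q \<in> pts C")
      case True
      then show ?thesis
        using met_zero2[OF sC_in[OF True] linv_tangent[OF S alg_J[OF b] sC_in[OF True]]]
        by (simp add: ev2_at \<omega>C_eq X_comp e_comp e_tC b cpx_linv[OF S sC_in])
    qed (simp add: ev2_off)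
  qed
  note sp = sC_in[OF p]
  note bt = cpx_tangent[OF S sp base_tangent[OF p W_tan[OF a b p]]]
  have 1: "\<omega>C p (W a b p) (X p) = fst p * W a b p tC"
    using met_zero2[OF sp bt] by (simp add: \<omega>C_eq X_comp p)
  have "- e (JT S a) = e (- JT S a)" using e_neg[OF alg_J[OF a]] by simp
  then have "\<omega>C p (e b p) (nabla (e a) X p) = - ((fst p)\<^sup>2 * gT S b a)"
    using \<omega>C_e_e[OF b _ p, of "- JT S a"] a b by (simp add: nab_e_X L.g_simps)
  then have "fst p * W a b p tC = fst p * (fst p * gT S a b)"
    using par_rule[OF e_vf[OF a] e_vf[OF b] X_vf p] L.g_sym[OF a b]
    by (simp add: 0 1 e_const a p power2_eq_square)
  then show ?thesis using fst_pos[OF p] by simp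
qed

text \<open>The projection of the cone is holomorphic; both sides are compared by pairing with the frame.\<close>

lemma base_J:
  assumes w: "w \<in> tangent C p" and p: "p \<in> pts C"
  shows "base (J p w) = cpx S (sC p) (base w)"
proof -
  note sp = sC_in[OF p]
  note t1 = base_tangent[OF p pk_J_tangent[OF pkC p w]]
    and t2 = cpx_tangent[OF S sp base_tangent[OF p w]]
  have "(- 1) *\<^sub>R cpx S (sC p) (base w) + base (J p w) = 0"
  proof (rule pk_nondeg[OF klg_pk[OF S] sp])
    show "(- 1) *\<^sub>R cpx S (sC p) (base w) + base (J p w) \<in> tangent S (sC p)"
      by (intro subspace_add subspace_scale subspace_tangent cS' t1 t2)
    fix u assume u: "u \<in> tangent S (sC p)"
    obtain c where c: "c \<in> alg S" "u = linv S c (sC p)" using linv_at[OF S sp u] by blast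
    have "met S (sC p) (base (J p w)) u = met S (sC p) (cpx S (sC p) (base w)) u"
      using \<omega>C_J[OF p w e_tan[OF c(1) p]] e_comp[OF c(1) p] fst_pos[OF p]
      by (simp add: \<omega>C_eq gC_eq e_tC c)
    then show "met S (sC p) ((- 1) *\<^sub>R cpx S (sC p) (base w) + base (J p w)) u = 0"
      using met_linear1[OF S sp u t2 t1, of "- 1"] by simp
  qed
  then show ?thesis by (simp add: algebra_simps)
qed

text \<open>The horizontal part of the derivative of the frame, as a vector of the Lie algebra that depends on
  the point of the cone.\<close>

definition \<Gamma> :: "real \<times> 'c \<Rightarrow> 'a tvec \<Rightarrow> 'a tvec \<Rightarrow> 'a tvec" where
  "\<Gamma> p a b = (SOME u. u \<in> alg S \<and> base (W a b p) = linv S u (sC p))"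

lemma linv_eq:
  assumes "u \<in> alg S" "v \<in> alg S" "s \<in> pts S" "linv S u s = linv S v s" shows "u = v"
proof -
  have "linv S (u + (- 1) *\<^sub>R v) s = 0" using assms(4) by (simp only: linv_add[OF S] linv_scale[OF S]) simp
  from linv_inj[OF S _ this assms(3)] assms(1,2) show ?thesis by simp
qed

context
  fixes p assumes p: "p \<in> pts C"
begin

lemma \<Gamma>: assumes "a \<in> alg S" "b \<in> alg S" shows "\<Gamma> p a b \<in> alg S" "base (W a b p) = linv S (\<Gamma> p a b) (sC p)"
proof -
  have "\<exists>u. u \<in> alg S \<and> base (W a b p) = linv S u (sC p)"
    using linv_at[OF S sC_in[OF p] base_tangent[OF p W_tan[OF assms p]]] by blast
  from someI_ex[OF this] show "\<Gamma> p a b \<in> alg S" "base (W a b p) = linv S (\<Gamma> p a b) (sC p)"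
    unfolding \<Gamma>_def by blast+
qed

lemma \<Gamma>_eqI:
  assumes "u \<in> alg S" "v \<in> alg S" "linv S u (sC p) = linv S v (sC p)" shows "u = v"
  by (rule linv_eq[OF assms(1,2) sC_in[OF p] assms(3)])

lemma \<Gamma>_lin1: assumes a: "a \<in> alg S" and a': "a' \<in> alg S" and b: "b \<in> alg S"
  shows "\<Gamma> p (c *\<^sub>R a + a') b = c *\<^sub>R \<Gamma> p a b + \<Gamma> p a' b"
proof (rule \<Gamma>_eqI)
  have aa: "c *\<^sub>R a + a' \<in> alg S" using a a' by simp
  show "\<Gamma> p (c *\<^sub>R a + a') b \<in> alg S" by (rule \<Gamma>(1)[OF aa b])
  show "c *\<^sub>R \<Gamma> p a b + \<Gamma> p a' b \<in> alg S" using \<Gamma>(1) a a' b by simp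
  have "W (c *\<^sub>R a + a') b = c *\<^sub>R W a b + W a' b"
    unfolding e_lin[OF a a'] by (rule nab_lin1[OF e_vf[OF a] e_vf[OF a'] e_vf[OF b]])
  then have "base (W (c *\<^sub>R a + a') b p) = c *\<^sub>R base (W a b p) + base (W a' b p)"
    by (simp add: push_add push_scale)
  then show "linv S (\<Gamma> p (c *\<^sub>R a + a') b) (sC p) = linv S (c *\<^sub>R \<Gamma> p a b + \<Gamma> p a' b) (sC p)"
    by (simp add: \<Gamma>(2)[OF aa b] \<Gamma>(2)[OF a b] \<Gamma>(2)[OF a' b] linv_add[OF S] linv_scale[OF S])
qed

lemma \<Gamma>_lin2: assumes a: "a \<in> alg S" and b: "b \<in> alg S" and b': "b' \<in> alg S"
  shows "\<Gamma> p a (c *\<^sub>R b + b') = c *\<^sub>R \<Gamma> p a b + \<Gamma> p a b'"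
proof (rule \<Gamma>_eqI)
  have bb: "c *\<^sub>R b + b' \<in> alg S" using b b' by simp
  show "\<Gamma> p a (c *\<^sub>R b + b') \<in> alg S" by (rule \<Gamma>(1)[OF a bb])
  show "c *\<^sub>R \<Gamma> p a b + \<Gamma> p a b' \<in> alg S" using \<Gamma>(1) a b b' by simp
  have "W a (c *\<^sub>R b + b') = c *\<^sub>R W a b + W a b'"
    unfolding e_lin[OF b b'] by (rule nab_lin2[OF e_vf[OF a] e_vf[OF b] e_vf[OF b']])
  then have "base (W a (c *\<^sub>R b + b') p) = c *\<^sub>R base (W a b p) + base (W a b' p)"
    by (simp add: push_add push_scale)
  then show "linv S (\<Gamma> p a (c *\<^sub>R b + b')) (sC p) = linv S (c *\<^sub>R \<Gamma> p a b + \<Gamma> p a b') (sC p)"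
    by (simp add: \<Gamma>(2)[OF a bb] \<Gamma>(2)[OF a b] \<Gamma>(2)[OF a b'] linv_add[OF S] linv_scale[OF S])
qed

lemma \<omega>C_W_e:
  assumes a: "a \<in> alg S" and b: "b \<in> alg S" and c: "c \<in> alg S"
  shows "\<omega>C p (W a b p) (e c p) = (fst p)\<^sup>2 * gT S (JT S (\<Gamma> p a b)) c"
    "\<omega>C p (e c p) (W a b p) = (fst p)\<^sup>2 * gT S (JT S c) (\<Gamma> p a b)"
  using \<Gamma>[OF a b] c by (simp_all add: \<omega>C_eq e_comp e_tC p cpx_linv[OF S sC_in] met_linv[OF S sC_in] alg_J)

text \<open>Horizontal fields do not differentiate functions of t.\<close>

lemma e_quadratic: assumes a: "a \<in> alg S" shows "e a p (cut C (\<lambda>q. (fst q)\<^sup>2 * k)) = 0"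
proof -
  note t = e_tan[OF a p]
  have "cut C (\<lambda>q. (fst q)\<^sup>2 * k) = (\<lambda>q. k * (tC q * tC q))" by (auto simp: cut_def power2_eq_square)
  then show ?thesis
    using tangent_cmult[OF cC t smooth_fun_mult[OF cC smooth_tC smooth_tC], of k] tangent_mult[OF t smooth_tC smooth_tC]
    by (simp add: e_tC a)
qed

lemma symplectic:
  assumes a: "a \<in> alg S" and b: "b \<in> alg S" and c: "c \<in> alg S"
  shows "gT S (JT S (\<Gamma> p a b)) c + gT S (JT S b) (\<Gamma> p a c) = 0"
proof -
  have "ev2 C \<omega>C (e b) (e c) = cut C (\<lambda>q. (fst q)\<^sup>2 * gT S (JT S b) c)"
    using \<omega>C_e_e[OF b c] by (auto simp: ev2_def cut_def fun_eq_iff)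
  then have "(fst p)\<^sup>2 * (gT S (JT S (\<Gamma> p a b)) c + gT S (JT S b) (\<Gamma> p a c)) = 0"
    using par_rule[OF e_vf[OF a] e_vf[OF b] e_vf[OF c] p] e_quadratic[OF a]
    by (simp add: \<omega>C_W_e a b c algebra_simps)
  then show ?thesis using fst_pos[OF p] by simp
qed

lemma torsion:
  assumes a: "a \<in> alg S" and b: "b \<in> alg S" shows "\<Gamma> p a b - \<Gamma> p b a = lie S a b"
proof (rule \<Gamma>_eqI)
  note l = alg_lie[OF a b]
  show "\<Gamma> p a b - \<Gamma> p b a \<in> alg S" using \<Gamma>(1) a b by simp
  show "lie S a b \<in> alg S" by (rule l)
  have "W a b p = W b a p + ((- 2 * gT S (JT S a) b) *\<^sub>R X p + e (lie S a b) p)"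
    using nab_swap[OF e_vf[OF a] e_vf[OF b]] e_bracket[OF a b] by simp
  then have "base (W a b p) = base (W b a p) + linv S (lie S a b) (sC p)"
    by (simp only: push_add push_scale X_comp[OF p] e_comp[OF l p]) simp
  then show "linv S (\<Gamma> p a b - \<Gamma> p b a) (sC p) = linv S (lie S a b) (sC p)"
    using \<Gamma>(2)[OF a b] \<Gamma>(2)[OF b a] linv_add[OF S, of "\<Gamma> p a b" "(- 1) *\<^sub>R \<Gamma> p b a"] linv_scale[OF S, of "- 1" "\<Gamma> p b a"]
    by simp
qed

lemma special:
  assumes a: "a \<in> alg S" and b: "b \<in> alg S"
  shows "\<Gamma> p a (JT S b) - JT S (\<Gamma> p a b) = \<Gamma> p b (JT S a) - JT S (\<Gamma> p b a)"
proof (rule \<Gamma>_eqI)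
  have A: "\<Gamma> p x (JT S y) - JT S (\<Gamma> p x y) \<in> alg S" if "x \<in> alg S" "y \<in> alg S" for x y
    using \<Gamma>(1) that alg_J by simp
  have B: "linv S (\<Gamma> p x (JT S y) - JT S (\<Gamma> p x y)) (sC p) = base (cov_endo C nabla J (e x) (e y) p)"
    if "x \<in> alg S" "y \<in> alg S" for x y
  proof -
    have "cov_endo C nabla J (e x) (e y) p = W x (JT S y) p - J p (W x y p)"
      using p by (simp add: cov_endo_eq app_e that app_at)
    then have "base (cov_endo C nabla J (e x) (e y) p) = linv S (\<Gamma> p x (JT S y)) (sC p) - linv S (JT S (\<Gamma> p x y)) (sC p)"
      using base_J[OF W_tan[OF that p] p] cpx_linv[OF S sC_in[OF p] \<Gamma>(1)[OF that]] \<Gamma>(2)[OF that] \<Gamma>(2)[OF that(1) alg_J[OF that(2)]]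
      by (simp add: push_diff)
    then show ?thesis
      using linv_add[OF S, of "\<Gamma> p x (JT S y)" "(- 1) *\<^sub>R JT S (\<Gamma> p x y)"] linv_scale[OF S, of "- 1" "JT S (\<Gamma> p x y)"]
      by simp
  qed
  show "\<Gamma> p a (JT S b) - JT S (\<Gamma> p a b) \<in> alg S" by (rule A[OF a b])
  show "\<Gamma> p b (JT S a) - JT S (\<Gamma> p b a) \<in> alg S" by (rule A[OF b a])
  show "linv S (\<Gamma> p a (JT S b) - JT S (\<Gamma> p a b)) (sC p) = linv S (\<Gamma> p b (JT S a) - JT S (\<Gamma> p b a)) (sC p)"
    unfolding B[OF a b] B[OF b a] spec[OF e_vf[OF a] e_vf[OF b]] ..
qed

theorem special_point_\<Gamma>: "special_point (alg S) (gT S) (JT S) (lie S) (\<Gamma> p)"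
  by unfold_locales (rule \<Gamma>(1) \<Gamma>_lin1 \<Gamma>_lin2 symplectic torsion special; assumption)+

end

lemma ev2_smooth:
  assumes A: "A \<in> vfields C" and B: "B \<in> vfields C" shows "ev2 C \<omega>C A B \<in> smooth_fun C"
proof -
  have "ev2 C \<omega>C A B = ev2 C gC (app C J A) B"
    using \<omega>C_J[OF _ vfieldsD(1)[OF A] vfieldsD(1)[OF B]] by (auto simp: ev2_def cut_def app_def fun_eq_iff)
  moreover have "bilinear_field C gC" using pkC unfolding pseudo_kaehler_def pseudo_riemannian_def by (elim conjE)
  ultimately show ?thesis using pk_J_field[OF pkC A] B unfolding bilinear_field_def by simp
qed

text \<open>Up to the factor \<open>t\<^sup>2\<close>, the derivative along \<open>e\<^sub>a\<close> of \<open>\<omega>(\<Gamma> b c, d)\<close>. This is the only place where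
  the variation of \<open>\<Gamma>\<close> enters the flatness equation, and it is never computed.\<close>

definition dW where "dW p a b c d = e a p (ev2 C \<omega>C (W b c) (e d)) / (fst p)\<^sup>2"

text \<open>In the sum over c, d and \<open>J c\<close>, \<open>J d\<close> only the J-commuting part of \<open>\<Gamma> b\<close> remains, which the Koszul
  formula expresses through constants; a horizontal field then differentiates a multiple of \<open>t\<^sup>2\<close>.\<close>

lemma dW_J:
  assumes p: "p \<in> pts C" and a: "a \<in> alg S" and b: "b \<in> alg S" and c: "c \<in> alg S" and d: "d \<in> alg S"
  shows "dW p a b c d + dW p a b (JT S c) (JT S d) = 0"
proof -
  define k where "k = - (gT S (lie S b c) (JT S d) - gT S (lie S c (JT S d)) b + gT S (lie S (JT S d) b) c)"
  note Jc = alg_J[OF c] and Jd = alg_J[OF d]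
  have "gT S (JT S (\<Gamma> q b c)) d + gT S (JT S (\<Gamma> q b (JT S c))) (JT S d) = k" if q: "q \<in> pts C" for q
  proof -
    interpret P: special_point "alg S" "gT S" "JT S" "lie S" "\<Gamma> q" by (rule special_point_\<Gamma>[OF q])
    have "gT S (JT S (\<Gamma> q b c)) d = - gT S (\<Gamma> q b c) (JT S d)" using L.gJ[of "\<Gamma> q b c" d] b c d by simp
    moreover have "2 * gT S (P.D b c) (JT S d) = gT S (\<Gamma> q b c) (JT S d) - gT S (JT S (\<Gamma> q b (JT S c))) (JT S d)"
      using b c d Jc Jd by (simp add: P.D_def L.g_simps)
    ultimately show ?thesis using P.koszul[OF b c Jd] unfolding k_def by simp
  qed
  then have "(\<lambda>q. ev2 C \<omega>C (W b c) (e d) q + ev2 C \<omega>C (W b (JT S c)) (e (JT S d)) q) = cut C (\<lambda>q. (fst q)\<^sup>2 * k)"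
    using \<omega>C_W_e(1)[OF _ b c d] \<omega>C_W_e(1)[OF _ b Jc Jd]
    by (auto simp: ev2_def cut_def fun_eq_iff distrib_left[symmetric])
  then have "e a p (ev2 C \<omega>C (W b c) (e d)) + e a p (ev2 C \<omega>C (W b (JT S c)) (e (JT S d))) = 0"
    using tangent_add[OF cC e_tan[OF a p] ev2_smooth[OF W_vf[OF b c] e_vf[OF d]] ev2_smooth[OF W_vf[OF b Jc] e_vf[OF Jd]]]
      e_quadratic[OF p a] by simp
  then show ?thesis unfolding dW_def add_divide_distrib[symmetric] by simp
qed

text \<open>As \<open>\<omega>\<close> is parallel, the second derivative is obtained from \<open>dW\<close> and the pairing of two first
  derivatives, whose vertical and radial components contribute the terms without \<open>\<Gamma>\<close>.\<close>

lemma \<omega>C_nab_W: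
  assumes p: "p \<in> pts C" and a: "a \<in> alg S" and b: "b \<in> alg S" and c: "c \<in> alg S" and d: "d \<in> alg S"
  shows "\<omega>C p (nabla (e a) (W b c) p) (e d p) = (fst p)\<^sup>2 * (dW p a b c d -
    (gT S (JT S (\<Gamma> p b c)) (\<Gamma> p a d) + gT S (JT S b) c * gT S a d - gT S (JT S a) d * gT S b c))"
proof -
  have "e a p (ev2 C \<omega>C (W b c) (e d)) = (fst p)\<^sup>2 * dW p a b c d"
    using fst_pos[OF p] by (simp add: dW_def)
  moreover have sk: "gT S (JT S y) x = - gT S (JT S x) y" if "x \<in> alg S" "y \<in> alg S" for x y
    using L.gJ[OF that] L.g_sym[OF alg_J[OF that(2)] that(1)] by simp
  have "\<omega>C p (W b c p) (W a d p) = (fst p)\<^sup>2 *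
     (gT S (JT S (\<Gamma> p b c)) (\<Gamma> p a d) + gT S (JT S b) c * gT S a d - gT S (JT S a) d * gT S b c)"
    using a b c d \<Gamma>(1)[OF p b c] \<Gamma>(1)[OF p a d] sk[OF b c] sk[OF a d]
    by (simp add: \<omega>C_eq W_\<phi> W_tC p \<Gamma>(2)[OF p] cpx_linv[OF S sC_in] met_linv[OF S sC_in] alg_J)
      (simp add: power2_eq_square algebra_simps)
  ultimately show ?thesis
    using par_rule[OF e_vf[OF a] W_vf[OF b c] e_vf[OF d] p] by (simp add: algebra_simps)
qed

text \<open>Flatness on \<open>e\<^sub>a\<close>, \<open>e\<^sub>b\<close>, \<open>e\<^sub>c\<close>, paired with \<open>e\<^sub>d\<close>. The last summand comes from the vertical part of
  \<open>[e\<^sub>a, e\<^sub>b]\<close>.\<close>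

lemma curvature:
  assumes p: "p \<in> pts C" and a: "a \<in> alg S" and b: "b \<in> alg S" and c: "c \<in> alg S" and d: "d \<in> alg S"
  shows "dW p a b c d - dW p b a c d
      - (gT S (JT S (\<Gamma> p b c)) (\<Gamma> p a d) + gT S (JT S b) c * gT S a d - gT S (JT S a) d * gT S b c)
      + (gT S (JT S (\<Gamma> p a c)) (\<Gamma> p b d) + gT S (JT S a) c * gT S b d - gT S (JT S b) d * gT S a c)
      - gT S (JT S (\<Gamma> p (lie S a b) c)) d + 2 * gT S (JT S a) b * gT S c d = 0"
proof -
  note l = alg_lie[OF a b] and Jc = alg_J[OF c]
  let ?k = "- 2 * gT S (JT S a) b"
  have vf: "nabla (e b) (W a c) \<in> vfields C" by (rule nab_vf[OF e_vf[OF b] W_vf[OF a c]])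
  note tl = W_tan[OF l c p] and tn = vfieldsD(1)[OF vf p] and te = e_tan[OF Jc p]
  have k: "nabla (bracket (e a) (e b)) (e c) = ?k *\<^sub>R (- e (JT S c)) + W (lie S a b) c"
    unfolding e_bracket[OF a b] nab_lin1[OF X_vf e_vf[OF l] e_vf[OF c]] nab_X_e[OF c] ..
  have "nabla (e a) (W b c) p = (- ?k) *\<^sub>R e (JT S c) p + (1 *\<^sub>R W (lie S a b) c p + nabla (e b) (W a c) p)"
  proof
    fix f
    have "nabla (e a) (W b c) p f - nabla (e b) (W a c) p f - nabla (bracket (e a) (e b)) (e c) p f = 0"
      using fl e_vf[OF a] e_vf[OF b] e_vf[OF c] unfolding flat_def by blast
    then show "nabla (e a) (W b c) p f = ((- ?k) *\<^sub>R e (JT S c) p + (1 *\<^sub>R W (lie S a b) c p + nabla (e b) (W a c) p)) f"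
      unfolding k by simp
  qed
  then have 1: "\<omega>C p (nabla (e a) (W b c) p) (e d p) =
      - ?k * \<omega>C p (e (JT S c) p) (e d p) + (\<omega>C p (W (lie S a b) c p) (e d p) + \<omega>C p (nabla (e b) (W a c) p) (e d p))"
    using \<omega>C_lin[OF p te subspace_add[OF subspace_tangent[OF cC] tl tn] e_tan[OF d p], of "- ?k"]
      \<omega>C_lin[OF p tl tn e_tan[OF d p], of 1] by simp
  have 2: "\<omega>C p (e (JT S c) p) (e d p) = (fst p)\<^sup>2 * - gT S c d"
    using \<omega>C_e_e[OF Jc d p] c d by (simp add: L.g_simps)
  have 3: "\<omega>C p (W (lie S a b) c p) (e d p) = (fst p)\<^sup>2 * gT S (JT S (\<Gamma> p (lie S a b) c)) d"
    by (rule \<omega>C_W_e(1)[OF p l c d])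
  have "(fst p)\<^sup>2 * (dW p a b c d - dW p b a c d
      - (gT S (JT S (\<Gamma> p b c)) (\<Gamma> p a d) + gT S (JT S b) c * gT S a d - gT S (JT S a) d * gT S b c)
      + (gT S (JT S (\<Gamma> p a c)) (\<Gamma> p b d) + gT S (JT S a) c * gT S b d - gT S (JT S b) d * gT S a c)
      - gT S (JT S (\<Gamma> p (lie S a b) c)) d + 2 * gT S (JT S a) b * gT S c d) = 0"
    using 1 unfolding 2 3 \<omega>C_nab_W[OF p a b c d] \<omega>C_nab_W[OF p b a c d] by (simp add: algebra_simps)
  then show ?thesis using fst_pos[OF p] by simp
qed

lemma pts_C_nonempty: "\<exists>p. p \<in> pts C"
proof -
  have "\<forall>s\<in>pts S. \<exists>U \<Phi>. openin (mtop S) U \<and> s \<in> U \<and>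
        diffeo (open_submfd C0 (pts C0 \<inter> \<pi> -` U)) (prod_mfd (open_submfd S U) circle) \<Phi> \<and>
        (\<forall>x\<in>pts C0 \<inter> \<pi> -` U. fst (\<Phi> x) = \<pi> x \<and>
           (\<forall>z\<in>pts circle. \<Phi> (act z x) = (\<pi> x, z * snd (\<Phi> x))))"
    using bdl unfolding principal_circle_bundle_def by (elim conjE)
  from bspec[OF this klg_one[OF S]] obtain U \<Phi> where U: "openin (mtop S) U" "one_of S \<in> U"
    "diffeo (open_submfd C0 (pts C0 \<inter> \<pi> -` U)) (prod_mfd (open_submfd S U) circle) \<Phi>" by (elim exE conjE)
  have "\<Phi> ` pts (open_submfd C0 (pts C0 \<inter> \<pi> -` U)) = pts (prod_mfd (open_submfd S U) circle)"
    using U(3) unfolding diffeo_def bij_betw_def by (elim conjE)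
  moreover have "(one_of S, 1) \<in> pts (prod_mfd (open_submfd S U) circle)"
    using U klg_one[OF S] by (simp add: prod_mfd_def open_submfd_def circle_def)
  ultimately have "pts (open_submfd C0 (pts C0 \<inter> \<pi> -` U)) \<noteq> {}" by auto
  then obtain x where "x \<in> pts C0" by (auto simp: open_submfd_def)
  then have "(1, x) \<in> pts C" by (simp add: pts_C)
  then show ?thesis by blast
qed

theorem special_curvature:
  obtains \<Gamma>' where "special_point (alg S) (gT S) (JT S) (lie S) \<Gamma>'"
    "\<And>a b c. a \<in> alg S \<Longrightarrow> b \<in> alg S \<Longrightarrow> c \<in> alg S \<Longrightarrow>
      special_point.R (JT S) (lie S) \<Gamma>' a b c + special_point.S (JT S) \<Gamma>' a (special_point.S (JT S) \<Gamma>' b c)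
        - special_point.S (JT S) \<Gamma>' b (special_point.S (JT S) \<Gamma>' a c) =
      gT S a c *\<^sub>R b + gT S (JT S a) c *\<^sub>R JT S b - gT S b c *\<^sub>R a - gT S (JT S b) c *\<^sub>R JT S a + (2 * gT S (JT S a) b) *\<^sub>R JT S c"
proof -
  obtain p where p: "p \<in> pts C" using pts_C_nonempty by blast
  note sp = special_point_\<Gamma>[OF p]
  show thesis
    by (rule that[OF sp], rule special_point.curvature_identity[OF sp, where X = "dW p"])
      (assumption | rule dW_J[OF p] curvature[OF p])+
qed

end

section \<open>The Lie algebra of a group covered by a product\<close>

text \<open>The product of Kaehler Lie groups is a record extending the product manifold; derivatives of maps
  see only the manifold.\<close>

lemma push_same_source:
  assumes "mtop M' = mtop M" shows "push M' N F = push M N F"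
  using assms by (simp add: fun_eq_iff push_def cut_def)

lemma push_same_target:
  assumes "mtop N' = mtop N" "mdim N' = mdim N" "atlas N' = atlas N" shows "push M N' F = push M N F"
proof -
  have "smooth_fun N' = smooth_fun N" using assms by (simp add: smooth_fun_def)
  then show ?thesis by (simp add: fun_eq_iff push_def)
qed

text \<open>A factor of a simply connected product is a retract of it; loops are pushed into the product,
  contracted there and mapped back.\<close>

lemma simply_connected_retract:
  assumes Y: "simply_connected_top Y" and s: "continuous_map X Y s" and h: "continuous_map Y X h"
    and hs: "\<And>x. x \<in> topspace X \<Longrightarrow> h (s x) = x"
  shows "simply_connected_top X"
  unfolding simply_connected_top_def
proof (intro allI impI, elim conjE)
  fix \<gamma> \<delta> assume c: "pathin X \<gamma>" "\<gamma> 1 = \<gamma> 0" "pathin X \<delta>" "\<delta> 1 = \<delta> 0"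
  have lp: "pathin Y (s \<circ> \<alpha>)" if "pathin X \<alpha>" for \<alpha>
    using that s unfolding pathin_def by (rule continuous_map_compose)
  have eq: "homotopic_with (\<lambda>r. r 1 = r 0) (top_of_set {0..1::real}) X \<alpha> (h \<circ> (s \<circ> \<alpha>))"
    if a: "pathin X \<alpha>" "\<alpha> 1 = \<alpha> 0" for \<alpha>
  proof (rule homotopic_with_equal)
    show "continuous_map (top_of_set {0..1}) X \<alpha>" using a(1) by (simp add: pathin_def)
    then have "\<alpha> t \<in> topspace X" if "t \<in> {0..1}" for t
      using that by (auto simp: continuous_map_def Pi_iff)
    then show "\<And>t. t \<in> topspace (top_of_set {0..1}) \<Longrightarrow> \<alpha> t = (h \<circ> (s \<circ> \<alpha>)) t" using hs by simp
  qed (use a in auto)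
  have "homotopic_with (\<lambda>r. r 1 = r 0) (top_of_set {0..1::real}) Y (s \<circ> \<gamma>) (s \<circ> \<delta>)"
    using Y[unfolded simply_connected_top_def, rule_format, of "s \<circ> \<gamma>" "s \<circ> \<delta>"] lp[OF c(1)] lp[OF c(3)] c(2,4) by simp
  then have "homotopic_with (\<lambda>r. r 1 = r 0) (top_of_set {0..1::real}) X (h \<circ> (s \<circ> \<gamma>)) (h \<circ> (s \<circ> \<delta>))"
    by (rule homotopic_with_compose_continuous_map_left[OF _ h]) simp
  from homotopic_with_trans[OF homotopic_with_trans[OF eq[OF c(1,2)] this] homotopic_with_symD[OF eq[OF c(3,4)]]]
  show "homotopic_with (\<lambda>r. r 1 = r 0) (top_of_set {0..1::real}) X \<gamma> \<delta>" .
qed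

text \<open>The hypotheses on the universal cover, with the isomorphism \<open>\<Phi>\<close> to the product as a parameter.\<close>

locale product_cover =
  fixes S :: "'a klg" and St :: "'b klg" and p :: "'b \<Rightarrow> 'a" and F :: "nat \<Rightarrow> 'd klg" and r :: nat
    and \<Phi> :: "'b \<Rightarrow> nat \<Rightarrow> 'd"
  assumes S: "kaehler_lie_group S" and cov: "universal_cover St p S"
    and F: "\<And>i. i < r \<Longrightarrow> kaehler_lie_group (F i)"
    and iso\<Phi>: "\<Phi> \<in> iso (grp St) (grp (prod_klg {..<r} F))"
    and diff\<Phi>: "diffeo St (prod_klg {..<r} F) \<Phi>"
    and pres\<Phi>: "preserves_kaehler St (prod_klg {..<r} F) \<Phi>"
begin

abbreviation "P \<equiv> prod_klg {..<r} F"
abbreviation "oneP \<equiv> \<lambda>j\<in>{..<r}. one_of (F j)"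

lemma P_simps:
  "mtop P = mtop (Pi_mfd {..<r} F)" "mdim P = mdim (Pi_mfd {..<r} F)" "atlas P = atlas (Pi_mfd {..<r} F)"
  "grp P = product_group {..<r} (\<lambda>i. grp (F i))"
  by (simp_all add: prod_klg_def Let_def)

lemma isP: "is_Pi P {..<r} F" unfolding is_Pi_def using P_simps by blast

lemma push_Pi: "push (Pi_mfd {..<r} F) N f = push P N f" "push N' (Pi_mfd {..<r} F) k = push N' P k"
  by (rule push_same_source push_same_target; simp add: P_simps)+

lemma met_P: "met P x v w = (\<Sum>i<r. met (F i) (x i) (push P (F i) (\<lambda>x. x i) v) (push P (F i) (\<lambda>x. x i) w))"
proof -
  have "met P x v w = (\<Sum>i<r. met (F i) (x i) (push (Pi_mfd {..<r} F) (F i) (\<lambda>x. x i) v) (push (Pi_mfd {..<r} F) (F i) (\<lambda>x. x i) w))"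
    by (simp add: prod_klg_def Let_def)
  then show ?thesis unfolding push_Pi .
qed

lemma cpx_P: "cpx P x v = (\<Sum>i<r. push (F i) P (\<lambda>y. x(i := y)) (cpx (F i) (x i) (push P (F i) (\<lambda>x. x i) v)))"
proof
  fix f
  have "cpx P x v f = (\<Sum>i<r. push (F i) (Pi_mfd {..<r} F) (\<lambda>y. x(i := y)) (cpx (F i) (x i) (push (Pi_mfd {..<r} F) (F i) (\<lambda>x. x i) v)) f)"
    by (simp add: prod_klg_def Let_def)
  then show "cpx P x v f = (\<Sum>i<r. push (F i) P (\<lambda>y. x(i := y)) (cpx (F i) (x i) (push P (F i) (\<lambda>x. x i) v))) f"
    unfolding push_Pi sum_fun_apply .
qed

lemma cF: "i < r \<Longrightarrow> charted (F i)" by (rule klg_charted[OF F])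
lemma sF: "i < r \<Longrightarrow> smooth_manifold (F i)" by (rule klg_smooth[OF F])
lemma cP: "charted P" by (rule charted_Pi[OF isP]) (simp_all add: cF)
lemma pts_P: "pts P = (\<Pi>\<^sub>E i\<in>{..<r}. pts (F i))" by (rule Pi_simps(3)[OF isP]) (simp_all add: cF)
lemma proj_smooth: "i < r \<Longrightarrow> smooth_map P (F i) (\<lambda>x. x i)"
  by (rule smooth_map_proj[OF isP _ _ _ sF]) (simp_all add: cF)
lemma tuple_smooth: "charted Q \<Longrightarrow> (\<And>i. i < r \<Longrightarrow> smooth_map Q (F i) (G i)) \<Longrightarrow> smooth_map Q P (\<lambda>x. \<lambda>i\<in>{..<r}. G i x)"
  by (rule smooth_map_tuple[OF isP]) (simp_all add: cF)

lemma St: "kaehler_lie_group St" using cov unfolding universal_cover_def by (elim conjE)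
lemma cSt: "charted St" by (rule klg_charted[OF St])

abbreviation "\<Psi> \<equiv> inv_into (pts St) \<Phi>"

lemma bij\<Phi>: "bij_betw \<Phi> (pts St) (pts P)" and smooth\<Phi>: "smooth_map St P \<Phi>" and smooth\<Psi>: "smooth_map P St \<Psi>"
  using diff\<Phi> unfolding diffeo_def by blast+

lemma \<Psi>\<Phi>: "x \<in> pts St \<Longrightarrow> \<Psi> (\<Phi> x) = x" by (rule inv_into_f_f[OF bij_betw_imp_inj_on[OF bij\<Phi>]])
lemma \<Phi>\<Psi>: "x \<in> pts P \<Longrightarrow> \<Phi> (\<Psi> x) = x" by (rule bij_betw_inv_into_right[OF bij\<Phi>])

text \<open>The i-th component of the isomorphism, and the inclusion of the i-th factor. Both are
  homomorphisms, and their derivatives at the unit split the Lie algebra of the cover.\<close>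

definition h where "h i x = \<Phi> x i"
definition \<sigma> where "\<sigma> i y = \<Psi> (oneP(i := y))"

lemma h_smooth: "i < r \<Longrightarrow> smooth_map St (F i) (h i)"
  unfolding h_def[abs_def] by (rule smooth_map_compose[OF cSt cP cF smooth\<Phi> proj_smooth])

lemma slice_eq: "i < r \<Longrightarrow> oneP(i := y) = (\<lambda>j\<in>{..<r}. if j = i then y else one_of (F j))"
  by auto

lemma slice_smooth:
  assumes i: "i < r" shows "smooth_map (F i) P (\<lambda>y. oneP(i := y))"
  unfolding slice_eq[OF i]
proof (rule tuple_smooth[OF cF[OF i]])
  fix j assume j: "j < r"
  show "smooth_map (F i) (F j) (\<lambda>y. if j = i then y else one_of (F j))"
  proof (cases "j = i")
    case True
    then show ?thesis using smooth_map_id[OF sF[OF i]] by simp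
  next
    case False
    then show ?thesis using smooth_map_const[OF cF[OF i] klg_one[OF F[OF j]]] by simp
  qed
qed

lemma \<sigma>_smooth: "i < r \<Longrightarrow> smooth_map (F i) St (\<sigma> i)"
  unfolding \<sigma>_def[abs_def] by (rule smooth_map_compose[OF cF cP cSt slice_smooth smooth\<Psi>])

lemma h_hom: assumes i: "i < r" shows "h i \<in> hom (grp St) (grp (F i))"
proof -
  have hm: "\<Phi> \<in> hom (grp St) (grp P)" using iso\<Phi> by (simp add: iso_def)
  show ?thesis
  proof (rule homI)
    fix x assume "x \<in> carrier (grp St)"
    then show "h i x \<in> carrier (grp (F i))"
      using smooth_map_in[OF h_smooth[OF i]] klg_carrier[OF St] klg_carrier[OF F[OF i]] by simp
    fix y assume "y \<in> carrier (grp St)"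
    with \<open>x \<in> _\<close> have "\<Phi> (x \<otimes>\<^bsub>grp St\<^esub> y) = \<Phi> x \<otimes>\<^bsub>grp P\<^esub> \<Phi> y" using hom_mult[OF hm] by simp
    then show "h i (x \<otimes>\<^bsub>grp St\<^esub> y) = h i x \<otimes>\<^bsub>grp (F i)\<^esub> h i y" using i by (simp add: h_def P_simps)
  qed
qed

lemma slice_in: "i < r \<Longrightarrow> y \<in> pts (F i) \<Longrightarrow> oneP(i := y) \<in> pts P"
  by (rule smooth_map_in[OF slice_smooth])

lemma \<sigma>_hom: assumes i: "i < r" shows "\<sigma> i \<in> hom (grp (F i)) (grp St)"
proof -
  have "inv_into (carrier (grp St)) \<Phi> \<in> iso (grp P) (grp St)"
    by (rule group.iso_set_sym[OF klg_group[OF St] iso\<Phi>])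
  then have hm: "\<Psi> \<in> hom (grp P) (grp St)" by (simp add: iso_def klg_carrier[OF St])
  have car: "carrier (grp P) = pts P" 
    unfolding P_simps(4) pts_P carrier_product_group by (rule PiE_cong) (simp add: klg_carrier[OF F])
  show ?thesis
  proof (rule homI)
    fix x assume x: "x \<in> carrier (grp (F i))"
    then show "\<sigma> i x \<in> carrier (grp St)"
      using smooth_map_in[OF \<sigma>_smooth[OF i]] klg_carrier[OF St] klg_carrier[OF F[OF i]] by simp
    fix y assume y: "y \<in> carrier (grp (F i))"
    have "oneP(i := x) \<otimes>\<^bsub>grp P\<^esub> oneP(i := y) = oneP(i := x \<otimes>\<^bsub>grp (F i)\<^esub> y)"
      using klg_l_one[OF F klg_one[OF F]] i by (auto simp: P_simps(4) fun_eq_iff)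
    then show "\<sigma> i (x \<otimes>\<^bsub>grp (F i)\<^esub> y) = \<sigma> i x \<otimes>\<^bsub>grp St\<^esub> \<sigma> i y"
      using hom_mult[OF hm, of "oneP(i := x)" "oneP(i := y)"] slice_in[OF i] x y klg_carrier[OF F[OF i]]
      by (simp add: \<sigma>_def car)
  qed
qed

lemma h_\<sigma>: "i < r \<Longrightarrow> j < r \<Longrightarrow> y \<in> pts (F i) \<Longrightarrow> h j (\<sigma> i y) = (if j = i then y else one_of (F j))"
  by (simp add: h_def \<sigma>_def \<Phi>\<Psi> slice_in)

lemma lie_hom_h: "i < r \<Longrightarrow> lie_hom St (F i) (h i)" by (simp add: lie_hom_def h_smooth h_hom)
lemma lie_hom_\<sigma>: "i < r \<Longrightarrow> lie_hom (F i) St (\<sigma> i)" by (simp add: lie_hom_def \<sigma>_smooth \<sigma>_hom)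
lemma lie_hom_p: "lie_hom St S p" using cov unfolding lie_hom_def universal_cover_def by blast

abbreviation "dh i \<equiv> push St (F i) (h i)"
abbreviation "d\<sigma> i \<equiv> push (F i) St (\<sigma> i)"
abbreviation "dp \<equiv> push St S p"

lemma dh_d\<sigma>:
  assumes i: "i < r" and j: "j < r" and v: "v \<in> alg (F i)"
  shows "dh j (d\<sigma> i v) = (if j = i then v else 0)"
proof -
  note one = klg_one[OF F[OF i]]
  have "dh j (d\<sigma> i v) = push (F i) (F j) (\<lambda>y. h j (\<sigma> i y)) v"
    by (rule push_compose[OF cSt cF[OF j] \<sigma>_smooth[OF i] h_smooth[OF j]])
  also have "\<dots> = push (F i) (F j) (\<lambda>y. if j = i then y else one_of (F j)) v"
    by (rule push_cong) (rule h_\<sigma>[OF i j])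
  also have "\<dots> = (if j = i then v else 0)"
    using push_id[OF cF[OF i] v] push_const[OF cF[OF i] one v, of "F j" "one_of (F j)"] by simp
  finally show ?thesis .
qed

lemma \<Phi>_one: "\<Phi> (one_of St) = oneP"
proof
  fix i show "\<Phi> (one_of St) i = oneP i"
  proof (cases "i < r")
    case True
    then show ?thesis using lie_hom_one[OF St F[OF True] lie_hom_h[OF True]] by (simp add: h_def)
  next
    case False
    have "\<Phi> (one_of St) \<in> pts P" by (rule smooth_map_in[OF smooth\<Phi> klg_one[OF St]])
    then show ?thesis using False by (auto simp: pts_P PiE_def extensional_def)
  qed
qed

lemma proj_d\<Phi>: "i < r \<Longrightarrow> push P (F i) (\<lambda>x. x i) (push St P \<Phi> v) = dh i v"
  using push_compose[OF cP cF smooth\<Phi> proj_smooth] unfolding h_def[abs_def] by blast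

lemma gT_St:
  assumes v: "v \<in> alg St" and w: "w \<in> alg St"
  shows "gT St v w = (\<Sum>i<r. gT (F i) (dh i v) (dh i w))"
proof -
  have "gT St v w = met P (\<Phi> (one_of St)) (push St P \<Phi> v) (push St P \<Phi> w)"
    using pres\<Phi> klg_one[OF St] v w unfolding preserves_kaehler_def gT_def by simp
  then show ?thesis unfolding met_P \<Phi>_one by (simp add: proj_d\<Phi> gT_def)
qed

text \<open>The complex structure of the product is a sum of maps that factor through the single factors. Apart
  from describing J this shows that the images of the factors span: each vector is J of \<open>- J\<close> of itself.\<close>

lemma JT_St:
  assumes v: "v \<in> alg St" shows "JT St v = (\<Sum>i<r. d\<sigma> i (JT (F i) (dh i v)))"
proof -
  have inv: "push P St \<Psi> (push St P \<Phi> u) = u" if u: "u \<in> alg St" for u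
  proof -
    have "push P St \<Psi> (push St P \<Phi> u) = push St St (\<lambda>x. \<Psi> (\<Phi> x)) u"
      by (rule push_compose[OF cP cSt smooth\<Phi> smooth\<Psi>])
    also have "\<dots> = push St St (\<lambda>x. x) u" by (rule push_cong) (rule \<Psi>\<Phi>)
    also have "\<dots> = u" by (rule push_id[OF cSt u])
    finally show ?thesis .
  qed
  have 1: "push P St \<Psi> (push (F i) P (\<lambda>y. oneP(i := y)) w) = d\<sigma> i w" if "i < r" for i w
    unfolding \<sigma>_def[abs_def] by (rule push_compose[OF cP cSt slice_smooth[OF that] smooth\<Psi>])
  have "push St P \<Phi> (JT St v) = cpx P (\<Phi> (one_of St)) (push St P \<Phi> v)"
    using pres\<Phi> klg_one[OF St] v unfolding preserves_kaehler_def JT_def by simp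
  also have "\<dots> = (\<Sum>i<r. push (F i) P (\<lambda>y. oneP(i := y)) (JT (F i) (dh i v)))"
    unfolding cpx_P \<Phi>_one by (intro sum.cong refl) (simp add: proj_d\<Phi> JT_def)
  finally have "push P St \<Psi> (push St P \<Phi> (JT St v)) =
      push P St \<Psi> (\<Sum>i<r. push (F i) P (\<lambda>y. oneP(i := y)) (JT (F i) (dh i v)))" by simp
  then show ?thesis unfolding inv[OF JT_alg[OF St v]] push_sum by (simp add: 1)
qed

lemma hl: "kaehler_lie_group G \<Longrightarrow> hermitian_lie (alg G) (gT G) (JT G) (lie G)" for G :: "'z klg"
  by (rule klg_hermitian_lie)

lemma d\<sigma>_alg: "i < r \<Longrightarrow> v \<in> alg (F i) \<Longrightarrow> d\<sigma> i v \<in> alg St" by (rule hom_alg[OF F St lie_hom_\<sigma>])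
lemma dh_alg: "i < r \<Longrightarrow> v \<in> alg St \<Longrightarrow> dh i v \<in> alg (F i)" by (rule hom_alg[OF St F lie_hom_h])

lemma gT_d\<sigma>:
  assumes i: "i < r" and j: "j < r" and v: "v \<in> alg (F i)" and w: "w \<in> alg (F j)"
  shows "gT St (d\<sigma> i v) (d\<sigma> j w) = (if i = j then gT (F i) v w else 0)"
proof -
  have "gT (F k) (dh k (d\<sigma> i v)) (dh k (d\<sigma> j w)) = (if k = i \<and> i = j then gT (F i) v w else 0)" if k: "k < r" for k
  proof -
    interpret K: hermitian_lie "alg (F k)" "gT (F k)" "JT (F k)" "lie (F k)" by (rule hl[OF F[OF k]])
    show ?thesis
      using dh_d\<sigma>[OF i k v] dh_d\<sigma>[OF j k w] K.g_zero2[OF dh_alg[OF k d\<sigma>_alg[OF i v]]] K.g_zero1[OF dh_alg[OF k d\<sigma>_alg[OF j w]]]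
      by (cases "k = i"; cases "k = j") auto
  qed
  then have "gT St (d\<sigma> i v) (d\<sigma> j w) = (\<Sum>k<r. if k = i \<and> i = j then gT (F i) v w else 0)"
    unfolding gT_St[OF d\<sigma>_alg[OF i v] d\<sigma>_alg[OF j w]] by (intro sum.cong refl) simp
  also have "\<dots> = (if i = j then gT (F i) v w else 0)" using i by (cases "i = j") (simp_all add: sum.delta)
  finally show ?thesis .
qed

lemma JT_d\<sigma>:
  assumes i: "i < r" and v: "v \<in> alg (F i)" shows "JT St (d\<sigma> i v) = d\<sigma> i (JT (F i) v)"
proof -
  have "d\<sigma> k (JT (F k) (dh k (d\<sigma> i v))) = (if k = i then d\<sigma> i (JT (F i) v) else 0)" if k: "k < r" for k
  proof -
    interpret K: hermitian_lie "alg (F k)" "gT (F k)" "JT (F k)" "lie (F k)" by (rule hl[OF F[OF k]])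
    show ?thesis using dh_d\<sigma>[OF i k v] by simp
  qed
  then have "JT St (d\<sigma> i v) = (\<Sum>k<r. if k = i then d\<sigma> i (JT (F i) v) else 0)"
    unfolding JT_St[OF d\<sigma>_alg[OF i v]] by (intro sum.cong refl) simp
  also have "\<dots> = d\<sigma> i (JT (F i) v)" using i by (simp add: sum.delta)
  finally show ?thesis .
qed

text \<open>For different factors all projections of the bracket vanish, because each of them kills one of the
  two arguments.\<close>

lemma lie_d\<sigma>:
  assumes i: "i < r" and j: "j < r" and v: "v \<in> alg (F i)" and w: "w \<in> alg (F j)"
  shows "lie St (d\<sigma> i v) (d\<sigma> j w) = (if i = j then d\<sigma> i (lie (F i) v w) else 0)"
proof (cases "i = j")
  case True
  then show ?thesis using hom_lie[OF F[OF i] St lie_hom_\<sigma>[OF i] v] w by simp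
next
  case False
  let ?u = "lie St (d\<sigma> i v) (d\<sigma> j w)"
  note a = d\<sigma>_alg[OF i v] and b = d\<sigma>_alg[OF j w]
  have u: "?u \<in> alg St" by (rule lie_alg[OF St a b])
  have "gT (F k) (dh k ?u) (dh k ?u) = 0" if k: "k < r" for k
  proof -
    interpret K: hermitian_lie "alg (F k)" "gT (F k)" "JT (F k)" "lie (F k)" by (rule hl[OF F[OF k]])
    have "dh k ?u = lie (F k) (dh k (d\<sigma> i v)) (dh k (d\<sigma> j w))" by (rule hom_lie[OF St F[OF k] lie_hom_h[OF k] a b])
    also have "\<dots> = 0"
    proof (cases "k = i")
      case True
      then have "dh k (d\<sigma> j w) = 0" using dh_d\<sigma>[OF j k w] False by simp
      then show ?thesis using K.br_swap[of 0 "dh k (d\<sigma> i v)"] dh_alg[OF k a] by simp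
    next
      case False
      then have "dh k (d\<sigma> i v) = 0" using dh_d\<sigma>[OF i k v] by simp
      then show ?thesis using dh_alg[OF k b] by simp
    qed
    finally show ?thesis by simp
  qed
  then have "gT St ?u ?u = 0" unfolding gT_St[OF u u] by simp
  moreover interpret L: hermitian_lie "alg St" "gT St" "JT St" "lie St" by (rule hl[OF St])
  have "?u = 0 \<or> 0 < gT St ?u ?u" using L.g_pos[OF u] by blast
  ultimately show ?thesis using False by auto
qed

lemma span_St:
  assumes u: "u \<in> alg St" shows "\<exists>w. (\<forall>i<r. w i \<in> alg (F i)) \<and> u = (\<Sum>i<r. d\<sigma> i (w i))"
proof -
  interpret L: hermitian_lie "alg St" "gT St" "JT St" "lie St" by (rule hl[OF St])
  have v: "- JT St u \<in> alg St" using u by simp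
  have "u = JT St (- JT St u)" using u by (simp add: L.J_neg)
  then have "u = (\<Sum>i<r. d\<sigma> i (JT (F i) (dh i (- JT St u))))" using JT_St[OF v] by simp
  moreover have "\<forall>i<r. JT (F i) (dh i (- JT St u)) \<in> alg (F i)" using JT_alg[OF F dh_alg[OF _ v]] by blast
  ultimately show ?thesis by (intro exI[of _ "\<lambda>i. JT (F i) (dh i (- JT St u))"]) (rule conjI)
qed

lemma p_one: "p (one_of St) = one_of S" by (rule lie_hom_one[OF St S lie_hom_p])

lemma dp_bij: "bij_betw dp (alg St) (alg S)"
proof -
  have "\<forall>x\<in>pts St. bij_betw (push St S p) (tangent St x) (tangent S (p x))"
    using cov unfolding universal_cover_def by (elim conjE)
  from bspec[OF this klg_one[OF St]] show ?thesis unfolding p_one .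
qed

lemma dp_kaehler:
  assumes v: "v \<in> alg St"
  shows "JT S (dp v) = dp (JT St v)" "w \<in> alg St \<Longrightarrow> gT S (dp v) (dp w) = gT St v w"
proof -
  have pk: "preserves_kaehler St S p" using cov unfolding universal_cover_def by (elim conjE)
  have "cpx S (p (one_of St)) (dp v) = dp (cpx St (one_of St) v) \<and>
     (\<forall>w\<in>tangent St (one_of St). met S (p (one_of St)) (dp v) (dp w) = met St (one_of St) v w)"
    using bspec[OF bspec[OF pk[unfolded preserves_kaehler_def] klg_one[OF St]] v] .
  then show "JT S (dp v) = dp (JT St v)" "w \<in> alg St \<Longrightarrow> gT S (dp v) (dp w) = gT St v w"
    unfolding p_one JT_def gT_def by simp_all
qed

text \<open>The inclusion of the Lie algebra of the i-th factor into that of S.\<close>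

definition \<iota> where "\<iota> i v = dp (d\<sigma> i v)"

lemma \<iota>_alg: "i < r \<Longrightarrow> v \<in> alg (F i) \<Longrightarrow> \<iota> i v \<in> alg S"
  unfolding \<iota>_def by (rule hom_alg[OF St S lie_hom_p d\<sigma>_alg])

lemma \<iota>_lin: "\<iota> i (c *\<^sub>R v + w) = c *\<^sub>R \<iota> i v + \<iota> i w"
  by (simp add: \<iota>_def push_add push_scale)

lemma \<iota>_zero: "\<iota> i 0 = 0" by (simp add: \<iota>_def)

lemma gT_\<iota>: "i < r \<Longrightarrow> j < r \<Longrightarrow> v \<in> alg (F i) \<Longrightarrow> w \<in> alg (F j) \<Longrightarrow>
    gT S (\<iota> i v) (\<iota> j w) = (if i = j then gT (F i) v w else 0)"
  unfolding \<iota>_def by (simp only: dp_kaehler(2)[OF d\<sigma>_alg d\<sigma>_alg] gT_d\<sigma>)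

lemma JT_\<iota>: "i < r \<Longrightarrow> v \<in> alg (F i) \<Longrightarrow> JT S (\<iota> i v) = \<iota> i (JT (F i) v)"
  unfolding \<iota>_def by (simp only: dp_kaehler(1)[OF d\<sigma>_alg] JT_d\<sigma>)

lemma lie_\<iota>:
  assumes "i < r" "j < r" "v \<in> alg (F i)" "w \<in> alg (F j)"
  shows "lie S (\<iota> i v) (\<iota> j w) = (if i = j then \<iota> i (lie (F i) v w) else 0)"
proof -
  have "lie S (\<iota> i v) (\<iota> j w) = dp (lie St (d\<sigma> i v) (d\<sigma> j w))"
    unfolding \<iota>_def by (rule hom_lie[OF St S lie_hom_p d\<sigma>_alg d\<sigma>_alg, symmetric]) (rule assms)+
  then show ?thesis unfolding lie_d\<sigma>[OF assms] by (simp add: \<iota>_def)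
qed

lemma span_\<iota>:
  assumes u: "u \<in> alg S" shows "\<exists>w. (\<forall>i<r. w i \<in> alg (F i)) \<and> u = (\<Sum>i<r. \<iota> i (w i))"
proof -
  obtain v where v: "v \<in> alg St" "u = dp v" using dp_bij u unfolding bij_betw_def by blast
  obtain w where w: "\<forall>i<r. w i \<in> alg (F i)" "v = (\<Sum>i<r. d\<sigma> i (w i))" using span_St[OF v(1)] by (elim exE conjE)
  have "u = (\<Sum>i<r. \<iota> i (w i))" unfolding v(2) w(2) push_sum \<iota>_def ..
  with w(1) show ?thesis by (intro exI[of _ w]) (rule conjI)
qed

lemma \<iota>_inj:
  assumes i: "i < r" and v: "v \<in> alg (F i)" and w: "w \<in> alg (F i)" and e: "\<iota> i v = \<iota> i w" shows "v = w"
proof -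
  interpret K: hermitian_lie "alg (F i)" "gT (F i)" "JT (F i)" "lie (F i)" by (rule hl[OF F[OF i]])
  let ?d = "(- 1) *\<^sub>R w + v"
  have d: "?d \<in> alg (F i)" using v w by simp
  have "\<iota> i ?d = 0" unfolding \<iota>_lin e by simp
  then have "gT (F i) ?d ?d = 0" using gT_\<iota>[OF i i d d] klg_hermitian_lie[OF S] hermitian_lie.g_zero1[OF hl[OF S], of 0]
    hermitian_lie.T_zero[OF hl[OF S]] by simp
  then have "?d = 0" using K.g_pos[OF d] by force
  then show ?thesis by simp
qed

lemma simply_connected_factor: "i < r \<Longrightarrow> simply_connected_top (mtop (F i))"
proof (rule simply_connected_retract)
  show "simply_connected_top (mtop St)" using cov unfolding universal_cover_def by (elim conjE)
  assume i: "i < r"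
  show "continuous_map (mtop (F i)) (mtop St) (\<sigma> i)" by (rule smooth_map_cont[OF \<sigma>_smooth[OF i]])
  show "continuous_map (mtop St) (mtop (F i)) (h i)" by (rule smooth_map_cont[OF h_smooth[OF i]])
  show "h i (\<sigma> i x) = x" if "x \<in> pts (F i)" for x using h_\<sigma>[OF i i that] by simp
qed

end

text \<open>A coordinate derivation takes the value 1 on its own coordinate.\<close>

lemma alg_nontrivial:
  assumes G: "kaehler_lie_group G" and d: "0 < mdim G" shows "\<exists>a\<in>alg G. a \<noteq> 0"
proof -
  note cG = klg_charted[OF G]
  obtain U \<psi> where U: "(U, \<psi>) \<in> atlas G" "one_of G \<in> U" using charted_cover[OF cG klg_one[OF G]] by blast
  obtain W c where W: "openin (mtop G) W" "one_of G \<in> W" "W \<subseteq> U" "\<forall>i. c i \<in> smooth_fun G" "\<forall>i. \<forall>y\<in>W. c i y = \<psi> y i"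
    using tangent_coords[OF klg_smooth[OF G] U] by blast
  let ?v = "\<lambda>f. if f \<in> smooth_fun G then chart_pd U \<psi> 0 f (one_of G) else 0"
  have "?v (c 0) = 1"
    using W(4) chart_pd_coord[OF cG U(1) W(1,3,2), of "c 0" 0 0] W(5) d by simp
  then have "?v \<noteq> 0" by (auto dest: fun_cong[where x = "c 0"])
  with coord_tangent[OF cG U d] show ?thesis by (intro bexI[of _ ?v])
qed

context product_cover
begin

text \<open>The images of the Lie algebras of the factors satisfy the assumptions of \<open>special_product\<close>, and the
  structure found in T is pulled back along the isometric inclusions \<open>\<iota> i\<close>.\<close>

theorem factors:
  assumes sp: "special_point (alg S) (gT S) (JT S) (lie S) \<Gamma>"
    and K: "\<And>a b c. a \<in> alg S \<Longrightarrow> b \<in> alg S \<Longrightarrow> c \<in> alg S \<Longrightarrow>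
      special_point.R (JT S) (lie S) \<Gamma> a b c + special_point.S (JT S) \<Gamma> a (special_point.S (JT S) \<Gamma> b c)
        - special_point.S (JT S) \<Gamma> b (special_point.S (JT S) \<Gamma> a c) =
      gT S a c *\<^sub>R b + gT S (JT S a) c *\<^sub>R JT S b - gT S b c *\<^sub>R a - gT S (JT S b) c *\<^sub>R JT S a + (2 * gT S (JT S a) b) *\<^sub>R JT S c"
    and r: "3 \<le> r" and dim: "\<And>i. i < r \<Longrightarrow> 0 < mdim (F i)"
  shows "r = 3"
    and "i < r \<Longrightarrow> \<exists>u\<in>alg (F i). gT (F i) u u = 1 \<and>
      (\<forall>c\<in>alg (F i). c = gT (F i) u c *\<^sub>R u + gT (F i) (JT (F i) u) c *\<^sub>R JT (F i) u) \<and>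
      lie (F i) u (JT (F i) u) = 2 *\<^sub>R JT (F i) u"
proof -
  define V where "V i = \<iota> i ` alg (F i)" for i
  have VI: "\<iota> i v \<in> V i" if "v \<in> alg (F i)" for i v using that by (simp add: V_def)
  have VE: thesis if "x \<in> V i" "\<And>v. v \<in> alg (F i) \<Longrightarrow> x = \<iota> i v \<Longrightarrow> thesis" for x i thesis
    using that by (auto simp: V_def)
  have prod: "special_product (alg S) (gT S) (JT S) (lie S) \<Gamma> V r"
  proof (intro special_product.intro[OF sp] special_product_axioms.intro)
    show "3 \<le> r" by (rule r)
    fix i assume i: "i < r"
    show "subspace (V i)"
    proof (rule subspaceI)
      show "0 \<in> V i" using VI[of 0 i] subspace_0[OF subspace_alg[OF F[OF i]]] by (simp add: \<iota>_zero)
      fix x y c assume x: "x \<in> V i" and y: "y \<in> V i"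
      obtain v w where v: "v \<in> alg (F i)" "x = \<iota> i v" and w: "w \<in> alg (F i)" "y = \<iota> i w"
        using VE[OF x] VE[OF y] by metis
      show "x + y \<in> V i"
        using VI[OF subspace_add[OF subspace_alg[OF F[OF i]] v(1) w(1)]] \<iota>_lin[of i 1 v w] v w by simp
      have "c *\<^sub>R x = \<iota> i (c *\<^sub>R v)" using \<iota>_lin[of i c v 0] v by (simp add: \<iota>_zero)
      then show "c *\<^sub>R x \<in> V i" using VI[OF subspace_scale[OF subspace_alg[OF F[OF i]] v(1)]] by simp
    qed
    show "v \<in> alg S" if "v \<in> V i" for v using that by (elim VE) (simp add: \<iota>_alg i)
    show "JT S v \<in> V i" if "v \<in> V i" for v
      using that by (elim VE) (simp add: JT_\<iota> i VI JT_alg[OF F[OF i]])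
    show "lie S u v \<in> V i" if "u \<in> V i" "v \<in> V i" for u v
      using that by (elim VE) (simp add: lie_\<iota> i VI lie_alg[OF F[OF i]])
    obtain a where a: "a \<in> alg (F i)" "a \<noteq> 0" using alg_nontrivial[OF F[OF i] dim[OF i]] by blast
    have "\<iota> i a \<noteq> 0"
      using \<iota>_inj[OF i a(1) subspace_0[OF subspace_alg[OF F[OF i]]]] a(2) by (auto simp: \<iota>_zero)
    then show "\<exists>a\<in>V i. a \<noteq> 0" using VI[OF a(1)] by blast
    fix j assume j: "j < r" "i \<noteq> j"
    show "gT S u v = 0" if "u \<in> V i" "v \<in> V j" for u v
      using that by (elim VE) (simp add: gT_\<iota> i j)
    show "lie S u v = 0" if "u \<in> V i" "v \<in> V j" for u v
      using that by (elim VE) (simp add: lie_\<iota> i j)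
  next
    fix u assume "u \<in> alg S"
    from span_\<iota>[OF this] obtain w where w: "\<forall>i<r. w i \<in> alg (F i)" "u = (\<Sum>i<r. \<iota> i (w i))" by (elim exE conjE)
    then show "\<exists>w. (\<forall>i<r. w i \<in> V i) \<and> u = (\<Sum>i<r. w i)"
      by (intro exI[of _ "\<lambda>i. \<iota> i (w i)"]) (simp add: VI)
  next
    fix a b c assume "a \<in> alg S" "b \<in> alg S" "c \<in> alg S"
    then show "special_point.R (JT S) (lie S) \<Gamma> a b c + special_point.S (JT S) \<Gamma> a (special_point.S (JT S) \<Gamma> b c)
        - special_point.S (JT S) \<Gamma> b (special_point.S (JT S) \<Gamma> a c) =
      gT S a c *\<^sub>R b + gT S (JT S a) c *\<^sub>R JT S b - gT S b c *\<^sub>R a - gT S (JT S b) c *\<^sub>R JT S a + (2 * gT S (JT S a) b) *\<^sub>R JT S c"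
      by (rule K)
  qed
  show "r = 3" by (rule special_product.three_factors[OF prod])
  assume i: "i < r"
  from special_product.factor_structure[OF prod i] obtain x where x: "x \<in> V i" "gT S x x = 1"
    "\<forall>c\<in>V i. c = gT S x c *\<^sub>R x + gT S (JT S x) c *\<^sub>R JT S x" "lie S x (JT S x) = 2 *\<^sub>R JT S x" by (elim bexE conjE)
  obtain u where u: "u \<in> alg (F i)" "x = \<iota> i u" using VE[OF x(1)] .
  note Ju = JT_alg[OF F[OF i] u(1)]
  note sub = subspace_add[OF subspace_alg[OF F[OF i]]] subspace_scale[OF subspace_alg[OF F[OF i]]]
  show "\<exists>u\<in>alg (F i). gT (F i) u u = 1 \<and>
      (\<forall>c\<in>alg (F i). c = gT (F i) u c *\<^sub>R u + gT (F i) (JT (F i) u) c *\<^sub>R JT (F i) u) \<and>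
      lie (F i) u (JT (F i) u) = 2 *\<^sub>R JT (F i) u"
  proof (intro bexI[OF _ u(1)] conjI ballI)
    show "gT (F i) u u = 1" using x(2) gT_\<iota>[OF i i u(1) u(1)] u(2) by simp
    have lin: "\<iota> i (c *\<^sub>R v) = c *\<^sub>R \<iota> i v" for c v using \<iota>_lin[of i c v 0] by (simp add: \<iota>_zero)
    show "lie (F i) u (JT (F i) u) = 2 *\<^sub>R JT (F i) u"
    proof (rule \<iota>_inj[OF i lie_alg[OF F[OF i] u(1) Ju] sub(2)[OF Ju]])
      show "\<iota> i (lie (F i) u (JT (F i) u)) = \<iota> i (2 *\<^sub>R JT (F i) u)"
        using x(4) lie_\<iota>[OF i i u(1) Ju] JT_\<iota>[OF i u(1)] unfolding u(2) lin by simp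
    qed
    fix c assume c: "c \<in> alg (F i)"
    show "c = gT (F i) u c *\<^sub>R u + gT (F i) (JT (F i) u) c *\<^sub>R JT (F i) u"
    proof (rule \<iota>_inj[OF i c sub(1)[OF sub(2)[OF u(1)] sub(2)[OF Ju]]])
      show "\<iota> i c = \<iota> i (gT (F i) u c *\<^sub>R u + gT (F i) (JT (F i) u) c *\<^sub>R JT (F i) u)"
        unfolding \<iota>_lin lin JT_\<iota>[OF i u(1), symmetric]
        using bspec[OF x(3) VI[OF c]] gT_\<iota>[OF i i u(1) c] gT_\<iota>[OF i i Ju c] JT_\<iota>[OF i u(1)] unfolding u(2) by simp
    qed
  qed
qed

end

section \<open>The complex hyperbolic line\<close>

lemma bracket_mult_left:
  assumes M: "charted M" and X: "X \<in> vfields M" and Y: "Y \<in> vfields M" and f: "f \<in> smooth_fun M"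
  shows "bracket (\<lambda>p. f p *\<^sub>R X p) Y p = (- Y p f) *\<^sub>R X p + f p *\<^sub>R bracket X Y p"
proof
  fix h
  show "bracket (\<lambda>p. f p *\<^sub>R X p) Y p h = ((- Y p f) *\<^sub>R X p + f p *\<^sub>R bracket X Y p) h"
  proof (cases "h \<in> smooth_fun M \<and> p \<in> pts M")
    case True
    then show ?thesis
      using tangent_mult[OF vfieldsD(1)[OF Y, of p] f vfieldsD(3)[OF X, of h]]
      by (simp add: bracket_def algebra_simps)
  next
    case False
    have z: "bracket A Y p h = 0" if "A \<in> vfields M" for A
      using vfield_off[OF bracket_vfields[OF M that Y], of h p] vfieldsD(2)[OF bracket_vfields[OF M that Y], of p] False by auto
    have "X p h = 0" using vfield_off[OF X, of h p] vfieldsD(2)[OF X, of p] False by auto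
    then show ?thesis using z[OF X] z[OF vfields_mult[OF M X f]] by simp
  qed
qed

context
  fixes M :: "('a, 'z) mfd_scheme" and \<alpha> assumes M: "charted M" and \<alpha>: "one_form M \<alpha>"
begin

lemma d1_swap: "X \<in> vfields M \<Longrightarrow> Y \<in> vfields M \<Longrightarrow> p \<in> pts M \<Longrightarrow> d1 M \<alpha> Y X p = - d1 M \<alpha> X Y p"
  using form_scale[OF M \<alpha> _ vfieldsD(1)[OF bracket_vfields[OF M]], of p X Y "- 1"] bracket_swap[of Y X]
  by (simp add: d1_def)

text \<open>The terms containing a derivative of f cancel: exterior derivatives are tensorial. Hence they need
  to be computed only on a frame.\<close>

lemma d1_linear:
  assumes X: "X \<in> vfields M" and Y: "Y \<in> vfields M" and Z: "Z \<in> vfields M" and f: "f \<in> smooth_fun M" and p: "p \<in> pts M"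
  shows "d1 M \<alpha> ((\<lambda>p. f p *\<^sub>R X p) + Z) Y p = f p * d1 M \<alpha> X Y p + d1 M \<alpha> Z Y p"
proof -
  note fX = vfields_mult[OF M X f] and Yp = vfieldsD(1)[OF Y p]
  note sX = form_smooth[OF \<alpha> X] and sZ = form_smooth[OF \<alpha> Z]
  have "ev1 M \<alpha> ((\<lambda>p. f p *\<^sub>R X p) + Z) = (\<lambda>q. f q * ev1 M \<alpha> X q + ev1 M \<alpha> Z q)"
    using form_linear[OF \<alpha> _ vfieldsD(1)[OF X] vfieldsD(1)[OF Z]] by (auto simp: ev1_def cut_def fun_eq_iff)
  then have 1: "Y p (ev1 M \<alpha> ((\<lambda>p. f p *\<^sub>R X p) + Z)) =
      f p * Y p (ev1 M \<alpha> X) + \<alpha> p (X p) * Y p f + Y p (ev1 M \<alpha> Z)"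
    using tangent_add[OF M Yp smooth_fun_mult[OF M f sX] sZ] tangent_mult[OF Yp f sX] p
    by (simp add: ev1_def cut_def)
  have b: "bracket ((\<lambda>p. f p *\<^sub>R X p) + Z) Y p =
      (- Y p f) *\<^sub>R X p + (f p *\<^sub>R bracket X Y p + bracket Z Y p)"
    using bracket_add_left[OF M fX Z Y, of 1] bracket_mult_left[OF M X Y f, of p] by (simp add: add.assoc)
  note t = vfieldsD(1)[OF X p] vfieldsD(1)[OF bracket_vfields[OF M X Y] p] vfieldsD(1)[OF bracket_vfields[OF M Z Y] p]
  have "\<alpha> p (bracket ((\<lambda>p. f p *\<^sub>R X p) + Z) Y p) =
      - Y p f * \<alpha> p (X p) + (f p * \<alpha> p (bracket X Y p) + \<alpha> p (bracket Z Y p))"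
    unfolding b form_linear[OF \<alpha> p t(1) subspace_add[OF subspace_tangent[OF M] subspace_scale[OF subspace_tangent[OF M] t(2)] t(3)]]
      form_linear[OF \<alpha> p t(2,3)] ..
  then show ?thesis unfolding d1_def 1 by (simp add: algebra_simps)
qed

lemma d1_frame:
  assumes e: "e1 \<in> vfields M" "e2 \<in> vfields M"
    and X: "f \<in> smooth_fun M" "f' \<in> smooth_fun M" and Y: "h \<in> smooth_fun M" "h' \<in> smooth_fun M" and p: "p \<in> pts M"
  shows "d1 M \<alpha> ((\<lambda>p. f p *\<^sub>R e1 p) + (\<lambda>p. f' p *\<^sub>R e2 p)) ((\<lambda>p. h p *\<^sub>R e1 p) + (\<lambda>p. h' p *\<^sub>R e2 p)) p =
    (f p * h' p - h p * f' p) * d1 M \<alpha> e1 e2 p"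
proof -
  have z: "0 \<in> vfields M" by (rule vfields_zero[OF M])
  have lin: "d1 M \<alpha> ((\<lambda>p. k p *\<^sub>R e1 p) + (\<lambda>p. k' p *\<^sub>R e2 p)) Z p = k p * d1 M \<alpha> e1 Z p + k' p * d1 M \<alpha> e2 Z p"
    if k: "k \<in> smooth_fun M" "k' \<in> smooth_fun M" and Z: "Z \<in> vfields M" for k k' Z
  proof -
    have "(\<lambda>p. cut M (\<lambda>_. 1) p *\<^sub>R (0 :: 'a vfield) p) + 0 = 0" by (simp add: fun_eq_iff)
    then have "d1 M \<alpha> 0 Z p = 0" using d1_linear[OF z Z z smooth_fun_const[OF M, of 1] p] p by (simp add: cut_def[of M "\<lambda>_. 1"])
    then have "d1 M \<alpha> (\<lambda>p. k' p *\<^sub>R e2 p) Z p = k' p * d1 M \<alpha> e2 Z p" using d1_linear[OF e(2) Z z k(2) p] by simp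
    then show ?thesis using d1_linear[OF e(1) Z vfields_mult[OF M e(2) k(2)] k(1) p] by simp
  qed
  let ?Y = "(\<lambda>p. h p *\<^sub>R e1 p) + (\<lambda>p. h' p *\<^sub>R e2 p)"
  have Yv: "?Y \<in> vfields M" by (intro vfields_add vfields_mult M e Y)
  have r: "d1 M \<alpha> E ?Y p = h p * d1 M \<alpha> E e1 p + h' p * d1 M \<alpha> E e2 p" if E: "E \<in> vfields M" for E
    using lin[OF Y E] d1_swap[OF E Yv p] d1_swap[OF E e(1) p] d1_swap[OF E e(2) p] by simp
  have "d1 M \<alpha> e1 e1 p = 0" "d1 M \<alpha> e2 e2 p = 0" using d1_swap[OF e(1) e(1) p] d1_swap[OF e(2) e(2) p] by simp_all
  then show ?thesis using lin[OF X Yv] r[OF e(1)] r[OF e(2)] d1_swap[OF e p] by (simp add: algebra_simps)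
qed

end

text \<open>The coordinate derivations of a chart at the unit form a basis.\<close>

lemma dim_alg:
  assumes G: "kaehler_lie_group G" shows "dim (alg G) = mdim G"
proof -
  note cG = klg_charted[OF G]
  let ?d = "mdim G"
  obtain U \<psi> where U: "(U, \<psi>) \<in> atlas G" "one_of G \<in> U" using charted_cover[OF cG klg_one[OF G]] by blast
  obtain W c where W: "openin (mtop G) W" "one_of G \<in> W" "W \<subseteq> U" "\<forall>i. c i \<in> smooth_fun G" "\<forall>i. \<forall>y\<in>W. c i y = \<psi> y i"
    and v: "\<forall>y\<in>W. \<forall>v\<in>tangent G y. \<forall>h\<in>smooth_fun G. v h = (\<Sum>i<?d. v (c i) * chart_pd U \<psi> i h y)"
    using tangent_coords[OF klg_smooth[OF G] U] by (elim exE conjE)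
  define D where "D i f = (if f \<in> smooth_fun G then chart_pd U \<psi> i f (one_of G) else 0)" for i f
  have D: "D i \<in> alg G" if "i < ?d" for i unfolding D_def[abs_def] by (rule coord_tangent[OF cG U that])
  have Dc: "D i (c j) = (if i = j then 1 else 0)" if "i < ?d" for i j
    using W(4) chart_pd_coord[OF cG U(1) W(1,3,2), of "c j" j i] W(5) that by (simp add: D_def)
  have sp: "w = (\<Sum>i<?d. w (c i) *\<^sub>R D i)" if w: "w \<in> alg G" for w
  proof
    fix h show "w h = (\<Sum>i<?d. w (c i) *\<^sub>R D i) h"
    proof (cases "h \<in> smooth_fun G")
      case True
      from bspec[OF bspec[OF bspec[OF v W(2)] w] True] show ?thesis by (simp add: sum_fun_apply D_def True)
    next
      case False
      then show ?thesis using tangent_off[OF w False] by (simp add: sum_fun_apply D_def)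
    qed
  qed
  have inj: "inj_on D {..<?d}"
  proof (rule inj_onI)
    fix i j assume "i \<in> {..<?d}" "j \<in> {..<?d}" "D i = D j"
    then show "i = j" using Dc[of i j] Dc[of j j] by (auto split: if_splits)
  qed
  have ind: "independent (D ` {..<?d})"
    unfolding dependent_finite[OF finite_imageI[OF finite_lessThan]]
  proof (intro notI, elim exE conjE bexE)
    fix f x assume z: "(\<Sum>x\<in>D ` {..<?d}. f x *\<^sub>R x) = 0" and x: "x \<in> D ` {..<?d}" and fx: "f x \<noteq> 0"
    obtain j where j: "j < ?d" "x = D j" using x by auto
    have "(\<Sum>i<?d. f (D i) *\<^sub>R D i) = 0" using z unfolding sum.reindex[OF inj] by simp
    then have "(\<Sum>i<?d. f (D i) *\<^sub>R D i) (c j) = 0" by simp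
    moreover have "(\<Sum>i<?d. f (D i) *\<^sub>R D i) (c j) = (\<Sum>i<?d. if i = j then f (D j) else 0)"
      unfolding sum_fun_apply by (intro sum.cong refl) (simp add: Dc)
    ultimately show False using j fx by (simp add: sum.delta)
  qed
  have "span (D ` {..<?d}) = alg G"
  proof (rule span_unique)
    show "D ` {..<?d} \<subseteq> alg G" using D by auto
    show "subspace (alg G)" by (rule subspace_alg[OF G])
    fix A assume A: "D ` {..<?d} \<subseteq> A" "subspace A"
    show "alg G \<subseteq> A"
    proof
      fix w assume "w \<in> alg G"
      from sp[OF this] show "w \<in> A" using A
        by (metis (no_types, lifting) image_subset_iff subspace_scale subspace_sum)
    qed
  qed
  also have "alg G = span (alg G)" by (rule span_eq_iff[THEN iffD2, OF subspace_alg[OF G], symmetric])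
  finally have "dim (alg G) = card (D ` {..<?d})" by (rule dim_eq_card[OF _ ind])
  then show ?thesis using card_image[OF inj] by simp
qed

text \<open>The coframe dual to the left-invariant frame u, \<open>J u\<close> has the required properties. For an invariant
  form \<open>\<alpha>\<close> the exterior derivative on the frame is \<open>- \<alpha> [u, J u] = - 2 \<alpha> (J u)\<close>, which is 0 for the
  first and -2 for the second form.\<close>

lemma is_CH1I:
  assumes G: "kaehler_lie_group G" and sc: "simply_connected_top (mtop G)" and u: "u \<in> alg G" and uu: "gT G u u = 1"
    and sp: "\<And>c. c \<in> alg G \<Longrightarrow> c = gT G u c *\<^sub>R u + gT G (JT G u) c *\<^sub>R JT G u"
    and br: "lie G u (JT G u) = 2 *\<^sub>R JT G u"
  shows "is_CH1 (- 2) G"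
proof -
  interpret L: hermitian_lie "alg G" "gT G" "JT G" "lie G" by (rule klg_hermitian_lie[OF G])
  note cG = klg_charted[OF G]
  let ?w = "JT G u"
  have w: "?w \<in> alg G" by (rule JT_alg[OF G u])
  have uw: "gT G ?w u = 0" "gT G u ?w = 0" "gT G ?w ?w = 1" using u uu L.g_sym[OF u w] by simp_all
  define a where "a x v = met G x (linv G u x) v" for x v
  define b where "b x v = met G x (linv G ?w x) v" for x v
  have bil: "bilinear_field G (met G)" using klg_pr[OF G] by (simp add: pseudo_riemannian_def)
  have form: "left_invariant_form G (\<lambda>x v. met G x (linv G c x) v)" if c: "c \<in> alg G" for c
    unfolding left_invariant_form_def one_form_def
  proof (intro conjI ballI)
    fix x assume x: "x \<in> pts G"
    show "linear_on_tangent G x (met G x (linv G c x))"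
      using bil linv_tangent[OF G c x] x unfolding bilinear_field_def by blast
    fix y v assume y: "y \<in> pts G" and v: "v \<in> tangent G y"
    show "met G (x \<otimes>\<^bsub>grp G\<^esub> y) (linv G c (x \<otimes>\<^bsub>grp G\<^esub> y)) (dL G x v) = met G y (linv G c y) v"
      using klg_invariant(2)[OF G x y linv_tangent[OF G c y] v] linv_dL[OF G x y, of c] by simp
  next
    fix X assume X: "X \<in> vfields G"
    have "ev1 G (\<lambda>x. met G x (linv G c x)) X = ev2 G (met G) (linv G c) X" by (simp add: ev1_def ev2_def)
    then show "ev1 G (\<lambda>x. met G x (linv G c x)) X \<in> smooth_fun G"
      using bil X linv_vfield[OF G c] unfolding bilinear_field_def by simp
  qed
  have fa: "left_invariant_form G a" unfolding a_def[abs_def] by (rule form[OF u])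
  have fb: "left_invariant_form G b" unfolding b_def[abs_def] by (rule form[OF w])
  have oa: "one_form G a" and ob: "one_form G b" using fa fb by (simp_all add: left_invariant_form_def)
  have frame: "v = a x v *\<^sub>R linv G u x + b x v *\<^sub>R linv G ?w x" if x: "x \<in> pts G" and v: "v \<in> tangent G x" for x v
  proof -
    obtain c where c: "c \<in> alg G" "v = linv G c x" using linv_at[OF G x v] by blast
    have "linv G c = gT G u c *\<^sub>R linv G u + gT G ?w c *\<^sub>R linv G ?w"
      using arg_cong[OF sp[OF c(1)], of "linv G"] by (simp only: linv_add[OF G] linv_scale[OF G])
    then show ?thesis using c met_linv[OF G x u c(1)] met_linv[OF G x w c(1)] by (simp add: a_def b_def)
  qed
  have ba: "b x v = - a x (cpx G x v)" if x: "x \<in> pts G" and v: "v \<in> tangent G x" for x v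
  proof -
    note t = linv_tangent[OF G u x] and Jv = cpx_tangent[OF G x v]
    have "a x (cpx G x v) = met G x (cpx G x (linv G u x)) (cpx G x (cpx G x v))"
      using met_cpx[OF G x t Jv] by (simp add: a_def)
    also have "\<dots> = b x ((- 1) *\<^sub>R v)" using cpx_linv[OF G x u] cpx_cpx[OF G x v] by (simp add: b_def)
    also have "\<dots> = - b x v" using form_scale[OF cG ob x v, of "- 1"] by simp
    finally show ?thesis by simp
  qed
  have ab: "a x v = b x (cpx G x v)" if x: "x \<in> pts G" and v: "v \<in> tangent G x" for x v
    using ba[OF x cpx_tangent[OF G x v]] cpx_cpx[OF G x v] form_scale[OF cG oa x v, of "- 1"] by simp
  have met: "met G x v y = a x v * a x y + b x v * b x y" if x: "x \<in> pts G" and v: "v \<in> tangent G x" and y: "y \<in> tangent G x" for x v y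
  proof -
    note t = linv_tangent[OF G u x] linv_tangent[OF G w x]
    have 0: "0 \<in> tangent G x" by (rule subspace_0[OF subspace_tangent[OF cG]])
    have s: "b x v *\<^sub>R linv G ?w x \<in> tangent G x" by (rule subspace_scale[OF subspace_tangent[OF cG] t(2)])
    have "met G x v y = met G x (a x v *\<^sub>R linv G u x + b x v *\<^sub>R linv G ?w x) y" using frame[OF x v] by simp
    also have "\<dots> = a x v * a x y + met G x (b x v *\<^sub>R linv G ?w x) y"
      unfolding met_linear1[OF G x y t(1) s] by (simp add: a_def)
    also have "met G x (b x v *\<^sub>R linv G ?w x) y = b x v * b x y"
      using met_linear1[OF G x y t(2) 0, of "b x v"] met_linear1[OF G x y 0 0, of 1] by (simp add: b_def)
    finally show ?thesis .
  qed
  have kf: "kform (met G) (cpx G) x v y = wedge a b x v y" if x: "x \<in> pts G" and v: "v \<in> tangent G x" and y: "y \<in> tangent G x" for x v y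
    using met[OF x cpx_tangent[OF G x v] y] ba[OF x v] ab[OF x v] by (simp add: kform_def wedge_def)
  have frame_vals: "a x (linv G u x) = 1" "a x (linv G ?w x) = 0" "b x (linv G u x) = 0" "b x (linv G ?w x) = 1"
    if x: "x \<in> pts G" for x
    using met_linv[OF G x u u] met_linv[OF G x u w] met_linv[OF G x w u] met_linv[OF G x w w] uu uw
    by (simp_all add: a_def b_def)
  have d: "d1 G \<alpha> X Y x = wedge a b x (X x) (Y x) * (- 2 * \<alpha> x (linv G ?w x))"
    if \<alpha>: "one_form G \<alpha>" and k: "\<And>c. c \<in> {u, ?w} \<Longrightarrow> \<exists>k. \<forall>x\<in>pts G. \<alpha> x (linv G c x) = k"
      and X: "X \<in> vfields G" and Y: "Y \<in> vfields G" and x: "x \<in> pts G" for \<alpha> X Y x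
  proof -
    have fr: "Z = (\<lambda>p. ev1 G a Z p *\<^sub>R linv G u p) + (\<lambda>p. ev1 G b Z p *\<^sub>R linv G ?w p)" if Z: "Z \<in> vfields G" for Z
    proof
      fix p show "Z p = ((\<lambda>p. ev1 G a Z p *\<^sub>R linv G u p) + (\<lambda>p. ev1 G b Z p *\<^sub>R linv G ?w p)) p"
        using frame[OF _ vfieldsD(1)[OF Z], of p] vfieldsD(2)[OF Z, of p]
        by (cases "p \<in> pts G") (simp_all add: ev1_def cut_def)
    qed
    have cst: "v (ev1 G \<alpha> (linv G c)) = 0" if c: "c \<in> {u, ?w}" and v: "v \<in> tangent G x" for c v
    proof -
      obtain k' where "\<forall>x\<in>pts G. \<alpha> x (linv G c x) = k'" using k[OF c] by blast
      then have "ev1 G \<alpha> (linv G c) = cut G (\<lambda>_. k')" by (auto simp: ev1_def cut_def fun_eq_iff)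
      then show ?thesis using tangent_const[OF cG v x] by simp
    qed
    have "d1 G \<alpha> (linv G u) (linv G ?w) x = - \<alpha> x (linv G (2 *\<^sub>R ?w) x)"
      using cst[of ?w, OF _ linv_tangent[OF G u x]] cst[of u, OF _ linv_tangent[OF G w x]]
      by (simp add: d1_def bracket_linv[OF G u w] br)
    also have "\<dots> = - 2 * \<alpha> x (linv G ?w x)"
      using form_scale[OF cG \<alpha> x linv_tangent[OF G w x], of 2] by (simp add: linv_scale[OF G])
    finally have e: "d1 G \<alpha> (linv G u) (linv G ?w) x = - 2 * \<alpha> x (linv G ?w x)" .
    note sm = form_smooth[OF oa] form_smooth[OF ob]
    have "d1 G \<alpha> X Y x = (ev1 G a X x * ev1 G b Y x - ev1 G a Y x * ev1 G b X x) * d1 G \<alpha> (linv G u) (linv G ?w) x"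
      using d1_frame[OF cG \<alpha> linv_vfield[OF G u] linv_vfield[OF G w] sm(1)[OF X] sm(2)[OF X] sm(1)[OF Y] sm(2)[OF Y] x]
      unfolding fr[OF X, symmetric] fr[OF Y, symmetric] .
    then show ?thesis unfolding e using x by (simp add: ev1_def cut_def wedge_def)
  qed
  have ka: "\<exists>k. \<forall>x\<in>pts G. a x (linv G c x) = k" if "c \<in> {u, ?w}" for c
    using that frame_vals by (elim insertE emptyE) auto
  have kb: "\<exists>k. \<forall>x\<in>pts G. b x (linv G c x) = k" if "c \<in> {u, ?w}" for c
    using that frame_vals by (elim insertE emptyE) auto
  have da: "has_d1 G a (\<lambda>x v w. 0)"
    unfolding has_d1_def
  proof (intro ballI)
    fix X Y x assume X: "X \<in> vfields G" and Y: "Y \<in> vfields G" and x: "x \<in> pts G"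
    show "d1 G a X Y x = 0"
      using d[OF oa ka X Y x] frame_vals(2)[OF x] by simp
  qed
  have db: "has_d1 G b (\<lambda>x v w. - 2 * wedge a b x v w)"
    unfolding has_d1_def
  proof (intro ballI)
    fix X Y x assume X: "X \<in> vfields G" and Y: "Y \<in> vfields G" and x: "x \<in> pts G"
    show "d1 G b X Y x = - 2 * wedge a b x (X x) (Y x)"
      using d[OF ob kb X Y x] frame_vals(4)[OF x] by simp
  qed
  have "dim (alg G) = 2"
  proof -
    have ne: "u \<noteq> ?w" using uu uw by auto
    have fin: "finite {u, ?w}" by simp
    have "independent {u, ?w}"
      unfolding dependent_finite[OF fin]
    proof (intro notI, elim exE conjE bexE)
      fix f x assume z: "(\<Sum>x\<in>{u, ?w}. f x *\<^sub>R x) = 0" and x: "x \<in> {u, ?w}" "f x \<noteq> 0"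
      have "f u *\<^sub>R u + f ?w *\<^sub>R ?w = 0" using z ne by simp
      then have "gT G (f u *\<^sub>R u + f ?w *\<^sub>R ?w) u = 0" "gT G (f u *\<^sub>R u + f ?w *\<^sub>R ?w) ?w = 0" using u w by simp_all
      then have "f u = 0" "f ?w = 0" using u w uu uw by (simp_all add: L.g_simps)
      then show False using x by auto
    qed
    note ind = this
    have "span {u, ?w} = alg G"
    proof (rule span_unique)
      show "{u, ?w} \<subseteq> alg G" using u w by simp
      show "subspace (alg G)" by (rule subspace_alg[OF G])
      fix A assume A: "{u, ?w} \<subseteq> A" "subspace A"
      show "alg G \<subseteq> A"
      proof
        fix c assume "c \<in> alg G"
        from sp[OF this] show "c \<in> A" using A by (metis insert_subset subspace_add subspace_scale)
      qed
    qed
    also have "alg G = span (alg G)" by (rule span_eq_iff[THEN iffD2, OF subspace_alg[OF G], symmetric])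
    finally have "dim (alg G) = card {u, ?w}" by (rule dim_eq_card[OF _ ind])
    then show ?thesis using ne by simp
  qed
  then have "mdim G = 2" using dim_alg[OF G] by simp
  then show ?thesis unfolding is_CH1_def
    using G sc fa fb ba met kf da db by (intro conjI exI[of _ a] exI[of _ b] ballI) simp_all
qed

section \<open>Three or more Kaehler factors\<close>

theorem proposition5p1:
  fixes S :: "'a klg" and St :: "'b klg" and p :: "'b \<Rightarrow> 'a"
    and F :: "nat \<Rightarrow> 'd klg" and n r :: nat
  assumes "kaehler_lie_group S" and "mdim S = 2 * n"
    and "extends_to_psk TYPE('c) S"
    and "universal_cover St p S"
    and "3 \<le> r"
    and "\<forall>i<r. kaehler_lie_group (F i) \<and> 0 < mdim (F i)"
    and "kaehler_lie_isomorphic St (prod_klg {..<r} F)"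
  shows "r = 3 \<and>
    kaehler_lie_isomorphic St (prod_klg {..<3} F) \<and>
    (\<forall>i<3. \<exists>c. is_CH1 c (F i) \<and> CH1_hol_sect_curv c = -1)"
proof -
  obtain C0 :: "'c mfd" and \<pi> act \<phi> J nabla where E:
    "principal_circle_bundle C0 S \<pi> act" "connection_form C0 act \<phi>"
    "has_d1 C0 \<phi> (\<lambda>x v w. 2 * kform (met S) (cpx S) (\<pi> x) (push C0 S \<pi> v) (push C0 S \<pi> w))"
    "pseudo_kaehler (cone_mfd C0) (cone_metric S C0 \<pi> \<phi>) J"
    "\<forall>p\<in>pts (cone_mfd C0). \<forall>v\<in>tangent (cone_mfd C0) p. \<forall>w\<in>tangent (cone_mfd C0) p.
      cone_kform S C0 \<pi> \<phi> p v w = kform (cone_metric S C0 \<pi> \<phi>) J p v w"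
    "app (cone_mfd C0) J (circle_generator (cone_mfd C0) (cone_act act)) = cone_t_ddt C0"
    "affine_connection (cone_mfd C0) nabla" "torsion_free (cone_mfd C0) nabla" "flat (cone_mfd C0) nabla"
    "parallel2 (cone_mfd C0) nabla (cone_kform S C0 \<pi> \<phi>)"
    "\<forall>A\<in>vfields (cone_mfd C0). \<forall>B\<in>vfields (cone_mfd C0).
      cov_endo (cone_mfd C0) nabla J A B = cov_endo (cone_mfd C0) nabla J B A"
    "\<forall>A\<in>vfields (cone_mfd C0). nabla A (circle_generator (cone_mfd C0) (cone_act act)) = (\<lambda>p f. - app (cone_mfd C0) J A p f)"
    using assms(3) unfolding extends_to_psk_def Let_def by (elim exE conjE)
  have "psk S C0 \<pi> act \<phi> J nabla"
  proof (rule psk.intro)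
    show "kaehler_lie_group S" by (rule assms(1))
    show "cone_kform S C0 \<pi> \<phi> p v w = kform (cone_metric S C0 \<pi> \<phi>) J p v w"
      if "p \<in> pts (cone_mfd C0)" "v \<in> tangent (cone_mfd C0) p" "w \<in> tangent (cone_mfd C0) p" for p v w
      by (rule bspec[OF bspec[OF bspec[OF E(5) that(1)] that(2)] that(3)])
    show "cov_endo (cone_mfd C0) nabla J A B = cov_endo (cone_mfd C0) nabla J B A"
      if "A \<in> vfields (cone_mfd C0)" "B \<in> vfields (cone_mfd C0)" for A B
      by (rule bspec[OF bspec[OF E(11) that(1)] that(2)])
    show "nabla A (circle_generator (cone_mfd C0) (cone_act act)) = (\<lambda>p f. - app (cone_mfd C0) J A p f)"
      if "A \<in> vfields (cone_mfd C0)" for A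
      by (rule bspec[OF E(12) that])
  qed (rule E)+
  then obtain \<Gamma> where \<Gamma>: "special_point (alg S) (gT S) (JT S) (lie S) \<Gamma>"
    "\<And>a b c. a \<in> alg S \<Longrightarrow> b \<in> alg S \<Longrightarrow> c \<in> alg S \<Longrightarrow>
      special_point.R (JT S) (lie S) \<Gamma> a b c + special_point.S (JT S) \<Gamma> a (special_point.S (JT S) \<Gamma> b c)
        - special_point.S (JT S) \<Gamma> b (special_point.S (JT S) \<Gamma> a c) =
      gT S a c *\<^sub>R b + gT S (JT S a) c *\<^sub>R JT S b - gT S b c *\<^sub>R a - gT S (JT S b) c *\<^sub>R JT S a + (2 * gT S (JT S a) b) *\<^sub>R JT S c"
    using psk.special_curvature[where S = S] by metis
  obtain \<Phi> where \<Phi>: "\<Phi> \<in> iso (grp St) (grp (prod_klg {..<r} F))" "diffeo St (prod_klg {..<r} F) \<Phi>"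
    "preserves_kaehler St (prod_klg {..<r} F) \<Phi>"
    using assms(7) unfolding kaehler_lie_isomorphic_def by (elim exE conjE)
  have F: "kaehler_lie_group (F i)" "0 < mdim (F i)" if "i < r" for i using assms(6) that by simp_all
  interpret pc: product_cover S St p F r \<Phi>
    by (rule product_cover.intro) (rule assms(1) assms(4) F(1) \<Phi>; assumption?)+
  have r3: "r = 3" by (rule pc.factors(1)[OF \<Gamma> assms(5) F(2)])
  have "\<exists>c. is_CH1 c (F i) \<and> CH1_hol_sect_curv c = -1" if "i < 3" for i
  proof -
    have i: "i < r" using that r3 by simp
    have "\<exists>u\<in>alg (F i). gT (F i) u u = 1 \<and>
      (\<forall>c\<in>alg (F i). c = gT (F i) u c *\<^sub>R u + gT (F i) (JT (F i) u) c *\<^sub>R JT (F i) u) \<and>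
      lie (F i) u (JT (F i) u) = 2 *\<^sub>R JT (F i) u"
      by (rule pc.factors(2)[OF \<Gamma>(1) _ assms(5) _ i]) (erule (2) \<Gamma>(2) | erule F(2))+
    then obtain u where u: "u \<in> alg (F i)" "gT (F i) u u = 1"
      "\<forall>c\<in>alg (F i). c = gT (F i) u c *\<^sub>R u + gT (F i) (JT (F i) u) c *\<^sub>R JT (F i) u"
      "lie (F i) u (JT (F i) u) = 2 *\<^sub>R JT (F i) u" by (elim bexE conjE)
    have "is_CH1 (- 2) (F i)"
      by (rule is_CH1I[OF F(1)[OF i] pc.simply_connected_factor[OF i] u(1,2) bspec[OF u(3)] u(4)])
    then show ?thesis by (intro exI[of _ "- 2"]) (simp add: CH1_hol_sect_curv_def)
  qed
  then show ?thesis using r3 assms(7) by simp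
qed

end
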